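(* Assume (HV) and (HP), as defined in the context, and that $\lambda_0=0$ (critical case). Let $\nu=\mu_0/\mu_0(1)$, $A=\int\mu_0(dy)$, $B=\int\Theta_0^2(y)\,b(y)\,\mu_0(dy)$, let $\xi$ be an exponential random variable with mean $1$, and let $f\in C_b(\mathbb R)$, $x\in\mathbb R$. (1) For every bounded continuous $F:\mathbb R^2\to\mathbb R$, $$\lim_{t\to\infty}\mathbb E_{\delta_x}\!\left(F\Big(\tfrac1{(t+1)AB}\big(\langle Z_t,f\rangle,\langle Z_t,1\rangle\big)\Big)\,\Big|\,N_t>0\right)=\mathbb E\big(F(\xi\,\nu(f),\xi)\big).$$ In particular, the random measures $\frac1{(t+1)AB}Z_t$ (with values in $M_F(\mathbb R)$), conditioned on $N_t>0$, converge in law as $t\to\infty$ to the probability measure $\Lambda$ on $M_F(\mathbb R)$ given by $\Lambda(d\mu)=\int_0^\infty e^{-z}\,\delta_{z\nu}(d\mu)\,dz$. (2) The distribution of the ratio $\langle Z_t,f\rangle/\langle Z_t,1\rangle$ conditioned on $N_t>0$ converges, as $t\to\infty$, to the Dirac mass at $\nu(f)$. (3) Assume $\nu(f)\ne0$. Then $$\Upsilon_t:=\frac1{\nu(f)(AB)^{1/2}}\;\frac{\frac{\langle Z_t,f\rangle}{t+1}-\nu(f)AB/2}{\sqrt{\frac{N_t}{t+1}}},$$ conditioned on $N_t>0$, converges in distribution as $t\to\infty$ to $\xi^{1/2}-\frac12\xi^{-1/2}$.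
   Context: Setting and notation. $(X_t)_{t\ge 0}$ is a Markov process on $\mathbb R$ and $\mathbb E_x$ denotes expectation when $X_0=x$. Let $b,d:\mathbb R\to[0,\infty)$ be birth and death rates and $V=b-d$. Consider the branching Markov process started from one individual with trait $x$ (law $\mathbb P_{\delta_x}$, expectation $\mathbb E_{\delta_x}$): individuals behave independently, the trait of each individual moves as $X$, an individual with trait $y$ gives birth to one new individual with the same trait at rate $b(y)$ and dies at rate $d(y)$. If $\mathcal V_t$ is the set of individuals alive at time $t$ and $X^i_t$ is the trait of $i$, put $Z_t=\sum_{i\in\mathcal V_t}\delta_{X^i_t}$, $\langle Z_t,f\rangle=\sum_{i\in\mathcal V_t}f(X^i_t)$, $N_t=\langle Z_t,1\rangle$. The Feynman--Kac semigroup is $P_tf(x)=\mathbb E_{\delta_x}(\langle Z_t,f\rangle)=\mathbb E_x\big(e^{\int_0^tV(X_s)ds}f(X_t)\big)$. $C_b(\mathbb R)$ (bounded continuous), $C_0(\mathbb R)$ (continuous, tending to $0$ at infinity) and $\mathscr B$ (bounded measurable functions) carry the sup norm $\|\cdot\|_\infty$. $M_F(\mathbb R)$ is the set of finite measures on $\mathbb R$ with the topology of weak convergence. For a measure $\nu$, $\nu(f)=\int f\,d\nu$. The limit $\Lambda$ is called a Yaglom limit. (HV): HV1) $b,d$ are nonnegative, nonzero and continuous. HV2) $b$ is bounded above by a finite number $b^*>0$. (HP): HP1) There exist a positive function $\Theta_0\in C_0(\mathbb R)$ and a real $\lambda_0$ with $P_t\Theta_0=e^{-\lambda_0t}\Theta_0$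 for all $t\ge0$. HP2) There exist a positive finite measure $\mu_0$ charging every nonempty open set, and numbers $\lambda_1>\lambda_0$, $H>0$, such that $\int\Theta_0\,d\mu_0=1$ and, with $\Pi(g)=\Theta_0\int g\,d\mu_0$, $\|e^{\lambda_0t}P_t(g)-\Pi(g)\|_\infty\le H\|g\|_\infty e^{-(\lambda_1-\lambda_0)t}$ for all $g\in C_b(\mathbb R)$, $t\ge0$. HP3) $(P_t)$ is strongly continuous and irreducible in $C_0(\mathbb R)$ (irreducible: for every nonzero $f\ge0$ in $C_0(\mathbb R)$ and every nonzero positive finite measure $m$ there is $t\ge 0$ with $\int P_tf\,dm>0$), and $x\mapsto\int_0^tP_sf(x)\,ds$ belongs to $C_b(\mathbb R)$ for every $f\in\mathscr B$ and every $t$. HP4) For any $t>0$, $P_t$ maps $C_b(\mathbb R)$ to $C_0(\mathbb R)$. HP5) With $T_m=\inf\{s\ge0:\langle Z_s,\mathbf 1_{[-m,m]^c}\rangle>0\}$, for every $x\in\mathbb R$, $T_m\to+\infty$ $\mathbb P_{\delta_x}$-a.s. as $m\to\infty$. *)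

theory Defs
  imports "HOL-Probability.Probability" "HOL-Library.Sublist"
begin

subsection \<open>Function spaces\<close>

definition Cb :: "('a::topological_space \<Rightarrow> real) set" where
  "Cb = {f. continuous_on UNIV f \<and> bounded (range f)}"

definition C0 :: "(real \<Rightarrow> real) set" where
  "C0 = {f. continuous_on UNIV f \<and> (f \<longlongrightarrow> 0) at_infinity}"

definition Bm :: "(real \<Rightarrow> real) set" where
  "Bm = {f \<in> borel_measurable borel. bounded (range f)}"

definition sup_norm :: "(real \<Rightarrow> real) \<Rightarrow> real" where
  "sup_norm f = (SUP x. \<bar>f x\<bar>)"


subsection \<open>Markov processes on the real line\<close>

text \<open>
  A Markov process is given by the laws \<open>P x\<close> of its paths on a set \<open>D\<close> of paths
  (for instance the continuous or the cadlag ones), the process being the coordinate process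
  \<open>X\<^sub>t(w) = w t\<close>, \<open>t \<ge> 0\<close>. The natural filtration is \<open>path_space D {0..t}\<close>. Besides the Markov
  property, the only requirement on the paths is that the coordinate process is progressively
  measurable, which gives a meaning to the time integrals of functions of \<open>X\<close>;
  it holds whenever all paths in \<open>D\<close> are right-continuous.
\<close>

definition path_space :: "(real \<Rightarrow> real) set \<Rightarrow> real set \<Rightarrow> (real \<Rightarrow> real) measure" where
  "path_space D I = sigma D {{w \<in> D. w s \<in> B} |s B. s \<in> I \<and> B \<in> sets borel}"

locale markov_process =
  fixes D :: "(real \<Rightarrow> real) set" and P :: "real \<Rightarrow> (real \<Rightarrow> real) measure"
  assumes shift_closed: "\<And>w s. w \<in> D \<Longrightarrow> 0 \<le> s \<Longrightarrow> (\<lambda>t. w (s + t)) \<in> D"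
    and progressive: "\<And>t. 0 \<le> t \<Longrightarrow>
      (\<lambda>(s, w). w s) \<in> restrict_space borel {0..t} \<Otimes>\<^sub>M path_space D {0..t} \<rightarrow>\<^sub>M (borel :: real measure)"
    and kernel: "P \<in> borel \<rightarrow>\<^sub>M prob_algebra (path_space D {0..})"
    and initial: "\<And>x. AE w in P x. w 0 = x"
    and markov: "\<And>x s A B. 0 \<le> s \<Longrightarrow> A \<in> sets (path_space D {0..s}) \<Longrightarrow>
      B \<in> sets (path_space D {0..}) \<Longrightarrow>
      emeasure (P x) {w \<in> A. (\<lambda>t. w (s + t)) \<in> B} =
        (\<integral>\<^sup>+w. emeasure (P (w s)) B * indicator A w \<partial>P x)"

text \<open>
  The Feynman--Kac semigroup. It is used for potentials \<open>V\<close> bounded above, so that the integral of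
  \<open>V\<close> along a path over \<open>[0, t]\<close> is always defined in \<open>[-\<infinity>, \<infinity>)\<close>;
  it equals \<open>-\<infinity>\<close> exactly when \<open>V\<close> is not integrable along the path, and then the weight is
  \<open>e\<^sup>-\<^sup>\<infinity> = 0\<close>.
\<close>

definition FK_weight :: "(real \<Rightarrow> real) \<Rightarrow> real \<Rightarrow> (real \<Rightarrow> real) \<Rightarrow> real" where
  "FK_weight V t w =
    (if set_integrable lborel {0..t} (\<lambda>s. V (w s)) then exp (LBINT s:{0..t}. V (w s)) else 0)"

definition FK :: "(real \<Rightarrow> (real \<Rightarrow> real) measure) \<Rightarrow> (real \<Rightarrow> real) \<Rightarrow>
    real \<Rightarrow> (real \<Rightarrow> real) \<Rightarrow> real \<Rightarrow> real" where
  "FK P V t f x = (\<integral>w. FK_weight V t w * f (w t) \<partial>P x)"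


subsection \<open>The branching Markov process\<close>

text \<open>
  Individuals are labelled by \<^typ>\<open>nat list\<close>: \<open>[]\<close> is the initial individual and \<open>k # u\<close> is the
  child number \<open>k\<close> (in order of birth, starting from 0) of \<open>u\<close>; the descendants of \<open>u\<close>, itself
  included, are the labels of which \<open>u\<close> is a suffix. Each individual carries
  a triple \<open>(w, e, g)\<close>: its trait \<open>w a\<close> as a function of its age \<open>a\<close>, an exponential clock \<open>e\<close>
  for its death and exponential gaps \<open>g\<close> for its births. Death happens at rate \<open>d(w a)\<close>, i.e. when
  the cumulated rate \<open>\<integral>\<^sub>0\<^sup>a d(w s) ds\<close> reaches \<open>e\<close>. Births happen at rate \<open>b(w a)\<close>, i.e. when
  the cumulated rate \<open>\<integral>\<^sub>0\<^sup>a b(w s) ds\<close> reaches the successive points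
  \<open>g 0, g 0 + g 1, \<dots>\<close> of a Poisson process of rate 1.
\<close>

type_synonym mark = "(real \<Rightarrow> real) \<times> real \<times> (nat \<Rightarrow> real)"
type_synonym tree = "nat list \<Rightarrow> mark"

definition cumulated :: "(real \<Rightarrow> real) \<Rightarrow> (real \<Rightarrow> real) \<Rightarrow> real \<Rightarrow> ennreal" where
  "cumulated r w a = (\<integral>\<^sup>+s\<in>{0..a}. ennreal (r (w s)) \<partial>lborel)"

definition alive_at_age :: "(real \<Rightarrow> real) \<Rightarrow> mark \<Rightarrow> real \<Rightarrow> bool" where
  "alive_at_age d = (\<lambda>(w, e, g) a. cumulated d w a < ennreal e)"

text \<open>Age of the parent at the birth of its child number \<open>k\<close> (if it lives that long).\<close>

definition birth_age :: "(real \<Rightarrow> real) \<Rightarrow> mark \<Rightarrow> nat \<Rightarrow> ereal" where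
  "birth_age b = (\<lambda>(w, e, g) k.
     Inf {ereal a |a. 0 \<le> a \<and> ennreal (\<Sum>j\<le>k. g j) \<le> cumulated b w a})"

text \<open>Date of birth, \<open>\<infinity>\<close> for the labels that are never born.\<close>

primrec birth_time :: "(real \<Rightarrow> real) \<Rightarrow> (real \<Rightarrow> real) \<Rightarrow> tree \<Rightarrow> nat list \<Rightarrow> ereal" where
  "birth_time b d c [] = 0"
| "birth_time b d c (k # u) =
     (if birth_age b (c u) k < \<infinity> \<and> alive_at_age d (c u) (real_of_ereal (birth_age b (c u) k))
      then birth_time b d c u + birth_age b (c u) k else \<infinity>)"

text \<open>Trait at birth: the current trait of the parent (irrelevant for labels never born).\<close>

primrec birth_trait :: "(real \<Rightarrow> real) \<Rightarrow> real \<Rightarrow> tree \<Rightarrow> nat list \<Rightarrow> real" where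
  "birth_trait b x c [] = x"
| "birth_trait b x c (k # u) = fst (c u) (real_of_ereal (birth_age b (c u) k))"

definition alive :: "(real \<Rightarrow> real) \<Rightarrow> (real \<Rightarrow> real) \<Rightarrow> real \<Rightarrow> tree \<Rightarrow> nat list set" where
  "alive b d t c = {u. birth_time b d c u \<le> ereal t \<and>
     alive_at_age d (c u) (t - real_of_ereal (birth_time b d c u))}"

definition trait :: "(real \<Rightarrow> real) \<Rightarrow> (real \<Rightarrow> real) \<Rightarrow> real \<Rightarrow> tree \<Rightarrow> nat list \<Rightarrow> real" where
  "trait b d t c u = fst (c u) (t - real_of_ereal (birth_time b d c u))"

text \<open>
  The population is almost surely finite at all times when \<open>b\<close> is bounded; on the exceptional
  null event where it is infinite, the sums below are 0.
\<close>

definition Zpair :: "(real \<Rightarrow> real) \<Rightarrow> (real \<Rightarrow> real) \<Rightarrow> real \<Rightarrow> (real \<Rightarrow> real) \<Rightarrow> tree \<Rightarrow> real" where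
  "Zpair b d t f c = (\<Sum>u\<in>alive b d t c. f (trait b d t c u))"

definition Npop :: "(real \<Rightarrow> real) \<Rightarrow> (real \<Rightarrow> real) \<Rightarrow> real \<Rightarrow> tree \<Rightarrow> real" where
  "Npop b d t c = Zpair b d t (\<lambda>_. 1) c"

definition Zmeas :: "(real \<Rightarrow> real) \<Rightarrow> (real \<Rightarrow> real) \<Rightarrow> real \<Rightarrow> tree \<Rightarrow> real measure" where
  "Zmeas b d t c =
    measure_of UNIV (sets borel) (\<lambda>B. \<Sum>u\<in>alive b d t c. indicator B (trait b d t c u))"

text \<open>First time at which some individual has its trait outside \<open>[-m, m]\<close>.\<close>

definition exit_time :: "(real \<Rightarrow> real) \<Rightarrow> (real \<Rightarrow> real) \<Rightarrow> real \<Rightarrow> tree \<Rightarrow> ereal" where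
  "exit_time b d m c = Inf {ereal s |s. 0 \<le> s \<and> Zpair b d s (indicator (- {-m..m})) c > 0}"

definition mark_space :: "(real \<Rightarrow> real) set \<Rightarrow> mark measure" where
  "mark_space D = path_space D {0..} \<Otimes>\<^sub>M borel \<Otimes>\<^sub>M (\<Pi>\<^sub>M j\<in>UNIV. borel)"

abbreviation exp1 :: "real measure" where
  "exp1 \<equiv> density lborel (exponential_density 1)"

definition mark_law :: "(real \<Rightarrow> (real \<Rightarrow> real) measure) \<Rightarrow> real \<Rightarrow> mark measure" where
  "mark_law P y = P y \<Otimes>\<^sub>M exp1 \<Otimes>\<^sub>M (\<Pi>\<^sub>M j\<in>UNIV. exp1)"

definition tree_space :: "(real \<Rightarrow> real) set \<Rightarrow> tree measure" where
  "tree_space D = (\<Pi>\<^sub>M u\<in>UNIV. mark_space D)"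

definition non_descendants :: "(real \<Rightarrow> real) set \<Rightarrow> nat list \<Rightarrow> tree measure" where
  "non_descendants D u = sigma (space (tree_space D))
     {{c \<in> space (tree_space D). c v \<in> B} |v B. \<not> suffix u v \<and> B \<in> sets (mark_space D)}"

text \<open>
  \<open>Q x\<close> is the law of the process started from one individual with trait \<open>x\<close>.
  The individuals behave independently: given all the individuals that are not descendants of \<open>u\<close>
  (among them the ancestors of \<open>u\<close>, hence its trait at birth), the individual \<open>u\<close> moves as the
  Markov process started from its trait at birth, with fresh independent clocks. The death rate does not enter here: the marks describe
  what an individual would do if it never died, and \<open>d\<close> decides, through
  \<^const>\<open>birth_time\<close> and \<^const>\<open>alive\<close>, which of it is realized.
\<close>

locale branching_markov_process = markov_process D P
  for D :: "(real \<Rightarrow> real) set" and P :: "real \<Rightarrow> (real \<Rightarrow> real) measure" +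
  fixes b :: "real \<Rightarrow> real" and Q :: "real \<Rightarrow> tree measure"
  assumes Q_prob: "\<And>x. prob_space (Q x)"
    and Q_sets: "\<And>x. sets (Q x) = sets (tree_space D)"
    and branching: "\<And>x u A B. A \<in> sets (non_descendants D u) \<Longrightarrow> B \<in> sets (mark_space D) \<Longrightarrow>
      emeasure (Q x) {c \<in> A. c u \<in> B} =
        (\<integral>\<^sup>+c. emeasure (mark_law P (birth_trait b x c u)) B * indicator A c \<partial>Q x)"

text \<open>The law \<open>Q x\<close> conditioned on non-extinction at time \<open>t\<close>.\<close>

definition cond_law :: "(real \<Rightarrow> tree measure) \<Rightarrow> (real \<Rightarrow> real) \<Rightarrow> (real \<Rightarrow> real) \<Rightarrow>
    real \<Rightarrow> real \<Rightarrow> tree measure" where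
  "cond_law Q b d x t = uniform_measure (Q x) {c \<in> space (Q x). Npop b d t c > 0}"


subsection \<open>The hypotheses\<close>

definition HV :: "(real \<Rightarrow> real) \<Rightarrow> (real \<Rightarrow> real) \<Rightarrow> bool" where
  "HV b d \<longleftrightarrow>
     (\<forall>x. 0 \<le> b x) \<and> (\<forall>x. 0 \<le> d x) \<and> (\<exists>x. b x \<noteq> 0) \<and> (\<exists>x. d x \<noteq> 0) \<and>
     continuous_on UNIV b \<and> continuous_on UNIV d \<and>
     (\<exists>bs>0. \<forall>x. b x \<le> bs)"

definition finite_borel_measures :: "real measure set" where
  "finite_borel_measures = {\<mu>. sets \<mu> = sets borel \<and> finite_measure \<mu>}"

definition HP1 :: "(real \<Rightarrow> (real \<Rightarrow> real) \<Rightarrow> real \<Rightarrow> real) \<Rightarrow> (real \<Rightarrow> real) \<Rightarrow> real \<Rightarrow> bool" where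
  "HP1 S \<Theta>0 l0 \<longleftrightarrow>
     \<Theta>0 \<in> C0 \<and> (\<forall>x. 0 < \<Theta>0 x) \<and> (\<forall>t\<ge>0. \<forall>x. S t \<Theta>0 x = exp (- l0 * t) * \<Theta>0 x)"

definition HP2 :: "(real \<Rightarrow> (real \<Rightarrow> real) \<Rightarrow> real \<Rightarrow> real) \<Rightarrow>
    (real \<Rightarrow> real) \<Rightarrow> real measure \<Rightarrow> real \<Rightarrow> bool" where
  "HP2 S \<Theta>0 \<mu>0 l0 \<longleftrightarrow>
     \<mu>0 \<in> finite_borel_measures \<and> (\<forall>U. open U \<and> U \<noteq> {} \<longrightarrow> 0 < emeasure \<mu>0 U) \<and>
     (\<integral>y. \<Theta>0 y \<partial>\<mu>0) = 1 \<and>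
     (\<exists>l1 H. l0 < l1 \<and> 0 < H \<and>
        (\<forall>g\<in>Cb. \<forall>t\<ge>0. \<forall>x. \<bar>exp (l0 * t) * S t g x - \<Theta>0 x * (\<integral>y. g y \<partial>\<mu>0)\<bar>
            \<le> H * sup_norm g * exp (- (l1 - l0) * t)))"

definition strongly_continuous_C0 :: "(real \<Rightarrow> (real \<Rightarrow> real) \<Rightarrow> real \<Rightarrow> real) \<Rightarrow> bool" where
  "strongly_continuous_C0 S \<longleftrightarrow>
     (\<forall>f\<in>C0. (\<forall>t\<ge>0. S t f \<in> C0) \<and> uniform_limit UNIV (\<lambda>t. S t f) f (at_right 0))"

definition irreducible_C0 :: "(real \<Rightarrow> (real \<Rightarrow> real) \<Rightarrow> real \<Rightarrow> real) \<Rightarrow> bool" where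
  "irreducible_C0 S \<longleftrightarrow>
     (\<forall>f\<in>C0. \<forall>m\<in>finite_borel_measures. (\<forall>x. 0 \<le> f x) \<and> (\<exists>x. f x \<noteq> 0) \<and> emeasure m UNIV \<noteq> 0 \<longrightarrow>
        (\<exists>t\<ge>0. 0 < (\<integral>x. S t f x \<partial>m)))"

definition HP3 :: "(real \<Rightarrow> (real \<Rightarrow> real) \<Rightarrow> real \<Rightarrow> real) \<Rightarrow> bool" where
  "HP3 S \<longleftrightarrow> strongly_continuous_C0 S \<and> irreducible_C0 S \<and>
     (\<forall>f\<in>Bm. \<forall>t\<ge>0. (\<lambda>x. LBINT s:{0..t}. S s f x) \<in> Cb)"

definition HP4 :: "(real \<Rightarrow> (real \<Rightarrow> real) \<Rightarrow> real \<Rightarrow> real) \<Rightarrow> bool" where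
  "HP4 S \<longleftrightarrow> (\<forall>t>0. \<forall>f\<in>Cb. S t f \<in> C0)"

definition HP5 :: "(real \<Rightarrow> real) \<Rightarrow> (real \<Rightarrow> real) \<Rightarrow> (real \<Rightarrow> tree measure) \<Rightarrow> bool" where
  "HP5 b d Q \<longleftrightarrow> (\<forall>x. AE c in Q x. ((\<lambda>m. exit_time b d m c) \<longlongrightarrow> \<infinity>) at_top)"

definition HP :: "(real \<Rightarrow> (real \<Rightarrow> real) measure) \<Rightarrow> (real \<Rightarrow> real) \<Rightarrow> (real \<Rightarrow> real) \<Rightarrow>
    (real \<Rightarrow> tree measure) \<Rightarrow> (real \<Rightarrow> real) \<Rightarrow> real measure \<Rightarrow> real \<Rightarrow> bool" where
  "HP P b d Q \<Theta>0 \<mu>0 l0 \<longleftrightarrow>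
     (let S = FK P (\<lambda>y. b y - d y) in
        HP1 S \<Theta>0 l0 \<and> HP2 S \<Theta>0 \<mu>0 l0 \<and> HP3 S \<and> HP4 S \<and> HP5 b d Q)"


subsection \<open>Convergence in law\<close>

text \<open>
  For real random variables this is the library's \<^const>\<open>weak_conv_m\<close>, which is stated for
  sequences, along all sequences of times tending to infinity.
\<close>

definition weak_conv_at_top :: "(real \<Rightarrow> real measure) \<Rightarrow> real measure \<Rightarrow> bool" where
  "weak_conv_at_top L M \<longleftrightarrow>
     (\<forall>T::nat \<Rightarrow> real. filterlim T at_top sequentially \<longrightarrow> weak_conv_m (\<lambda>n. L (T n)) M)"

text \<open>The topology of weak convergence on the finite measures, and its Borel sigma-algebra.\<close>

definition weak_topology :: "real measure topology" where
  "weak_topology = topology_generated_by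
     {{\<mu> \<in> finite_borel_measures. (\<integral>y. g y \<partial>\<mu>) \<in> U} |g U. g \<in> Cb \<and> open U}"

definition weak_borel :: "real measure measure" where
  "weak_borel = sigma finite_borel_measures {U. openin weak_topology U}"

definition law_conv_at_top :: "(real \<Rightarrow> real measure measure) \<Rightarrow> real measure measure \<Rightarrow> bool" where
  "law_conv_at_top L M \<longleftrightarrow>
     (\<forall>\<Phi>. continuous_map weak_topology euclideanreal \<Phi> \<and> bounded (\<Phi> ` finite_borel_measures) \<longrightarrow>
        ((\<lambda>t. \<integral>\<mu>. \<Phi> \<mu> \<partial>L t) \<longlongrightarrow> (\<integral>\<mu>. \<Phi> \<mu> \<partial>M)) at_top)"

text \<open>\<open>\<Lambda>(d\<mu>) = \<integral>\<^sub>0\<^sup>\<infinity> e\<^sup>-\<^sup>z \<delta>\<^bsub>z\<nu>\<^esub>(d\<mu>) dz\<close>, as an image of the exponential distribution.\<close>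

definition yaglom_limit :: "real measure \<Rightarrow> real measure measure" where
  "yaglom_limit \<nu> = distr exp1 weak_borel (\<lambda>z. scale_measure (ennreal z) \<nu>)"


subsection \<open>Consistency of the two forms of the empirical measure\<close>

lemma topspace_weak_topology: "topspace weak_topology = finite_borel_measures"
proof -
  have "finite_borel_measures \<in>
      {{\<mu> \<in> finite_borel_measures. (\<integral>y. g y \<partial>\<mu>) \<in> U} |g U. g \<in> Cb \<and> open U}"
    by (rule CollectI, rule exI[of _ "\<lambda>_. 0"], rule exI[of _ UNIV]) (auto simp: Cb_def)
  then show ?thesis
    unfolding weak_topology_def topology_generated_by_topspace by auto
qed

lemma emeasure_Zmeas:
  assumes "B \<in> sets borel"
  shows "emeasure (Zmeas b d t c) B = (\<Sum>u\<in>alive b d t c. indicator B (trait b d t c u))"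
proof -
  let ?\<mu> = "\<lambda>B. \<Sum>u\<in>alive b d t c. indicator B (trait b d t c u) :: ennreal"
  have "countably_additive (sets borel) ?\<mu>"
    unfolding countably_additive_def
  proof (intro allI impI)
    fix A :: "nat \<Rightarrow> real set" assume "disjoint_family A"
    then show "(\<Sum>i. ?\<mu> (A i)) = ?\<mu> (\<Union>i. A i)"
      by (subst suminf_sum) (auto simp: suminf_indicator)
  qed
  then show ?thesis
    using assms sets.sigma_algebra_axioms[of "borel :: real measure"]
    unfolding Zmeas_def
    by (intro emeasure_measure_of_sigma) (auto simp: positive_def)
qed

lemma Zmeas_finite_borel: "Zmeas b d t c \<in> finite_borel_measures"
proof -
  have s: "sets (Zmeas b d t c) = sets borel" and sp: "space (Zmeas b d t c) = UNIV"
    unfolding Zmeas_def using sets.sigma_sets_eq[of "borel :: real measure"] by auto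
  have "emeasure (Zmeas b d t c) UNIV \<noteq> \<infinity>"
    by (subst emeasure_Zmeas) (auto simp: of_nat_less_top less_imp_neq)
  then show ?thesis
    using s sp by (auto simp: finite_borel_measures_def intro!: finite_measureI)
qed

lemma integral_Zmeas:
  assumes f: "f \<in> borel_measurable borel" and fin: "finite (alive b d t c)"
  shows "(\<integral>y. f y \<partial>Zmeas b d t c) = Zpair b d t f c"
proof -
  let ?V = "alive b d t c" and ?X = "trait b d t c"
  have m: "?X \<in> count_space ?V \<rightarrow>\<^sub>M borel" by simp
  have "Zmeas b d t c = distr (count_space ?V) borel ?X"
  proof (rule measure_eqI)
    show s: "sets (Zmeas b d t c) = sets (distr (count_space ?V) borel ?X)"
      using Zmeas_finite_borel[of b d t c] by (simp add: finite_borel_measures_def)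
    fix B assume "B \<in> sets (Zmeas b d t c)"
    then have B: "B \<in> sets borel" using s by simp
    have "emeasure (distr (count_space ?V) borel ?X) B = of_nat (card (?X -` B \<inter> ?V))"
      using B fin by (simp add: emeasure_distr emeasure_count_space)
    also have "\<dots> = (\<Sum>u\<in>?X -` B \<inter> ?V. 1)" by simp
    also have "\<dots> = (\<Sum>u\<in>?V. indicator B (?X u))"
      using fin by (intro sum.mono_neutral_cong_left) (auto simp: indicator_def)
    also have "\<dots> = emeasure (Zmeas b d t c) B"
      using B by (simp add: emeasure_Zmeas)
    finally show "emeasure (Zmeas b d t c) B = emeasure (distr (count_space ?V) borel ?X) B" ..
  qed
  then show ?thesis
    using f fin by (simp add: integral_distr lebesgue_integral_count_space_finite Zpair_def)
qed

end

theory Submission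
  imports Defs "HOL-Real_Asymp.Real_Asymp"
begin

text \<open>
  For \<open>0 \<le> p \<le> 1\<close> put \<open>v(t, x) = 1 - E\<^sub>x (\<Prod>\<^sub>i p(X\<^sub>t\<^sup>i))\<close>. Decomposing at the first individual
  shows that \<open>v\<close> solves the mild equation
  \<open>v\<^sub>t + \<integral>\<^sub>0\<^sup>t P\<^sub>r (b v\<^sub>t\<^sub>-\<^sub>r\<^sup>2) dr = P\<^sub>t v\<^sub>0\<close> with \<open>v\<^sub>0 = 1 - p\<close>. By the spectral gap, \<open>v\<^sub>t\<close> aligns
  with \<open>\<Theta>\<close>, so \<open>m(t) = \<mu>(v\<^sub>t)\<close> almost solves the logistic equation \<open>m' = - B m\<^sup>2\<close>. For initial data of
  order \<open>1/t\<close> this gives \<open>t v\<^sub>t \<approx> \<Theta> a / (1 + B a)\<close> with \<open>a = t \<mu>(v\<^sub>0)\<close>; for \<open>v\<^sub>0 = 1\<close> it gives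
  Kolmogorov's estimate \<open>t P\<^sub>x(N\<^sub>t > 0) \<rightarrow> \<Theta>(x) / B\<close>. Taking the quotient, the conditional Laplace
  transform of \<open>\<langle>Z\<^sub>t, g\<rangle> / (t A B)\<close> tends to \<open>1 / (1 + \<nu>(g))\<close> for all \<open>g \<ge> 0\<close>. Applied to constants this is
  the convergence of \<open>N\<^sub>t / (t A B)\<close> to \<open>\<xi>\<close>; and since the limit depends on \<open>g\<close> only through \<open>\<nu>(g)\<close>,
  the \<open>L\<^sup>2\<close> distance of \<open>exp (- \<langle>Z\<^sub>t, g\<rangle> / (t A B))\<close> and \<open>exp (- \<nu>(g) N\<^sub>t / (t A B))\<close> tends to 0. Thus
  \<open>\<langle>Z\<^sub>t, f\<rangle> / (t A B)\<close> is close in probability to \<open>\<nu>(f) N\<^sub>t / (t A B)\<close>, and all assertions follow by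
  continuous mapping on \<open>{N\<^sub>t / (t A B) \<in> [\<alpha>, \<beta>]}\<close>, \<open>0 < \<alpha> < \<beta> < \<infinity>\<close>.
\<close>

section \<open>Exponential clocks and Poisson products\<close>

text \<open>The branching law is given label by label, so the nonlinear equation has to be extracted
  from the tree. The births of the initial individual form a Poisson process in the time scale of
  its cumulated birth rate; averaging over it and over the death clock turns products over children
  into exponentials along one path. The resulting kernel kills at rate \<open>d + b u\<close>. A
  pathwise identity trades it for the Feynman-Kac weight of \<open>b - d\<close>, and what remains
  after the Markov property is exactly \<open>b u^2\<close>. Two obstacles shape the analysis. The
  spectral gap is assumed for continuous functions but applied to Borel solutions, hence a
  regularity argument. And the logistic comparison is uniform for initial data of order
  \<open>1/t\<close>, whereas survival starts from the datum 1: there one has to prove that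
  \<open>\<mu>(v)\<close> tends to 0, then that it controls the supremum of \<open>v\<close>, and
  only then that \<open>1 / \<mu>(v)\<close> grows at least linearly with the right slope. Path
  integrals are kept in \<open>ennreal\<close> as long as possible, because no bound on
  \<open>d\<close> is available and cumulated death rates can be infinite.\<close>

definition exp_neg :: "ennreal \<Rightarrow> ennreal" where
  "exp_neg x = (if x = \<top> then 0 else ennreal (exp (- enn2real x)))"

lemma exp_neg_ennreal: "0 \<le> x \<Longrightarrow> exp_neg (ennreal x) = ennreal (exp (- x))"
  by (simp add: exp_neg_def)

text \<open>A path along which the cumulated death rate is infinite gets weight 0. The case split in
  \<open>exp_neg\<close> is there because \<open>enn2real\<close> sends \<top> to 0, which would
  give weight 1.\<close>

lemma exp_neg_top [simp]: "exp_neg \<top> = 0"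
  by (simp add: exp_neg_def)

lemma exp_neg_0 [simp]: "exp_neg 0 = 1"
  by (simp add: exp_neg_def)

lemma exp_neg_add: "exp_neg (x + y) = exp_neg x * exp_neg y"
  by (cases x; cases y)
    (auto simp: exp_neg_ennreal exp_diff exp_minus field_simps simp flip: ennreal_plus ennreal_mult)

lemma exp_neg_antimono: "x \<le> y \<Longrightarrow> exp_neg y \<le> exp_neg x"
  by (cases x; cases y) (auto simp: exp_neg_ennreal top_unique)

lemma exp_neg_le_1: "exp_neg x \<le> 1"
  by (cases x) (auto simp: exp_neg_ennreal)

lemma measurable_exp_neg [measurable]: "exp_neg \<in> borel \<rightarrow>\<^sub>M borel"
  unfolding exp_neg_def[abs_def] by measurable

text \<open>Matches \<open>alive_at_age\<close>: this is the probability that the death clock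
  exceeds a cumulated rate \<open>x\<close>, finite or not. Negative clocks do no harm, since
  \<open>ennreal\<close> sends them to 0.\<close>

lemma emeasure_exp1_greater: "emeasure exp1 {e. x < ennreal e} = exp_neg x"
proof (cases x)
  case (real r)
  have "{e. ennreal r < ennreal e} = {r<..}"
    using real by (auto simp: ennreal_less_iff)
  moreover have "emeasure exp1 {r<..} = ennreal (exp (- r))"
  proof -
    interpret E: prob_space exp1
      by (rule prob_space_exponential_density) simp
    have "distributed exp1 lborel (\<lambda>x. x) (exponential_density 1)"
      by (auto simp: distributed_def exponential_density_nonneg distr_id2)
    from E.exponential_distributedD_gt[OF this, of r] real(1)
    have "measure exp1 {e \<in> space exp1. r < e} = exp (- r)" by simp
    then show ?thesis
      by (simp add: E.emeasure_eq_measure greaterThan_def)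
  qed
  ultimately show ?thesis using real by (simp add: exp_neg_ennreal)
qed auto

text \<open>Both the Markov and the branching property are assumed on events; this extends them to
  functions of the pair. The joint law and the mixture of the kernels agree on rectangles, an
  intersection-stable generator.\<close>

lemma nn_integral_disintegration:
  assumes "prob_space M"
    and X [measurable]: "X \<in> M \<rightarrow>\<^sub>M N1" and Y [measurable]: "Y \<in> M \<rightarrow>\<^sub>M N2"
    and K [measurable]: "K \<in> N1 \<rightarrow>\<^sub>M prob_algebra N2"
    and eq: "\<And>A B. A \<in> sets N1 \<Longrightarrow> B \<in> sets N2 \<Longrightarrow>
      emeasure M {\<omega> \<in> space M. X \<omega> \<in> A \<and> Y \<omega> \<in> B} =
        (\<integral>\<^sup>+\<omega>. emeasure (K (X \<omega>)) B * indicator A (X \<omega>) \<partial>M)"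
    and g [measurable]: "g \<in> borel_measurable (N1 \<Otimes>\<^sub>M N2)"
  shows "(\<integral>\<^sup>+\<omega>. g (X \<omega>, Y \<omega>) \<partial>M) = (\<integral>\<^sup>+\<omega>. \<integral>\<^sup>+y. g (X \<omega>, y) \<partial>K (X \<omega>) \<partial>M)"
proof -
  interpret prob_space M by fact
  let ?N = "N1 \<Otimes>\<^sub>M N2"
  note [measurable] = measurable_prob_algebraD[OF K]
  \<comment> \<open>\<open>L\<close> keeps the conditioning value as first coordinate, so that
    mixing it over the law of \<open>X\<close> gives a joint law and not just the law of
    \<open>Y\<close>.\<close>
  define L where "L x = distr (K x) ?N (Pair x)" for x
  have L: "L \<in> N1 \<rightarrow>\<^sub>M subprob_algebra ?N"
    unfolding L_def by (rule measurable_prob_algebraD) measurable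
  have sp: "X \<omega> \<in> space N1" if "\<omega> \<in> space M" for \<omega>
    using X that by (rule measurable_space)
  have KX: "sets (K (X \<omega>)) = sets N2" "prob_space (K (X \<omega>))" if "\<omega> \<in> space M" for \<omega>
    using measurable_space[OF K sp[OF that]] by (auto simp: space_prob_algebra)
  have LX: "(\<lambda>\<omega>. L (X \<omega>)) \<in> M \<rightarrow>\<^sub>M subprob_algebra ?N"
    using X L by (rule measurable_compose)
  have ne: "space M \<noteq> {}" by (rule not_empty)
  have "distr M ?N (\<lambda>\<omega>. (X \<omega>, Y \<omega>)) = M \<bind> (\<lambda>\<omega>. L (X \<omega>))" (is "?D = ?B")
  proof (rule measure_eqI_generator_eq[where E="{a \<times> b | a b. a \<in> sets N1 \<and> b \<in> sets N2}"
        and \<Omega>="space N1 \<times> space N2" and A="\<lambda>_. space N1 \<times> space N2"])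
    show "Int_stable {a \<times> b | a b. a \<in> sets N1 \<and> b \<in> sets N2}"
      by (rule Int_stable_pair_measure_generator)
    show "{a \<times> b | a b. a \<in> sets N1 \<and> b \<in> sets N2} \<subseteq> Pow (space N1 \<times> space N2)"
      by (rule pair_measure_closed)
    show "sets ?D = sigma_sets (space N1 \<times> space N2) {a \<times> b | a b. a \<in> sets N1 \<and> b \<in> sets N2}"
      by (simp add: sets_pair_measure)
    show "sets ?B = sigma_sets (space N1 \<times> space N2) {a \<times> b | a b. a \<in> sets N1 \<and> b \<in> sets N2}"
      using sets_bind[OF sets_kernel[OF LX] ne] by (simp add: sets_pair_measure)
    show "range (\<lambda>_. space N1 \<times> space N2) \<subseteq> {a \<times> b | a b. a \<in> sets N1 \<and> b \<in> sets N2}"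
      by auto
    show "emeasure ?D (space N1 \<times> space N2) \<noteq> \<infinity>"
      by (simp add: emeasure_distr emeasure_eq_measure)
    fix S assume "S \<in> {a \<times> b | a b. a \<in> sets N1 \<and> b \<in> sets N2}"
    then obtain A B where S: "S = A \<times> B" and [measurable]: "A \<in> sets N1" "B \<in> sets N2" by auto
    have "emeasure ?D S = emeasure M {\<omega> \<in> space M. X \<omega> \<in> A \<and> Y \<omega> \<in> B}"
      unfolding S by (subst emeasure_distr) (auto intro!: arg_cong[where f="emeasure M"])
    also have "\<dots> = (\<integral>\<^sup>+\<omega>. emeasure (K (X \<omega>)) B * indicator A (X \<omega>) \<partial>M)"
      by (rule eq) auto
    also have "\<dots> = (\<integral>\<^sup>+\<omega>. emeasure (L (X \<omega>)) S \<partial>M)"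
    proof (rule nn_integral_cong)
      fix \<omega> assume w: "\<omega> \<in> space M"
      note [simp] = KX(1)[OF w] sets_eq_imp_space_eq[OF KX(1)[OF w]]
      have "emeasure (L (X \<omega>)) S = emeasure (K (X \<omega>)) (Pair (X \<omega>) -` S \<inter> space (K (X \<omega>)))"
        unfolding L_def S
        by (rule emeasure_distr) (auto simp: measurable_cong_sets[OF KX(1)[OF w] refl] sp[OF w])
      also have "Pair (X \<omega>) -` S \<inter> space (K (X \<omega>)) = (if X \<omega> \<in> A then B else {})"
        using sets.sets_into_space[of B N2] by (auto simp: S)
      finally show "emeasure (K (X \<omega>)) B * indicator A (X \<omega>) = emeasure (L (X \<omega>)) S"
        by auto
    qed
    also have "\<dots> = emeasure ?B S"
      using S by (subst emeasure_bind[OF ne LX]) auto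
    finally show "emeasure ?D S = emeasure ?B S" .
  qed auto
  then have "(\<integral>\<^sup>+z. g z \<partial>?D) = (\<integral>\<^sup>+z. g z \<partial>?B)" by simp
  also have "(\<integral>\<^sup>+z. g z \<partial>?B) = (\<integral>\<^sup>+\<omega>. \<integral>\<^sup>+z. g z \<partial>L (X \<omega>) \<partial>M)"
    by (rule nn_integral_bind[OF g LX])
  also have "\<dots> = (\<integral>\<^sup>+\<omega>. \<integral>\<^sup>+y. g (X \<omega>, y) \<partial>K (X \<omega>) \<partial>M)"
  proof (rule nn_integral_cong)
    fix \<omega> assume w: "\<omega> \<in> space M"
    show "(\<integral>\<^sup>+z. g z \<partial>L (X \<omega>)) = (\<integral>\<^sup>+y. g (X \<omega>, y) \<partial>K (X \<omega>))"
      unfolding L_def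
      by (rule nn_integral_distr) (auto simp: measurable_cong_sets[OF KX(1)[OF w] refl] sp[OF w])
  qed
  finally show ?thesis by (simp add: nn_integral_distr)
qed

section \<open>Time change by a cumulated rate\<close>

locale bounded_rate =
  fixes f :: "real \<Rightarrow> ennreal" and C :: real
  assumes f [measurable]: "f \<in> borel_measurable borel"
    and f_le: "\<And>s. f s \<le> ennreal C"
    and C: "0 \<le> C"
begin

definition F :: "real \<Rightarrow> ennreal" where
  "F a = (\<integral>\<^sup>+s\<in>{0..a}. f s \<partial>lborel)"

text \<open>Generalised inverse of \<open>F\<close>. For \<open>f\<close> the birth rate along a
  path it is \<open>birth_age\<close> as a function of the level to be reached.\<close>

definition \<tau> :: "real \<Rightarrow> ereal" where
  "\<tau> z = Inf {ereal a |a. 0 \<le> a \<and> ennreal z \<le> F a}"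

lemma measurable_F [measurable]: "F \<in> borel_measurable borel"
proof -
  have "(\<lambda>a. \<integral>\<^sup>+s. (if 0 \<le> s \<and> s \<le> a then f s else 0) \<partial>lborel) \<in> borel_measurable borel"
    by measurable
  also have "(\<lambda>a. \<integral>\<^sup>+s. (if 0 \<le> s \<and> s \<le> a then f s else 0) \<partial>lborel) = F"
    unfolding F_def by (intro ext nn_integral_cong) auto
  finally show ?thesis .
qed

lemma F_mono: "a \<le> a' \<Longrightarrow> F a \<le> F a'"
  unfolding F_def by (intro nn_integral_mono) (auto split: split_indicator)

lemma F_neg: "a \<le> 0 \<Longrightarrow> F a = 0"
proof -
  assume a: "a \<le> 0"
  have "AE s in lborel. s \<noteq> (0::real)" by (rule AE_lborel_singleton)
  then have "AE s in lborel. f s * indicator {0..a} s = 0"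
    by eventually_elim (use a in \<open>auto split: split_indicator\<close>)
  then show ?thesis unfolding F_def by (subst nn_integral_0_iff_AE) auto
qed

lemma F_diff: "0 \<le> a \<Longrightarrow> a \<le> a' \<Longrightarrow> F a' = F a + (\<integral>\<^sup>+s\<in>{a<..a'}. f s \<partial>lborel)"
  unfolding F_def
  by (subst nn_integral_add[symmetric]) (auto intro!: nn_integral_cong split: split_indicator)

lemma F_Lipschitz: "0 \<le> a \<Longrightarrow> a \<le> a' \<Longrightarrow> F a' \<le> F a + ennreal (C * (a' - a))"
proof -
  assume a: "0 \<le> a" "a \<le> a'"
  have "(\<integral>\<^sup>+s\<in>{a<..a'}. f s \<partial>lborel) \<le> (\<integral>\<^sup>+s\<in>{a<..a'}. ennreal C \<partial>lborel)"
    by (intro nn_integral_mono) (auto split: split_indicator simp: f_le)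
  also have "\<dots> = ennreal (C * (a' - a))"
    using a C by (simp add: nn_integral_cmult_indicator ennreal_mult)
  finally show ?thesis using F_diff[OF a] by (simp add: add_left_mono)
qed

lemma F_finite: "F a < \<top>"
proof (cases "0 \<le> a")
  case True
  have "F a \<le> F 0 + ennreal (C * (a - 0))"
    using True by (intro F_Lipschitz) auto
  then show ?thesis by (simp add: F_neg order_le_less_trans)
qed (simp add: F_neg)

lemma \<tau>_nonneg: "0 \<le> \<tau> z"
  unfolding \<tau>_def by (rule Inf_greatest) auto

text \<open>The infimum is attained because a bounded rate makes \<open>F\<close> Lipschitz, hence
  continuous.\<close>

lemma \<tau>_le_iff:
  assumes "0 \<le> a"
  shows "\<tau> z \<le> ereal a \<longleftrightarrow> ennreal z \<le> F a"
proof
  assume "ennreal z \<le> F a"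
  then show "\<tau> z \<le> ereal a"
    unfolding \<tau>_def using assms by (intro Inf_lower) auto
next
  assume le: "\<tau> z \<le> ereal a"
  show "ennreal z \<le> F a"
  proof (rule ennreal_le_epsilon)
    fix e :: real assume e: "0 < e"
    \<comment> \<open>Moving right by \<open>h\<close> raises \<open>F\<close> by at most
      \<open>e\<close>; the \<open>+ 1\<close> covers \<open>C = 0\<close>.\<close>
    define h where "h = e / (C + 1)"
    have h: "0 < h" "C * h \<le> e" using e C by (auto simp: h_def field_simps)
    have "\<tau> z < ereal (a + h)" using le h by (auto intro: order_le_less_trans)
    then obtain a' where a': "0 \<le> a'" "ennreal z \<le> F a'" "a' < a + h"
      unfolding \<tau>_def Inf_less_iff by auto
    have "ennreal z \<le> F (a + h)" using a' F_mono[of a' "a + h"] by (auto intro: order_trans)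
    also have "\<dots> \<le> F a + ennreal (C * (a + h - a))"
      using assms h by (intro F_Lipschitz) auto
    also have "\<dots> \<le> F a + ennreal e"
      using h by (intro add_left_mono ennreal_leI) simp
    finally show "ennreal z \<le> F a + ennreal e" .
  qed
qed

lemma measurable_\<tau> [measurable]: "\<tau> \<in> borel_measurable borel"
proof (rule borel_measurableI_le)
  fix y :: ereal
  show "{x \<in> space borel. \<tau> x \<le> y} \<in> sets borel"
  proof (cases y)
    case (real a)
    have "{x. \<tau> x \<le> ereal a} = (if 0 \<le> a then {x. ennreal x \<le> F a} else {})"
      using \<tau>_nonneg by (auto simp: \<tau>_le_iff intro: order_trans dest: order_trans[OF \<tau>_nonneg])
    moreover have "{x. ennreal x \<le> F a} \<in> sets borel" by measurable
    ultimately show ?thesis using real by auto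
  next
    case MInf
    then show ?thesis using \<tau>_nonneg by (auto intro: order_trans)
  qed auto
qed

text \<open>Continuity from the left excludes an overshoot; \<open>0 < z\<close> forces
  \<open>\<tau> z > 0\<close>, so that there is room to step back.\<close>

lemma F_\<tau>:
  assumes "0 < z" "\<tau> z \<le> ereal t"
  shows "F (real_of_ereal (\<tau> z)) = ennreal z"
proof -
  obtain a where a: "\<tau> z = ereal a" "0 \<le> a" "a \<le> t"
    using assms(2) \<tau>_nonneg[of z] by (cases "\<tau> z") auto
  have ge: "ennreal z \<le> F a" using \<tau>_le_iff[OF a(2), of z] a(1) by simp
  have a0: "0 < a"
  proof (rule ccontr)
    assume "\<not> 0 < a"
    then show False using ge assms(1) by (simp add: F_neg)
  qed
  have "F a \<le> ennreal z"
  proof (rule ennreal_le_epsilon)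
    fix e :: real assume e: "0 < e"
    define h where "h = min a (e / (C + 1))"
    have "C * h \<le> C * (e / (C + 1))" using C by (intro mult_left_mono) (auto simp: h_def)
    also have "\<dots> \<le> e" using C e by (auto simp: field_simps)
    finally have h: "0 < h" "h \<le> a" "C * h \<le> e" using C e a0 by (auto simp: h_def)
    have "\<not> \<tau> z \<le> ereal (a - h)" using a h by simp
    then have "F (a - h) < ennreal z" using \<tau>_le_iff[of "a - h" z] h by (simp add: not_le)
    moreover have "F a \<le> F (a - h) + ennreal (C * (a - (a - h)))"
      using h by (intro F_Lipschitz) auto
    moreover have "ennreal (C * (a - (a - h))) \<le> ennreal e" using h by (intro ennreal_leI) simp
    ultimately show "F a \<le> ennreal z + ennreal e"
      by (meson add_mono less_imp_le order_trans)
  qed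
  then show ?thesis using ge a by simp
qed

text \<open>The image under \<open>\<tau>\<close> of Lebesgue measure on the levels has density
  \<open>f\<close>: both measures give \<open>F t - F x\<close> to the half-line beyond
  \<open>x\<close>. Arguing with measures avoids differentiating \<open>F\<close>, since
  \<open>f\<close> is merely measurable.\<close>

lemma time_change:
  assumes g [measurable]: "g \<in> borel_measurable borel" and t: "0 \<le> t"
  shows "(\<integral>\<^sup>+z. (if 0 < z \<and> \<tau> z \<le> ereal t then g (real_of_ereal (\<tau> z)) else 0) \<partial>lborel) =
    (\<integral>\<^sup>+s\<in>{0..t}. f s * g s \<partial>lborel)"
proof -
  define D where "D = {z. 0 < z \<and> \<tau> z \<le> ereal t}"
  have D [measurable]: "D \<in> sets borel" unfolding D_def by measurable
  define M1 where "M1 = distr (density lborel (indicator D)) borel (\<lambda>z. real_of_ereal (\<tau> z))"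
  define M2 where "M2 = density lborel (\<lambda>s. f s * indicator {0..t} s)"
  have e1: "emeasure M1 {x<..} = F t - F x" for x
  proof -
    have "emeasure M1 {x<..} = emeasure (density lborel (indicator D)) {z. x < real_of_ereal (\<tau> z)}"
      unfolding M1_def by (subst emeasure_distr) (auto intro!: arg_cong2[where f=emeasure])
    also have "\<dots> = emeasure lborel (D \<inter> {z. x < real_of_ereal (\<tau> z)})"
      by (subst emeasure_density)
         (auto simp flip: nn_integral_indicator simp: indicator_inter_arith)
    also have "D \<inter> {z. x < real_of_ereal (\<tau> z)} = {enn2real (F x)<..enn2real (F t)}"
    proof (cases "0 \<le> x")
      case True
      have "z \<in> D \<and> x < real_of_ereal (\<tau> z) \<longleftrightarrow> enn2real (F x) < z \<and> z \<le> enn2real (F t)" for z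
      proof -
        have "0 < z \<and> ennreal z \<le> F t \<and> \<not> ennreal z \<le> F x
            \<longleftrightarrow> enn2real (F x) < z \<and> z \<le> enn2real (F t)"
          using F_finite[of x] F_finite[of t]
          by (cases "F x"; cases "F t") (auto simp: ennreal_le_iff2 not_le)
        moreover have "z \<in> D \<and> x < real_of_ereal (\<tau> z) \<longleftrightarrow> 0 < z \<and> \<tau> z \<le> ereal t \<and> \<not> \<tau> z \<le> ereal x"
          using \<tau>_nonneg[of z] by (cases "\<tau> z") (auto simp: D_def)
        ultimately show ?thesis using \<tau>_le_iff[OF t] \<tau>_le_iff[OF True] by simp
      qed
      then show ?thesis
        by (simp only: set_eq_iff Int_iff mem_Collect_eq greaterThanAtMost_iff) simp
    next
      case False
      have "z \<in> D \<and> x < real_of_ereal (\<tau> z) \<longleftrightarrow> 0 < z \<and> z \<le> enn2real (F t)" for z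
      proof -
        have "0 < z \<and> ennreal z \<le> F t \<longleftrightarrow> 0 < z \<and> z \<le> enn2real (F t)"
          using F_finite[of t] by (cases "F t") (auto simp: ennreal_le_iff2)
        moreover have "x < real_of_ereal (\<tau> z)"
          using real_of_ereal_pos[OF \<tau>_nonneg[of z]] False by linarith
        ultimately show ?thesis using \<tau>_le_iff[OF t, of z] by (simp add: D_def)
      qed
      moreover have "F x = 0" using False by (simp add: F_neg)
      ultimately show ?thesis
        by (simp only: set_eq_iff Int_iff mem_Collect_eq greaterThanAtMost_iff) simp
    qed
    also have "emeasure lborel \<dots> = F t - F x"
    proof (cases "x \<le> t")
      case True
      have "enn2real (F x) \<le> enn2real (F t)"
        using F_mono[OF True] F_finite by (intro enn2real_mono) auto
      then show ?thesis
        using F_finite[of x] F_finite[of t]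
        by (cases "F x"; cases "F t") (auto simp: ennreal_minus)
    next
      case False
      then have "F t \<le> F x" "enn2real (F t) \<le> enn2real (F x)"
        using F_mono[of t x] F_finite by (auto intro!: enn2real_mono)
      then show ?thesis by (simp add: diff_eq_0_iff_ennreal F_finite)
    qed
    finally show ?thesis .
  qed
  have e2: "emeasure M2 {x<..} = F t - F x" for x
  proof -
    have *: "emeasure M2 {x<..} = (\<integral>\<^sup>+s\<in>{0..t} \<inter> {x<..}. f s \<partial>lborel)"
      unfolding M2_def by (subst emeasure_density) (auto simp: indicator_inter_arith mult.assoc)
    show ?thesis
    proof (cases "0 \<le> x \<and> x \<le> t")
      case True
      then have "{0..t} \<inter> {x<..} = {x<..t}" by auto
      then show ?thesis using * F_diff[of x t] True F_finite[of x] by (simp add: ennreal_add_diff_cancel_left)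
    next
      case False
      then consider "x < 0" | "t < x" by linarith
      then show ?thesis
      proof cases
        case 1
        then have "{0..t} \<inter> {x<..} = {0..t}" by auto
        then show ?thesis using * 1 by (simp add: F_neg F_def)
      next
        case 2
        then have "{0..t} \<inter> {x<..} = {}" by auto
        moreover have "F t \<le> F x" using 2 by (intro F_mono) auto
        ultimately show ?thesis using * by (simp add: diff_eq_0_iff_ennreal F_finite)
      qed
    qed
  qed
  have eq: "M1 = M2"
  proof (rule measure_eqI_lessThan)
    show "emeasure M1 {x<..} < \<infinity>" for x
      unfolding e1 using F_finite[of t] by (simp add: diff_less_top_ennreal)
  qed (auto simp: M1_def M2_def e1[unfolded M1_def] e2[unfolded M2_def])
  have "(\<integral>\<^sup>+z. (if 0 < z \<and> \<tau> z \<le> ereal t then g (real_of_ereal (\<tau> z)) else 0) \<partial>lborel)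
      = (\<integral>\<^sup>+z. indicator D z * g (real_of_ereal (\<tau> z)) \<partial>lborel)"
    by (intro nn_integral_cong) (auto simp: D_def)
  also have "\<dots> = (\<integral>\<^sup>+s. g s \<partial>M1)"
    unfolding M1_def by (simp add: nn_integral_distr nn_integral_density)
  also have "\<dots> = (\<integral>\<^sup>+s\<in>{0..t}. f s * g s \<partial>lborel)"
    unfolding eq M2_def by (simp add: nn_integral_density ac_simps)
  finally show ?thesis .
qed

text \<open>For a point process of rate \<open>f\<close>, either there is no point up to
  \<open>t\<close> or there is a first one at some \<open>s\<close>. The time change turns the
  integral into that of \<open>exp (- z)\<close> over \<open>]0, F t]\<close>.\<close>

lemma exp_forward:
  assumes t: "0 \<le> t"
  shows "exp_neg (F t) + (\<integral>\<^sup>+s\<in>{0..t}. f s * exp_neg (F s) \<partial>lborel) = 1"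
proof -
  obtain r where r: "F t = ennreal r" "0 \<le> r" using F_finite[of t] by (cases "F t") auto
  have "(\<integral>\<^sup>+s\<in>{0..t}. f s * exp_neg (F s) \<partial>lborel) =
    (\<integral>\<^sup>+z. (if 0 < z \<and> \<tau> z \<le> ereal t then exp_neg (F (real_of_ereal (\<tau> z))) else 0) \<partial>lborel)"
    by (rule time_change[symmetric, OF _ t]) measurable
  also have "\<dots> = (\<integral>\<^sup>+z. ennreal (exp (- z)) * indicator {0<..r} z \<partial>lborel)"
  proof (intro nn_integral_cong)
    fix z :: real
    show "(if 0 < z \<and> \<tau> z \<le> ereal t then exp_neg (F (real_of_ereal (\<tau> z))) else 0) =
       ennreal (exp (- z)) * indicator {0<..r} z"
      using F_\<tau>[of z t] \<tau>_le_iff[OF t, of z] r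
      by (auto simp: exp_neg_ennreal ennreal_le_iff2 split: split_indicator)
  qed
  also have "\<dots> = (\<integral>\<^sup>+z. ennreal (exp (- z)) * indicator {0..r} z \<partial>lborel)"
    by (intro nn_integral_cong_AE) (use AE_lborel_singleton[of "0::real"] in
        \<open>eventually_elim; auto split: split_indicator\<close>)
  also have "\<dots> = ennreal ((- exp (- r)) - (- exp (- 0)))"
    by (rule nn_integral_FTC_Icc) (auto intro!: derivative_eq_intros simp: r)
  finally show ?thesis
    using r by (simp add: exp_neg_ennreal flip: ennreal_plus)
qed

end

lemma nn_integral_reflect:
  fixes g :: "real \<Rightarrow> ennreal"
  assumes [measurable]: "g \<in> borel_measurable borel"
  shows "(\<integral>\<^sup>+s. g (t - s) \<partial>lborel) = (\<integral>\<^sup>+s. g s \<partial>lborel)"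
  using nn_integral_real_affine[of g "-1" t] by simp

text \<open>The same identity with the last point at \<open>r\<close> in place of the first; it
  follows by reversing time.\<close>

lemma exp_backward:
  fixes f :: "real \<Rightarrow> ennreal"
  assumes [measurable]: "f \<in> borel_measurable borel" and "\<And>s. f s \<le> ennreal C" "0 \<le> C" and t: "0 \<le> t"
  shows "exp_neg (\<integral>\<^sup>+s\<in>{0..t}. f s \<partial>lborel) +
    (\<integral>\<^sup>+r\<in>{0..t}. f r * exp_neg (\<integral>\<^sup>+s\<in>{r..t}. f s \<partial>lborel) \<partial>lborel) = 1"
proof -
  interpret bounded_rate "\<lambda>s. f (t - s)" C
    using assms by unfold_locales auto
  have F: "F a = (\<integral>\<^sup>+s\<in>{t - a..t}. f s \<partial>lborel)" for a
  proof -
    have "F a = (\<integral>\<^sup>+s. (f s * indicator {0..a} (t - s)) \<partial>lborel)"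
      unfolding F_def
      using nn_integral_reflect[of "\<lambda>s. f (t - s) * indicator {0..a} s" t]
      by simp
    also have "\<dots> = (\<integral>\<^sup>+s\<in>{t - a..t}. f s \<partial>lborel)"
      by (intro nn_integral_cong) (auto split: split_indicator)
    finally show ?thesis .
  qed
  have "(\<integral>\<^sup>+s\<in>{0..t}. f (t - s) * exp_neg (F s) \<partial>lborel)
     = (\<integral>\<^sup>+r. f r * exp_neg (F (t - r)) * indicator {0..t} (t - r) \<partial>lborel)"
    using nn_integral_reflect[of "\<lambda>s. f (t - s) * exp_neg (F s) * indicator {0..t} s" t] by simp
  also have "\<dots> = (\<integral>\<^sup>+r\<in>{0..t}. f r * exp_neg (\<integral>\<^sup>+s\<in>{r..t}. f s \<partial>lborel) \<partial>lborel)"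
    by (intro nn_integral_cong) (auto split: split_indicator simp: F)
  finally show ?thesis using exp_forward[OF t] F[of t] by simp
qed


section \<open>Product functionals of a Poisson process\<close>

locale poisson_product =
  fixes \<psi> :: "real \<Rightarrow> ennreal" and R :: real
  assumes \<psi> [measurable]: "\<psi> \<in> borel_measurable borel"
    and \<psi>_le: "\<And>z. \<psi> z \<le> 1"
    and \<psi>_1: "\<And>z. R < z \<Longrightarrow> \<psi> z = 1"
    and R: "0 \<le> R"
begin

interpretation E: prob_space exp1
  by (rule prob_space_exponential_density) simp

interpretation S: sequence_space exp1
  by unfold_locales


text \<open>Candidate for the expectation of the product of \<open>\<psi>\<close> over the points
  beyond \<open>a\<close> of a Poisson process of rate 1.\<close>

definition G :: "real \<Rightarrow> ennreal" where
  "G a = exp_neg (\<integral>\<^sup>+z. (1 - \<psi> z) * indicator {a<..} z \<partial>lborel)"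

text \<open>The same product restricted to the next \<open>j\<close> points after \<open>a\<close>;
  the points are partial sums of the gaps, as in \<open>birth_age\<close>.\<close>

definition H :: "nat \<Rightarrow> real \<Rightarrow> ennreal" where
  "H j a = (\<integral>\<^sup>+g. (\<Prod>k<j. \<psi> (a + (\<Sum>i\<le>k. g i))) \<partial>(\<Pi>\<^sub>M j\<in>(UNIV::nat set). exp1))"

lemma \<psi>_prod_le_1: "(\<Prod>k<(j::nat). \<psi> (\<sigma> k)) \<le> 1"
  by (induction j) (auto intro: mult_le_one simp: \<psi>_le)

lemma H_le_1: "H j a \<le> 1"
proof -
  have "H j a \<le> (\<integral>\<^sup>+g. 1 \<partial>(\<Pi>\<^sub>M j\<in>(UNIV::nat set). exp1))"
    unfolding H_def by (rule nn_integral_mono) (rule \<psi>_prod_le_1)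
  then show ?thesis using S.P.emeasure_space_1 by simp
qed

lemma measurable_G [measurable]: "G \<in> borel_measurable borel"
proof -
  have "(\<lambda>a. exp_neg (\<integral>\<^sup>+z. (if a < z then 1 - \<psi> z else 0) \<partial>lborel)) \<in> borel_measurable borel"
    by measurable
  also have "(\<lambda>a. exp_neg (\<integral>\<^sup>+z. (if a < z then 1 - \<psi> z else 0) \<partial>lborel)) = G"
    unfolding G_def by (intro ext arg_cong[where f=exp_neg] nn_integral_cong) auto
  finally show ?thesis .
qed

lemma measurable_H [measurable]: "H j \<in> borel_measurable borel"
proof -
  have "(\<lambda>a. \<integral>\<^sup>+g. (\<Prod>k<j. \<psi> (a + (\<Sum>i\<le>k. g i))) \<partial>(\<Pi>\<^sub>M j\<in>(UNIV::nat set). exp1)) \<in> borel_measurable borel"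
    by measurable
  then show ?thesis unfolding H_def[abs_def] .
qed

lemma G_ge_R: "R \<le> a \<Longrightarrow> G a = 1"
proof -
  assume "R \<le> a"
  then have "(\<lambda>z. (1 - \<psi> z) * indicator {a<..} z) = (\<lambda>_. 0)"
    by (auto simp: fun_eq_iff \<psi>_1 split: split_indicator)
  then show ?thesis unfolding G_def by simp
qed

lemma H_Suc: "H (Suc j) a = (\<integral>\<^sup>+z. \<psi> (a + z) * H j (a + z) \<partial>exp1)"
proof -
  let ?P = "\<Pi>\<^sub>M j\<in>(UNIV::nat set). exp1"
  have "H (Suc j) a = (\<integral>\<^sup>+g. (\<Prod>k<Suc j. \<psi> (a + (\<Sum>i\<le>k. g i)))
      \<partial>distr (exp1 \<Otimes>\<^sub>M ?P) ?P (\<lambda>(s, \<omega>). case_nat s \<omega>))"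
    unfolding H_def S.PiM_iter ..
  also have "\<dots> = (\<integral>\<^sup>+x. (\<Prod>k<Suc j. \<psi> (a + (\<Sum>i\<le>k. (case x of (s, \<omega>) \<Rightarrow> case_nat s \<omega>) i)))
      \<partial>(exp1 \<Otimes>\<^sub>M ?P))"
    by (rule nn_integral_distr) measurable
  also have "\<dots> = (\<integral>\<^sup>+x. \<psi> (a + fst x) * (\<Prod>k<j. \<psi> (a + fst x + (\<Sum>i\<le>k. snd x i))) \<partial>(exp1 \<Otimes>\<^sub>M ?P))"
    by (intro nn_integral_cong)
       (auto simp: prod.lessThan_Suc_shift sum.atMost_Suc_shift ac_simps simp del: prod.lessThan_Suc sum.atMost_Suc)
  also have "\<dots> = (\<integral>\<^sup>+z. \<integral>\<^sup>+g. \<psi> (a + z) * (\<Prod>k<j. \<psi> (a + z + (\<Sum>i\<le>k. g i))) \<partial>?P \<partial>exp1)"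
    by (subst S.P.nn_integral_fst[symmetric]) (auto simp: H_def)
  also have "\<dots> = (\<integral>\<^sup>+z. \<psi> (a + z) * H j (a + z) \<partial>exp1)"
    unfolding H_def by (intro nn_integral_cong nn_integral_cmult) simp
  finally show ?thesis .
qed

text \<open>The integrand is the density of the first point of a process of rate
  \<open>\<psi> (a + z)\<close>. Its total mass is 1 because \<open>\<psi> = 1\<close> beyond
  \<open>R\<close> makes the cumulated rate diverge.\<close>

lemma integral_\<psi>:
  "(\<integral>\<^sup>+z. \<psi> (a + z) * exp_neg (\<integral>\<^sup>+s\<in>{0..z}. \<psi> (a + s) \<partial>lborel) * indicator {0..} z \<partial>lborel) = 1"
proof -
  interpret bounded_rate "\<lambda>s. \<psi> (a + s)" 1
    by unfold_locales (auto simp: \<psi>_le)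
  define I where "I n = (\<integral>\<^sup>+s\<in>{0..real n}. \<psi> (a + s) * exp_neg (F s) \<partial>lborel)" for n
  define g where "g s = \<psi> (a + s) * exp_neg (F s)" for s
  have [measurable]: "g \<in> borel_measurable borel" unfolding g_def by measurable
  have "(\<lambda>n. \<integral>\<^sup>+s. g s * indicator {0..real n} s \<partial>lborel) \<longlonglongrightarrow> (\<integral>\<^sup>+s. g s * indicator {0..} s \<partial>lborel)"
  proof (rule nn_integral_LIMSEQ)
    show "incseq (\<lambda>n s. g s * indicator {0..real n} s)"
      by (auto simp: incseq_def le_fun_def split: split_indicator)
    show "(\<lambda>n. g s * indicator {0..real n} s) \<longlonglongrightarrow> g s * indicator {0..} s" for s
    proof -
      obtain N where "s \<le> real N" using real_arch_simple by blast
      then have "eventually (\<lambda>n. g s * indicator {0..real n} s = g s * indicator {0..} s) sequentially"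
        by (intro eventually_sequentiallyI[of N]) (auto split: split_indicator)
      then show ?thesis by (rule tendsto_eventually)
    qed
  qed auto
  then have lim: "I \<longlonglongrightarrow> (\<integral>\<^sup>+s. g s * indicator {0..} s \<partial>lborel)"
    unfolding I_def g_def .
  have lim0: "(\<lambda>n. exp_neg (F (real n))) \<longlonglongrightarrow> 0"
  proof (rule tendsto_sandwich[where f="\<lambda>_. 0"])
    define r where "r = max 0 (R - a)"
    show "\<forall>\<^sub>F n in sequentially. exp_neg (F (real n)) \<le> ennreal (exp (- (real n - r)))"
    proof (rule eventually_sequentiallyI[of "nat \<lceil>r\<rceil>"])
      fix n assume "nat \<lceil>r\<rceil> \<le> n"
      then have n: "r \<le> real n" by linarith
      have "ennreal (real n - r) = (\<integral>\<^sup>+s. indicator {r<..real n} s \<partial>lborel)"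
        using n by simp
      also have "\<dots> \<le> F (real n)"
        unfolding F_def by (intro nn_integral_mono) (auto simp: r_def \<psi>_1 split: split_indicator)
      finally show "exp_neg (F (real n)) \<le> ennreal (exp (- (real n - r)))"
        using exp_neg_antimono exp_neg_ennreal[of "real n - r"] n by fastforce
    qed
    have "((\<lambda>n. exp (- (real n - r))) \<longlongrightarrow> 0) sequentially"
      by real_asymp
    then show "(\<lambda>n. ennreal (exp (- (real n - r)))) \<longlonglongrightarrow> 0"
      using tendsto_ennrealI by fastforce
  qed auto
  have "exp_neg (F (real n)) + I n = 1" for n
    unfolding I_def by (rule exp_forward) simp
  then have "(\<lambda>n::nat. 1) \<longlonglongrightarrow> 0 + (\<integral>\<^sup>+s. g s * indicator {0..} s \<partial>lborel)"
    using tendsto_add[OF lim0 lim] by simp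
  then have "0 + (\<integral>\<^sup>+s. g s * indicator {0..} s \<partial>lborel) = 1"
    using LIMSEQ_const_iff by metis
  then show ?thesis
    unfolding g_def F_def by simp
qed

text \<open>First-step equation: the first point after \<open>a\<close> is at an exponential
  distance. Multiplying \<open>\<psi> (a + z) * G (a + z)\<close> by \<open>exp (- z)\<close> gives
  \<open>G a\<close> times the density of \<open>integral_\<psi>\<close>.\<close>

lemma G_rec: "(\<integral>\<^sup>+z. \<psi> (a + z) * G (a + z) \<partial>exp1) = G a"
proof -
  have key: "exp_neg (ennreal z) * G (a + z) = G a * exp_neg (\<integral>\<^sup>+s\<in>{0..z}. \<psi> (a + s) \<partial>lborel)"
    if z: "0 \<le> z" for z
  proof -
    have "ennreal z + (\<integral>\<^sup>+y. (1 - \<psi> y) * indicator {a + z<..} y \<partial>lborel)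
       = (\<integral>\<^sup>+y. indicator {a..a + z} y \<partial>lborel) + (\<integral>\<^sup>+y. (1 - \<psi> y) * indicator {a + z<..} y \<partial>lborel)"
      using z by simp
    also have "\<dots> = (\<integral>\<^sup>+y. indicator {a..a + z} y + (1 - \<psi> y) * indicator {a + z<..} y \<partial>lborel)"
      by (subst nn_integral_add) auto
    also have "\<dots> = (\<integral>\<^sup>+y. (1 - \<psi> y) * indicator {a<..} y + \<psi> y * indicator {a..a + z} y \<partial>lborel)"
    proof (intro nn_integral_cong_AE)
      have *: "1 - \<psi> y + \<psi> y = 1" for y
        using \<psi>_le[of y] by (simp add: diff_add_cancel_ennreal)
      show "AE y in lborel. indicator {a..a + z} y + (1 - \<psi> y) * indicator {a + z<..} y =
          (1 - \<psi> y) * indicator {a<..} y + \<psi> y * indicator {a..a + z} y"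
        using AE_lborel_singleton[of a]
        by eventually_elim (use z in \<open>auto split: split_indicator simp: *\<close>)
    qed
    also have "\<dots> = (\<integral>\<^sup>+y. (1 - \<psi> y) * indicator {a<..} y \<partial>lborel) + (\<integral>\<^sup>+y. \<psi> y * indicator {a..a + z} y \<partial>lborel)"
      by (subst nn_integral_add) auto
    also have "(\<integral>\<^sup>+y. \<psi> y * indicator {a..a + z} y \<partial>lborel) = (\<integral>\<^sup>+s\<in>{0..z}. \<psi> (a + s) \<partial>lborel)"
      by (subst nn_integral_real_affine[where c=1 and t=a])
         (auto intro!: nn_integral_cong split: split_indicator)
    finally show ?thesis
      unfolding G_def by (simp flip: exp_neg_add)
  qed
  have "(\<integral>\<^sup>+z. \<psi> (a + z) * G (a + z) \<partial>exp1)
     = (\<integral>\<^sup>+z. G a * (\<psi> (a + z) * exp_neg (\<integral>\<^sup>+s\<in>{0..z}. \<psi> (a + s) \<partial>lborel) * indicator {0..} z) \<partial>lborel)"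
  proof (subst nn_integral_density, measurable, intro nn_integral_cong)
    fix z :: real
    show "ennreal (exponential_density 1 z) * (\<psi> (a + z) * G (a + z)) =
      G a * (\<psi> (a + z) * exp_neg (\<integral>\<^sup>+s\<in>{0..z}. \<psi> (a + s) \<partial>lborel) * indicator {0..} z)"
    proof (cases "0 \<le> z")
      case True
      have "ennreal (exponential_density 1 z) * (\<psi> (a + z) * G (a + z))
         = \<psi> (a + z) * (exp_neg (ennreal z) * G (a + z))"
        using True by (simp add: exponential_density_def exp_neg_ennreal mult_ac)
      then show ?thesis using key[OF True] True by (simp add: mult_ac)
    qed (simp add: exponential_density_def)
  qed
  also have "\<dots> = G a"
  proof -
    interpret bounded_rate "\<lambda>s. \<psi> (a + s)" 1
      by unfold_locales (auto simp: \<psi>_le)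
    have "(\<lambda>z. \<psi> (a + z) * exp_neg (F z) * indicator {0..} z) \<in> borel_measurable lborel"
      by measurable
    then show ?thesis
      using integral_\<psi>[of a] by (subst nn_integral_cmult) (simp_all add: F_def)
  qed
  finally show ?thesis .
qed

lemma G_le_H: "G a \<le> H j a"
proof (induction j arbitrary: a)
  case 0
  then show ?case using S.P.emeasure_space_1 exp_neg_le_1 by (simp add: H_def G_def)
next
  case (Suc j)
  have "G a = (\<integral>\<^sup>+z. \<psi> (a + z) * G (a + z) \<partial>exp1)" by (rule G_rec[symmetric])
  also have "\<dots> \<le> (\<integral>\<^sup>+z. \<psi> (a + z) * H j (a + z) \<partial>exp1)"
    by (intro nn_integral_mono mult_left_mono Suc) auto
  finally show ?case by (simp add: H_Suc)
qed

text \<open>Both functionals obey the same recursion, and from \<open>R\<close> on the excess of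
  \<open>H\<close> over \<open>G\<close> is 0 because \<open>G = 1\<close> there. From below
  \<open>R\<close> the next point exceeds \<open>R\<close> with probability at least
  \<open>exp (- R)\<close>, so each step multiplies the error by at most
  \<open>1 - exp (- R)\<close>.\<close>

lemma H_le_G:
  "0 \<le> a \<Longrightarrow> H j a \<le> G a + ennreal ((1 - exp (- R)) ^ j) * indicator {..<R} a"
proof (induction j arbitrary: a)
  case 0
  then show ?case
    using H_le_1[of 0 a] G_ge_R[of a]
    by (cases "a < R") (auto intro: order_trans add_increasing)
next
  case (Suc j)
  define q where "q = 1 - exp (- R)"
  have q: "0 \<le> q" using R by (simp add: q_def)
  show ?case
  proof (cases "a < R")
    case False
    then show ?thesis using H_le_1[of "Suc j" a] G_ge_R[of a] by simp
  next
    case True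
    have "H (Suc j) a = (\<integral>\<^sup>+z. \<psi> (a + z) * H j (a + z) \<partial>exp1)" by (rule H_Suc)
    also have "\<dots> \<le> (\<integral>\<^sup>+z. \<psi> (a + z) * G (a + z) + ennreal (q ^ j) * indicator {..R - a} z \<partial>exp1)"
    proof (intro nn_integral_mono_AE)
      have "AE z in exp1. 0 \<le> z"
        by (subst AE_density) (auto simp: exponential_density_def)
      then show "AE z in exp1. \<psi> (a + z) * H j (a + z)
          \<le> \<psi> (a + z) * G (a + z) + ennreal (q ^ j) * indicator {..R - a} z"
      proof eventually_elim
        case (elim z)
        have "\<psi> (a + z) * H j (a + z) \<le> \<psi> (a + z) * (G (a + z) + ennreal (q ^ j) * indicator {..<R} (a + z))"
          using Suc elim by (intro mult_left_mono) (auto simp: q_def)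
        also have "\<dots> \<le> \<psi> (a + z) * G (a + z) + ennreal (q ^ j) * indicator {..R - a} z"
          using \<psi>_le[of "a + z"] mult_right_mono[OF \<psi>_le[of "a + z"], of "ennreal (q ^ j)"]
          by (auto simp: distrib_left split: split_indicator)
        finally show ?case .
      qed
    qed
    also have "\<dots> = G a + ennreal (q ^ j) * emeasure exp1 {..R - a}"
      by (subst nn_integral_add) (auto simp: G_rec nn_integral_cmult_indicator)
    also have "emeasure exp1 {..R - a} = ennreal (1 - exp (- (R - a)))"
    proof -
      have "distributed exp1 lborel (\<lambda>x. x) (exponential_density 1)"
        by (auto simp: distributed_def exponential_density_nonneg distr_id2)
      from E.exponential_distributedD_le[OF this, of "R - a"] True
      show ?thesis by (simp add: E.emeasure_eq_measure atMost_def)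
    qed
    also have "ennreal (q ^ j) * ennreal (1 - exp (- (R - a))) \<le> ennreal (q ^ j) * ennreal q"
      using Suc.prems by (intro mult_left_mono ennreal_leI) (auto simp: q_def)
    also have "\<dots> = ennreal (q ^ Suc j)"
      using q by (simp add: ennreal_mult mult.commute)
    finally show ?thesis using True by (simp add: q_def)
  qed
qed

text \<open>Laplace functional of the Poisson process. The infinite product is encoded as an infimum
  of finite ones, which is legitimate since all factors are at most 1.\<close>

lemma expectation:
  "(\<integral>\<^sup>+g. (INF j. \<Prod>k<(j::nat). \<psi> (\<Sum>i\<le>k. g i)) \<partial>(\<Pi>\<^sub>M j\<in>(UNIV::nat set). exp1)) =
    exp_neg (\<integral>\<^sup>+z. (1 - \<psi> z) * indicator {0<..} z \<partial>lborel)"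
proof -
  have anti: "decseq (\<lambda>j. (\<Prod>k<(j::nat). \<psi> (\<sigma> k)))" for \<sigma>
  proof (intro decseq_SucI)
    fix n
    show "(\<Prod>k<Suc n. \<psi> (\<sigma> k)) \<le> (\<Prod>k<n. \<psi> (\<sigma> k))"
      using mult_left_mono[OF \<psi>_le, of "\<Prod>k<n. \<psi> (\<sigma> k)" "\<sigma> n"] by simp
  qed
  have "(\<integral>\<^sup>+g. (INF j. \<Prod>k<(j::nat). \<psi> (\<Sum>i\<le>k. g i)) \<partial>(\<Pi>\<^sub>M j\<in>(UNIV::nat set). exp1))
     = (INF j. \<integral>\<^sup>+g. (\<Prod>k<(j::nat). \<psi> (\<Sum>i\<le>k. g i)) \<partial>(\<Pi>\<^sub>M j\<in>(UNIV::nat set). exp1))"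
  proof (rule nn_integral_monotone_convergence_INF_decseq[where i=0])
    show "decseq (\<lambda>j g. \<Prod>k<(j::nat). \<psi> (\<Sum>i\<le>k. g i))"
      using decseq_SucD[OF anti] by (intro decseq_SucI le_funI) simp
    show "(\<integral>\<^sup>+g. (\<Prod>k<(0::nat). \<psi> (\<Sum>i\<le>k. g i)) \<partial>(\<Pi>\<^sub>M j\<in>(UNIV::nat set). exp1)) < \<infinity>"
      using S.P.emeasure_space_1 by simp
  qed measurable
  also have "\<dots> = (INF j. H j 0)" by (simp add: H_def)
  also have "\<dots> = G 0"
  proof (rule antisym)
    have lim: "(\<lambda>j. (1 - exp (- R)) ^ j) \<longlonglongrightarrow> 0"
      using R by (intro LIMSEQ_realpow_zero) auto
    have "(\<lambda>j. G 0 + ennreal ((1 - exp (- R)) ^ j)) \<longlonglongrightarrow> G 0 + 0"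
      using tendsto_ennrealI[OF lim] by (intro tendsto_add) auto
    moreover have "(INF j. H j 0) \<le> G 0 + ennreal ((1 - exp (- R)) ^ j)" for j
    proof -
      have "(INF j. H j 0) \<le> H j 0" by (rule INF_lower) simp
      also have "\<dots> \<le> G 0 + ennreal ((1 - exp (- R)) ^ j) * indicator {..<R} 0" by (rule H_le_G) simp
      also have "\<dots> \<le> G 0 + ennreal ((1 - exp (- R)) ^ j)" by (auto split: split_indicator)
      finally show ?thesis .
    qed
    ultimately show "(INF j. H j 0) \<le> G 0"
      by (intro LIMSEQ_le_const) auto
  qed (auto intro: INF_greatest G_le_H)
  finally show ?thesis by (simp add: G_def)
qed

end

section \<open>Path functionals and the Feynman--Kac semigroup\<close>

text \<open>Freezing the path at its initial value for negative times makes it a function of all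
  real times, measurable for \<open>borel\<close> instead of a restricted space.\<close>

definition path_at :: "(real \<Rightarrow> real) \<Rightarrow> real \<Rightarrow> real" where
  "path_at w s = w (max 0 s)"

definition path_shift :: "real \<Rightarrow> (real \<Rightarrow> real) \<Rightarrow> real \<Rightarrow> real" where
  "path_shift r w = (\<lambda>t. w (max 0 r + t))"

lemma path_at_shift: "0 \<le> r \<Longrightarrow> 0 \<le> s \<Longrightarrow> path_at (path_shift r w) s = path_at w (r + s)"
  by (simp add: path_at_def path_shift_def)

lemma nn_integral_translate:
  fixes h :: "real \<Rightarrow> ennreal"
  assumes "h \<in> borel_measurable borel"
  shows "(\<integral>\<^sup>+a. h (s + a) \<partial>lborel) = (\<integral>\<^sup>+a. h a \<partial>lborel)"
  using nn_integral_real_affine[OF assms, of 1 s] by simp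

lemma space_path_space [simp]: "space (path_space D I) = D"
  by (simp add: path_space_def space_measure_of_conv)

lemma sets_path_space:
  "sets (path_space D I) = sigma_sets D {{w \<in> D. w s \<in> B} |s B. s \<in> I \<and> B \<in> sets borel}"
  unfolding path_space_def by (rule sets_measure_of) auto

lemma measurable_path_coordinate:
  "s \<in> I \<Longrightarrow> (\<lambda>w. w s) \<in> path_space D I \<rightarrow>\<^sub>M borel"
  by (rule measurableI) (auto simp: sets_path_space intro!: sigma_sets.Basic)

lemma measurable_path_spaceI:
  assumes "\<And>x. x \<in> space M \<Longrightarrow> X x \<in> D" and "\<And>s. s \<in> I \<Longrightarrow> (\<lambda>x. X x s) \<in> M \<rightarrow>\<^sub>M borel"
  shows "X \<in> M \<rightarrow>\<^sub>M path_space D I"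
  unfolding path_space_def
proof (rule measurable_measure_of)
  show "X -` A \<inter> space M \<in> sets M"
    if A': "A \<in> {{w \<in> D. w s \<in> B} |s B. s \<in> I \<and> B \<in> sets borel}" for A
  proof -
    obtain s B where A: "A = {w \<in> D. w s \<in> B}" "s \<in> I" "B \<in> sets borel" using A' by blast
    have "(\<lambda>x. X x s) -` B \<inter> space M \<in> sets M"
      using assms(2)[OF A(2)] A(3) by (rule measurable_sets)
    also have "(\<lambda>x. X x s) -` B \<inter> space M = X -` A \<inter> space M"
      using assms(1) A by auto
    finally show ?thesis .
  qed
qed (use assms(1) in auto)

lemma measurable_path_space_mono:
  "J \<subseteq> I \<Longrightarrow> (\<lambda>w. w) \<in> path_space D I \<rightarrow>\<^sub>M path_space D J"
  by (rule measurable_path_spaceI) (auto intro: measurable_path_coordinate)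

section \<open>Measurability along paths and the Markov property\<close>

context markov_process
begin

abbreviation PS :: "(real \<Rightarrow> real) measure" where
  "PS \<equiv> path_space D {0..}"

lemma measurable_path_at_min:
  assumes t: "0 \<le> t"
  shows "(\<lambda>(s, w). path_at w (min s t)) \<in> borel \<Otimes>\<^sub>M path_space D {0..t} \<rightarrow>\<^sub>M borel"
proof -
  have "(\<lambda>(s, w). (max 0 (min s t), w)) \<in> borel \<Otimes>\<^sub>M path_space D {0..t} \<rightarrow>\<^sub>M
      restrict_space borel {0..t} \<Otimes>\<^sub>M path_space D {0..t}"
    unfolding split_beta'
    by (intro measurable_Pair measurable_restrict_space2) (use t in auto)
  from measurable_compose[OF this progressive[OF t]] show ?thesis
    by (simp add: split_beta' path_at_def)
qed

text \<open>Progressive measurability speaks of bounded time intervals. The path stopped at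
  \<open>n\<close> agrees at any given time with the path itself for all large
  \<open>n\<close>.\<close>

lemma measurable_path_at_pair: "(\<lambda>(s, w). path_at w s) \<in> borel \<Otimes>\<^sub>M PS \<rightarrow>\<^sub>M borel"
proof (rule borel_measurable_LIMSEQ_metric)
  show "(\<lambda>(s, w). path_at w (min s (real n))) \<in> borel \<Otimes>\<^sub>M PS \<rightarrow>\<^sub>M borel" for n
  proof -
    have "(\<lambda>(s, w). (s, w)) \<in> borel \<Otimes>\<^sub>M PS \<rightarrow>\<^sub>M borel \<Otimes>\<^sub>M path_space D {0..real n}"
      unfolding split_beta'
      by (intro measurable_Pair measurable_compose[OF measurable_snd measurable_path_space_mono]) auto
    from measurable_compose[OF this measurable_path_at_min[of "real n"]] show ?thesis
      by (simp add: split_beta')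
  qed
  show "(\<lambda>n. case x of (s, w) \<Rightarrow> path_at w (min s (real n))) \<longlonglongrightarrow> (case x of (s, w) \<Rightarrow> path_at w s)" for x
  proof -
    obtain N where N: "fst x \<le> real N" using real_arch_simple by blast
    have "eventually (\<lambda>n. (case x of (s, w) \<Rightarrow> path_at w (min s (real n))) = (case x of (s, w) \<Rightarrow> path_at w s)) sequentially"
      by (rule eventually_sequentiallyI[of N]) (use N in \<open>auto simp: split_beta' min_def\<close>)
    then show ?thesis by (rule tendsto_eventually)
  qed
qed

lemma measurable_path_at [measurable (raw)]:
  assumes "f \<in> M \<rightarrow>\<^sub>M borel" "g \<in> M \<rightarrow>\<^sub>M PS"
  shows "(\<lambda>x. path_at (g x) (f x)) \<in> M \<rightarrow>\<^sub>M borel"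
  using measurable_compose[OF measurable_Pair[OF assms] measurable_path_at_pair] by simp

lemma path_shift_closed: "w \<in> D \<Longrightarrow> path_shift r w \<in> D"
  unfolding path_shift_def by (rule shift_closed) auto

lemma measurable_path_shift [measurable (raw)]:
  assumes [measurable]: "f \<in> M \<rightarrow>\<^sub>M borel" "g \<in> M \<rightarrow>\<^sub>M PS"
  shows "(\<lambda>x. path_shift (f x) (g x)) \<in> M \<rightarrow>\<^sub>M PS"
proof (rule measurable_path_spaceI)
  show "path_shift (f x) (g x) \<in> D" if "x \<in> space M" for x
    using measurable_space[OF assms(2) that] by (simp add: path_shift_closed)
  show "(\<lambda>x. path_shift (f x) (g x) s) \<in> M \<rightarrow>\<^sub>M borel" if s: "s \<in> {0..}" for s
  proof -
    have "(\<lambda>x. path_at (g x) (max 0 (f x) + s)) \<in> M \<rightarrow>\<^sub>M borel" by measurable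
    then show ?thesis using s by (simp add: path_at_def path_shift_def)
  qed
qed

lemma measurable_path_nn_integral:
  fixes k :: "'x \<Rightarrow> real \<Rightarrow> real \<Rightarrow> ennreal"
  assumes [measurable]: "(\<lambda>(x, s, y). k x s y) \<in> borel_measurable (M \<Otimes>\<^sub>M borel \<Otimes>\<^sub>M borel)"
    and [measurable]: "p \<in> borel_measurable M" "q \<in> borel_measurable M" "g \<in> M \<rightarrow>\<^sub>M PS"
  shows "(\<lambda>x. \<integral>\<^sup>+s\<in>{p x..q x}. k x s (path_at (g x) s) \<partial>lborel) \<in> borel_measurable M"
proof -
  have "(\<lambda>x. \<integral>\<^sup>+s. (if p x \<le> s \<and> s \<le> q x then (\<lambda>(x, s, y). k x s y) (x, s, path_at (g x) s) else 0) \<partial>lborel)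
      \<in> borel_measurable M"
    by measurable
  also have "(\<lambda>x. \<integral>\<^sup>+s. (if p x \<le> s \<and> s \<le> q x then (\<lambda>(x, s, y). k x s y) (x, s, path_at (g x) s) else 0) \<partial>lborel)
     = (\<lambda>x. \<integral>\<^sup>+s\<in>{p x..q x}. k x s (path_at (g x) s) \<partial>lborel)"
    by (intro ext nn_integral_cong) auto
  finally show ?thesis .
qed

lemma cumulated_path_at: "cumulated r w a = (\<integral>\<^sup>+s\<in>{0..a}. ennreal (r (path_at w s)) \<partial>lborel)"
  unfolding cumulated_def by (intro nn_integral_cong) (auto simp: path_at_def split: split_indicator)

lemma measurable_cumulated [measurable (raw)]:
  assumes [measurable]: "r \<in> borel_measurable borel" "g \<in> M \<rightarrow>\<^sub>M PS" "a \<in> borel_measurable M"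
  shows "(\<lambda>x. cumulated r (g x) (a x)) \<in> borel_measurable M"
  unfolding cumulated_path_at
  by (rule measurable_path_nn_integral) measurable

text \<open>Measurability with respect to the past up to \<open>t\<close> is what allows a weight at
  time \<open>t\<close> to appear as past factor in \<open>markov_nn_integral\<close>.\<close>

lemma measurable_cumulated_past:
  assumes [measurable]: "r \<in> borel_measurable borel" and t: "0 \<le> t"
  shows "(\<lambda>w. cumulated r w t) \<in> borel_measurable (path_space D {0..t})"
proof -
  note measurable_path_at_min[OF t, measurable]
  have "(\<lambda>w. \<integral>\<^sup>+s. ennreal (r ((\<lambda>(s, w). path_at w (min s t)) (s, w))) * indicator {0..t} s \<partial>lborel)
      \<in> borel_measurable (path_space D {0..t})"
    by measurable
  also have "(\<lambda>w. \<integral>\<^sup>+s. ennreal (r ((\<lambda>(s, w). path_at w (min s t)) (s, w))) * indicator {0..t} s \<partial>lborel)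
    = (\<lambda>w. cumulated r w t)"
    unfolding cumulated_path_at by (intro ext nn_integral_cong) (auto split: split_indicator simp: min_def)
  finally show ?thesis .
qed

lemma cumulated_add:
  assumes [measurable]: "r \<in> borel_measurable borel" and w: "w \<in> D" and "0 \<le> s" "0 \<le> t"
  shows "cumulated r w (s + t) = cumulated r w s + cumulated r (path_shift s w) t"
proof -
  have [measurable]: "(\<lambda>_. w) \<in> borel \<rightarrow>\<^sub>M PS" using w by simp
  have "cumulated r (path_shift s w) t = (\<integral>\<^sup>+a\<in>{0..t}. ennreal (r (path_at w (s + a))) \<partial>lborel)"
    unfolding cumulated_path_at using \<open>0 \<le> s\<close>
    by (intro nn_integral_cong) (auto simp: path_at_shift split: split_indicator)
  also have "\<dots> = (\<integral>\<^sup>+a. ennreal (r (path_at w a)) * indicator {s..s + t} a \<partial>lborel)"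
    using nn_integral_translate[of "\<lambda>a. ennreal (r (path_at w a)) * indicator {s..s + t} a" s]
    by (simp add: indicator_def)
  finally have "cumulated r w s + cumulated r (path_shift s w) t =
    (\<integral>\<^sup>+a. ennreal (r (path_at w a)) * indicator {0..s} a + ennreal (r (path_at w a)) * indicator {s..s + t} a \<partial>lborel)"
    unfolding cumulated_path_at by (subst nn_integral_add) auto
  also have "\<dots> = (\<integral>\<^sup>+a. ennreal (r (path_at w a)) * indicator {0..s + t} a \<partial>lborel)"
    by (intro nn_integral_cong_AE)
       (use AE_lborel_singleton[of s] in eventually_elim, use assms in \<open>auto split: split_indicator\<close>)
  finally show ?thesis by (simp add: cumulated_path_at)
qed

lemma P_prob: "prob_space (P x)" and P_sets [simp]: "sets (P x) = sets PS"
  using measurable_space[OF kernel, of x] by (auto simp: space_prob_algebra)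

lemma P_space [simp]: "space (P x) = D"
  using sets_eq_imp_space_eq[OF P_sets, of x] by simp

lemma P_measurable [simp]: "P x \<rightarrow>\<^sub>M N = PS \<rightarrow>\<^sub>M N"
  by (rule measurable_cong_sets) auto

lemma P_subprob [measurable]: "P \<in> borel \<rightarrow>\<^sub>M subprob_algebra PS"
  using kernel by (rule measurable_prob_algebraD)

text \<open>Instance of the disintegration with the past as conditioning variable and the kernel
  \<open>P\<close> evaluated at the current position.\<close>

lemma markov_nn_integral:
  assumes r: "0 \<le> r" and G: "G \<in> borel_measurable (path_space D {0..r} \<Otimes>\<^sub>M PS)"
  shows "(\<integral>\<^sup>+w. G (w, path_shift r w) \<partial>P x) = (\<integral>\<^sup>+w. \<integral>\<^sup>+w'. G (w, w') \<partial>P (path_at w r) \<partial>P x)"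
proof (rule nn_integral_disintegration[where ?N1.0="path_space D {0..r}"])
  show "prob_space (P x)" by (rule P_prob)
  show "(\<lambda>w. w) \<in> P x \<rightarrow>\<^sub>M path_space D {0..r}"
    by simp (rule measurable_path_space_mono, auto)
  show "(\<lambda>w. path_shift r w) \<in> P x \<rightarrow>\<^sub>M PS" by simp measurable
  have "(\<lambda>w. path_at w r) \<in> path_space D {0..r} \<rightarrow>\<^sub>M borel"
    using r by (auto simp: path_at_def intro: measurable_path_coordinate)
  from measurable_compose[OF this kernel]
  show "(\<lambda>w. P (path_at w r)) \<in> path_space D {0..r} \<rightarrow>\<^sub>M prob_algebra PS" .
  fix A B assume A: "A \<in> sets (path_space D {0..r})" and B: "B \<in> sets PS"
  have "A \<subseteq> D" using sets.sets_into_space[OF A] by simp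
  then have "{w \<in> space (P x). w \<in> A \<and> path_shift r w \<in> B} = {w \<in> A. (\<lambda>t. w (r + t)) \<in> B}"
    using r by (auto simp: path_shift_def)
  then show "emeasure (P x) {w \<in> space (P x). w \<in> A \<and> path_shift r w \<in> B} =
      (\<integral>\<^sup>+w. emeasure (P (path_at w r)) B * indicator A w \<partial>P x)"
    using markov[OF r A B] r by (simp add: path_at_def)
qed (rule G)

end

section \<open>Weight and semigroup with values in \<open>ennreal\<close>\<close>

locale branching_rates = markov_process D P
  for D :: "(real \<Rightarrow> real) set" and P :: "real \<Rightarrow> (real \<Rightarrow> real) measure" +
  fixes b d :: "real \<Rightarrow> real" and bs :: real
  assumes b_meas [measurable]: "b \<in> borel_measurable borel"
    and d_meas [measurable]: "d \<in> borel_measurable borel"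
    and b_nonneg: "\<And>y. 0 \<le> b y" and d_nonneg: "\<And>y. 0 \<le> d y"
    and b_le: "\<And>y. b y \<le> bs"
begin

lemma bs_nonneg: "0 \<le> bs"
  using b_nonneg b_le by (rule order_trans)

lemma cumulated_b_le: "0 \<le> t \<Longrightarrow> cumulated b w t \<le> ennreal (bs * t)"
proof -
  assume t: "0 \<le> t"
  have "cumulated b w t \<le> (\<integral>\<^sup>+s\<in>{0..t}. ennreal bs \<partial>lborel)"
    unfolding cumulated_def by (intro nn_integral_mono) (auto split: split_indicator simp: b_le ennreal_leI)
  also have "\<dots> = ennreal (bs * t)"
    using t bs_nonneg by (simp add: nn_integral_cmult_indicator ennreal_mult)
  finally show ?thesis .
qed

text \<open>Exponential of the integral of \<open>b - d\<close>, split in two because the birth part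
  is always finite while the death part may be infinite and then gives weight 0.\<close>

definition Wt :: "real \<Rightarrow> (real \<Rightarrow> real) \<Rightarrow> ennreal" where
  "Wt t w = ennreal (exp (enn2real (cumulated b w t))) * exp_neg (cumulated d w t)"

definition Sn :: "real \<Rightarrow> (real \<Rightarrow> ennreal) \<Rightarrow> real \<Rightarrow> ennreal" where
  "Sn t f x = (\<integral>\<^sup>+w. Wt t w * f (path_at w t) \<partial>P x)"

lemma measurable_Wt [measurable (raw)]:
  assumes [measurable]: "t \<in> borel_measurable M" "g \<in> M \<rightarrow>\<^sub>M PS"
  shows "(\<lambda>x. Wt (t x) (g x)) \<in> borel_measurable M"
  unfolding Wt_def by measurable

lemma measurable_Wt_past: "0 \<le> t \<Longrightarrow> Wt t \<in> borel_measurable (path_space D {0..t})"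
  unfolding Wt_def[abs_def]
  using measurable_cumulated_past[OF b_meas] measurable_cumulated_past[OF d_meas]
  by measurable

lemma Wt_le: "0 \<le> t \<Longrightarrow> Wt t w \<le> ennreal (exp (bs * t))"
proof -
  assume t: "0 \<le> t"
  have "enn2real (cumulated b w t) \<le> bs * t"
    using cumulated_b_le[OF t] t bs_nonneg by (intro enn2real_leI) auto
  then have "Wt t w \<le> ennreal (exp (bs * t)) * 1"
    unfolding Wt_def by (intro mult_mono exp_neg_le_1 ennreal_leI) auto
  then show ?thesis by simp
qed

lemma Wt_add:
  assumes w: "w \<in> D" and s: "0 \<le> s" and t: "0 \<le> t"
  shows "Wt (s + t) w = Wt s w * Wt t (path_shift s w)"
proof -
  have fin: "cumulated b w s < \<top>" "cumulated b (path_shift s w) t < \<top>"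
    by (rule le_less_trans[OF cumulated_b_le[OF s]], simp)
       (rule le_less_trans[OF cumulated_b_le[OF t]], simp)
  then have "enn2real (cumulated b w (s + t)) = enn2real (cumulated b w s) + enn2real (cumulated b (path_shift s w) t)"
    using cumulated_add[OF b_meas w s t] by (simp add: enn2real_plus)
  then show ?thesis
    unfolding Wt_def using cumulated_add[OF d_meas w s t]
    by (simp add: exp_add ennreal_mult exp_neg_add mult_ac)
qed

lemma measurable_Sn [measurable (raw)]:
  assumes [measurable]: "t \<in> borel_measurable M" "z \<in> borel_measurable M"
    and f: "(\<lambda>(x, y). f x y) \<in> borel_measurable (M \<Otimes>\<^sub>M borel)"
  shows "(\<lambda>x. Sn (t x) (f x) (z x)) \<in> borel_measurable M"
  unfolding Sn_def
proof (rule nn_integral_measurable_subprob_algebra2)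
  note f[measurable]
  have "(\<lambda>(x, w). Wt (t x) w * (\<lambda>(x, y). f x y) (x, path_at w (t x))) \<in> borel_measurable (M \<Otimes>\<^sub>M PS)"
    by measurable
  then show "(\<lambda>(x, w). Wt (t x) w * f x (path_at w (t x))) \<in> borel_measurable (M \<Otimes>\<^sub>M PS)"
    by simp
  show "(\<lambda>x. P (z x)) \<in> M \<rightarrow>\<^sub>M subprob_algebra PS" by measurable
qed

lemma Sn_semigroup:
  assumes s: "0 \<le> s" and t: "0 \<le> t" and f [measurable]: "f \<in> borel_measurable borel"
  shows "Sn (s + t) f x = Sn s (Sn t f) x"
proof -
  note measurable_Wt_past[OF s, measurable]
  have "Sn (s + t) f x = (\<integral>\<^sup>+w. (\<lambda>(w, w'). Wt s w * (Wt t w' * f (path_at w' t))) (w, path_shift s w) \<partial>P x)"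
    unfolding Sn_def
    by (intro nn_integral_cong) (simp add: Wt_add[OF _ s t] path_at_shift s t mult.assoc)
  also have "\<dots> = (\<integral>\<^sup>+w. \<integral>\<^sup>+w'. (\<lambda>(w, w'). Wt s w * (Wt t w' * f (path_at w' t))) (w, w') \<partial>P (path_at w s) \<partial>P x)"
    by (rule markov_nn_integral[OF s]) measurable
  also have "\<dots> = Sn s (Sn t f) x"
    unfolding Sn_def by (intro nn_integral_cong) (simp, subst nn_integral_cmult, auto)
  finally show ?thesis .
qed

lemma Sn_mono: "(\<And>y. f y \<le> g y) \<Longrightarrow> Sn t f x \<le> Sn t g x"
  unfolding Sn_def by (intro nn_integral_mono mult_left_mono) auto

lemma Sn_add:
  assumes [measurable]: "f \<in> borel_measurable borel" "g \<in> borel_measurable borel"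
  shows "Sn t (\<lambda>y. f y + g y) x = Sn t f x + Sn t g x"
  unfolding Sn_def by (subst nn_integral_add[symmetric]) (auto simp: distrib_left)

lemma Sn_cmult:
  assumes [measurable]: "f \<in> borel_measurable borel"
  shows "Sn t (\<lambda>y. c * f y) x = c * Sn t f x"
  unfolding Sn_def by (subst nn_integral_cmult[symmetric]) (auto simp: mult_ac)

lemma Sn_le:
  assumes "0 \<le> t" "\<And>y. f y \<le> c"
  shows "Sn t f x \<le> ennreal (exp (bs * t)) * c"
proof -
  interpret prob_space "P x" by (rule P_prob)
  have "Sn t f x \<le> (\<integral>\<^sup>+w. ennreal (exp (bs * t)) * c \<partial>P x)"
    unfolding Sn_def using assms by (intro nn_integral_mono mult_mono Wt_le) auto
  then show ?thesis using emeasure_space_1 by simp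
qed

lemma Sn_nn_integral:
  assumes f: "(\<lambda>(r, y). f r y) \<in> borel_measurable (borel \<Otimes>\<^sub>M borel)"
    and I [measurable]: "I \<in> sets borel"
  shows "Sn t (\<lambda>y. \<integral>\<^sup>+r\<in>I. f r y \<partial>lborel) x = (\<integral>\<^sup>+r\<in>I. Sn t (f r) x \<partial>lborel)"
proof -
  interpret prob_space "P x" by (rule P_prob)
  interpret pair_sigma_finite "P x" lborel ..
  note f[measurable]
  have m: "(\<lambda>(w, r). Wt t w * (\<lambda>(r, y). f r y) (r, path_at w t) * indicator I r) \<in> borel_measurable (PS \<Otimes>\<^sub>M lborel)"
    by measurable
  have m': "(\<lambda>(w, r). Wt t w * f r (path_at w t) * indicator I r) \<in> borel_measurable (P x \<Otimes>\<^sub>M lborel)"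
    using m measurable_cong_sets[OF sets_pair_measure_cong[OF P_sets refl] refl, of x lborel borel] by simp
  have "Sn t (\<lambda>y. \<integral>\<^sup>+r\<in>I. f r y \<partial>lborel) x = (\<integral>\<^sup>+w. \<integral>\<^sup>+r. Wt t w * f r (path_at w t) * indicator I r \<partial>lborel \<partial>P x)"
    unfolding Sn_def
  proof (intro nn_integral_cong)
    fix w
    have "(\<lambda>r. (\<lambda>(r, y). f r y) (r, path_at w t) * indicator I r) \<in> borel_measurable lborel"
      by measurable
    then show "Wt t w * (\<integral>\<^sup>+r\<in>I. f r (path_at w t) \<partial>lborel) = (\<integral>\<^sup>+r. Wt t w * f r (path_at w t) * indicator I r \<partial>lborel)"
      by (subst nn_integral_cmult[symmetric]) (auto simp: mult_ac)
  qed
  also have "\<dots> = (\<integral>\<^sup>+r. \<integral>\<^sup>+w. Wt t w * f r (path_at w t) * indicator I r \<partial>P x \<partial>lborel)"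
    using Fubini'[OF m'] by simp
  also have "\<dots> = (\<integral>\<^sup>+r\<in>I. Sn t (f r) x \<partial>lborel)"
    unfolding Sn_def by (intro nn_integral_cong) (auto split: split_indicator)
  finally show ?thesis .
qed

text \<open>Since \<open>b\<close> is bounded, \<open>b - d\<close> is integrable along a path
  exactly when \<open>d\<close> is; so the case distinction in \<open>FK_weight\<close> is the one
  made by \<open>exp_neg\<close>.\<close>

lemma ennreal_FK_weight:
  assumes t: "0 \<le> t" and w: "w \<in> D"
  shows "ennreal (FK_weight (\<lambda>y. b y - d y) t w) = Wt t w"
proof -
  have [measurable]: "(\<lambda>_. w) \<in> borel \<rightarrow>\<^sub>M PS" using w by simp
  have eq: "indicator {0..t} s *\<^sub>R r (w s) = indicator {0..t} s *\<^sub>R r (path_at w s)" for r :: "real \<Rightarrow> real" and s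
    by (auto simp: path_at_def split: split_indicator)
  have ib: "set_integrable lborel {0..t} (\<lambda>s. b (path_at w s))"
    unfolding set_integrable_def
  proof (rule integrableI_bounded)
    show "(\<lambda>s. indicator {0..t} s *\<^sub>R b (path_at w s)) \<in> borel_measurable lborel" by measurable
    have "(\<integral>\<^sup>+s. ennreal (norm (indicator {0..t} s *\<^sub>R b (path_at w s))) \<partial>lborel) = cumulated b w t"
      unfolding cumulated_path_at using b_nonneg
      by (intro nn_integral_cong) (auto split: split_indicator)
    then show "(\<integral>\<^sup>+s. ennreal (norm (indicator {0..t} s *\<^sub>R b (path_at w s))) \<partial>lborel) < \<infinity>"
      using cumulated_b_le[OF t, of w] by (auto intro: le_less_trans)
  qed
  have id_iff: "set_integrable lborel {0..t} (\<lambda>s. d (path_at w s)) \<longleftrightarrow> cumulated d w t < \<top>"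
  proof -
    have "(\<integral>\<^sup>+s. ennreal (norm (indicator {0..t} s *\<^sub>R d (path_at w s))) \<partial>lborel) = cumulated d w t"
      unfolding cumulated_path_at using d_nonneg
      by (intro nn_integral_cong) (auto split: split_indicator)
    moreover have "(\<lambda>s. indicator {0..t} s *\<^sub>R d (path_at w s)) \<in> borel_measurable lborel" by measurable
    ultimately show ?thesis unfolding set_integrable_def integrable_iff_bounded by simp
  qed
  have int: "(LBINT s:{0..t}. r (path_at w s)) = enn2real (cumulated r w t)"
    if "r \<in> borel_measurable borel" "\<And>y. 0 \<le> r y" for r
  proof -
    note that(1)[measurable]
    have "(LBINT s:{0..t}. r (path_at w s)) = enn2real (\<integral>\<^sup>+s. ennreal (indicator {0..t} s *\<^sub>R r (path_at w s)) \<partial>lborel)"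
      unfolding set_lebesgue_integral_def
    proof (rule integral_eq_nn_integral)
      show "(\<lambda>s. indicator {0..t} s *\<^sub>R r (path_at w s)) \<in> borel_measurable lborel" by measurable
      show "AE s in lborel. 0 \<le> indicator {0..t} s *\<^sub>R r (path_at w s)"
        by (rule AE_I2) (simp add: that(2))
    qed
    also have "(\<integral>\<^sup>+s. ennreal (indicator {0..t} s *\<^sub>R r (path_at w s)) \<partial>lborel) = cumulated r w t"
      unfolding cumulated_path_at by (intro nn_integral_cong) (auto split: split_indicator)
    finally show ?thesis .
  qed
  have iV: "set_integrable lborel {0..t} (\<lambda>s. b (w s) - d (w s)) \<longleftrightarrow> cumulated d w t < \<top>"
  proof -
    have "set_integrable lborel {0..t} (\<lambda>s. b (w s) - d (w s)) \<longleftrightarrow>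
        set_integrable lborel {0..t} (\<lambda>s. b (path_at w s) - d (path_at w s))"
      unfolding set_integrable_def
      by (rule Bochner_Integration.integrable_cong[OF refl]) (rule eq)
    also have "\<dots> \<longleftrightarrow> set_integrable lborel {0..t} (\<lambda>s. d (path_at w s))"
      using set_integral_diff(1)[OF ib, of "\<lambda>s. b (path_at w s) - d (path_at w s)"]
        set_integral_diff(1)[OF ib, of "\<lambda>s. d (path_at w s)"] by auto
    finally show ?thesis using id_iff by simp
  qed
  show ?thesis
  proof (cases "cumulated d w t < \<top>")
    case True
    have "(LBINT s:{0..t}. b (w s) - d (w s)) = (LBINT s:{0..t}. b (path_at w s) - d (path_at w s))"
      unfolding set_lebesgue_integral_def
      by (rule Bochner_Integration.integral_cong[OF refl]) (rule eq)
    also have "\<dots> = enn2real (cumulated b w t) - enn2real (cumulated d w t)"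
      using True id_iff ib int b_nonneg d_nonneg by (subst set_integral_diff(2)) auto
    finally show ?thesis
      using True iV
      by (cases "cumulated d w t")
         (auto simp: FK_weight_def Wt_def exp_neg_ennreal exp_diff exp_minus divide_inverse ennreal_mult)
  next
    case False
    then show ?thesis using iV by (simp add: FK_weight_def Wt_def not_less top_unique)
  qed
qed

lemma Sn_eq_FK:
  assumes t: "0 \<le> t" and f [measurable]: "f \<in> borel_measurable borel" and pos: "\<And>y. 0 \<le> f y"
    and bd: "\<And>y. f y \<le> c"
  shows "Sn t (\<lambda>y. ennreal (f y)) x = ennreal (FK P (\<lambda>y. b y - d y) t f x)"
proof -
  let ?V = "\<lambda>y. b y - d y"
  have pw: "0 \<le> FK_weight ?V t w" for w by (simp add: FK_weight_def)
  have eq: "ennreal (FK_weight ?V t w * f (w t)) = Wt t w * ennreal (f (path_at w t))" if "w \<in> D" for w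
    using ennreal_FK_weight[OF t that] pw pos t by (simp add: ennreal_mult path_at_def)
  have m: "(\<lambda>w. FK_weight ?V t w * f (w t)) \<in> borel_measurable (P x)"
  proof -
    have "(\<lambda>w. enn2real (Wt t w * ennreal (f (path_at w t)))) \<in> borel_measurable (P x)"
      by simp measurable
    also have "?this \<longleftrightarrow> ?thesis"
      by (rule measurable_cong) (use eq pw pos in \<open>auto simp flip: eq\<close>)
    finally show ?thesis .
  qed
  have "FK P ?V t f x = enn2real (\<integral>\<^sup>+w. ennreal (FK_weight ?V t w * f (w t)) \<partial>P x)"
    unfolding FK_def by (rule integral_eq_nn_integral) (use m pw pos in auto)
  also have "(\<integral>\<^sup>+w. ennreal (FK_weight ?V t w * f (w t)) \<partial>P x) = Sn t (\<lambda>y. ennreal (f y)) x"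
    unfolding Sn_def by (intro nn_integral_cong) (use eq in auto)
  finally have *: "FK P ?V t f x = enn2real (Sn t (\<lambda>y. ennreal (f y)) x)" .
  have "Sn t (\<lambda>y. ennreal (f y)) x \<le> ennreal (exp (bs * t)) * ennreal c"
    using t bd by (intro Sn_le) (auto intro: ennreal_leI)
  then have "Sn t (\<lambda>y. ennreal (f y)) x < \<top>"
    by (rule le_less_trans) (simp add: ennreal_mult_less_top)
  then show ?thesis using * by simp
qed

end

section \<open>Generating functionals of the branching process\<close>

lemma INF_mult_left_decseq:
  fixes f :: "nat \<Rightarrow> ennreal"
  assumes "decseq f" "c < \<top>"
  shows "(INF j. c * f j) = c * (INF j. f j)"
proof (rule LIMSEQ_unique)
  show "(\<lambda>j. c * f j) \<longlonglongrightarrow> c * (INF j. f j)"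
    using assms by (intro ennreal_tendsto_cmult LIMSEQ_INF)
  show "(\<lambda>j. c * f j) \<longlonglongrightarrow> (INF j. c * f j)"
    using assms(1) by (intro LIMSEQ_INF) (auto simp: decseq_def intro!: mult_left_mono)
qed

lemma prod_le_1_ennreal:
  fixes f :: "'i \<Rightarrow> ennreal"
  shows "(\<And>i. i \<in> A \<Longrightarrow> f i \<le> 1) \<Longrightarrow> prod f A \<le> 1"
  by (induction A rule: infinite_finite_induct) (auto intro: mult_le_one)

lemma prod_mono_ennreal:
  fixes f g :: "'i \<Rightarrow> ennreal"
  shows "(\<And>i. i \<in> A \<Longrightarrow> f i \<le> g i) \<Longrightarrow> prod f A \<le> prod g A"
  by (induction A rule: infinite_finite_induct) (auto intro: mult_mono)

lemma prod_antimono_ennreal: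
  fixes f :: "'i \<Rightarrow> ennreal"
  assumes "A \<subseteq> A'" "finite A'" "\<And>i. i \<in> A' \<Longrightarrow> f i \<le> 1"
  shows "prod f A' \<le> prod f A"
proof -
  have "prod f A' = prod f (A' - A) * prod f A"
    using assms by (intro prod.subset_diff)
  also have "\<dots> \<le> 1 * prod f A"
    using assms(3) by (intro mult_right_mono prod_le_1_ennreal) auto
  finally show ?thesis by simp
qed

lemma tendsto_prod_ennreal:
  fixes f :: "nat \<Rightarrow> 'i \<Rightarrow> ennreal"
  assumes "\<And>i. i \<in> A \<Longrightarrow> (\<lambda>n. f n i) \<longlonglongrightarrow> g i" "\<And>i. i \<in> A \<Longrightarrow> g i \<le> 1"
  shows "(\<lambda>n. \<Prod>i\<in>A. f n i) \<longlonglongrightarrow> (\<Prod>i\<in>A. g i)"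
  using assms
proof (induction A rule: infinite_finite_induct)
  case (insert i A)
  have "g i < \<top>" "prod g A < \<top>"
    using insert.prems(2) prod_le_1_ennreal[of A g]
    by (auto intro!: le_less_trans[of "g i" 1] le_less_trans[of "prod g A" 1])
  then show ?case
    using insert by (auto intro!: tendsto_mult_ennreal)
qed auto

section \<open>The law of a mark\<close>

context markov_process
begin

abbreviation PE :: "(nat \<Rightarrow> real) measure" where
  "PE \<equiv> \<Pi>\<^sub>M j\<in>UNIV. exp1"

lemma prob_exp1: "prob_space exp1"
  by (rule prob_space_exponential_density) simp

lemma prob_PE: "prob_space PE"
  by (intro prob_space_PiM prob_exp1)

lemma sets_PE: "sets PE = sets (\<Pi>\<^sub>M j\<in>UNIV. borel)"
  by (rule sets_PiM_cong) auto

lemma prob_rest: "prob_space (exp1 \<Otimes>\<^sub>M PE)"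
proof -
  interpret A: prob_space exp1 by (rule prob_exp1)
  interpret B: prob_space PE by (rule prob_PE)
  interpret pair_prob_space exp1 PE ..
  show ?thesis by (rule prob_space_axioms)
qed

lemma sets_rest: "sets (exp1 \<Otimes>\<^sub>M PE) = sets (borel \<Otimes>\<^sub>M (\<Pi>\<^sub>M j\<in>UNIV. borel))"
  by (intro sets_pair_measure_cong sets_PE) auto

lemma sets_mark_law: "sets (mark_law P y) = sets (mark_space D)"
  unfolding mark_law_def mark_space_def by (intro sets_pair_measure_cong sets_rest P_sets)

lemma prob_mark_law: "prob_space (mark_law P y)"
proof -
  interpret A: prob_space "P y" by (rule P_prob)
  interpret B: prob_space "exp1 \<Otimes>\<^sub>M PE" by (rule prob_rest)
  interpret pair_prob_space "P y" "exp1 \<Otimes>\<^sub>M PE" ..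
  show ?thesis unfolding mark_law_def by (rule prob_space_axioms)
qed

text \<open>Required for conditioning on the trait at birth. On rectangles only the path factor
  depends on the starting point.\<close>

lemma mark_law_kernel [measurable]: "mark_law P \<in> borel \<rightarrow>\<^sub>M prob_algebra (mark_space D)"
proof (rule measurable_prob_algebra_generated)
  let ?R = "borel \<Otimes>\<^sub>M (\<Pi>\<^sub>M j\<in>UNIV. borel) :: (real \<times> (nat \<Rightarrow> real)) measure"
  show "sets (mark_space D) = sigma_sets (space PS \<times> space ?R) {a \<times> b | a b. a \<in> sets PS \<and> b \<in> sets ?R}"
    unfolding mark_space_def sets_pair_measure[of PS] ..
  show "Int_stable {a \<times> b | a b. a \<in> sets PS \<and> b \<in> sets ?R}"
    by (rule Int_stable_pair_measure_generator)
  show "{a \<times> b | a b. a \<in> sets PS \<and> b \<in> sets ?R} \<subseteq> Pow (space PS \<times> space ?R)"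
    by (rule pair_measure_closed)
  show "prob_space (mark_law P y)" "sets (mark_law P y) = sets (mark_space D)" for y
    by (rule prob_mark_law sets_mark_law)+
  fix S assume "S \<in> {a \<times> b | a b. a \<in> sets PS \<and> b \<in> sets ?R}"
  then obtain A B where S: "S = A \<times> B" and [measurable]: "A \<in> sets PS" and B: "B \<in> sets ?R" by auto
  interpret prob_space "exp1 \<Otimes>\<^sub>M PE" by (rule prob_rest)
  have "emeasure (mark_law P y) S = emeasure (P y) A * emeasure (exp1 \<Otimes>\<^sub>M PE) B" for y
    unfolding S mark_law_def using B by (intro emeasure_pair_measure_Times) (simp_all add: sets_rest)
  moreover have "(\<lambda>y. emeasure (P y) A * emeasure (exp1 \<Otimes>\<^sub>M PE) B) \<in> borel_measurable borel"
    by measurable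
  ultimately show "(\<lambda>y. emeasure (mark_law P y) S) \<in> borel_measurable borel" by simp
qed

lemma nn_integral_mark_law:
  assumes F: "F \<in> borel_measurable (mark_space D)"
  shows "(\<integral>\<^sup>+m. F m \<partial>mark_law P y) = (\<integral>\<^sup>+w. \<integral>\<^sup>+e. \<integral>\<^sup>+g. F (w, e, g) \<partial>PE \<partial>exp1 \<partial>P y)"
proof -
  interpret E: prob_space PE by (rule prob_PE)
  interpret R: prob_space "exp1 \<Otimes>\<^sub>M PE" by (rule prob_rest)
  have s: "sets (P y \<Otimes>\<^sub>M (exp1 \<Otimes>\<^sub>M PE)) = sets (mark_space D)"
    using sets_mark_law[of y] unfolding mark_law_def .
  have F': "F \<in> borel_measurable (P y \<Otimes>\<^sub>M (exp1 \<Otimes>\<^sub>M PE))"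
    using F measurable_cong_sets[OF s refl] by blast
  have "(\<integral>\<^sup>+m. F m \<partial>mark_law P y) = (\<integral>\<^sup>+w. \<integral>\<^sup>+r. F (w, r) \<partial>(exp1 \<Otimes>\<^sub>M PE) \<partial>P y)"
    unfolding mark_law_def by (rule R.nn_integral_fst[symmetric, OF F'])
  also have "\<dots> = (\<integral>\<^sup>+w. \<integral>\<^sup>+e. \<integral>\<^sup>+g. F (w, e, g) \<partial>PE \<partial>exp1 \<partial>P y)"
  proof (rule nn_integral_cong)
    fix w assume w: "w \<in> space (P y)"
    have "(\<lambda>r. F (w, r)) \<in> borel_measurable (exp1 \<Otimes>\<^sub>M PE)"
      using measurable_compose[OF measurable_Pair1'[OF w] F'] .
    from E.nn_integral_fst[OF this]
    show "(\<integral>\<^sup>+r. F (w, r) \<partial>(exp1 \<Otimes>\<^sub>M PE)) = (\<integral>\<^sup>+e. \<integral>\<^sup>+g. F (w, e, g) \<partial>PE \<partial>exp1)"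
      by simp
  qed
  finally show ?thesis .
qed

lemma mark_components:
  assumes m: "c \<in> M \<rightarrow>\<^sub>M mark_space D"
  shows measurable_mark_path [measurable (raw)]: "(\<lambda>x. fst (c x)) \<in> M \<rightarrow>\<^sub>M PS"
    and measurable_mark_clock [measurable (raw)]: "(\<lambda>x. fst (snd (c x))) \<in> M \<rightarrow>\<^sub>M borel"
    and measurable_mark_gap [measurable (raw)]: "(\<lambda>x. snd (snd (c x)) (j::nat)) \<in> M \<rightarrow>\<^sub>M borel"
proof -
  note m[unfolded mark_space_def, measurable]
  show "(\<lambda>x. fst (c x)) \<in> M \<rightarrow>\<^sub>M PS" "(\<lambda>x. fst (snd (c x))) \<in> M \<rightarrow>\<^sub>M borel"
    by measurable
  have "(\<lambda>x. snd (snd (c x))) \<in> M \<rightarrow>\<^sub>M (\<Pi>\<^sub>M j\<in>UNIV. borel)"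
    by measurable
  then show "(\<lambda>x. snd (snd (c x)) j) \<in> M \<rightarrow>\<^sub>M borel"
    by (rule measurable_compose[OF _ measurable_component_singleton]) simp
qed

end

section \<open>One generation of the tree\<close>

context branching_rates
begin

lemma bounded_rate_path: "w \<in> D \<Longrightarrow> bounded_rate (\<lambda>s. ennreal (b (path_at w s))) bs"
proof
  assume w: "w \<in> D"
  have [measurable]: "(\<lambda>_. w) \<in> borel \<rightarrow>\<^sub>M PS" using w by simp
  show "(\<lambda>s. ennreal (b (path_at w s))) \<in> borel_measurable borel" by measurable
qed (auto simp: b_le bs_nonneg ennreal_leI)

lemma F_path: "w \<in> D \<Longrightarrow> bounded_rate.F (\<lambda>s. ennreal (b (path_at w s))) a = cumulated b w a"
  by (simp add: bounded_rate.F_def[OF bounded_rate_path] cumulated_path_at)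

lemma birth_age_\<tau>:
  "w \<in> D \<Longrightarrow> birth_age b (w, e, g) k = bounded_rate.\<tau> (\<lambda>s. ennreal (b (path_at w s))) (\<Sum>j\<le>k. g j)"
  by (simp add: bounded_rate.\<tau>_def[OF bounded_rate_path] birth_age_def F_path)

lemma birth_age_le_iff:
  "w \<in> D \<Longrightarrow> 0 \<le> a \<Longrightarrow> birth_age b (w, e, g) k \<le> ereal a \<longleftrightarrow> ennreal (\<Sum>j\<le>k. g j) \<le> cumulated b w a"
  using bounded_rate.\<tau>_le_iff[OF bounded_rate_path] by (simp add: birth_age_\<tau> F_path)

lemma birth_age_nonneg: "0 \<le> birth_age b m k"
  by (cases m) (auto simp: birth_age_def intro!: Inf_greatest)

text \<open>By \<open>birth_age_le_iff\<close> the sublevel sets compare a sum of gaps with a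
  cumulated rate at a fixed age.\<close>

lemma measurable_birth_age [measurable (raw)]:
  assumes m [measurable]: "c \<in> M \<rightarrow>\<^sub>M mark_space D"
  shows "(\<lambda>x. birth_age b (c x) k) \<in> borel_measurable M"
proof (rule borel_measurableI_le)
  fix y :: ereal
  have D: "fst (c x) \<in> D" if "x \<in> space M" for x
    using measurable_space[OF measurable_mark_path[OF m] that] by simp
  show "{x \<in> space M. birth_age b (c x) k \<le> y} \<in> sets M"
  proof (cases y)
    case (real a)
    show ?thesis
    proof (cases "0 \<le> a")
      case True
      have "{x \<in> space M. birth_age b (c x) k \<le> y} =
          {x \<in> space M. ennreal (\<Sum>j\<le>k. snd (snd (c x)) j) \<le> cumulated b (fst (c x)) a}"
        using D birth_age_le_iff[OF _ True] real by (metis (no_types, lifting) prod.collapse)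
      also have "\<dots> \<in> sets M" by measurable
      finally show ?thesis .
    next
      case False
      then have "\<not> birth_age b (c x) k \<le> y" for x
        using order_trans[OF birth_age_nonneg, of "c x" k y] real by auto
      then show ?thesis by simp
    qed
  next
    case MInf
    then have "\<not> birth_age b (c x) k \<le> y" for x
      using order_trans[OF birth_age_nonneg, of "c x" k y] by auto
    then show ?thesis by simp
  qed auto
qed

lemma alive_at_age_alt: "alive_at_age d m a \<longleftrightarrow> cumulated d (fst m) a < ennreal (fst (snd m))"
  by (cases m) (simp add: alive_at_age_def)

lemma measurable_alive_at_age [measurable (raw)]:
  assumes [measurable]: "c \<in> M \<rightarrow>\<^sub>M mark_space D" "a \<in> borel_measurable M"
  shows "Measurable.pred M (\<lambda>x. alive_at_age d (c x) (a x))"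
  unfolding alive_at_age_alt by measurable

lemma birth_time_nonneg: "0 \<le> birth_time b d c u"
  by (induction u) (auto simp: birth_age_nonneg)

lemma measurable_birth_time:
  "(\<And>v. length v < length u \<Longrightarrow> (\<lambda>x. c x v) \<in> M \<rightarrow>\<^sub>M mark_space D) \<Longrightarrow>
    (\<lambda>x. birth_time b d (c x) u) \<in> borel_measurable M"
proof (induction u)
  case (Cons k u)
  have [measurable]: "(\<lambda>x. c x u) \<in> M \<rightarrow>\<^sub>M mark_space D" "(\<lambda>x. birth_time b d (c x) u) \<in> borel_measurable M"
    using Cons by auto
  show ?case by simp measurable
qed simp

lemma measurable_birth_trait:
  assumes "\<And>v. length v < length u \<Longrightarrow> (\<lambda>x. c x v) \<in> M \<rightarrow>\<^sub>M mark_space D"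
  shows "(\<lambda>x. birth_trait b z (c x) u) \<in> borel_measurable M"
proof (cases u)
  case (Cons k v)
  then have [measurable]: "(\<lambda>x. c x v) \<in> M \<rightarrow>\<^sub>M mark_space D" using assms by auto
  have "(\<lambda>x. path_at (fst (c x v)) (real_of_ereal (birth_age b (c x v) k))) \<in> borel_measurable M"
    by measurable
  then show ?thesis
    using Cons real_of_ereal_pos[OF birth_age_nonneg] by (simp add: path_at_def)
qed simp

definition own :: "(real \<Rightarrow> ennreal) \<Rightarrow> real \<Rightarrow> mark \<Rightarrow> ennreal" where
  "own \<phi> s m = (if alive_at_age d m s then \<phi> (path_at (fst m) s) else 1)"

definition child :: "(real \<Rightarrow> real \<Rightarrow> ennreal) \<Rightarrow> real \<Rightarrow> mark \<Rightarrow> nat \<Rightarrow> ennreal" where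
  "child g s m k = (let a = real_of_ereal (birth_age b m k) in
     if birth_age b m k \<le> ereal s \<and> alive_at_age d m a then g (s - a) (path_at (fst m) a) else 1)"

definition node :: "(real \<Rightarrow> ennreal) \<Rightarrow> nat \<Rightarrow> (real \<Rightarrow> real \<Rightarrow> ennreal) \<Rightarrow> real \<Rightarrow> mark \<Rightarrow> ennreal" where
  "node \<phi> K g s m = own \<phi> s m * (\<Prod>k<K. child g s m k)"

text \<open>Operator whose iterates will produce the generating functional. The argument
  \<open>g\<close> stands for what is known about the descendants of a child; only the first
  \<open>K\<close> children are counted, so that products stay finite.\<close>

definition \<Gamma> :: "(real \<Rightarrow> ennreal) \<Rightarrow> nat \<Rightarrow> (real \<Rightarrow> real \<Rightarrow> ennreal) \<Rightarrow> real \<Rightarrow> real \<Rightarrow> ennreal" where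
  "\<Gamma> \<phi> K g s y = (\<integral>\<^sup>+m. node \<phi> K g s m \<partial>mark_law P y)"

lemma measurable_own [measurable (raw)]:
  assumes [measurable]: "\<phi> \<in> borel_measurable borel" "c \<in> M \<rightarrow>\<^sub>M mark_space D" "s \<in> borel_measurable M"
  shows "(\<lambda>x. own \<phi> (s x) (c x)) \<in> borel_measurable M"
  unfolding own_def by measurable

lemma measurable_child:
  assumes [measurable]: "(\<lambda>(s, y). g s y) \<in> borel_measurable (borel \<Otimes>\<^sub>M borel)"
    "c \<in> M \<rightarrow>\<^sub>M mark_space D" "s \<in> borel_measurable M"
  shows "(\<lambda>x. child g (s x) (c x) k) \<in> borel_measurable M"
proof -
  have "(\<lambda>x. if birth_age b (c x) k \<le> ereal (s x) \<and> alive_at_age d (c x) (real_of_ereal (birth_age b (c x) k))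
     then (\<lambda>(s, y). g s y) (s x - real_of_ereal (birth_age b (c x) k), path_at (fst (c x)) (real_of_ereal (birth_age b (c x) k)))
     else 1) \<in> borel_measurable M"
    by measurable
  then show ?thesis by (simp add: child_def Let_def)
qed

lemma measurable_node:
  assumes g: "(\<lambda>(s, y). g s y) \<in> borel_measurable (borel \<Otimes>\<^sub>M borel)"
    and [measurable]: "\<phi> \<in> borel_measurable borel" "c \<in> M \<rightarrow>\<^sub>M mark_space D" "s \<in> borel_measurable M"
  shows "(\<lambda>x. node \<phi> K g (s x) (c x)) \<in> borel_measurable M"
proof -
  note measurable_child[OF g, measurable (raw)]
  show ?thesis unfolding node_def by measurable
qed

lemma measurable_\<Gamma>:
  assumes g: "(\<lambda>(s, y). g s y) \<in> borel_measurable (borel \<Otimes>\<^sub>M borel)"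
    and [measurable]: "\<phi> \<in> borel_measurable borel"
  shows "(\<lambda>(s, y). \<Gamma> \<phi> K g s y) \<in> borel_measurable (borel \<Otimes>\<^sub>M borel)"
proof -
  note measurable_prob_algebraD[OF mark_law_kernel, measurable]
  have "(\<lambda>x. \<integral>\<^sup>+m. (\<lambda>(x, m). node \<phi> K g (fst x) m) (x, m) \<partial>mark_law P (snd x)) \<in> borel_measurable (borel \<Otimes>\<^sub>M borel)"
  proof (rule nn_integral_measurable_subprob_algebra2[where N="mark_space D"])
    have "(\<lambda>x. node \<phi> K g (fst (fst x)) (snd x)) \<in> borel_measurable ((borel \<Otimes>\<^sub>M borel) \<Otimes>\<^sub>M mark_space D)"
      by (rule measurable_node[OF g]) measurable
    then show "(\<lambda>(x, m). (\<lambda>(x, m). node \<phi> K g (fst x) m) (x, m)) \<in> borel_measurable ((borel \<Otimes>\<^sub>M borel) \<Otimes>\<^sub>M mark_space D)"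
      by (simp add: split_beta')
  qed measurable
  then show ?thesis by (simp add: \<Gamma>_def split_beta')
qed

end

section \<open>Integrating out the tree, generation by generation\<close>

locale branching_tree = branching_markov_process D P b Q + branching_rates D P b d bs
  for D :: "(real \<Rightarrow> real) set" and P :: "real \<Rightarrow> (real \<Rightarrow> real) measure"
    and b d :: "real \<Rightarrow> real" and bs :: real and Q :: "real \<Rightarrow> tree measure" +
  fixes \<phi> :: "real \<Rightarrow> ennreal"
  assumes \<phi> [measurable]: "\<phi> \<in> borel_measurable borel" and \<phi>_le: "\<And>y. \<phi> y \<le> 1"
begin

lemma Q_space [simp]: "space (Q x) = space (tree_space D)"
  using sets_eq_imp_space_eq[OF Q_sets] .

lemma measurable_tree_component [measurable]: "(\<lambda>c. c u) \<in> tree_space D \<rightarrow>\<^sub>M mark_space D"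
  unfolding tree_space_def by (rule measurable_component_singleton) simp

lemma Q_measurable [simp]: "Q x \<rightarrow>\<^sub>M N = tree_space D \<rightarrow>\<^sub>M N"
  by (rule measurable_cong_sets) (auto simp: Q_sets)

lemma space_non_descendants [simp]: "space (non_descendants D u) = space (tree_space D)"
  by (simp add: non_descendants_def space_measure_of_conv)

lemma sets_non_descendants: "sets (non_descendants D u) = sigma_sets (space (tree_space D))
     {{c \<in> space (tree_space D). c v \<in> B} |v B. \<not> suffix u v \<and> B \<in> sets (mark_space D)}"
  unfolding non_descendants_def by (rule sets_measure_of) auto

lemma measurable_non_descendant:
  assumes "\<not> suffix u v"
  shows "(\<lambda>c. c v) \<in> non_descendants D u \<rightarrow>\<^sub>M mark_space D"
proof (rule measurableI)
  show "c v \<in> space (mark_space D)" if "c \<in> space (non_descendants D u)" for c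
    using measurable_space[OF measurable_tree_component] that by auto
  show "(\<lambda>c. c v) -` B \<inter> space (non_descendants D u) \<in> sets (non_descendants D u)"
    if "B \<in> sets (mark_space D)" for B
    unfolding sets_non_descendants using assms that by (intro sigma_sets.Basic) auto
qed

lemma non_descendants_sub: "(\<lambda>c. c) \<in> tree_space D \<rightarrow>\<^sub>M non_descendants D u"
  unfolding non_descendants_def
proof (rule measurable_measure_of)
  show "(\<lambda>c. c) -` A \<inter> space (tree_space D) \<in> sets (tree_space D)"
    if A: "A \<in> {{c \<in> space (tree_space D). c v \<in> B} |v B. \<not> suffix u v \<and> B \<in> sets (mark_space D)}" for A
  proof -
    obtain v B where A: "A = {c \<in> space (tree_space D). c v \<in> B}" and [measurable]: "B \<in> sets (mark_space D)"
      using A by blast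
    have "{c \<in> space (tree_space D). c v \<in> B} \<in> sets (tree_space D)" by measurable
    moreover have "(\<lambda>c. c) -` A \<inter> space (tree_space D) = A" using A by auto
    ultimately show ?thesis using A by simp
  qed
qed auto

lemma not_suffix: "length v \<le> length u \<Longrightarrow> v \<noteq> u \<Longrightarrow> \<not> suffix u v"
  by (auto simp: suffix_def)

text \<open>Stands for the average over the whole subtree of \<open>u\<close>, in terms of what is
  known at its birth. In contrast, \<open>indiv\<close> is the contribution of \<open>u\<close>
  alone, and \<open>inode\<close> that of \<open>u\<close> together with its first \<open>K\<close>
  children, seen through \<open>g\<close>.\<close>

definition born :: "(real \<Rightarrow> real \<Rightarrow> ennreal) \<Rightarrow> real \<Rightarrow> real \<Rightarrow> tree \<Rightarrow> nat list \<Rightarrow> ennreal" where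
  "born g t x c u = (if birth_time b d c u \<le> ereal t
     then g (t - real_of_ereal (birth_time b d c u)) (birth_trait b x c u) else 1)"

definition indiv :: "real \<Rightarrow> tree \<Rightarrow> nat list \<Rightarrow> ennreal" where
  "indiv t c u = (if birth_time b d c u \<le> ereal t
     then own \<phi> (t - real_of_ereal (birth_time b d c u)) (c u) else 1)"

definition inode :: "nat \<Rightarrow> (real \<Rightarrow> real \<Rightarrow> ennreal) \<Rightarrow> real \<Rightarrow> tree \<Rightarrow> nat list \<Rightarrow> ennreal" where
  "inode K g t c u = (if birth_time b d c u \<le> ereal t
     then node \<phi> K g (t - real_of_ereal (birth_time b d c u)) (c u) else 1)"

text \<open>Truncating both the generation and the child numbers makes the set of labels
  finite.\<close>

definition low :: "nat \<Rightarrow> nat \<Rightarrow> nat list set" where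
  "low n K = {u. set u \<subseteq> {..<K} \<and> length u < n}"

definition lev :: "nat \<Rightarrow> nat \<Rightarrow> nat list set" where
  "lev n K = {u. set u \<subseteq> {..<K} \<and> length u = n}"

lemma finite_lev [simp]: "finite (lev n K)"
  unfolding lev_def by (rule finite_lists_length_eq) simp

lemma low_Suc: "low (Suc n) K = low n K \<union> lev n K"
  by (auto simp: low_def lev_def)

lemma finite_low [simp]: "finite (low n K)"
  by (induction n) (auto simp: low_Suc, simp add: low_def)

lemma low_mono: "n \<le> n' \<Longrightarrow> K \<le> K' \<Longrightarrow> low n K \<subseteq> low n' K'"
  by (auto simp: low_def)

lemma own_le: "own \<phi> s m \<le> 1"
  by (simp add: own_def \<phi>_le)

lemma indiv_le: "indiv t c u \<le> 1"
  by (simp add: indiv_def own_le)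

text \<open>A child not born by time \<open>t\<close> contributes 1 on both sides, whether its birth
  age is too large, its parent dies first, or the parent itself is never born. The value \<infinity>
  of \<open>birth_time\<close> lets all these cases be treated alike.\<close>

lemma born_child:
  "born g t x c (k # u) =
    (if birth_time b d c u \<le> ereal t then child g (t - real_of_ereal (birth_time b d c u)) (c u) k else 1)"
proof (cases "birth_age b (c u) k < \<infinity> \<and> birth_time b d c u < \<infinity>")
  case True
  then obtain T a where "birth_time b d c u = ereal T" "birth_age b (c u) k = ereal a" "0 \<le> T" "0 \<le> a"
    using birth_time_nonneg[of c u] birth_age_nonneg[of "c u" k]
    by (cases "birth_time b d c u"; cases "birth_age b (c u) k") auto
  then show ?thesis
    by (auto simp: born_def child_def path_at_def algebra_simps)
next
  case False
  then have "birth_time b d c (k # u) = \<infinity>"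
    using birth_time_nonneg[of c u] birth_age_nonneg[of "c u" k] by auto
  moreover have "birth_time b d c u \<le> ereal t \<Longrightarrow> birth_age b (c u) k = \<infinity>"
    using False by auto
  ultimately show ?thesis
    by (auto simp: born_def child_def simp del: birth_time.simps)
qed

lemma prod_lev_Suc: "(\<Prod>v\<in>lev (Suc n) K. f v) = (\<Prod>u\<in>lev n K. \<Prod>k<K. f (k # u))"
proof -
  have "lev (Suc n) K = (\<lambda>(u, k). k # u) ` (lev n K \<times> {..<K})"
  proof (intro set_eqI iffI)
    fix v assume "v \<in> lev (Suc n) K"
    then obtain k u where "v = k # u" "u \<in> lev n K" "k < K"
      by (cases v) (auto simp: lev_def)
    then show "v \<in> (\<lambda>(u, k). k # u) ` (lev n K \<times> {..<K})" by force
  qed (auto simp: lev_def)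
  then have "(\<Prod>v\<in>lev (Suc n) K. f v) = (\<Prod>p\<in>lev n K \<times> {..<K}. f (case p of (u, k) \<Rightarrow> k # u))"
    by (simp add: prod.reindex inj_on_def split_beta')
  then show ?thesis by (simp add: prod.cartesian_product split_beta')
qed

lemma indiv_born:
  "indiv t c u * (\<Prod>k<K. born g t x c (k # u)) = inode K g t c u"
  by (simp add: indiv_def born_child inode_def node_def)

lemma measurable_tree_functionals:
  assumes g: "(\<lambda>(s, y). g s y) \<in> borel_measurable (borel \<Otimes>\<^sub>M borel)"
    and M: "\<And>v. length v < length u \<Longrightarrow> (\<lambda>c. c v) \<in> M \<rightarrow>\<^sub>M mark_space D"
  shows measurable_born: "(\<lambda>c. born g t x c u) \<in> borel_measurable M"
    and "(\<lambda>c. c u) \<in> M \<rightarrow>\<^sub>M mark_space D \<Longrightarrow> (\<lambda>c. indiv t c u) \<in> borel_measurable M"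
    and "(\<lambda>c. c u) \<in> M \<rightarrow>\<^sub>M mark_space D \<Longrightarrow> (\<lambda>c. inode K g t c u) \<in> borel_measurable M"
proof -
  have T [measurable]: "(\<lambda>c. birth_time b d c u) \<in> borel_measurable M"
    by (rule measurable_birth_time[OF M])
  have X [measurable]: "(\<lambda>c. birth_trait b x c u) \<in> borel_measurable M"
    by (rule measurable_birth_trait[OF M])
  have "(\<lambda>c. if birth_time b d c u \<le> ereal t then
      (\<lambda>(s, y). g s y) (t - real_of_ereal (birth_time b d c u), birth_trait b x c u) else 1) \<in> borel_measurable M"
    using g by measurable
  then show "(\<lambda>c. born g t x c u) \<in> borel_measurable M"
    by (simp only: born_def prod.case)
  assume [measurable]: "(\<lambda>c. c u) \<in> M \<rightarrow>\<^sub>M mark_space D"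
  show "(\<lambda>c. indiv t c u) \<in> borel_measurable M"
    unfolding indiv_def by measurable
  note measurable_node[OF g, measurable (raw)]
  show "(\<lambda>c. inode K g t c u) \<in> borel_measurable M"
    unfolding inode_def by measurable
qed

text \<open>Given all non-descendants, the mark of \<open>u\<close> has law \<open>mark_law\<close>
  at its trait at birth, while \<open>R\<close> and the date of birth are already determined. This
  is where the branching property enters.\<close>

lemma integrate_mark:
  assumes g: "(\<lambda>(s, y). g s y) \<in> borel_measurable (borel \<Otimes>\<^sub>M borel)"
    and R: "R \<in> borel_measurable (non_descendants D u)"
  shows "(\<integral>\<^sup>+c. R c * inode K g t c u \<partial>Q x) = (\<integral>\<^sup>+c. R c * born (\<Gamma> \<phi> K g) t x c u \<partial>Q x)"
proof -
  let ?N = "non_descendants D u"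
  note measurable_node[OF g, measurable (raw)] R[measurable]
  have comp: "(\<lambda>c. c v) \<in> ?N \<rightarrow>\<^sub>M mark_space D" if "length v < length u" for v
    using that by (intro measurable_non_descendant not_suffix) auto
  have [measurable]: "(\<lambda>c. birth_time b d c u) \<in> borel_measurable ?N"
    by (rule measurable_birth_time[OF comp])
  have [measurable]: "(\<lambda>c. birth_trait b x c u) \<in> borel_measurable ?N"
    by (rule measurable_birth_trait[OF comp])
  define G where "G = (\<lambda>(c, m). R c * (if birth_time b d c u \<le> ereal t
     then node \<phi> K g (t - real_of_ereal (birth_time b d c u)) m else 1))"
  have G: "G \<in> borel_measurable (?N \<Otimes>\<^sub>M mark_space D)"
    unfolding G_def split_beta' by measurable
  have "(\<integral>\<^sup>+c. R c * inode K g t c u \<partial>Q x) = (\<integral>\<^sup>+c. G (c, c u) \<partial>Q x)"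
    by (simp add: G_def inode_def)
  also have "\<dots> = (\<integral>\<^sup>+c. \<integral>\<^sup>+m. G (c, m) \<partial>mark_law P (birth_trait b x c u) \<partial>Q x)"
  proof (rule nn_integral_disintegration[OF Q_prob _ _ _ _ G, where X="\<lambda>c. c" and Y="\<lambda>c. c u"
        and K="\<lambda>c. mark_law P (birth_trait b x c u)"])
    show "(\<lambda>c. c) \<in> Q x \<rightarrow>\<^sub>M ?N" by (simp add: non_descendants_sub)
    show "(\<lambda>c. c u) \<in> Q x \<rightarrow>\<^sub>M mark_space D" by simp
    show "(\<lambda>c. mark_law P (birth_trait b x c u)) \<in> ?N \<rightarrow>\<^sub>M prob_algebra (mark_space D)"
      by measurable
    fix A B assume A: "A \<in> sets ?N" and B: "B \<in> sets (mark_space D)"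
    have "{c \<in> space (Q x). c \<in> A \<and> c u \<in> B} = {c \<in> A. c u \<in> B}"
      using sets.sets_into_space[OF A] by auto
    then show "emeasure (Q x) {c \<in> space (Q x). c \<in> A \<and> c u \<in> B} =
        (\<integral>\<^sup>+c. emeasure (mark_law P (birth_trait b x c u)) B * indicator A c \<partial>Q x)"
      using branching[OF A B] by simp
  qed
  also have "\<dots> = (\<integral>\<^sup>+c. R c * born (\<Gamma> \<phi> K g) t x c u \<partial>Q x)"
  proof (intro nn_integral_cong)
    fix c
    interpret M: prob_space "mark_law P (birth_trait b x c u)" by (rule prob_mark_law)
    have "(\<lambda>m. node \<phi> K g s m) \<in> borel_measurable (mark_space D)" for s by measurable
    then have [measurable]: "(\<lambda>m. node \<phi> K g s m) \<in> borel_measurable (mark_law P (birth_trait b x c u))" for s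
      using measurable_cong_sets[OF sets_mark_law refl] by blast
    show "(\<integral>\<^sup>+m. G (c, m) \<partial>mark_law P (birth_trait b x c u)) = R c * born (\<Gamma> \<phi> K g) t x c u"
      using M.emeasure_space_1
      by (cases "birth_time b d c u \<le> ereal t") (simp_all add: G_def born_def \<Gamma>_def nn_integral_cmult)
  qed
  finally show ?thesis .
qed

text \<open>The marks of generation \<open>n\<close> are integrated one at a time. All other factors
  involve labels of length at most \<open>n\<close> different from \<open>u\<close>, hence
  non-descendants of \<open>u\<close>; in particular the factor \<open>born\<close> of a label
  already treated depends on its ancestors alone.\<close>

lemma integrate_level:
  assumes g: "(\<lambda>(s, y). g s y) \<in> borel_measurable (borel \<Otimes>\<^sub>M borel)"
  shows "(\<integral>\<^sup>+c. (\<Prod>u\<in>low (Suc n) K. indiv t c u) * (\<Prod>v\<in>lev (Suc n) K. born g t x c v) \<partial>Q x) =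
    (\<integral>\<^sup>+c. (\<Prod>u\<in>low n K. indiv t c u) * (\<Prod>v\<in>lev n K. born (\<Gamma> \<phi> K g) t x c v) \<partial>Q x)"
proof -
  define R where "R c = (\<Prod>u\<in>low n K. indiv t c u)" for c
  have \<Gamma>: "(\<lambda>(s, y). \<Gamma> \<phi> K g s y) \<in> borel_measurable (borel \<Otimes>\<^sub>M borel)"
    by (rule measurable_\<Gamma>[OF g]) simp
  have "(\<integral>\<^sup>+c. R c * ((\<Prod>v\<in>lev n K - U. inode K g t c v) * (\<Prod>v\<in>U. born (\<Gamma> \<phi> K g) t x c v)) \<partial>Q x) =
      (\<integral>\<^sup>+c. R c * (\<Prod>v\<in>lev n K. inode K g t c v) \<partial>Q x)"
    if "finite U" "U \<subseteq> lev n K" for U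
    using that
  proof (induction U)
    case (insert u U)
    let ?N = "non_descendants D u"
    have u: "u \<in> lev n K" "length u = n" using insert by (auto simp: lev_def)
    have comp: "(\<lambda>c. c v) \<in> ?N \<rightarrow>\<^sub>M mark_space D" if "length v \<le> n" "v \<noteq> u" for v
      using that u by (intro measurable_non_descendant not_suffix) auto
    define R' where "R' c = R c * ((\<Prod>v\<in>lev n K - insert u U. inode K g t c v) * (\<Prod>v\<in>U. born (\<Gamma> \<phi> K g) t x c v))" for c
    have "R' \<in> borel_measurable ?N"
      unfolding R'_def R_def
    proof (intro borel_measurable_times_ennreal borel_measurable_prod_ennreal)
      show "(\<lambda>c. indiv t c v) \<in> borel_measurable ?N" if "v \<in> low n K" for v
        using that u by (intro measurable_tree_functionals(2)[OF g] comp) (auto simp: low_def)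
      show "(\<lambda>c. inode K g t c v) \<in> borel_measurable ?N" if "v \<in> lev n K - insert u U" for v
        using that u by (intro measurable_tree_functionals(3)[OF g] comp) (auto simp: lev_def)
      show "(\<lambda>c. born (\<Gamma> \<phi> K g) t x c v) \<in> borel_measurable ?N" if "v \<in> U" for v
        using that u insert.prems by (intro measurable_born[OF \<Gamma>] comp) (auto simp: lev_def)
    qed
    then have "(\<integral>\<^sup>+c. R' c * inode K g t c u \<partial>Q x) = (\<integral>\<^sup>+c. R' c * born (\<Gamma> \<phi> K g) t x c u \<partial>Q x)"
      by (rule integrate_mark[OF g])
    moreover have "R' c * inode K g t c u =
        R c * ((\<Prod>v\<in>lev n K - U. inode K g t c v) * (\<Prod>v\<in>U. born (\<Gamma> \<phi> K g) t x c v))" for c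
    proof -
      have eq: "lev n K - insert u U = (lev n K - U) - {u}" by (rule Diff_insert)
      have "(\<Prod>v\<in>lev n K - U. inode K g t c v) = inode K g t c u * (\<Prod>v\<in>lev n K - insert u U. inode K g t c v)"
        unfolding eq by (rule prod.remove) (use u insert in auto)
      then show ?thesis unfolding R'_def by (simp only: mult_ac)
    qed
    moreover have "R' c * born (\<Gamma> \<phi> K g) t x c u =
        R c * ((\<Prod>v\<in>lev n K - insert u U. inode K g t c v) * (\<Prod>v\<in>insert u U. born (\<Gamma> \<phi> K g) t x c v))" for c
      unfolding R'_def prod.insert[OF insert.hyps] by (simp only: mult_ac)
    moreover have "(\<integral>\<^sup>+c. R c * ((\<Prod>v\<in>lev n K - U. inode K g t c v) * (\<Prod>v\<in>U. born (\<Gamma> \<phi> K g) t x c v)) \<partial>Q x) =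
      (\<integral>\<^sup>+c. R c * (\<Prod>v\<in>lev n K. inode K g t c v) \<partial>Q x)"
      using insert by blast
    ultimately show ?case by (simp only:)
  qed simp
  from this[of "lev n K"]
  have "(\<integral>\<^sup>+c. R c * (\<Prod>v\<in>lev n K. born (\<Gamma> \<phi> K g) t x c v) \<partial>Q x) =
      (\<integral>\<^sup>+c. R c * (\<Prod>v\<in>lev n K. inode K g t c v) \<partial>Q x)"
    by simp
  moreover have "(\<Prod>u\<in>low (Suc n) K. indiv t c u) * (\<Prod>v\<in>lev (Suc n) K. born g t x c v) =
      R c * (\<Prod>v\<in>lev n K. inode K g t c v)" for c
  proof -
    have "(\<Prod>u\<in>low (Suc n) K. indiv t c u) = R c * (\<Prod>u\<in>lev n K. indiv t c u)"
      unfolding low_Suc R_def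
      by (rule prod.union_disjoint[OF finite_low finite_lev]) (auto simp: low_def lev_def)
    then show ?thesis
      by (simp add: prod_lev_Suc mult.assoc indiv_born flip: prod.distrib)
  qed
  ultimately show ?thesis unfolding R_def by simp
qed

abbreviation iter :: "nat \<Rightarrow> nat \<Rightarrow> (real \<Rightarrow> real \<Rightarrow> ennreal) \<Rightarrow> real \<Rightarrow> real \<Rightarrow> ennreal" where
  "iter n K g \<equiv> (\<Gamma> \<phi> K ^^ n) g"

lemma measurable_iter:
  "(\<lambda>(s, y). g s y) \<in> borel_measurable (borel \<Otimes>\<^sub>M borel) \<Longrightarrow>
    (\<lambda>(s, y). iter n K g s y) \<in> borel_measurable (borel \<Otimes>\<^sub>M borel)"
  by (induction n) (auto intro: measurable_\<Gamma>)

text \<open>Unrolling \<open>integrate_level\<close> down to the root, which is born at time 0 with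
  trait \<open>x\<close> and leaves a single deterministic factor.\<close>

lemma integral_levels:
  assumes "(\<lambda>(s, y). g s y) \<in> borel_measurable (borel \<Otimes>\<^sub>M borel)" "0 \<le> t"
  shows "(\<integral>\<^sup>+c. (\<Prod>u\<in>low n K. indiv t c u) * (\<Prod>v\<in>lev n K. born g t x c v) \<partial>Q x) = iter n K g t x"
  using assms(1)
proof (induction n arbitrary: g)
  case 0
  interpret prob_space "Q x" by (rule Q_prob)
  have "low 0 K = {}" "lev 0 K = {[]}" by (auto simp: low_def lev_def)
  then show ?case using assms(2) emeasure_space_1 by (simp add: born_def)
next
  case (Suc n)
  have "iter (Suc n) K g t x = iter n K (\<Gamma> \<phi> K g) t x"
    by (simp only: funpow_Suc_right comp_apply)
  then show ?case
    using Suc.IH[OF measurable_\<Gamma>[OF Suc.prems \<phi>]] integrate_level[OF Suc.prems] by simp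
qed

text \<open>With \<open>g = 1\<close> the factors of generation \<open>n\<close> disappear, so that
  individuals beyond the truncation are ignored.\<close>

definition gen :: "nat \<Rightarrow> nat \<Rightarrow> real \<Rightarrow> real \<Rightarrow> ennreal" where
  "gen n K = iter n K (\<lambda>_ _. 1)"

lemma gen_eq: "0 \<le> t \<Longrightarrow> gen n K t x = (\<integral>\<^sup>+c. (\<Prod>u\<in>low n K. indiv t c u) \<partial>Q x)"
  unfolding gen_def by (subst integral_levels[symmetric]) (auto simp: born_def)

lemma measurable_gen [measurable]: "(\<lambda>(s, y). gen n K s y) \<in> borel_measurable (borel \<Otimes>\<^sub>M borel)"
  unfolding gen_def by (rule measurable_iter) simp

lemma gen_Suc: "gen (Suc n) K = \<Gamma> \<phi> K (gen n K)"
  by (simp add: gen_def)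

lemma gen_antimono: "0 \<le> t \<Longrightarrow> n \<le> n' \<Longrightarrow> K \<le> K' \<Longrightarrow> gen n' K' t x \<le> gen n K t x"
  unfolding gen_eq by (intro nn_integral_mono prod_antimono_ennreal low_mono finite_low indiv_le)

lemma gen_le_1: "0 \<le> t \<Longrightarrow> gen n K t x \<le> 1"
proof -
  assume "0 \<le> t"
  interpret prob_space "Q x" by (rule Q_prob)
  have "gen n K t x \<le> (\<integral>\<^sup>+c. 1 \<partial>Q x)"
    unfolding gen_eq[OF \<open>0 \<le> t\<close>] by (intro nn_integral_mono prod_le_1_ennreal indiv_le)
  then show ?thesis using emeasure_space_1 by simp
qed

text \<open>All factors are at most 1, so the truncations decrease in both indices and the diagonal
  captures the limit.\<close>

definition h :: "real \<Rightarrow> real \<Rightarrow> ennreal" where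
  "h t x = (INF n. gen n n t x)"

lemma measurable_h [measurable]: "(\<lambda>(s, y). h s y) \<in> borel_measurable (borel \<Otimes>\<^sub>M borel)"
  unfolding h_def split_beta' using measurable_gen[unfolded split_beta'] by measurable

lemma h_le_1: "0 \<le> t \<Longrightarrow> h t x \<le> 1"
  unfolding h_def by (rule INF_lower2[of 0]) (auto intro: gen_le_1)

lemma h_eq_integral: "0 \<le> t \<Longrightarrow> h t x = (\<integral>\<^sup>+c. (INF n. \<Prod>u\<in>low n n. indiv t c u) \<partial>Q x)"
proof -
  assume t: "0 \<le> t"
  interpret prob_space "Q x" by (rule Q_prob)
  have "(\<integral>\<^sup>+c. (INF n. \<Prod>u\<in>low n n. indiv t c u) \<partial>Q x) = (INF n. \<integral>\<^sup>+c. (\<Prod>u\<in>low n n. indiv t c u) \<partial>Q x)"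
  proof (rule nn_integral_monotone_convergence_INF_decseq[where i=0])
    show "decseq (\<lambda>n c. \<Prod>u\<in>low n n. indiv t c u)"
      by (intro decseq_SucI le_funI prod_antimono_ennreal low_mono finite_low indiv_le) auto
    show "(\<lambda>c. \<Prod>u\<in>low n n. indiv t c u) \<in> borel_measurable (Q x)" for n
      by (simp, intro borel_measurable_prod_ennreal
           measurable_tree_functionals(2)[where g="\<lambda>_ _. 1"]) auto
    show "(\<integral>\<^sup>+c. (\<Prod>u\<in>low 0 0. indiv t c u) \<partial>Q x) < \<infinity>"
      using emeasure_space_1 by (simp add: low_def)
  qed
  then show ?thesis by (simp add: h_def gen_eq[OF t])
qed

text \<open>Applying \<open>\<Gamma> \<phi> (Suc n)\<close> to this off-diagonal term gives the next
  diagonal one, which is why its limit is wanted; it lies between two diagonal terms.\<close>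

lemma LIMSEQ_gen: "0 \<le> t \<Longrightarrow> (\<lambda>n. gen n (Suc n) t x) \<longlonglongrightarrow> h t x"
proof (rule tendsto_sandwich[where f="\<lambda>n. gen (Suc n) (Suc n) t x" and h="\<lambda>n. gen n n t x"])
  assume t: "0 \<le> t"
  have lim: "(\<lambda>n. gen n n t x) \<longlonglongrightarrow> h t x"
    unfolding h_def by (intro LIMSEQ_INF decseq_SucI gen_antimono t) auto
  then show "(\<lambda>n. gen n n t x) \<longlonglongrightarrow> h t x" .
  show "(\<lambda>n. gen (Suc n) (Suc n) t x) \<longlonglongrightarrow> h t x"
    using LIMSEQ_Suc[OF lim] .
  show "\<forall>\<^sub>F n in sequentially. gen (Suc n) (Suc n) t x \<le> gen n (Suc n) t x"
    "\<forall>\<^sub>F n in sequentially. gen n (Suc n) t x \<le> gen n n t x"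
    by (intro always_eventually allI gen_antimono t; simp)+
qed

lemma child_mono:
  assumes "\<And>s' y. 0 \<le> s' \<Longrightarrow> g s' y \<le> g' s' y"
  shows "child g s m k \<le> child g' s m k"
proof -
  have "0 \<le> s - real_of_ereal (birth_age b m k)" if "birth_age b m k \<le> ereal s"
    using that birth_age_nonneg[of m k] by (cases "birth_age b m k") auto
  then show ?thesis by (auto simp: child_def Let_def assms)
qed

lemma child_le_1:
  assumes "\<And>s' y. 0 \<le> s' \<Longrightarrow> g s' y \<le> 1"
  shows "child g s m k \<le> 1"
  using child_mono[of g "\<lambda>_ _. 1" s m k] assms by (simp add: child_def Let_def)

text \<open>The number of children and the depth of their subtrees grow together. Monotonicity in
  both separates the limits: depth first, for a fixed number \<open>j\<close> of children, then
  \<open>j\<close>.\<close>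

lemma INF_node:
  "(INF n. node \<phi> (Suc n) (gen n (Suc n)) t m) = own \<phi> t m * (INF j. \<Prod>k<j. child h t m k)"
proof -
  have own_fin: "own \<phi> t m < \<top>" using own_le[of t m] by (auto intro: le_less_trans)
  have h_le_gen: "h s y \<le> gen n (Suc n) s y" if "0 \<le> s" for s y n
    unfolding h_def by (rule INF_lower2[of "Suc n"]) (auto intro: gen_antimono that)
  have c1: "child (gen n (Suc n)) t m k \<le> 1" "child h t m k \<le> 1" for n k
    by (auto intro!: child_le_1 gen_le_1 h_le_1)
  have ch: "child h t m k \<le> child (gen n (Suc n)) t m k" for n k
    by (rule child_mono) (rule h_le_gen)
  have lim: "(\<lambda>n. child (gen n (Suc n)) t m k) \<longlonglongrightarrow> child h t m k" for k
  proof (cases "birth_age b m k \<le> ereal t")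
    case True
    then have "0 \<le> t - real_of_ereal (birth_age b m k)"
      using birth_age_nonneg[of m k] by (cases "birth_age b m k") auto
    then show ?thesis by (auto simp: child_def Let_def intro: LIMSEQ_gen)
  qed (simp add: child_def Let_def)
  have "(INF n. node \<phi> (Suc n) (gen n (Suc n)) t m) = (INF j. own \<phi> t m * (\<Prod>k<j. child h t m k))"
  proof (rule antisym)
    show "(INF n. node \<phi> (Suc n) (gen n (Suc n)) t m) \<le> (INF j. own \<phi> t m * (\<Prod>k<j. child h t m k))"
    proof (rule INF_greatest)
      fix j :: nat
      have "(\<lambda>n. own \<phi> t m * (\<Prod>k<j. child (gen n (Suc n)) t m k)) \<longlonglongrightarrow> own \<phi> t m * (\<Prod>k<j. child h t m k)"
        by (intro ennreal_tendsto_cmult own_fin tendsto_prod_ennreal lim c1)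
      then show "(INF n. node \<phi> (Suc n) (gen n (Suc n)) t m) \<le> own \<phi> t m * (\<Prod>k<j. child h t m k)"
      proof (rule LIMSEQ_le_const)
        show "\<exists>N. \<forall>n\<ge>N. (INF n. node \<phi> (Suc n) (gen n (Suc n)) t m)
            \<le> own \<phi> t m * (\<Prod>k<j. child (gen n (Suc n)) t m k)"
        proof (intro exI[of _ j] allI impI)
          fix n assume n: "j \<le> n"
          have "(INF n. node \<phi> (Suc n) (gen n (Suc n)) t m) \<le> node \<phi> (Suc n) (gen n (Suc n)) t m"
            by (rule INF_lower) simp
          also have "\<dots> \<le> own \<phi> t m * (\<Prod>k<j. child (gen n (Suc n)) t m k)"
            unfolding node_def using n
            by (intro mult_left_mono prod_antimono_ennreal c1) auto
          finally show "(INF n. node \<phi> (Suc n) (gen n (Suc n)) t m)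
            \<le> own \<phi> t m * (\<Prod>k<j. child (gen n (Suc n)) t m k)" .
        qed
      qed
    qed
    show "(INF j. own \<phi> t m * (\<Prod>k<j. child h t m k)) \<le> (INF n. node \<phi> (Suc n) (gen n (Suc n)) t m)"
    proof (rule INF_greatest)
      fix n
      have "(INF j. own \<phi> t m * (\<Prod>k<j. child h t m k)) \<le> own \<phi> t m * (\<Prod>k<Suc n. child h t m k)"
        by (rule INF_lower) simp
      also have "\<dots> \<le> node \<phi> (Suc n) (gen n (Suc n)) t m"
        unfolding node_def by (intro mult_left_mono prod_mono_ennreal) (auto simp: ch)
      finally show "(INF j. own \<phi> t m * (\<Prod>k<j. child h t m k)) \<le> node \<phi> (Suc n) (gen n (Suc n)) t m" .
    qed
  qed
  also have "\<dots> = own \<phi> t m * (INF j. \<Prod>k<j. child h t m k)"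
    by (intro INF_mult_left_decseq own_fin decseq_SucI prod_antimono_ennreal c1) auto
  finally show ?thesis .
qed

text \<open>Monotone convergence in the recursion \<open>gen_Suc\<close> along the diagonal; the
  infimum of the products restores all children.\<close>

lemma h_fixed_point:
  assumes t: "0 \<le> t"
  shows "h t y = (\<integral>\<^sup>+m. own \<phi> t m * (INF j. \<Prod>k<j. child h t m k) \<partial>mark_law P y)"
proof -
  interpret M: prob_space "mark_law P y" by (rule prob_mark_law)
  have lim: "(\<lambda>n. gen n n t y) \<longlonglongrightarrow> h t y"
    unfolding h_def by (intro LIMSEQ_INF decseq_SucI gen_antimono t) auto
  have dec: "gen (Suc (Suc n)) (Suc (Suc n)) t y \<le> gen (Suc n) (Suc n) t y" for n
    by (rule gen_antimono[OF t]) auto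
  have "h t y = (INF n. gen (Suc n) (Suc n) t y)"
    by (rule LIMSEQ_unique[OF LIMSEQ_Suc[OF lim]]) (intro LIMSEQ_INF decseq_SucI dec)
  also have "\<dots> = (INF n. \<integral>\<^sup>+m. node \<phi> (Suc n) (gen n (Suc n)) t m \<partial>mark_law P y)"
    by (simp only: gen_Suc \<Gamma>_def)
  also have "\<dots> = (\<integral>\<^sup>+m. (INF n. node \<phi> (Suc n) (gen n (Suc n)) t m) \<partial>mark_law P y)"
  proof (rule nn_integral_monotone_convergence_INF_decseq[symmetric, where i=0])
    have c: "child (gen n K) t m k \<le> 1" for n K m k by (intro child_le_1 gen_le_1)
    show "decseq (\<lambda>n m. node \<phi> (Suc n) (gen n (Suc n)) t m)"
    proof (intro decseq_SucI le_funI)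
      fix n m
      have "(\<Prod>k<Suc (Suc n). child (gen (Suc n) (Suc (Suc n))) t m k) \<le> (\<Prod>k<Suc n. child (gen (Suc n) (Suc (Suc n))) t m k)"
        by (intro prod_antimono_ennreal c) auto
      also have "\<dots> \<le> (\<Prod>k<Suc n. child (gen n (Suc n)) t m k)"
        by (intro prod_mono_ennreal child_mono gen_antimono) auto
      finally show "node \<phi> (Suc (Suc n)) (gen (Suc n) (Suc (Suc n))) t m \<le> node \<phi> (Suc n) (gen n (Suc n)) t m"
        unfolding node_def by (rule mult_left_mono) simp
    qed
    show "(\<lambda>m. node \<phi> (Suc n) (gen n (Suc n)) t m) \<in> borel_measurable (mark_law P y)" for n
      by (subst measurable_cong_sets[OF sets_mark_law refl]) (rule measurable_node, auto)
    have "node \<phi> (Suc 0) (gen 0 (Suc 0)) t m \<le> 1" for m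
      unfolding node_def by (intro mult_le_one own_le prod_le_1_ennreal c) auto
    then have "(\<integral>\<^sup>+m. node \<phi> (Suc 0) (gen 0 (Suc 0)) t m \<partial>mark_law P y) \<le> (\<integral>\<^sup>+m. 1 \<partial>mark_law P y)"
      by (intro nn_integral_mono)
    then show "(\<integral>\<^sup>+m. node \<phi> (Suc 0) (gen 0 (Suc 0)) t m \<partial>mark_law P y) < \<infinity>"
      using M.emeasure_space_1 by (simp add: le_less_trans)
  qed
  finally show ?thesis by (simp only: INF_node)
qed

end

section \<open>The mild equation\<close>

lemma measurable_interval_nn_integral:
  fixes k :: "'x \<Rightarrow> real \<Rightarrow> ennreal"
  assumes [measurable]: "(\<lambda>z. k (fst z) (snd z)) \<in> borel_measurable (M \<Otimes>\<^sub>M borel)"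
    "p \<in> borel_measurable M" "q \<in> borel_measurable M"
  shows "(\<lambda>x. \<integral>\<^sup>+s\<in>{p x..q x}. k x s \<partial>lborel) \<in> borel_measurable M"
proof -
  have "(\<lambda>x. \<integral>\<^sup>+s. (if p x \<le> s \<and> s \<le> q x then (\<lambda>z. k (fst z) (snd z)) (x, s) else 0) \<partial>lborel)
      \<in> borel_measurable M"
    by measurable
  also have "(\<lambda>x. \<integral>\<^sup>+s. (if p x \<le> s \<and> s \<le> q x then (\<lambda>z. k (fst z) (snd z)) (x, s) else 0) \<partial>lborel)
     = (\<lambda>x. \<integral>\<^sup>+s\<in>{p x..q x}. k x s \<partial>lborel)"
    by (intro ext nn_integral_cong) auto
  finally show ?thesis .
qed

lemma interval_shift:
  fixes g :: "real \<Rightarrow> ennreal"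
  assumes [measurable]: "g \<in> borel_measurable borel"
  shows "(\<integral>\<^sup>+s\<in>{0..c}. g (r + s) \<partial>lborel) = (\<integral>\<^sup>+s\<in>{r..r + c}. g s \<partial>lborel)"
  using nn_integral_translate[of "\<lambda>s. g s * indicator {r..r + c} s" r]
  by (simp add: indicator_def)

lemma interval_split:
  fixes g :: "real \<Rightarrow> ennreal"
  assumes [measurable]: "g \<in> borel_measurable borel" and "p \<le> q" "q \<le> r"
  shows "(\<integral>\<^sup>+s\<in>{p..r}. g s \<partial>lborel) = (\<integral>\<^sup>+s\<in>{p..q}. g s \<partial>lborel) + (\<integral>\<^sup>+s\<in>{q..r}. g s \<partial>lborel)"
proof -
  have "(\<integral>\<^sup>+s\<in>{p..r}. g s \<partial>lborel) = (\<integral>\<^sup>+s. g s * indicator {p..q} s + g s * indicator {q..r} s \<partial>lborel)"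
    by (intro nn_integral_cong_AE, use AE_lborel_singleton[of q] in eventually_elim)
       (use assms in \<open>auto split: split_indicator\<close>)
  then show ?thesis by (simp add: nn_integral_add)
qed

lemma interval_add:
  fixes f g :: "real \<Rightarrow> ennreal"
  assumes [measurable]: "f \<in> borel_measurable borel" "g \<in> borel_measurable borel"
  shows "(\<integral>\<^sup>+s\<in>{p..q}. (f s + g s) \<partial>lborel) = (\<integral>\<^sup>+s\<in>{p..q}. f s \<partial>lborel) + (\<integral>\<^sup>+s\<in>{p..q}. g s \<partial>lborel)"
  by (simp add: distrib_right nn_integral_add)

lemma triangle_Fubini:
  fixes k :: "real \<Rightarrow> real \<Rightarrow> ennreal"
  assumes [measurable]: "(\<lambda>z. k (fst z) (snd z)) \<in> borel_measurable (borel \<Otimes>\<^sub>M borel)"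
  shows "(\<integral>\<^sup>+r\<in>{0..t}. (\<integral>\<^sup>+a\<in>{r..t}. k r a \<partial>lborel) \<partial>lborel) =
    (\<integral>\<^sup>+a\<in>{0..t}. (\<integral>\<^sup>+r\<in>{0..a}. k r a \<partial>lborel) \<partial>lborel)"
proof -
  define f where "f = (\<lambda>(r, a). (\<lambda>z. k (fst z) (snd z)) (r, a) * (if 0 \<le> r \<and> r \<le> a \<and> a \<le> t then 1 else 0))"
  have [measurable]: "f \<in> borel_measurable (lborel \<Otimes>\<^sub>M lborel)"
    unfolding f_def by measurable
  have [measurable]: "(\<lambda>a. k r a) \<in> borel_measurable borel" "(\<lambda>r. k r a) \<in> borel_measurable borel" for r a
    using measurable_compose[OF measurable_Pair1'[of r borel borel] assms]
      measurable_compose[OF measurable_Pair2'[of a borel borel] assms] by simp_all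
  have "(\<integral>\<^sup>+r\<in>{0..t}. (\<integral>\<^sup>+a\<in>{r..t}. k r a \<partial>lborel) \<partial>lborel) = (\<integral>\<^sup>+r. \<integral>\<^sup>+a. f (r, a) \<partial>lborel \<partial>lborel)"
  proof (intro nn_integral_cong)
    fix r
    have "(\<integral>\<^sup>+a\<in>{r..t}. k r a \<partial>lborel) * indicator {0..t} r =
        (\<integral>\<^sup>+a. k r a * indicator {r..t} a * indicator {0..t} r \<partial>lborel)"
      by (rule nn_integral_multc[symmetric]) measurable
    also have "\<dots> = (\<integral>\<^sup>+a. f (r, a) \<partial>lborel)"
      by (intro nn_integral_cong) (auto simp: f_def split: split_indicator)
    finally show "(\<integral>\<^sup>+a\<in>{r..t}. k r a \<partial>lborel) * indicator {0..t} r = (\<integral>\<^sup>+a. f (r, a) \<partial>lborel)" .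
  qed
  also have "\<dots> = (\<integral>\<^sup>+a. \<integral>\<^sup>+r. f (r, a) \<partial>lborel \<partial>lborel)"
    by (rule lborel_pair.Fubini'[symmetric]) (simp add: split_beta')
  also have "\<dots> = (\<integral>\<^sup>+a\<in>{0..t}. (\<integral>\<^sup>+r\<in>{0..a}. k r a \<partial>lborel) \<partial>lborel)"
  proof (intro nn_integral_cong)
    fix a
    have "(\<integral>\<^sup>+r\<in>{0..a}. k r a \<partial>lborel) * indicator {0..t} a =
        (\<integral>\<^sup>+r. k r a * indicator {0..a} r * indicator {0..t} a \<partial>lborel)"
      by (rule nn_integral_multc[symmetric]) measurable
    also have "\<dots> = (\<integral>\<^sup>+r. f (r, a) \<partial>lborel)"
      by (intro nn_integral_cong) (auto simp: f_def split: split_indicator)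
    finally show "(\<integral>\<^sup>+r. f (r, a) \<partial>lborel) = (\<integral>\<^sup>+r\<in>{0..a}. k r a \<partial>lborel) * indicator {0..t} a" ..
  qed
  finally show ?thesis .
qed

section \<open>A pathwise Duhamel identity and its average\<close>

context branching_rates
begin

text \<open>Rate at which the individual on path \<open>w\<close> bears, at age \<open>s\<close>, a
  child with a marked descendant at time \<open>t\<close>, when \<open>u\<close> is the probability
  that the progeny of a new individual contains a mark.\<close>

definition \<beta> :: "(real \<Rightarrow> real \<Rightarrow> ennreal) \<Rightarrow> real \<Rightarrow> real \<Rightarrow> (real \<Rightarrow> real) \<Rightarrow> ennreal" where
  "\<beta> u t s w = ennreal (b (path_at w s)) * u (t - s) (path_at w s)"

definition \<delta> :: "real \<Rightarrow> (real \<Rightarrow> real) \<Rightarrow> ennreal" where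
  "\<delta> s w = ennreal (d (path_at w s))"

text \<open>With \<open>u = 1 - h\<close>, this is one minus the conditional expectation, given the path \<open>w\<close> of
  the initial individual, of the generating functional at time \<open>t\<close>: either that individual is
  alive at time \<open>t\<close> and is marked, or one of its children has marked descendants.\<close>

definition J :: "(real \<Rightarrow> real \<Rightarrow> ennreal) \<Rightarrow> (real \<Rightarrow> ennreal) \<Rightarrow> real \<Rightarrow> (real \<Rightarrow> real) \<Rightarrow> ennreal" where
  "J u u0 t w =
     exp_neg (\<integral>\<^sup>+s\<in>{0..t}. (\<delta> s w + \<beta> u t s w) \<partial>lborel) * u0 (path_at w t) +
     (\<integral>\<^sup>+a\<in>{0..t}. \<beta> u t a w * exp_neg (\<integral>\<^sup>+s\<in>{0..a}. (\<delta> s w + \<beta> u t s w) \<partial>lborel) \<partial>lborel)"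

lemma measurable_\<delta> [measurable (raw)]:
  "s \<in> borel_measurable M \<Longrightarrow> g \<in> M \<rightarrow>\<^sub>M PS \<Longrightarrow> (\<lambda>x. \<delta> (s x) (g x)) \<in> borel_measurable M"
  unfolding \<delta>_def by measurable

lemma measurable_\<beta>:
  assumes u: "(\<lambda>(s, y). u s y) \<in> borel_measurable (borel \<Otimes>\<^sub>M borel)"
    and [measurable]: "t \<in> borel_measurable M" "s \<in> borel_measurable M" "g \<in> M \<rightarrow>\<^sub>M PS"
  shows "(\<lambda>x. \<beta> u (t x) (s x) (g x)) \<in> borel_measurable M"
proof -
  have "(\<lambda>x. (\<lambda>(s, y). u s y) (t x - s x, path_at (g x) (s x))) \<in> borel_measurable M"
    using u by measurable
  then have [measurable]: "(\<lambda>x. u (t x - s x) (path_at (g x) (s x))) \<in> borel_measurable M" by simp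
  show ?thesis unfolding \<beta>_def by measurable
qed

lemma measurable_J:
  assumes u: "(\<lambda>(s, y). u s y) \<in> borel_measurable (borel \<Otimes>\<^sub>M borel)"
    and [measurable]: "u0 \<in> borel_measurable borel" "t \<in> borel_measurable M" "g \<in> M \<rightarrow>\<^sub>M PS"
  shows "(\<lambda>x. J u u0 (t x) (g x)) \<in> borel_measurable M"
proof -
  note measurable_\<beta>[OF u, measurable (raw)]
  have [measurable]: "(\<lambda>x. \<integral>\<^sup>+s\<in>{0..t x}. (\<delta> s (g x) + \<beta> u (t x) s (g x)) \<partial>lborel) \<in> borel_measurable M"
    by (rule measurable_interval_nn_integral) measurable
  have [measurable]: "(\<lambda>z. \<integral>\<^sup>+s\<in>{0..snd z}. (\<delta> s (g (fst z)) + \<beta> u (t (fst z)) s (g (fst z))) \<partial>lborel)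
      \<in> borel_measurable (M \<Otimes>\<^sub>M borel)"
    by (rule measurable_interval_nn_integral) measurable
  have [measurable]: "(\<lambda>x. \<integral>\<^sup>+a\<in>{0..t x}. \<beta> u (t x) a (g x) *
      exp_neg (\<integral>\<^sup>+s\<in>{0..a}. (\<delta> s (g x) + \<beta> u (t x) s (g x)) \<partial>lborel) \<partial>lborel) \<in> borel_measurable M"
    by (rule measurable_interval_nn_integral) measurable
  show ?thesis unfolding J_def by measurable
qed

lemma \<beta>_shift: "0 \<le> r \<Longrightarrow> 0 \<le> s \<Longrightarrow> \<beta> u (t - r) s (path_shift r w) = \<beta> u t (r + s) w"
  by (simp add: \<beta>_def path_at_shift algebra_simps)

lemma \<delta>_shift: "0 \<le> r \<Longrightarrow> 0 \<le> s \<Longrightarrow> \<delta> s (path_shift r w) = \<delta> (r + s) w"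
  by (simp add: \<delta>_def path_at_shift)

context
  fixes u :: "real \<Rightarrow> real \<Rightarrow> ennreal" and u0 :: "real \<Rightarrow> ennreal"
  assumes u_meas: "(\<lambda>(s, y). u s y) \<in> borel_measurable (borel \<Otimes>\<^sub>M borel)"
    and u_le: "\<And>s y. u s y \<le> 1"
    and u0_meas [measurable]: "u0 \<in> borel_measurable borel" and u0_le: "\<And>y. u0 y \<le> 1"
begin

lemma \<beta>_le: "\<beta> u t s w \<le> ennreal bs"
proof -
  have "\<beta> u t s w \<le> ennreal bs * 1"
    unfolding \<beta>_def by (intro mult_mono ennreal_leI b_le u_le) auto
  then show ?thesis by simp
qed

text \<open>The shortened horizon and the shifted path recombine to the original rates, by
  \<open>\<beta>_shift\<close> and \<open>\<delta>_shift\<close>, so everything can be written over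
  \<open>[r, t]\<close> along \<open>w\<close>.\<close>

lemma J_shift:
  assumes w: "w \<in> D" and r: "0 \<le> r" "r \<le> t"
  shows "J u u0 (t - r) (path_shift r w) =
     exp_neg (\<integral>\<^sup>+s\<in>{r..t}. (\<delta> s w + \<beta> u t s w) \<partial>lborel) * u0 (path_at w t) +
     (\<integral>\<^sup>+a\<in>{r..t}. \<beta> u t a w * exp_neg (\<integral>\<^sup>+s\<in>{r..a}. (\<delta> s w + \<beta> u t s w) \<partial>lborel) \<partial>lborel)"
proof -
  have [measurable]: "(\<lambda>_. w) \<in> M \<rightarrow>\<^sub>M PS" for M :: "'x measure" using w by simp
  note measurable_\<beta>[OF u_meas, measurable (raw)]
  define I where "I p a = (\<integral>\<^sup>+s\<in>{p..a}. (\<delta> s w + \<beta> u t s w) \<partial>lborel)" for p a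
  have [measurable]: "I p \<in> borel_measurable borel" for p
    unfolding I_def by (rule measurable_interval_nn_integral) measurable
  have 1: "(\<integral>\<^sup>+s\<in>{0..a}. (\<delta> s (path_shift r w) + \<beta> u (t - r) s (path_shift r w)) \<partial>lborel) = I r (r + a)" for a
  proof -
    have "(\<integral>\<^sup>+s\<in>{0..a}. (\<delta> s (path_shift r w) + \<beta> u (t - r) s (path_shift r w)) \<partial>lborel) =
        (\<integral>\<^sup>+s\<in>{0..a}. (\<delta> (r + s) w + \<beta> u t (r + s) w) \<partial>lborel)"
      by (intro nn_integral_cong) (auto simp: \<beta>_shift \<delta>_shift r split: split_indicator)
    also have "\<dots> = I r (r + a)"
      unfolding I_def by (rule interval_shift) measurable
    finally show ?thesis .
  qed
  have "(\<integral>\<^sup>+a\<in>{0..t - r}. \<beta> u (t - r) a (path_shift r w) * exp_neg (I r (r + a)) \<partial>lborel) =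
      (\<integral>\<^sup>+a\<in>{0..t - r}. \<beta> u t (r + a) w * exp_neg (I r (r + a)) \<partial>lborel)"
    by (intro nn_integral_cong) (auto simp: \<beta>_shift r split: split_indicator)
  also have "\<dots> = (\<integral>\<^sup>+a\<in>{r..r + (t - r)}. \<beta> u t a w * exp_neg (I r a) \<partial>lborel)"
    by (rule interval_shift[where g="\<lambda>a. \<beta> u t a w * exp_neg (I r a)"]) measurable
  finally show ?thesis
    unfolding J_def 1 using r by (simp add: I_def path_at_shift)
qed

text \<open>\<open>J\<close> is built from the kernel killed at rate
  \<open>\<delta> + \<beta>\<close>; passing to the Feynman-Kac weight amounts to adding the rate
  \<open>b + \<beta>\<close>, and the integral on the left accounts for this. After averaging over
  paths \<open>\<beta>\<close> becomes \<open>b u\<close> and \<open>J\<close> becomes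
  \<open>u\<close>, so that the integral on the right cancels against part of the one on the
  left.\<close>

lemma J_identity:
  assumes w: "w \<in> D" and t: "0 \<le> t"
  shows "J u u0 t w + (\<integral>\<^sup>+r\<in>{0..t}. Wt r w * (ennreal (b (path_at w r)) + \<beta> u t r w) *
        J u u0 (t - r) (path_shift r w) \<partial>lborel) =
    Wt t w * u0 (path_at w t) + (\<integral>\<^sup>+r\<in>{0..t}. Wt r w * \<beta> u t r w \<partial>lborel)"
proof -
  have [measurable]: "(\<lambda>_. w) \<in> M \<rightarrow>\<^sub>M PS" for M :: "'x measure" using w by simp
  note measurable_\<beta>[OF u_meas, measurable (raw)]
  define bb where "bb s = ennreal (b (path_at w s))" for s
  define I where "I p a = (\<integral>\<^sup>+s\<in>{p..a}. (\<delta> s w + \<beta> u t s w) \<partial>lborel)" for p a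
  define K where "K p a = (\<integral>\<^sup>+s\<in>{p..a}. (bb s + \<beta> u t s w) \<partial>lborel)" for p a
  have [measurable]: "bb \<in> borel_measurable borel" unfolding bb_def by measurable
  have I_meas [measurable]: "(\<lambda>z. I (f z) (g z)) \<in> borel_measurable M"
    if [measurable]: "f \<in> borel_measurable M" "g \<in> borel_measurable M" for f g and M :: "'x measure"
    unfolding I_def by (rule measurable_interval_nn_integral) measurable
  have K_meas [measurable]: "(\<lambda>z. K (f z) (g z)) \<in> borel_measurable M"
    if [measurable]: "f \<in> borel_measurable M" "g \<in> borel_measurable M" for f g and M :: "'x measure"
    unfolding K_def by (rule measurable_interval_nn_integral) measurable
  \<comment> \<open>Over \<open>[r, a]\<close> the weight and the killing differ by the rate
    \<open>b + \<beta>\<close>: the death terms are common to both sides, so nothing is subtracted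
    and they may be infinite.\<close>
  have W_I: "Wt r w * exp_neg (I r a) = Wt a w * exp_neg (K r a)" if "0 \<le> r" "r \<le> a" for r a
  proof -
    define B where "B = (\<integral>\<^sup>+s\<in>{r..a}. bb s \<partial>lborel)"
    define B0 where "B0 = cumulated b w r"
    have cb: "cumulated b w a = B0 + B"
      unfolding cumulated_path_at B_def bb_def B0_def using that by (intro interval_split) auto
    have cd: "cumulated d w a = cumulated d w r + (\<integral>\<^sup>+s\<in>{r..a}. \<delta> s w \<partial>lborel)"
      unfolding cumulated_path_at \<delta>_def using that by (intro interval_split) auto
    have "B0 + B \<le> ennreal (bs * a)" using cumulated_b_le[of a w] that cb by simp
    also have "\<dots> < \<top>" by simp
    finally have fin: "B0 < \<top>" "B < \<top>" by simp_all
    have I: "I r a = (\<integral>\<^sup>+s\<in>{r..a}. \<delta> s w \<partial>lborel) + (\<integral>\<^sup>+s\<in>{r..a}. \<beta> u t s w \<partial>lborel)"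
      unfolding I_def by (simp add: distrib_right nn_integral_add)
    have K: "K r a = B + (\<integral>\<^sup>+s\<in>{r..a}. \<beta> u t s w \<partial>lborel)"
      unfolding K_def B_def by (simp add: distrib_right nn_integral_add)
    have "ennreal (exp (enn2real (B0 + B))) * exp_neg B = ennreal (exp (enn2real B0))"
      using fin by (cases B0; cases B) (auto simp: exp_neg_ennreal exp_add exp_minus simp flip: ennreal_plus ennreal_mult)
    then have E: "ennreal (exp (enn2real B0)) * z = ennreal (exp (enn2real (B0 + B))) * (exp_neg B * z)" for z
      by (metis mult.assoc)
    show ?thesis
      unfolding Wt_def cb cd I K exp_neg_add B0_def[symmetric]
      by (simp only: mult.assoc E mult.left_commute[of "exp_neg B"])
  qed
  \<comment> \<open>\<open>exp_backward\<close> for the rate \<open>b + \<beta>\<close>, multiplied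
    by the weight at time \<open>a\<close> and rewritten with \<open>W_I\<close>, expresses the
    weight through the killed kernel.\<close>
  have main: "exp_neg (I 0 a) + (\<integral>\<^sup>+r\<in>{0..a}. Wt r w * (bb r + \<beta> u t r w) * exp_neg (I r a) \<partial>lborel) = Wt a w"
    if a: "0 \<le> a" for a
  proof -
    have W0: "Wt 0 w = 1"
      by (simp add: Wt_def cumulated_path_at bounded_rate.F_neg[OF bounded_rate_path[OF w], of 0, unfolded F_path[OF w] cumulated_path_at])
    have "Wt a w = Wt a w * (exp_neg (K 0 a) + (\<integral>\<^sup>+r\<in>{0..a}. (bb r + \<beta> u t r w) * exp_neg (K r a) \<partial>lborel))"
      unfolding K_def
    proof (subst exp_backward[where C="2 * bs"])
      fix s
      have "bb s + \<beta> u t s w \<le> ennreal bs + ennreal bs"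
        unfolding bb_def by (intro add_mono \<beta>_le ennreal_leI b_le)
      also have "\<dots> = ennreal (2 * bs)"
        using bs_nonneg by (simp flip: ennreal_plus)
      finally show "bb s + \<beta> u t s w \<le> ennreal (2 * bs)" .
    qed (use a bs_nonneg in auto)
    also have "\<dots> = Wt a w * exp_neg (K 0 a) +
        (\<integral>\<^sup>+r. Wt a w * ((bb r + \<beta> u t r w) * exp_neg (K r a) * indicator {0..a} r) \<partial>lborel)"
      by (subst nn_integral_cmult) (simp_all add: distrib_left)
    also have "Wt a w * exp_neg (K 0 a) = exp_neg (I 0 a)"
      using W_I[of 0 a] a W0 by simp
    also have "(\<integral>\<^sup>+r. Wt a w * ((bb r + \<beta> u t r w) * exp_neg (K r a) * indicator {0..a} r) \<partial>lborel) =
       (\<integral>\<^sup>+r\<in>{0..a}. Wt r w * (bb r + \<beta> u t r w) * exp_neg (I r a) \<partial>lborel)"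
    proof (intro nn_integral_cong)
      fix r
      show "Wt a w * ((bb r + \<beta> u t r w) * exp_neg (K r a) * indicator {0..a} r) =
          Wt r w * (bb r + \<beta> u t r w) * exp_neg (I r a) * indicator {0..a} r"
      proof (cases "0 \<le> r \<and> r \<le> a")
        case True
        have "Wt a w * ((bb r + \<beta> u t r w) * exp_neg (K r a)) = (bb r + \<beta> u t r w) * (Wt a w * exp_neg (K r a))"
          by (simp only: mult_ac)
        also have "\<dots> = (bb r + \<beta> u t r w) * (Wt r w * exp_neg (I r a))"
          using W_I[of r a] True by simp
        also have "\<dots> = Wt r w * (bb r + \<beta> u t r w) * exp_neg (I r a)"
          by (simp only: mult_ac)
        finally show ?thesis using True by simp
      qed auto
    qed
    finally show ?thesis by simp
  qed
  let ?c = "\<lambda>r. Wt r w * (bb r + \<beta> u t r w)"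
  have "(\<integral>\<^sup>+r\<in>{0..t}. ?c r * J u u0 (t - r) (path_shift r w) \<partial>lborel) =
      (\<integral>\<^sup>+r\<in>{0..t}. (?c r * exp_neg (I r t) * u0 (path_at w t) +
        (\<integral>\<^sup>+a\<in>{r..t}. ?c r * (\<beta> u t a w * exp_neg (I r a)) \<partial>lborel)) \<partial>lborel)"
  proof (intro nn_integral_cong)
    fix r
    show "?c r * J u u0 (t - r) (path_shift r w) * indicator {0..t} r =
      (?c r * exp_neg (I r t) * u0 (path_at w t) +
        (\<integral>\<^sup>+a\<in>{r..t}. ?c r * (\<beta> u t a w * exp_neg (I r a)) \<partial>lborel)) * indicator {0..t} r"
    proof (cases "0 \<le> r \<and> r \<le> t")
      case True
      then have J: "J u u0 (t - r) (path_shift r w) = exp_neg (I r t) * u0 (path_at w t) +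
          (\<integral>\<^sup>+a\<in>{r..t}. \<beta> u t a w * exp_neg (I r a) \<partial>lborel)"
        unfolding I_def by (intro J_shift[OF w]) auto
      have "(\<integral>\<^sup>+a\<in>{r..t}. ?c r * (\<beta> u t a w * exp_neg (I r a)) \<partial>lborel) =
          ?c r * (\<integral>\<^sup>+a\<in>{r..t}. \<beta> u t a w * exp_neg (I r a) \<partial>lborel)"
        by (subst nn_integral_cmult[symmetric]) (auto simp: mult.assoc)
      then show ?thesis using True by (simp add: J distrib_left mult.assoc)
    qed auto
  qed
  also have "\<dots> = (\<integral>\<^sup>+r\<in>{0..t}. ?c r * exp_neg (I r t) * u0 (path_at w t) \<partial>lborel) +
      (\<integral>\<^sup>+r\<in>{0..t}. (\<integral>\<^sup>+a\<in>{r..t}. ?c r * (\<beta> u t a w * exp_neg (I r a)) \<partial>lborel) \<partial>lborel)"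
  proof (rule interval_add)
    show "(\<lambda>r. \<integral>\<^sup>+a\<in>{r..t}. ?c r * (\<beta> u t a w * exp_neg (I r a)) \<partial>lborel) \<in> borel_measurable borel"
      by (rule measurable_interval_nn_integral) measurable
  qed measurable
  also have "(\<integral>\<^sup>+r\<in>{0..t}. (\<integral>\<^sup>+a\<in>{r..t}. ?c r * (\<beta> u t a w * exp_neg (I r a)) \<partial>lborel) \<partial>lborel) =
      (\<integral>\<^sup>+a\<in>{0..t}. (\<integral>\<^sup>+r\<in>{0..a}. ?c r * (\<beta> u t a w * exp_neg (I r a)) \<partial>lborel) \<partial>lborel)"
    by (rule triangle_Fubini) measurable
  also have "\<dots> = (\<integral>\<^sup>+a\<in>{0..t}. \<beta> u t a w * (\<integral>\<^sup>+r\<in>{0..a}. ?c r * exp_neg (I r a) \<partial>lborel) \<partial>lborel)"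
  proof (intro nn_integral_cong)
    fix a
    have "(\<integral>\<^sup>+r\<in>{0..a}. ?c r * (\<beta> u t a w * exp_neg (I r a)) \<partial>lborel) =
        (\<integral>\<^sup>+r. \<beta> u t a w * (?c r * exp_neg (I r a) * indicator {0..a} r) \<partial>lborel)"
      by (intro nn_integral_cong) (simp only: mult_ac)
    also have "\<dots> = \<beta> u t a w * (\<integral>\<^sup>+r\<in>{0..a}. ?c r * exp_neg (I r a) \<partial>lborel)"
      by (rule nn_integral_cmult) measurable
    finally show "(\<integral>\<^sup>+r\<in>{0..a}. ?c r * (\<beta> u t a w * exp_neg (I r a)) \<partial>lborel) * indicator {0..t} a =
        \<beta> u t a w * (\<integral>\<^sup>+r\<in>{0..a}. ?c r * exp_neg (I r a) \<partial>lborel) * indicator {0..t} a"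
      by (simp only:)
  qed
  finally have eq: "(\<integral>\<^sup>+r\<in>{0..t}. ?c r * J u u0 (t - r) (path_shift r w) \<partial>lborel) =
      (\<integral>\<^sup>+r\<in>{0..t}. ?c r * exp_neg (I r t) * u0 (path_at w t) \<partial>lborel) +
      (\<integral>\<^sup>+a\<in>{0..t}. \<beta> u t a w * (\<integral>\<^sup>+r\<in>{0..a}. ?c r * exp_neg (I r a) \<partial>lborel) \<partial>lborel)" .
  have J: "J u u0 t w = exp_neg (I 0 t) * u0 (path_at w t) + (\<integral>\<^sup>+a\<in>{0..t}. \<beta> u t a w * exp_neg (I 0 a) \<partial>lborel)"
    by (simp add: J_def I_def)
  have 1: "(\<integral>\<^sup>+r\<in>{0..t}. ?c r * exp_neg (I r t) * u0 (path_at w t) \<partial>lborel) =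
      (\<integral>\<^sup>+r\<in>{0..t}. ?c r * exp_neg (I r t) \<partial>lborel) * u0 (path_at w t)"
  proof -
    have "(\<integral>\<^sup>+r\<in>{0..t}. ?c r * exp_neg (I r t) * u0 (path_at w t) \<partial>lborel) =
        (\<integral>\<^sup>+r. ?c r * exp_neg (I r t) * indicator {0..t} r * u0 (path_at w t) \<partial>lborel)"
      by (intro nn_integral_cong) (simp only: mult_ac)
    also have "\<dots> = (\<integral>\<^sup>+r\<in>{0..t}. ?c r * exp_neg (I r t) \<partial>lborel) * u0 (path_at w t)"
      by (rule nn_integral_multc) measurable
    finally show ?thesis .
  qed
  define Z where "Z a = (\<integral>\<^sup>+r\<in>{0..a}. ?c r * exp_neg (I r a) \<partial>lborel)" for a
  have [measurable]: "Z \<in> borel_measurable borel"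
    unfolding Z_def by (rule measurable_interval_nn_integral) measurable
  have 2: "(\<integral>\<^sup>+a\<in>{0..t}. \<beta> u t a w * exp_neg (I 0 a) \<partial>lborel) +
      (\<integral>\<^sup>+a\<in>{0..t}. \<beta> u t a w * Z a \<partial>lborel) = (\<integral>\<^sup>+a\<in>{0..t}. Wt a w * \<beta> u t a w \<partial>lborel)"
  proof -
    have "(\<integral>\<^sup>+a\<in>{0..t}. \<beta> u t a w * exp_neg (I 0 a) \<partial>lborel) + (\<integral>\<^sup>+a\<in>{0..t}. \<beta> u t a w * Z a \<partial>lborel) =
      (\<integral>\<^sup>+a\<in>{0..t}. (\<beta> u t a w * exp_neg (I 0 a) + \<beta> u t a w * Z a) \<partial>lborel)"
      by (rule interval_add[symmetric]) measurable
    also have "\<dots> = (\<integral>\<^sup>+a\<in>{0..t}. Wt a w * \<beta> u t a w \<partial>lborel)"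
    proof (intro nn_integral_cong)
      fix a
      show "(\<beta> u t a w * exp_neg (I 0 a) + \<beta> u t a w * Z a) * indicator {0..t} a =
          Wt a w * \<beta> u t a w * indicator {0..t} a"
      proof (cases "0 \<le> a \<and> a \<le> t")
        case True
        then have "Wt a w = exp_neg (I 0 a) + Z a" using main[of a] by (simp only: Z_def)
        then show ?thesis by (simp only: distrib_left distrib_right mult.commute)
      qed auto
    qed
    finally show ?thesis .
  qed
  have "J u u0 t w + (\<integral>\<^sup>+r\<in>{0..t}. ?c r * J u u0 (t - r) (path_shift r w) \<partial>lborel) =
     (exp_neg (I 0 t) + Z t) * u0 (path_at w t) +
     ((\<integral>\<^sup>+a\<in>{0..t}. \<beta> u t a w * exp_neg (I 0 a) \<partial>lborel) + (\<integral>\<^sup>+a\<in>{0..t}. \<beta> u t a w * Z a \<partial>lborel))"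
    unfolding eq[folded Z_def] J 1[folded Z_def]
    by (simp only: distrib_right[of "exp_neg (I 0 t)"] add.assoc add.left_commute)
  also have "\<dots> = Wt t w * u0 (path_at w t) + (\<integral>\<^sup>+r\<in>{0..t}. Wt r w * \<beta> u t r w \<partial>lborel)"
    using main[OF t, folded Z_def] 2 by (simp only:)
  finally show ?thesis unfolding bb_def .
qed

text \<open>Integrate \<open>J_identity\<close> over paths. By the Markov property at time
  \<open>r\<close>, \<open>J\<close> of the shifted path averages to \<open>u\<close>, so
  \<open>(b + b u) u\<close> splits into \<open>b u\<close> and \<open>b u^2\<close>. The
  \<open>b u\<close> terms on the two sides agree and cancel, which leaves the quadratic
  nonlinearity.\<close>

lemma mild_equation:
  assumes u_J: "\<And>t x. 0 \<le> t \<Longrightarrow> u t x = (\<integral>\<^sup>+w. J u u0 t w \<partial>P x)" and t: "0 \<le> t"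
  shows "u t x + (\<integral>\<^sup>+r\<in>{0..t}. Sn r (\<lambda>y. ennreal (b y) * (u (t - r) y)\<^sup>2) x \<partial>lborel) = Sn t u0 x"
proof -
  interpret PX: prob_space "P x" by (rule P_prob)
  interpret pair_sigma_finite "P x" lborel ..
  note measurable_\<beta>[OF u_meas, measurable (raw)] measurable_J[OF u_meas u0_meas, measurable (raw)]
  have u_meas' [measurable (raw)]: "(\<lambda>z. u (f z) (g z)) \<in> borel_measurable M"
    if "f \<in> borel_measurable M" "g \<in> borel_measurable M" for f g and M :: "'x measure"
    using measurable_compose[OF measurable_Pair[OF that] u_meas] by simp
  have u_sec [measurable]: "u s \<in> borel_measurable borel" for s
    by (rule u_meas'[of "\<lambda>_. s" borel "\<lambda>y. y"]) auto
  have swap: "(\<integral>\<^sup>+w. (\<integral>\<^sup>+r\<in>{0..t}. f r w \<partial>lborel) \<partial>P x) = (\<integral>\<^sup>+r\<in>{0..t}. (\<integral>\<^sup>+w. f r w \<partial>P x) \<partial>lborel)"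
    if f [measurable]: "(\<lambda>z. f (snd z) (fst z)) \<in> borel_measurable (PS \<Otimes>\<^sub>M borel)" for f
  proof -
    have "(\<lambda>z. f (snd z) (fst z) * indicator {0..t} (snd z)) \<in> borel_measurable (PS \<Otimes>\<^sub>M lborel)"
      by measurable
    then have "(\<lambda>(w, r). f r w * indicator {0..t} r) \<in> borel_measurable (P x \<Otimes>\<^sub>M lborel)"
      using measurable_cong_sets[OF sets_pair_measure_cong[OF P_sets refl] refl, of x lborel borel]
      by (simp add: split_beta')
    from Fubini'[OF this]
    have "(\<integral>\<^sup>+w. (\<integral>\<^sup>+r\<in>{0..t}. f r w \<partial>lborel) \<partial>P x) =
        (\<integral>\<^sup>+r. \<integral>\<^sup>+w. f r w * indicator {0..t} r \<partial>P x \<partial>lborel)" by (rule sym)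
    also have "\<dots> = (\<integral>\<^sup>+r\<in>{0..t}. (\<integral>\<^sup>+w. f r w \<partial>P x) \<partial>lborel)"
      by (intro nn_integral_cong) (auto split: split_indicator)
    finally show ?thesis .
  qed
  define C where "C = (\<integral>\<^sup>+r\<in>{0..t}. Sn r (\<lambda>y. ennreal (b y) * u (t - r) y) x \<partial>lborel)"
  define E where "E = (\<integral>\<^sup>+r\<in>{0..t}. Sn r (\<lambda>y. ennreal (b y) * (u (t - r) y)\<^sup>2) x \<partial>lborel)"
  define g where "g r w = Wt r w * (ennreal (b (path_at w r)) + \<beta> u t r w) * J u u0 (t - r) (path_shift r w)" for r w
  have g_meas: "(\<lambda>z. g (snd z) (fst z)) \<in> borel_measurable (PS \<Otimes>\<^sub>M borel)"
    unfolding g_def by measurable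
  have W\<beta>_meas: "(\<lambda>z. Wt (snd z) (fst z) * \<beta> u t (snd z) (fst z)) \<in> borel_measurable (PS \<Otimes>\<^sub>M borel)"
    by measurable
  have "(\<integral>\<^sup>+w. J u u0 t w \<partial>P x) + (\<integral>\<^sup>+w. (\<integral>\<^sup>+r\<in>{0..t}. g r w \<partial>lborel) \<partial>P x) =
      (\<integral>\<^sup>+w. J u u0 t w + (\<integral>\<^sup>+r\<in>{0..t}. g r w \<partial>lborel) \<partial>P x)"
    by (rule nn_integral_add[symmetric])
       (simp_all add: measurable_interval_nn_integral g_meas[unfolded split_beta']
          measurable_J[OF u_meas u0_meas] measurable_interval_nn_integral[of "\<lambda>w r. g r w"] g_meas)
  also have "\<dots> = (\<integral>\<^sup>+w. Wt t w * u0 (path_at w t) + (\<integral>\<^sup>+r\<in>{0..t}. Wt r w * \<beta> u t r w \<partial>lborel) \<partial>P x)"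
    unfolding g_def by (intro nn_integral_cong J_identity t) simp
  also have "\<dots> = Sn t u0 x + (\<integral>\<^sup>+w. (\<integral>\<^sup>+r\<in>{0..t}. Wt r w * \<beta> u t r w \<partial>lborel) \<partial>P x)"
    unfolding Sn_def
    by (rule nn_integral_add)
       (simp_all add: measurable_interval_nn_integral[of "\<lambda>w r. Wt r w * \<beta> u t r w"] W\<beta>_meas)
  also have "(\<integral>\<^sup>+w. (\<integral>\<^sup>+r\<in>{0..t}. Wt r w * \<beta> u t r w \<partial>lborel) \<partial>P x) = C"
    by (rule trans[OF swap[OF W\<beta>_meas]]) (simp only: C_def Sn_def \<beta>_def)
  also have "(\<integral>\<^sup>+w. J u u0 t w \<partial>P x) = u t x" by (rule u_J[OF t, symmetric])
  also have "(\<integral>\<^sup>+w. (\<integral>\<^sup>+r\<in>{0..t}. g r w \<partial>lborel) \<partial>P x) = (\<integral>\<^sup>+r\<in>{0..t}. (\<integral>\<^sup>+w. g r w \<partial>P x) \<partial>lborel)"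
    by (rule swap[OF g_meas])
  also have "\<dots> = (\<integral>\<^sup>+r\<in>{0..t}. (Sn r (\<lambda>y. ennreal (b y) * u (t - r) y) x +
      Sn r (\<lambda>y. ennreal (b y) * (u (t - r) y)\<^sup>2) x) \<partial>lborel)"
  proof (intro nn_integral_cong)
    fix r
    show "(\<integral>\<^sup>+w. g r w \<partial>P x) * indicator {0..t} r = (Sn r (\<lambda>y. ennreal (b y) * u (t - r) y) x +
      Sn r (\<lambda>y. ennreal (b y) * (u (t - r) y)\<^sup>2) x) * indicator {0..t} r"
    proof (cases "0 \<le> r \<and> r \<le> t")
      case True
      then have r: "0 \<le> r" "0 \<le> t - r" by auto
      note measurable_Wt_past[OF r(1), measurable]
      have [measurable]: "(\<lambda>w. path_at w r) \<in> path_space D {0..r} \<rightarrow>\<^sub>M borel"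
        using r by (auto simp: path_at_def intro: measurable_path_coordinate)
      define c where "c w = Wt r w * (ennreal (b (path_at w r)) + \<beta> u t r w)" for w
      have [measurable]: "c \<in> borel_measurable (path_space D {0..r})"
        unfolding c_def \<beta>_def by measurable
      have "(\<integral>\<^sup>+w. g r w \<partial>P x) = (\<integral>\<^sup>+w. (\<lambda>(w, w'). c w * J u u0 (t - r) w') (w, path_shift r w) \<partial>P x)"
        by (simp add: g_def c_def)
      also have "\<dots> = (\<integral>\<^sup>+w. \<integral>\<^sup>+w'. (\<lambda>(w, w'). c w * J u u0 (t - r) w') (w, w') \<partial>P (path_at w r) \<partial>P x)"
        by (rule markov_nn_integral[OF r(1)]) measurable
      also have "\<dots> = (\<integral>\<^sup>+w. c w * u (t - r) (path_at w r) \<partial>P x)"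
        by (intro nn_integral_cong)
           (simp add: u_J[OF r(2)] nn_integral_cmult measurable_J[OF u_meas u0_meas])
      also have "\<dots> = (\<integral>\<^sup>+w. Wt r w * (ennreal (b (path_at w r)) * u (t - r) (path_at w r)) +
          Wt r w * (ennreal (b (path_at w r)) * (u (t - r) (path_at w r))\<^sup>2) \<partial>P x)"
        by (intro nn_integral_cong) (simp add: c_def \<beta>_def distrib_left distrib_right power2_eq_square mult.assoc)
      also have "\<dots> = Sn r (\<lambda>y. ennreal (b y) * u (t - r) y) x + Sn r (\<lambda>y. ennreal (b y) * (u (t - r) y)\<^sup>2) x"
        unfolding Sn_def by (rule nn_integral_add) simp_all
      finally show ?thesis by simp
    qed auto
  qed
  also have "\<dots> = C + E"
    unfolding C_def E_def distrib_right
  proof (rule nn_integral_add)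
    have "(\<lambda>r. Sn r (\<lambda>y. ennreal (b y) * u (t - r) y) x) \<in> borel_measurable borel"
      by (rule measurable_Sn) (simp_all add: split_beta')
    then show "(\<lambda>r. Sn r (\<lambda>y. ennreal (b y) * u (t - r) y) x * indicator {0..t} r) \<in> borel_measurable lborel"
      by measurable
    have "(\<lambda>r. Sn r (\<lambda>y. ennreal (b y) * (u (t - r) y)\<^sup>2) x) \<in> borel_measurable borel"
      by (rule measurable_Sn) (simp_all add: split_beta')
    then show "(\<lambda>r. Sn r (\<lambda>y. ennreal (b y) * (u (t - r) y)\<^sup>2) x * indicator {0..t} r) \<in> borel_measurable lborel"
      by measurable
  qed
  finally have eq: "u t x + (C + E) = Sn t u0 x + C" .
  \<comment> \<open>Cancellation in \<open>ennreal\<close> requires a finite term; the bound on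
    \<open>b\<close> over a bounded horizon supplies it.\<close>
  have "C \<le> (\<integral>\<^sup>+r\<in>{0..t}. ennreal (exp (bs * t) * bs) \<partial>lborel)"
    unfolding C_def
  proof (intro nn_integral_mono)
    fix r
    have "Sn r (\<lambda>y. ennreal (b y) * u (t - r) y) x \<le> ennreal (exp (bs * t) * bs)" if r: "0 \<le> r" "r \<le> t"
    proof -
      have "Sn r (\<lambda>y. ennreal (b y) * u (t - r) y) x \<le> ennreal (exp (bs * r)) * ennreal bs"
      proof (rule Sn_le[OF r(1)])
        fix y
        show "ennreal (b y) * u (t - r) y \<le> ennreal bs"
          using mult_mono[OF ennreal_leI[OF b_le[of y]] u_le[of "t - r" y]] by simp
      qed
      also have "\<dots> \<le> ennreal (exp (bs * t) * bs)"
        using r bs_nonneg by (auto simp flip: ennreal_mult intro!: ennreal_leI mult_right_mono mult_left_mono)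
      finally show ?thesis .
    qed
    then show "Sn r (\<lambda>y. ennreal (b y) * u (t - r) y) x * indicator {0..t} r
        \<le> ennreal (exp (bs * t) * bs) * indicator {0..t} r"
      by (auto split: split_indicator)
  qed
  also have "\<dots> < \<top>"
    by (simp add: nn_integral_cmult_indicator ennreal_mult_less_top t)
  finally have "C \<noteq> \<top>" by simp
  moreover have "C + (u t x + E) = C + Sn t u0 x" using eq by (simp add: add_ac)
  ultimately have "u t x + E = Sn t u0 x"
    by (simp add: ennreal_add_left_cancel)
  then show ?thesis by (simp add: E_def)
qed

end

end

section \<open>The generating functional solves the mild equation\<close>

context branching_tree
begin

definition u :: "real \<Rightarrow> real \<Rightarrow> ennreal" where
  "u t y = (if 0 \<le> t then 1 - h t y else 0)"

lemma measurable_u: "(\<lambda>(s, y). u s y) \<in> borel_measurable (borel \<Otimes>\<^sub>M borel)"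
proof -
  have "(\<lambda>z. if 0 \<le> fst z then 1 - (\<lambda>(s, y). h s y) z else 0) \<in> borel_measurable (borel \<Otimes>\<^sub>M borel)"
    by measurable
  then show ?thesis by (simp add: u_def split_beta')
qed

lemma u_le_1: "u t y \<le> 1"
  by (simp add: u_def)

text \<open>In the scale of the cumulated birth rate the births are the points of a Poisson process
  of rate 1, and \<open>\<psi>\<close> is the factor of a child born at level \<open>z\<close>. The
  Poisson formula gives an exponential and the time change returns to ages.\<close>

lemma integral_gaps:
  assumes w: "w \<in> D" and t: "0 \<le> t"
  shows "(\<integral>\<^sup>+g. (INF j. \<Prod>k<j. child h t (w, e, g) k) \<partial>PE) =
    exp_neg (\<integral>\<^sup>+a\<in>{0..t}. \<beta> u t a w * of_bool (cumulated d w a < ennreal e) \<partial>lborel)"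
proof -
  have [measurable]: "(\<lambda>_. w) \<in> M \<rightarrow>\<^sub>M PS" for M :: "'x measure" using w by simp
  interpret B: bounded_rate "\<lambda>s. ennreal (b (path_at w s))" bs by (rule bounded_rate_path[OF w])
  have h_meas [measurable (raw)]: "(\<lambda>z. h (f z) (g z)) \<in> borel_measurable M"
    if "f \<in> borel_measurable M" "g \<in> borel_measurable M" for f g and M :: "'x measure"
    using measurable_compose[OF measurable_Pair[OF that] measurable_h] by simp
  define live where "live a \<longleftrightarrow> cumulated d w a < ennreal e" for a
  have [measurable]: "Measurable.pred borel live" unfolding live_def by measurable
  define \<psi> where "\<psi> z = (let a = real_of_ereal (B.\<tau> z) in
      if B.\<tau> z \<le> ereal t \<and> live a then h (t - a) (path_at w a) else 1)" for z
  have [measurable]: "\<psi> \<in> borel_measurable borel" unfolding \<psi>_def Let_def by measurable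
  have ta: "0 \<le> t - real_of_ereal (B.\<tau> z)" if "B.\<tau> z \<le> ereal t" for z
    using that B.\<tau>_nonneg[of z] by (cases "B.\<tau> z") auto
  interpret PP: poisson_product \<psi> "enn2real (B.F t)"
  proof
    show "\<psi> z \<le> 1" for z using ta by (auto simp: \<psi>_def Let_def h_le_1)
    show "\<psi> z = 1" if "enn2real (B.F t) < z" for z
    proof -
      have "B.F t < ennreal z"
        using that B.F_finite[of t] by (cases "B.F t") (auto simp: ennreal_less_iff)
      then have "\<not> B.\<tau> z \<le> ereal t" using B.\<tau>_le_iff[OF t, of z] by simp
      then show ?thesis by (simp add: \<psi>_def Let_def)
    qed
  qed auto
  have "child h t (w, e, g) k = \<psi> (\<Sum>j\<le>k. g j)" for g k
    unfolding child_def \<psi>_def birth_age_\<tau>[OF w] live_def alive_at_age_alt fst_conv snd_conv ..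
  then have "(\<integral>\<^sup>+g. (INF j. \<Prod>k<j. child h t (w, e, g) k) \<partial>PE) =
      exp_neg (\<integral>\<^sup>+z. (1 - \<psi> z) * indicator {0<..} z \<partial>lborel)"
    using PP.expectation by simp
  also have "(\<integral>\<^sup>+z. (1 - \<psi> z) * indicator {0<..} z \<partial>lborel) =
    (\<integral>\<^sup>+z. (if 0 < z \<and> B.\<tau> z \<le> ereal t then u (t - real_of_ereal (B.\<tau> z)) (path_at w (real_of_ereal (B.\<tau> z))) *
        of_bool (live (real_of_ereal (B.\<tau> z))) else 0) \<partial>lborel)"
    using ta by (intro nn_integral_cong) (auto simp: \<psi>_def Let_def u_def split: split_indicator)
  also have "\<dots> = (\<integral>\<^sup>+a\<in>{0..t}. ennreal (b (path_at w a)) * (u (t - a) (path_at w a) * of_bool (live a)) \<partial>lborel)"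
  proof (rule B.time_change[OF _ t])
    have "(\<lambda>a. if 0 \<le> t - a then (1 - h (t - a) (path_at w a)) * of_bool (live a) else 0) \<in> borel_measurable borel"
      by measurable
    also have "(\<lambda>a. if 0 \<le> t - a then (1 - h (t - a) (path_at w a)) * of_bool (live a) else 0) =
        (\<lambda>a. u (t - a) (path_at w a) * of_bool (live a))"
      by (auto simp: u_def fun_eq_iff)
    finally show "(\<lambda>a. u (t - a) (path_at w a) * of_bool (live a)) \<in> borel_measurable borel" .
  qed
  finally show ?thesis by (simp add: \<beta>_def live_def mult.assoc)
qed

text \<open>For a fixed clock \<open>e\<close>, \<open>exp_forward\<close> with the rate
  \<open>\<beta>\<close> cut off at death says that no relevant birth occurs or there is a first
  one. Averaging over \<open>e\<close> replaces survival to age \<open>a\<close> by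
  \<open>exp_neg (cumulated d w a)\<close> and produces the two terms of \<open>J\<close>.\<close>

lemma conditional_identity:
  assumes w: "w \<in> D" and t: "0 \<le> t"
  shows "(\<integral>\<^sup>+e. \<integral>\<^sup>+g. own \<phi> t (w, e, g) * (INF j. \<Prod>k<j. child h t (w, e, g) k) \<partial>PE \<partial>exp1) +
    J u (\<lambda>y. 1 - \<phi> y) t w = 1"
proof -
  interpret E: prob_space exp1 by (rule prob_exp1)
  interpret pair_sigma_finite lborel exp1 ..
  have [measurable]: "(\<lambda>_. w) \<in> M \<rightarrow>\<^sub>M PS" for M :: "'x measure" using w by simp
  note measurable_\<beta>[OF measurable_u, measurable (raw)]
  note \<beta>_le' = \<beta>_le[OF measurable_u u_le_1 _ _, of "\<lambda>_. 0"]
  define live where "live e a \<longleftrightarrow> cumulated d w a < ennreal e" for e a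
  have live_mono: "live e a" if "live e a'" "a \<le> a'" for e a a'
  proof -
    have "cumulated d w a \<le> cumulated d w a'"
      unfolding cumulated_def using that(2) by (intro nn_integral_mono) (auto split: split_indicator)
    then show ?thesis using that(1) by (simp add: live_def)
  qed
  have live_meas [measurable]: "Measurable.pred M (\<lambda>z. live (f z) (g z))"
    if [measurable]: "f \<in> borel_measurable M" "g \<in> borel_measurable M" for f g and M :: "'x measure"
    unfolding live_def by measurable
  define B where "B a = (\<integral>\<^sup>+s\<in>{0..a}. \<beta> u t s w \<partial>lborel)" for a
  have [measurable]: "B \<in> borel_measurable borel"
    unfolding B_def by (rule measurable_interval_nn_integral) measurable
  define BL where "BL e a = (\<integral>\<^sup>+s\<in>{0..a}. \<beta> u t s w * of_bool (live e s) \<partial>lborel)" for e a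
  have BL_meas [measurable]: "(\<lambda>z. BL (f z) (g z)) \<in> borel_measurable M"
    if [measurable]: "f \<in> borel_measurable M" "g \<in> borel_measurable M" for f g and M :: "'x measure"
    unfolding BL_def by (rule measurable_interval_nn_integral) measurable
  have \<beta>L: "bounded_rate (\<lambda>s. \<beta> u t s w * of_bool (live e s)) bs" for e
  proof
    show "\<beta> u t s w * of_bool (live e s) \<le> ennreal bs" for s
      using \<beta>_le' by (cases "live e s") auto
  qed (auto simp: bs_nonneg)
  \<comment> \<open>Being alive at age \<open>a\<close> implies being alive at all earlier ages, so
    up to then the cut-off has no effect.\<close>
  have BL_eq: "BL e a = B a" if "live e a" for e a
    unfolding BL_def B_def using live_mono[OF that]
    by (intro nn_integral_cong) (auto split: split_indicator)
  define ow where "ow e = (if live e t then \<phi> (path_at w t) else 1)" for e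
  define v where "v = 1 - \<phi> (path_at w t)"
  have \<phi>v: "\<phi> (path_at w t) + v = 1"
    unfolding v_def using \<phi>_le by (simp add: add_diff_inverse_ennreal)
  have key: "ow e * exp_neg (BL e t) + (of_bool (live e t) * (exp_neg (B t) * v) +
      (\<integral>\<^sup>+a\<in>{0..t}. \<beta> u t a w * exp_neg (B a) * of_bool (live e a) \<partial>lborel)) = 1" for e
  proof -
    have "exp_neg (BL e t) + (\<integral>\<^sup>+a\<in>{0..t}. \<beta> u t a w * of_bool (live e a) * exp_neg (BL e a) \<partial>lborel) = 1"
      using bounded_rate.exp_forward[OF \<beta>L t] unfolding BL_def bounded_rate.F_def[OF \<beta>L] .
    moreover have "(\<integral>\<^sup>+a\<in>{0..t}. \<beta> u t a w * of_bool (live e a) * exp_neg (BL e a) \<partial>lborel) =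
        (\<integral>\<^sup>+a\<in>{0..t}. \<beta> u t a w * exp_neg (B a) * of_bool (live e a) \<partial>lborel)"
      using BL_eq by (intro nn_integral_cong) (auto split: split_indicator)
    ultimately have *: "exp_neg (BL e t) + (\<integral>\<^sup>+a\<in>{0..t}. \<beta> u t a w * exp_neg (B a) * of_bool (live e a) \<partial>lborel) = 1"
      by simp
    show ?thesis
    proof (cases "live e t")
      case True
      have "\<phi> (path_at w t) * exp_neg (B t) + exp_neg (B t) * v = exp_neg (B t)"
        using \<phi>v by (metis distrib_left mult.commute mult.right_neutral)
      then show ?thesis using * True BL_eq[OF True] by (simp add: ow_def add.assoc[symmetric])
    next
      case False
      then show ?thesis using * by (simp add: ow_def)
    qed
  qed
  have emL: "(\<integral>\<^sup>+e. of_bool (live e a) \<partial>exp1) = exp_neg (cumulated d w a)" for a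
  proof -
    have "(\<integral>\<^sup>+e. of_bool (live e a) \<partial>exp1) = (\<integral>\<^sup>+e. indicator {e. cumulated d w a < ennreal e} e \<partial>exp1)"
      by (intro nn_integral_cong) (auto simp: live_def)
    also have "\<dots> = emeasure exp1 {e. cumulated d w a < ennreal e}"
      by (rule nn_integral_indicator) simp
    finally show ?thesis by (simp add: emeasure_exp1_greater)
  qed
  have dB: "exp_neg (\<integral>\<^sup>+s\<in>{0..a}. (\<delta> s w + \<beta> u t s w) \<partial>lborel) = exp_neg (cumulated d w a) * exp_neg (B a)" for a
    unfolding B_def cumulated_path_at \<delta>_def exp_neg_add[symmetric]
    by (subst nn_integral_add[symmetric]) (auto simp: distrib_right)
  have J: "J u (\<lambda>y. 1 - \<phi> y) t w = (\<integral>\<^sup>+e. of_bool (live e t) * (exp_neg (B t) * v) +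
      (\<integral>\<^sup>+a\<in>{0..t}. \<beta> u t a w * exp_neg (B a) * of_bool (live e a) \<partial>lborel) \<partial>exp1)"
  proof -
    have "(\<integral>\<^sup>+e. of_bool (live e t) * (exp_neg (B t) * v) \<partial>exp1) =
        exp_neg (\<integral>\<^sup>+s\<in>{0..t}. (\<delta> s w + \<beta> u t s w) \<partial>lborel) * (1 - \<phi> (path_at w t))"
      by (subst nn_integral_multc) (auto simp: emL dB v_def mult.assoc)
    moreover have "(\<integral>\<^sup>+e. (\<integral>\<^sup>+a\<in>{0..t}. \<beta> u t a w * exp_neg (B a) * of_bool (live e a) \<partial>lborel) \<partial>exp1) =
        (\<integral>\<^sup>+a. (\<integral>\<^sup>+e. \<beta> u t a w * exp_neg (B a) * of_bool (live e a) * indicator {0..t} a \<partial>exp1) \<partial>lborel)"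
      by (rule Fubini'[of "\<lambda>a e. \<beta> u t a w * exp_neg (B a) * of_bool (live e a) * indicator {0..t} a"])
         (simp add: split_beta')
    moreover have "\<dots> = (\<integral>\<^sup>+a\<in>{0..t}. \<beta> u t a w * exp_neg (\<integral>\<^sup>+s\<in>{0..a}. (\<delta> s w + \<beta> u t s w) \<partial>lborel) \<partial>lborel)"
    proof (intro nn_integral_cong)
      fix a
      have "(\<integral>\<^sup>+e. \<beta> u t a w * exp_neg (B a) * of_bool (live e a) * indicator {0..t} a \<partial>exp1) =
          (\<integral>\<^sup>+e. (\<beta> u t a w * exp_neg (B a) * indicator {0..t} a) * of_bool (live e a) \<partial>exp1)"
        by (simp add: mult_ac)
      also have "\<dots> = \<beta> u t a w * exp_neg (B a) * indicator {0..t} a * exp_neg (cumulated d w a)"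
        by (subst nn_integral_cmult) (auto simp: emL)
      finally show "(\<integral>\<^sup>+e. \<beta> u t a w * exp_neg (B a) * of_bool (live e a) * indicator {0..t} a \<partial>exp1) =
          \<beta> u t a w * exp_neg (\<integral>\<^sup>+s\<in>{0..a}. (\<delta> s w + \<beta> u t s w) \<partial>lborel) * indicator {0..t} a"
        unfolding dB by (simp only: mult_ac)
    qed
    moreover have "(\<lambda>e. \<integral>\<^sup>+a\<in>{0..t}. \<beta> u t a w * exp_neg (B a) * of_bool (live e a) \<partial>lborel) \<in> borel_measurable exp1"
      by (rule measurable_interval_nn_integral) measurable
    ultimately show ?thesis
      unfolding J_def by (subst nn_integral_add) auto
  qed
  have "(\<integral>\<^sup>+g. own \<phi> t (w, e, g) * (INF j. \<Prod>k<j. child h t (w, e, g) k) \<partial>PE) = ow e * exp_neg (BL e t)" for e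
  proof -
    have wm: "(\<lambda>g. (w, e, g)) \<in> PE \<rightarrow>\<^sub>M mark_space D"
      unfolding mark_space_def measurable_cong_sets[OF sets_PE refl]
      by measurable
    have "(\<lambda>g. (INF j. \<Prod>k<j. child h t (w, e, g) k)) \<in> borel_measurable PE"
      by (intro borel_measurable_INF borel_measurable_prod_ennreal measurable_child[OF measurable_h] wm) auto
    moreover have "own \<phi> t (w, e, g) = ow e" for g
      by (simp add: own_def ow_def live_def alive_at_age_alt)
    ultimately show ?thesis
      using integral_gaps[OF w t, of e] by (simp add: nn_integral_cmult BL_def live_def)
  qed
  then have "(\<integral>\<^sup>+e. \<integral>\<^sup>+g. own \<phi> t (w, e, g) * (INF j. \<Prod>k<j. child h t (w, e, g) k) \<partial>PE \<partial>exp1) +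
      J u (\<lambda>y. 1 - \<phi> y) t w = (\<integral>\<^sup>+e. ow e * exp_neg (BL e t) \<partial>exp1) +
      (\<integral>\<^sup>+e. of_bool (live e t) * (exp_neg (B t) * v) +
      (\<integral>\<^sup>+a\<in>{0..t}. \<beta> u t a w * exp_neg (B a) * of_bool (live e a) \<partial>lborel) \<partial>exp1)"
    unfolding J by presburger
  also have "\<dots> = (\<integral>\<^sup>+e. ow e * exp_neg (BL e t) + (of_bool (live e t) * (exp_neg (B t) * v) +
      (\<integral>\<^sup>+a\<in>{0..t}. \<beta> u t a w * exp_neg (B a) * of_bool (live e a) \<partial>lborel)) \<partial>exp1)"
  proof (rule nn_integral_add[symmetric])
    have [measurable]: "(\<lambda>e. \<integral>\<^sup>+a\<in>{0..t}. \<beta> u t a w * exp_neg (B a) * of_bool (live e a) \<partial>lborel) \<in> borel_measurable exp1"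
      by (rule measurable_interval_nn_integral) measurable
    show "(\<lambda>e. of_bool (live e t) * (exp_neg (B t) * v) +
      (\<integral>\<^sup>+a\<in>{0..t}. \<beta> u t a w * exp_neg (B a) * of_bool (live e a) \<partial>lborel)) \<in> borel_measurable exp1"
      by measurable
    show "(\<lambda>e. ow e * exp_neg (BL e t)) \<in> borel_measurable exp1"
      unfolding ow_def by measurable
  qed
  also have "\<dots> = (\<integral>\<^sup>+e. 1 \<partial>exp1)"
    by (intro nn_integral_cong key)
  finally have "(\<integral>\<^sup>+e. \<integral>\<^sup>+g. own \<phi> t (w, e, g) * (INF j. \<Prod>k<j. child h t (w, e, g) k) \<partial>PE \<partial>exp1) +
      J u (\<lambda>y. 1 - \<phi> y) t w = (\<integral>\<^sup>+e. 1 \<partial>exp1)" .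
  then show ?thesis using E.emeasure_space_1 by simp
qed

text \<open>Average \<open>conditional_identity\<close> over the path; \<open>h_fixed_point\<close>
  identifies the first term with \<open>h\<close>.\<close>

lemma u_eq_J:
  assumes t: "0 \<le> t"
  shows "u t y = (\<integral>\<^sup>+w. J u (\<lambda>y. 1 - \<phi> y) t w \<partial>P y)"
proof -
  interpret PY: prob_space "P y" by (rule P_prob)
  have m: "(\<lambda>m. own \<phi> t m * (INF j. \<Prod>k<j. child h t m k)) \<in> borel_measurable (mark_space D)"
    by (intro borel_measurable_times_ennreal borel_measurable_INF borel_measurable_prod_ennreal
        measurable_child[OF measurable_h] measurable_own) auto
  define N where "N w = (\<integral>\<^sup>+e. \<integral>\<^sup>+g. own \<phi> t (w, e, g) * (INF j. \<Prod>k<j. child h t (w, e, g) k) \<partial>PE \<partial>exp1)" for w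
  have JN: "N w + J u (\<lambda>y. 1 - \<phi> y) t w = 1" if "w \<in> D" for w
    unfolding N_def by (rule conditional_identity[OF that t])
  have [measurable]: "(\<lambda>w. J u (\<lambda>y. 1 - \<phi> y) t w) \<in> borel_measurable (P y)"
    by (simp add: measurable_J[OF measurable_u])
  have "N w = 1 - J u (\<lambda>y. 1 - \<phi> y) t w" if "w \<in> D" for w
    using JN[OF that] by (metis add.commute ennreal_add_diff_cancel_left ennreal_add_eq_top ennreal_one_neq_top)
  then have [measurable]: "N \<in> borel_measurable (P y)"
    by (subst measurable_cong[of _ _ "\<lambda>w. 1 - J u (\<lambda>y. 1 - \<phi> y) t w"]) auto
  have "h t y + (\<integral>\<^sup>+w. J u (\<lambda>y. 1 - \<phi> y) t w \<partial>P y) = (\<integral>\<^sup>+w. N w + J u (\<lambda>y. 1 - \<phi> y) t w \<partial>P y)"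
    unfolding h_fixed_point[OF t] nn_integral_mark_law[OF m] N_def[symmetric]
    by (rule nn_integral_add[symmetric]) auto
  also have "\<dots> = (\<integral>\<^sup>+w. 1 \<partial>P y)"
    by (intro nn_integral_cong JN) simp
  also have "\<dots> = 1" using PY.emeasure_space_1 by simp
  finally have "h t y + (\<integral>\<^sup>+w. J u (\<lambda>y. 1 - \<phi> y) t w \<partial>P y) = 1" .
  then show ?thesis
    using t by (metis u_def ennreal_add_diff_cancel_left ennreal_add_eq_top ennreal_one_neq_top)
qed

theorem u_mild:
  assumes t: "0 \<le> t"
  shows "u t x + (\<integral>\<^sup>+r\<in>{0..t}. Sn r (\<lambda>y. ennreal (b y) * (u (t - r) y)\<^sup>2) x \<partial>lborel) =
    Sn t (\<lambda>y. 1 - \<phi> y) x"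
  by (rule mild_equation[OF measurable_u u_le_1 _ _ u_eq_J t]) auto

end

section \<open>Mild solutions in the critical case\<close>

text \<open>Compact sets are reached by continuous functions decreasing to their indicator, Borel
  sets by inner regularity, bounded functions by their level sets. This will extend the spectral gap
  from continuous to Borel functions.\<close>

lemma finite_measures_close:
  fixes \<kappa> \<rho> :: "real measure" and \<delta> c :: real
  assumes "finite_measure \<kappa>" "finite_measure \<rho>" and s: "sets \<kappa> = sets borel" "sets \<rho> = sets borel"
    and cont: "\<And>g. continuous_on UNIV g \<Longrightarrow> (\<And>y. 0 \<le> g y \<and> g y \<le> 1) \<Longrightarrow> \<bar>(\<integral>y. g y \<partial>\<kappa>) - (\<integral>y. g y \<partial>\<rho>)\<bar> \<le> \<delta>"
    and f: "f \<in> borel_measurable borel" "\<And>y. 0 \<le> f y" "\<And>y. f y \<le> c"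
  shows "\<bar>(\<integral>y. f y \<partial>\<kappa>) - (\<integral>y. f y \<partial>\<rho>)\<bar> \<le> c * \<delta>"
proof -
  interpret K: finite_measure \<kappa> by fact
  interpret R: finite_measure \<rho> by fact
  note [measurable_cong] = s
  have "\<bar>(\<integral>y. (0::real) \<partial>\<kappa>) - (\<integral>y. (0::real) \<partial>\<rho>)\<bar> \<le> \<delta>" by (rule cont) auto
  then have \<delta>: "0 \<le> \<delta>" by simp
  have compact: "\<bar>measure \<kappa> C - measure \<rho> C\<bar> \<le> \<delta>" if C: "compact C" for C
  proof (cases "C = {}")
    case False
    have cl: "closed C" using C by (rule compact_imp_closed)
    have [measurable]: "C \<in> sets borel" using cl by simp
    define g where "g n y = max 0 (1 - real n * infdist y C)" for n y
    have gc: "continuous_on UNIV (g n)" for n unfolding g_def by (intro continuous_intros)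
    have g01: "0 \<le> g n y \<and> g n y \<le> 1" for n y by (simp add: g_def infdist_nonneg)
    have lim: "(\<lambda>n. g n y) \<longlonglongrightarrow> indicator C y" for y
    proof (cases "y \<in> C")
      case True
      then show ?thesis by (simp add: g_def)
    next
      case out: False
      then have pos: "0 < infdist y C"
        using in_closed_iff_infdist_zero[OF cl False] infdist_nonneg[of y C] by (metis order_less_le)
      obtain N where N: "1 / infdist y C \<le> real N" using real_arch_simple by blast
      have "eventually (\<lambda>n. g n y = indicator C y) sequentially"
      proof (rule eventually_sequentiallyI[of N])
        fix n assume "N \<le> n"
        then have "1 / infdist y C \<le> real n" using N by simp
        then have "1 \<le> real n * infdist y C" using pos by (simp add: divide_le_eq)
        then show "g n y = indicator C y" using out by (simp add: g_def)
      qed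
      then show ?thesis by (rule tendsto_eventually)
    qed
    have dct: "(\<lambda>n. \<integral>y. g n y \<partial>M) \<longlonglongrightarrow> measure M C" if M: "finite_measure M" "sets M = sets borel" for M :: "real measure"
    proof -
      interpret M: finite_measure M by fact
      note [measurable_cong] = M(2)
      have [measurable]: "g n \<in> borel_measurable borel" for n by (rule borel_measurable_continuous_onI[OF gc])
      have "(\<lambda>n. \<integral>y. g n y \<partial>M) \<longlonglongrightarrow> (\<integral>y. indicator C y \<partial>M)"
        by (rule integral_dominated_convergence[where w="\<lambda>_. 1"]) (use lim g01 in auto)
      then show ?thesis using sets_eq_imp_space_eq[OF M(2)] by simp
    qed
    have "(\<lambda>n. \<bar>(\<integral>y. g n y \<partial>\<kappa>) - (\<integral>y. g n y \<partial>\<rho>)\<bar>) \<longlonglongrightarrow> \<bar>measure \<kappa> C - measure \<rho> C\<bar>"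
      by (intro tendsto_intros dct assms)
    then show ?thesis
      by (rule LIMSEQ_le_const2) (use cont[OF gc g01] in auto)
  qed (use \<delta> in simp)
  have set: "\<bar>measure \<kappa> A - measure \<rho> A\<bar> \<le> \<delta>" if A [measurable]: "A \<in> sets borel" for A
  proof (rule field_le_epsilon)
    fix e :: real assume e: "0 < e"
    have approx: "\<exists>C. compact C \<and> C \<subseteq> A \<and> measure M A - e / 2 < measure M C"
      if M: "finite_measure M" "sets M = sets borel" for M :: "real measure"
    proof -
      interpret M: finite_measure M by fact
      have "\<exists>C\<in>{C. C \<subseteq> A \<and> compact C}. emeasure M A < emeasure M C + ennreal (e / 2)"
      proof (rule SUP_approx_ennreal)
        show "emeasure M A = (SUP C \<in> {C. C \<subseteq> A \<and> compact C}. emeasure M C)"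
          using M(2) A by (intro inner_regular) auto
        show "{C. C \<subseteq> A \<and> compact C} \<noteq> {}" by (auto intro: exI[of _ "{}"])
      qed (use e in \<open>auto simp: M.emeasure_eq_measure\<close>)
      then obtain C where C: "C \<subseteq> A" "compact C" "emeasure M A < emeasure M C + ennreal (e / 2)"
        by auto
      then have "measure M A < measure M C + e / 2"
        using e by (simp add: M.emeasure_eq_measure ennreal_less_iff flip: ennreal_plus)
      then show ?thesis using C by (intro exI[of _ C]) auto
    qed
    obtain C1 where C1: "compact C1" "C1 \<subseteq> A" "measure \<kappa> A - e / 2 < measure \<kappa> C1"
      using approx[OF assms(1) s(1)] by blast
    obtain C2 where C2: "compact C2" "C2 \<subseteq> A" "measure \<rho> A - e / 2 < measure \<rho> C2"
      using approx[OF assms(2) s(2)] by blast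
    have [measurable]: "C1 \<in> sets borel" "C2 \<in> sets borel"
      using C1 C2 by (auto intro: borel_compact)
    \<comment> \<open>The union of the two compact sets approximates \<open>A\<close> from inside
      for both measures at once.\<close>
    have "measure \<kappa> C1 \<le> measure \<kappa> (C1 \<union> C2)" "measure \<kappa> (C1 \<union> C2) \<le> measure \<kappa> A"
      "measure \<rho> C2 \<le> measure \<rho> (C1 \<union> C2)" "measure \<rho> (C1 \<union> C2) \<le> measure \<rho> A"
      using C1 C2 by (auto intro!: K.finite_measure_mono R.finite_measure_mono)
    then show "\<bar>measure \<kappa> A - measure \<rho> A\<bar> \<le> \<delta> + e"
      using compact[OF compact_Un[OF C1(1) C2(1)]] C1 C2 by linarith
  qed
  note f(1)[measurable]
  have c: "0 \<le> c" using f(2)[of 0] f(3)[of 0] by simp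
  have bnd: "\<bar>(\<integral>y. f y \<partial>\<kappa>) - (\<integral>y. f y \<partial>\<rho>)\<bar> \<le> c * \<delta> + c * (measure \<kappa> UNIV + measure \<rho> UNIV) / real N"
    if N: "0 < N" for N :: nat
  proof (cases "c = 0")
    case True
    then have "f y = 0" for y using f(2)[of y] f(3)[of y] by simp
    then show ?thesis using True by simp
  next
    case False
    then have c: "0 < c" using c by simp
    \<comment> \<open>Staircase below \<open>f\<close>: equal weights \<open>c / N\<close> on
      \<open>N\<close> level sets, so a bound \<open>\<delta>\<close> for each set sums to
      \<open>c * \<delta>\<close> without loss.\<close>
    define A where "A i = {y. c * real (Suc i) / real N \<le> f y}" for i
    have [measurable]: "A i \<in> sets borel" for i unfolding A_def by measurable
    define fN where "fN y = (\<Sum>i<N. c / real N * indicator (A i) y)" for y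
    have fN: "\<bar>f y - fN y\<bar> \<le> c / real N" for y
    proof -
      define j where "j = nat \<lfloor>f y * real N / c\<rfloor>"
      have q: "0 \<le> f y * real N / c" using f(2)[of y] c by simp
      have j: "real j \<le> f y * real N / c" "f y * real N / c < real j + 1"
        using q unfolding j_def by linarith+
      have "f y * real N / c \<le> real N" using mult_right_mono[OF f(3)[of y], of "real N"] c by (simp add: divide_le_eq mult.commute)
      then have jN: "j \<le> N" using j by linarith
      have "y \<in> A i \<longleftrightarrow> i < j" for i
      proof -
        have "y \<in> A i \<longleftrightarrow> real (Suc i) \<le> f y * real N / c"
          using c N by (simp add: A_def field_simps)
        also have "\<dots> \<longleftrightarrow> i < j"
        proof
          assume "real (Suc i) \<le> f y * real N / c"
          then have "real (Suc i) < real j + 1" using j by linarith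
          then show "i < j" by linarith
        next
          assume "i < j"
          then have "real (Suc i) \<le> real j" by linarith
          then show "real (Suc i) \<le> f y * real N / c" using j by linarith
        qed
        finally show ?thesis .
      qed
      then have "fN y = (\<Sum>i<N. if i < j then c / real N else 0)"
        unfolding fN_def by (intro sum.cong) (auto simp: indicator_def)
      also have "\<dots> = (\<Sum>i<j. c / real N)"
        using jN by (intro sum.mono_neutral_cong_right) auto
      finally have "fN y = real j * (c / real N)" by simp
      moreover have "real j * (c / real N) \<le> f y" using j(1) c N by (simp add: field_simps)
      moreover have "f y < real j * (c / real N) + c / real N" using j(2) c N by (simp add: field_simps)
      ultimately show ?thesis by linarith
    qed
    have int: "integrable M f" "integrable M fN" "(\<integral>y. fN y \<partial>M) = (\<Sum>i<N. c / real N * measure M (A i))"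
      "\<bar>(\<integral>y. f y \<partial>M) - (\<integral>y. fN y \<partial>M)\<bar> \<le> c / real N * measure M UNIV"
      if M: "finite_measure M" "sets M = sets borel" for M :: "real measure"
    proof -
      interpret M: finite_measure M by fact
      note [measurable_cong] = M(2)
      have sp: "space M = UNIV" using sets_eq_imp_space_eq[OF M(2)] by simp
      show i1: "integrable M f"
        by (rule M.integrable_const_bound[of _ c]) (use f in \<open>auto simp: abs_of_nonneg\<close>)
      show i2: "integrable M fN"
        unfolding fN_def by (intro Bochner_Integration.integrable_sum integrable_mult_right integrable_real_indicator)
           (auto simp: M.emeasure_eq_measure)
      show "(\<integral>y. fN y \<partial>M) = (\<Sum>i<N. c / real N * measure M (A i))"
        unfolding fN_def
        by (subst Bochner_Integration.integral_sum)
           (auto simp: sp M.emeasure_eq_measure intro!: integrable_mult_right integrable_real_indicator)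
      have "\<bar>(\<integral>y. f y \<partial>M) - (\<integral>y. fN y \<partial>M)\<bar> = \<bar>\<integral>y. f y - fN y \<partial>M\<bar>"
        using i1 i2 by simp
      also have "\<dots> \<le> (\<integral>y. \<bar>f y - fN y\<bar> \<partial>M)" by (rule integral_abs_bound)
      also have "\<dots> \<le> (\<integral>y. c / real N \<partial>M)"
        using i1 i2 fN by (intro integral_mono) auto
      finally show "\<bar>(\<integral>y. f y \<partial>M) - (\<integral>y. fN y \<partial>M)\<bar> \<le> c / real N * measure M UNIV"
        by (simp add: sp mult.commute)
    qed
    have "\<bar>(\<integral>y. fN y \<partial>\<kappa>) - (\<integral>y. fN y \<partial>\<rho>)\<bar> = \<bar>\<Sum>i<N. c / real N * (measure \<kappa> (A i) - measure \<rho> (A i))\<bar>"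
      using int(3)[OF assms(1) s(1)] int(3)[OF assms(2) s(2)] by (simp add: right_diff_distrib sum_subtractf)
    also have "\<dots> \<le> (\<Sum>i<N. \<bar>c / real N * (measure \<kappa> (A i) - measure \<rho> (A i))\<bar>)" by (rule sum_abs)
    also have "\<dots> \<le> (\<Sum>i<N. c / real N * \<delta>)"
      using c set by (intro sum_mono) (simp add: abs_mult mult_left_mono divide_right_mono)
    also have "\<dots> = c * \<delta>" using N by simp
    finally have m: "\<bar>(\<integral>y. fN y \<partial>\<kappa>) - (\<integral>y. fN y \<partial>\<rho>)\<bar> \<le> c * \<delta>" .
    have "c / real N * measure \<kappa> UNIV + c / real N * measure \<rho> UNIV =
        c * (measure \<kappa> UNIV + measure \<rho> UNIV) / real N"
      by (simp add: add_divide_distrib distrib_left)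
    then show ?thesis using m int(4)[OF assms(1) s(1)] int(4)[OF assms(2) s(2)] by linarith
  qed
  have "(\<lambda>N. c * \<delta> + c * (measure \<kappa> UNIV + measure \<rho> UNIV) / real N) \<longlonglongrightarrow> c * \<delta> + 0"
    by (intro tendsto_add tendsto_const) (rule lim_const_over_n)
  then show ?thesis
    using bnd by (intro LIMSEQ_le_const[where X="\<lambda>N. c * \<delta> + c * (measure \<kappa> UNIV + measure \<rho> UNIV) / real N"])
      (auto intro!: exI[of _ 1])
qed

text \<open>Work in the supremum norm weighted by \<open>exp (- 2 L s)\<close>, in which the
  integral term contributes at most half of the norm. This asks only for measurability and
  boundedness of \<open>\<phi>\<close>, at the price of the factors 2 in the bound.\<close>

lemma gronwall:
  fixes \<phi> :: "real \<Rightarrow> real" and T M L \<delta> t :: real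
  assumes [measurable]: "\<phi> \<in> borel_measurable borel" and M: "\<And>t. 0 \<le> t \<Longrightarrow> t \<le> T \<Longrightarrow> 0 \<le> \<phi> t \<and> \<phi> t \<le> M"
    and L: "0 < L"
    and le: "\<And>t. 0 \<le> t \<Longrightarrow> t \<le> T \<Longrightarrow> \<phi> t \<le> \<delta> + L * (LBINT s:{0..t}. \<phi> s)"
    and t: "0 \<le> t" "t \<le> T"
  shows "\<phi> t \<le> 2 * \<delta> * exp (2 * L * t)"
proof -
  define W where "W = (SUP s\<in>{0..T}. \<phi> s * exp (- (2 * L * s)))"
  have bdd: "bdd_above ((\<lambda>s. \<phi> s * exp (- (2 * L * s))) ` {0..T})"
  proof (rule bdd_aboveI2)
    fix s assume s: "s \<in> {0..T}"
    have "\<phi> s * exp (- (2 * L * s)) \<le> M * 1"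
      using M[of s] s L by (intro mult_mono) auto
    then show "\<phi> s * exp (- (2 * L * s)) \<le> M" by simp
  qed
  have W: "\<phi> s \<le> W * exp (2 * L * s)" if "0 \<le> s" "s \<le> T" for s
  proof -
    have "\<phi> s * exp (- (2 * L * s)) \<le> W"
      unfolding W_def using that by (intro cSUP_upper bdd) auto
    then have "\<phi> s * exp (- (2 * L * s)) * exp (2 * L * s) \<le> W * exp (2 * L * s)"
      by (rule mult_right_mono) simp
    then show ?thesis by (simp add: exp_minus field_simps)
  qed
  have W0: "0 \<le> W" using W[of t] M[OF t] t by (metis exp_gt_zero order_trans zero_le_mult_iff not_less)
  have "W \<le> \<delta> + W / 2"
    unfolding W_def
  proof (rule cSUP_least)
    show "{0..T} \<noteq> {}" using t by auto
    fix s assume s: "s \<in> {0..T}"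
    have i1: "set_integrable lborel {0..s} \<phi>"
      unfolding set_integrable_def
    proof (rule integrableI_bounded_set_indicator[where B=M])
      show "AE x in lborel. x \<in> {0..s} \<longrightarrow> norm (\<phi> x) \<le> M" using M s by auto
    qed (auto simp: emeasure_lborel_Icc_eq)
    have "((\<lambda>q. W * exp (2 * L * q)) has_integral (W * exp (2 * L * s) / (2 * L) - W * exp (2 * L * 0) / (2 * L))) {0..s}"
      using s L by (intro fundamental_theorem_of_calculus)
        (auto intro!: derivative_eq_intros simp flip: has_real_derivative_iff_has_vector_derivative)
    moreover have i2: "set_integrable lborel {0..s} (\<lambda>q. W * exp (2 * L * q))"
      by (intro borel_integrable_atLeastAtMost' continuous_intros)
    ultimately have eq: "(LBINT q:{0..s}. W * exp (2 * L * q)) = W * exp (2 * L * s) / (2 * L) - W * exp (2 * L * 0) / (2 * L)"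
      by (metis set_borel_integral_eq_integral(2) integral_unique)
    have "\<phi> s \<le> \<delta> + L * (LBINT q:{0..s}. \<phi> q)" using s by (intro le) auto
    also have "(LBINT q:{0..s}. \<phi> q) \<le> (LBINT q:{0..s}. W * exp (2 * L * q))"
      using s W by (intro set_integral_mono i1 i2) auto
    also have "\<dots> \<le> W * exp (2 * L * s) / (2 * L)"
      unfolding eq using W0 L by simp
    finally have "\<phi> s \<le> \<delta> + W * exp (2 * L * s) / 2"
      using L by (simp add: mult_left_mono field_simps)
    then have "\<phi> s * exp (- (2 * L * s)) \<le> (\<delta> + W * exp (2 * L * s) / 2) * exp (- (2 * L * s))"
      by (rule mult_right_mono) simp
    also have "\<dots> = \<delta> * exp (- (2 * L * s)) + W / 2"
      by (simp add: distrib_right exp_minus)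
    also have "\<dots> \<le> \<delta> + W / 2"
    proof -
      have "0 \<le> \<delta>"
      proof -
        have "(LBINT q:{0..0}. \<phi> q) = 0"
          unfolding set_lebesgue_integral_def
          by (rule integral_eq_zero_AE) (use AE_lborel_singleton[of "0::real"] in \<open>eventually_elim, auto split: split_indicator\<close>)
        then show ?thesis using le[of 0] M[of 0] s by auto
      qed
      then have "\<delta> * exp (- (2 * L * s)) \<le> \<delta> * 1" using s L by (intro mult_left_mono) auto
      then show ?thesis by simp
    qed
    finally show "\<phi> s * exp (- (2 * L * s)) \<le> \<delta> + (SUP s\<in>{0..T}. \<phi> s * exp (- (2 * L * s))) / 2"
      unfolding W_def .
  qed
  then have "W \<le> 2 * \<delta>" by simp
  then have "W * exp (2 * L * t) \<le> 2 * \<delta> * exp (2 * L * t)" by (rule mult_right_mono) simp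
  then show ?thesis using W[OF t] by linarith
qed

lemma set_integrable_bounded:
  fixes f :: "real \<Rightarrow> real"
  assumes "f \<in> borel_measurable borel" "\<And>s. s \<in> {p..q} \<Longrightarrow> \<bar>f s\<bar> \<le> c"
  shows "set_integrable lborel {p..q} f"
  unfolding set_integrable_def
  by (rule integrableI_bounded_set_indicator[where B=c])
     (use assms in \<open>auto simp: emeasure_lborel_Icc_eq\<close>)

lemma set_nn_integral_eq_LBINT:
  fixes f :: "real \<Rightarrow> real"
  assumes "f \<in> borel_measurable borel" "\<And>s. s \<in> {p..q} \<Longrightarrow> 0 \<le> f s \<and> f s \<le> c"
  shows "(\<integral>\<^sup>+s\<in>{p..q}. ennreal (f s) \<partial>lborel) = ennreal (LBINT s:{p..q}. f s)"
proof -
  have "set_integrable lborel {p..q} f"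
    using assms by (intro set_integrable_bounded[where c=c]) auto
  then have "(\<integral>\<^sup>+s. ennreal (indicator {p..q} s *\<^sub>R f s) \<partial>lborel) = ennreal (\<integral>s. indicator {p..q} s *\<^sub>R f s \<partial>lborel)"
    unfolding set_integrable_def
    by (rule nn_integral_eq_integral) (use assms(2) in \<open>auto split: split_indicator\<close>)
  moreover have "(\<integral>\<^sup>+s. ennreal (indicator {p..q} s *\<^sub>R f s) \<partial>lborel) = (\<integral>\<^sup>+s\<in>{p..q}. ennreal (f s) \<partial>lborel)"
    by (intro nn_integral_cong) (auto split: split_indicator)
  ultimately show ?thesis by (simp add: set_lebesgue_integral_def)
qed

lemma exp_integral_le:
  fixes l t :: real
  assumes "0 < l" "0 \<le> t"
  shows "(LBINT s:{0..t}. exp (- l * s)) \<le> 1 / l"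
proof -
  define F where "F q = - exp (- l * q) / l" for q :: real
  have "((\<lambda>q. exp (- l * q)) has_integral (F t - F 0)) {0..t}"
    using assms unfolding F_def by (intro fundamental_theorem_of_calculus)
      (auto intro!: derivative_eq_intros simp flip: has_real_derivative_iff_has_vector_derivative)
  moreover have "set_integrable lborel {0..t} (\<lambda>q. exp (- l * q))"
    by (intro borel_integrable_atLeastAtMost' continuous_intros)
  ultimately have "(LBINT s:{0..t}. exp (- l * s)) = F t - F 0"
    by (metis set_borel_integral_eq_integral(2) integral_unique)
  also have "\<dots> = (1 - exp (- l * t)) / l" by (simp add: F_def diff_divide_distrib)
  also have "\<dots> \<le> 1 / l" using assms by (intro divide_right_mono) auto
  finally show ?thesis .
qed

lemma LBINT_reflect:
  fixes f :: "real \<Rightarrow> real"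
  shows "(LBINT r:{0..t}. f (t - r)) = (LBINT q:{0..t}. f q)"
proof -
  have "(\<integral>r. indicator {0..t} r *\<^sub>R f r \<partial>lborel) = \<bar>-1\<bar> *\<^sub>R (\<integral>x. indicator {0..t} (t + (-1) * x) *\<^sub>R f (t + (-1) * x) \<partial>lborel)"
    by (rule lborel_integral_real_affine) simp
  also have "(\<lambda>x. indicator {0..t} (t + (-1) * x) *\<^sub>R f (t + (-1) * x)) = (\<lambda>x. indicator {0..t} x *\<^sub>R f (t - x))"
    by (auto simp: fun_eq_iff split: split_indicator)
  finally show ?thesis by (simp add: set_lebesgue_integral_def)
qed

lemma LBINT_split:
  fixes f :: "real \<Rightarrow> real"
  assumes "f \<in> borel_measurable borel" "\<And>s. \<bar>f s\<bar> \<le> c" "p \<le> q" "q \<le> r"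
  shows "(LBINT s:{p..r}. f s) = (LBINT s:{p..q}. f s) + (LBINT s:{q..r}. f s)"
proof -
  have i: "set_integrable lborel {a..b} f" for a b
    using assms by (intro set_integrable_bounded[where c=c]) auto
  have "(LBINT s:{p..r}. f s) = (\<integral>s. indicator {p..q} s *\<^sub>R f s + indicator {q..r} s *\<^sub>R f s \<partial>lborel)"
    unfolding set_lebesgue_integral_def
    using assms by (intro integral_cong_AE) (use AE_lborel_singleton[of q] in \<open>auto elim!: eventually_mono split: split_indicator\<close>)
  also have "\<dots> = (LBINT s:{p..q}. f s) + (LBINT s:{q..r}. f s)"
    unfolding set_lebesgue_integral_def
    by (rule Bochner_Integration.integral_add) (rule i[unfolded set_integrable_def])+
  finally show ?thesis .
qed

section \<open>Spectral gap and invariant measure\<close>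

locale critical_semigroup = branching_rates D P b d bs + \<mu>: finite_measure \<mu>
  for D :: "(real \<Rightarrow> real) set" and P :: "real \<Rightarrow> (real \<Rightarrow> real) measure"
    and b d :: "real \<Rightarrow> real" and bs :: real and \<mu> :: "real measure" +
  fixes \<Theta> :: "real \<Rightarrow> real" and \<theta>s lam H :: real
  assumes sets_\<mu> [measurable_cong]: "sets \<mu> = sets borel"
    and \<mu>_open: "\<And>U. open U \<Longrightarrow> U \<noteq> {} \<Longrightarrow> 0 < emeasure \<mu> U"
    and \<Theta>_cont: "continuous_on UNIV \<Theta>" and \<Theta>_pos: "\<And>y. 0 < \<Theta> y" and \<Theta>_le: "\<And>y. \<Theta> y \<le> \<theta>s"
    and \<mu>_\<Theta>: "(\<integral>y. \<Theta> y \<partial>\<mu>) = 1"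
    and lam: "0 < lam" and H: "0 < H"
    and gap: "\<And>g t x. g \<in> Cb \<Longrightarrow> 0 \<le> t \<Longrightarrow>
      \<bar>FK P (\<lambda>y. b y - d y) t g x - \<Theta> x * (\<integral>y. g y \<partial>\<mu>)\<bar> \<le> H * sup_norm g * exp (- lam * t)"
    and b_cont: "continuous_on UNIV b" and b_nonzero: "\<exists>y. b y \<noteq> 0"
begin

lemma space_\<mu> [simp]: "space \<mu> = UNIV"
  using sets_eq_imp_space_eq[OF sets_\<mu>] by simp

lemma \<Theta>_meas [measurable]: "\<Theta> \<in> borel_measurable borel"
  by (rule borel_measurable_continuous_onI[OF \<Theta>_cont])

lemma \<theta>s_pos: "0 < \<theta>s"
  using \<Theta>_pos \<Theta>_le by (rule less_le_trans)

text \<open>Solutions of the mild equation are known to be Borel measurable but not continuous, so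
  the analysis runs in this class instead of \<open>Cb\<close>.\<close>

definition bm :: "real \<Rightarrow> (real \<Rightarrow> real) \<Rightarrow> bool" where
  "bm c f \<longleftrightarrow> f \<in> borel_measurable borel \<and> (\<forall>y. 0 \<le> f y \<and> f y \<le> c)"

lemma bm_meas: "bm c f \<Longrightarrow> f \<in> borel_measurable borel"
  by (simp add: bm_def)

lemma bm_bounds: "bm c f \<Longrightarrow> 0 \<le> f y \<and> f y \<le> c"
  by (simp add: bm_def)

lemma bm_nonneg: "bm c f \<Longrightarrow> 0 \<le> c"
  using bm_bounds[of c f 0] by linarith

lemma bm_integrable: "bm c f \<Longrightarrow> integrable \<mu> f"
  using bm_meas[of c f] bm_bounds[of c f]
  by (intro \<mu>.integrable_const_bound[of _ c]) (auto simp: abs_of_nonneg)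

lemma bm_nn_integral: "bm c f \<Longrightarrow> (\<integral>\<^sup>+y. ennreal (f y) \<partial>\<mu>) = ennreal (\<integral>y. f y \<partial>\<mu>)"
  using bm_integrable[of c f] bm_bounds[of c f] by (intro nn_integral_eq_integral) auto

lemma bm_integral_le: "bm c f \<Longrightarrow> (\<integral>y. f y \<partial>\<mu>) \<le> c * measure \<mu> UNIV"
proof -
  assume f: "bm c f"
  have "(\<integral>y. f y \<partial>\<mu>) \<le> (\<integral>y. c \<partial>\<mu>)"
    using bm_integrable[OF f] bm_bounds[OF f] by (intro integral_mono) auto
  then show ?thesis by (simp add: mult.commute)
qed

lemma bm_integral_nonneg: "bm c f \<Longrightarrow> 0 \<le> (\<integral>y. f y \<partial>\<mu>)"
  using bm_bounds[of c f] by (intro integral_nonneg_AE) auto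

lemma bm_\<Theta>: "bm \<theta>s \<Theta>"
  using \<Theta>_pos \<Theta>_le by (auto simp: bm_def less_imp_le)

lemma bm_b: "bm bs b"
  using b_nonneg b_le by (auto simp: bm_def)

lemma bm_mult: "bm c f \<Longrightarrow> bm c' g \<Longrightarrow> bm (c * c') (\<lambda>y. f y * g y)"
  unfolding bm_def by (auto intro!: mult_mono intro: order_trans)

lemma bm_power2: "bm c f \<Longrightarrow> bm (c\<^sup>2) (\<lambda>y. (f y)\<^sup>2)"
  unfolding power2_eq_square by (rule bm_mult)

definition S :: "real \<Rightarrow> (real \<Rightarrow> real) \<Rightarrow> real \<Rightarrow> real" where
  "S t f x = enn2real (Sn t (\<lambda>y. ennreal (f y)) x)"

lemma Sn_bound: "0 \<le> t \<Longrightarrow> bm c f \<Longrightarrow> Sn t (\<lambda>y. ennreal (f y)) x \<le> ennreal (exp (bs * t) * c)"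
  using Sn_le[of t "\<lambda>y. ennreal (f y)" "ennreal c" x] bm_bounds[of c f] bm_nonneg[of c f]
  by (simp add: ennreal_leI ennreal_mult)

lemma Sn_eq: "0 \<le> t \<Longrightarrow> bm c f \<Longrightarrow> Sn t (\<lambda>y. ennreal (f y)) x = ennreal (S t f x)"
proof -
  assume "0 \<le> t" "bm c f"
  then have "Sn t (\<lambda>y. ennreal (f y)) x < \<top>" by (rule le_less_trans[OF Sn_bound]) simp
  then show ?thesis by (simp add: S_def)
qed

lemma S_nonneg: "0 \<le> S t f x"
  by (simp add: S_def)

lemma bm_S: "0 \<le> t \<Longrightarrow> bm c f \<Longrightarrow> bm (exp (bs * t) * c) (S t f)"
proof -
  assume t: "0 \<le> t" and f: "bm c f"
  have [measurable]: "f \<in> borel_measurable borel" by (rule bm_meas[OF f])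
  have "S t f \<in> borel_measurable borel"
    unfolding S_def[abs_def] by (intro borel_measurable_enn2real measurable_Sn) (auto simp: split_beta')
  moreover have "S t f x \<le> exp (bs * t) * c" for x
    using Sn_bound[OF t f, of x] bm_nonneg[OF f] unfolding S_def by (intro enn2real_leI) auto
  ultimately show ?thesis by (auto simp: bm_def S_nonneg)
qed

lemma S_mono: "0 \<le> t \<Longrightarrow> bm c f \<Longrightarrow> bm c' g \<Longrightarrow> (\<And>y. f y \<le> g y) \<Longrightarrow> S t f x \<le> S t g x"
proof -
  assume *: "0 \<le> t" "bm c f" "bm c' g" "\<And>y. f y \<le> g y"
  have "ennreal (S t f x) \<le> ennreal (S t g x)"
    unfolding Sn_eq[OF *(1,2), symmetric] Sn_eq[OF *(1,3), symmetric] using *(4)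
    by (intro Sn_mono ennreal_leI)
  then show ?thesis by (simp add: S_nonneg)
qed

lemma S_cmult: "bm c f \<Longrightarrow> 0 \<le> a \<Longrightarrow> S t (\<lambda>y. a * f y) x = a * S t f x"
proof -
  assume f: "bm c f" and a: "0 \<le> a"
  have [measurable]: "f \<in> borel_measurable borel" by (rule bm_meas[OF f])
  have "Sn t (\<lambda>y. ennreal (a * f y)) x = ennreal a * Sn t (\<lambda>y. ennreal (f y)) x"
    using a bm_bounds[OF f] by (subst Sn_cmult[symmetric]) (auto simp: ennreal_mult)
  then show ?thesis using a by (simp add: S_def enn2real_mult)
qed

lemma S_semigroup: "0 \<le> s \<Longrightarrow> 0 \<le> t \<Longrightarrow> bm c f \<Longrightarrow> S (s + t) f x = S s (S t f) x"
proof -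
  assume s: "0 \<le> s" and t: "0 \<le> t" and f: "bm c f"
  have [measurable]: "f \<in> borel_measurable borel" by (rule bm_meas[OF f])
  have "Sn (s + t) (\<lambda>y. ennreal (f y)) x = Sn s (Sn t (\<lambda>y. ennreal (f y))) x"
    by (rule Sn_semigroup[OF s t]) simp
  also have "Sn t (\<lambda>y. ennreal (f y)) = (\<lambda>y. ennreal (S t f y))"
    by (rule ext) (rule Sn_eq[OF t f])
  finally show ?thesis by (simp add: S_def)
qed

lemma measurable_S:
  assumes g: "(\<lambda>z. g (fst z) (snd z)) \<in> borel_measurable (borel \<Otimes>\<^sub>M borel)"
  shows "(\<lambda>z. S (fst z) (g (fst z)) (snd z)) \<in> borel_measurable (borel \<Otimes>\<^sub>M borel)"
proof -
  have [measurable (raw)]: "(\<lambda>z. g (f z) (k z)) \<in> borel_measurable M"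
    if "f \<in> borel_measurable M" "k \<in> borel_measurable M" for f k and M :: "'x measure"
    using measurable_compose[OF measurable_Pair[OF that] g] by simp
  show ?thesis
    unfolding S_def by (intro borel_measurable_enn2real measurable_Sn) (auto simp: split_beta')
qed

lemma measurable_S1:
  assumes g: "(\<lambda>z. g (fst z) (snd z)) \<in> borel_measurable (borel \<Otimes>\<^sub>M borel)"
  shows "(\<lambda>r. S r (g r) x) \<in> borel_measurable borel"
  using measurable_compose[OF measurable_Pair2'[of x borel borel] measurable_S[OF g]] by simp

text \<open>The weighted law \<open>\<kappa>\<close> of the position at time \<open>t\<close> and
  \<open>\<Theta> x\<close> times \<open>\<mu>\<close> are finite measures, close on continuous
  functions by \<open>gap\<close>, hence on bounded Borel ones.\<close>

lemma S_gap:
  assumes t: "0 \<le> t" and f: "bm c f"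
  shows "\<bar>S t f x - \<Theta> x * (\<integral>y. f y \<partial>\<mu>)\<bar> \<le> c * (H * exp (- lam * t))"
proof -
  have Wm: "Wt t \<in> borel_measurable (P x)" "(\<lambda>w. path_at w t) \<in> P x \<rightarrow>\<^sub>M borel"
    by (simp_all, measurable)
  define \<kappa> where "\<kappa> = distr (density (P x) (Wt t)) borel (\<lambda>w. path_at w t)"
  have \<kappa>n: "(\<integral>\<^sup>+y. g y \<partial>\<kappa>) = Sn t g x" if [measurable]: "g \<in> borel_measurable borel" for g
    unfolding \<kappa>_def Sn_def using Wm
    by (subst nn_integral_distr) (auto simp: nn_integral_density)
  have s\<kappa>: "sets \<kappa> = sets borel" by (simp add: \<kappa>_def)
  have [measurable_cong]: "sets \<kappa> = sets borel" by fact
  have f\<kappa>: "finite_measure \<kappa>"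
  proof
    have "emeasure \<kappa> (space \<kappa>) = (\<integral>\<^sup>+y. 1 \<partial>\<kappa>)" by simp
    also have "\<dots> = Sn t (\<lambda>_. 1) x" by (rule \<kappa>n) simp
    also have "\<dots> < \<top>" using Sn_le[OF t, of "\<lambda>_. 1" 1 x] by (auto intro: le_less_trans)
    finally show "emeasure \<kappa> (space \<kappa>) \<noteq> \<infinity>" by simp
  qed
  define \<rho> where "\<rho> = density \<mu> (\<lambda>_. ennreal (\<Theta> x))"
  have s\<rho>: "sets \<rho> = sets borel" by (simp add: \<rho>_def sets_\<mu>)
  have f\<rho>: "finite_measure \<rho>"
  proof
    show "emeasure \<rho> (space \<rho>) \<noteq> \<infinity>"
      unfolding \<rho>_def
      by (simp add: emeasure_density_const \<mu>.emeasure_eq_measure ennreal_mult_eq_top_iff)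
  qed
  have \<kappa>i: "(\<integral>y. g y \<partial>\<kappa>) = S t g x" if g: "bm c' g" for g c'
    unfolding S_def using bm_meas[OF g] bm_bounds[OF g]
    by (subst integral_eq_nn_integral) (auto simp: \<kappa>n)
  have \<rho>i: "(\<integral>y. g y \<partial>\<rho>) = \<Theta> x * (\<integral>y. g y \<partial>\<mu>)" if g: "bm c' g" for g c'
    unfolding \<rho>_def using bm_meas[OF g] \<Theta>_pos[of x]
    by (subst integral_density) (auto simp: less_imp_le)
  have "\<bar>(\<integral>y. f y \<partial>\<kappa>) - (\<integral>y. f y \<partial>\<rho>)\<bar> \<le> c * (H * exp (- lam * t))"
  proof (rule finite_measures_close[OF f\<kappa> f\<rho> s\<kappa> s\<rho>])
    fix g :: "real \<Rightarrow> real"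
    assume gc: "continuous_on UNIV g" and g: "\<And>y. 0 \<le> g y \<and> g y \<le> 1"
    have gm: "g \<in> borel_measurable borel" by (rule borel_measurable_continuous_onI[OF gc])
    have bg: "bm 1 g" using gm g by (simp add: bm_def)
    have gC: "g \<in> Cb"
      unfolding Cb_def using gc g by (auto simp: bounded_iff intro!: exI[of _ 1])
    have FK: "FK P (\<lambda>y. b y - d y) t g x = S t g x"
    proof -
      have nn: "0 \<le> FK P (\<lambda>y. b y - d y) t g x"
        unfolding FK_def using g by (intro integral_nonneg_AE) (auto simp: FK_weight_def)
      have "ennreal (S t g x) = ennreal (FK P (\<lambda>y. b y - d y) t g x)"
        using Sn_eq_FK[OF t gm, of 1 x] g Sn_eq[OF t bg, of x] by simp
      then show ?thesis using nn S_nonneg[of t g x] by simp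
    qed
    have "sup_norm g \<le> 1"
      unfolding sup_norm_def using g by (intro cSUP_least) (auto simp: abs_of_nonneg)
    then have "H * sup_norm g * exp (- lam * t) \<le> H * 1 * exp (- lam * t)"
      using H by (intro mult_right_mono mult_left_mono) auto
    then show "\<bar>(\<integral>y. g y \<partial>\<kappa>) - (\<integral>y. g y \<partial>\<rho>)\<bar> \<le> H * exp (- lam * t)"
      using gap[OF gC t, of x] by (simp add: FK \<kappa>i[OF bg] \<rho>i[OF bg])
  qed (use bm_meas[OF f] bm_bounds[OF f] in auto)
  then show ?thesis by (simp add: \<kappa>i[OF f] \<rho>i[OF f])
qed

lemma exp_lam_tendsto: "((\<lambda>t. exp (- lam * t)) \<longlongrightarrow> 0) at_top"
  using lam by real_asymp

text \<open>Compare the two limits that \<open>S_gap\<close> gives for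
  \<open>S (t + r) f = S t (S r f)\<close> as \<open>t\<close> tends to infinity; the common factor
  \<open>\<Theta> 0\<close> is positive.\<close>

lemma S_invariant:
  assumes r: "0 \<le> r" and f: "bm c f"
  shows "(\<integral>y. S r f y \<partial>\<mu>) = (\<integral>y. f y \<partial>\<mu>)"
proof -
  let ?x = "0 :: real"
  define c' where "c' = exp (bs * r) * c"
  have f': "bm c' (S r f)" unfolding c'_def by (rule bm_S[OF r f])
  have "\<bar>\<Theta> ?x * (\<integral>y. S r f y \<partial>\<mu>) - \<Theta> ?x * (\<integral>y. f y \<partial>\<mu>)\<bar> \<le> (c' * H + c * H * exp (- lam * r)) * exp (- lam * t)"
    if t: "0 \<le> t" for t
  proof -
    have "S (t + r) f ?x = S t (S r f) ?x" by (rule S_semigroup[OF t r f])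
    moreover have "\<bar>S t (S r f) ?x - \<Theta> ?x * (\<integral>y. S r f y \<partial>\<mu>)\<bar> \<le> c' * (H * exp (- lam * t))"
      by (rule S_gap[OF t f'])
    moreover have "\<bar>S (t + r) f ?x - \<Theta> ?x * (\<integral>y. f y \<partial>\<mu>)\<bar> \<le> c * (H * exp (- lam * (t + r)))"
      using t r by (intro S_gap f) auto
    moreover have "exp (- lam * (t + r)) = exp (- lam * r) * exp (- lam * t)"
      by (simp add: algebra_simps flip: exp_add)
    ultimately show ?thesis by (simp add: algebra_simps)
  qed
  then have "\<bar>\<Theta> ?x * (\<integral>y. S r f y \<partial>\<mu>) - \<Theta> ?x * (\<integral>y. f y \<partial>\<mu>)\<bar> \<le> (c' * H + c * H * exp (- lam * r)) * 0"
    by (intro tendsto_lowerbound[OF tendsto_mult[OF tendsto_const exp_lam_tendsto]])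
       (auto intro: eventually_at_top_linorderI[of 0])
  then show ?thesis using \<Theta>_pos[of ?x] by simp
qed

text \<open>Stated with nonnegative integrals, as the branching construction delivers it;
  \<open>mild_real\<close> is the form used for estimates.\<close>

definition mild :: "(real \<Rightarrow> real) \<Rightarrow> (real \<Rightarrow> real \<Rightarrow> real) \<Rightarrow> bool" where
  "mild v0 v \<longleftrightarrow> bm 1 v0 \<and> (\<lambda>z. v (fst z) (snd z)) \<in> borel_measurable (borel \<Otimes>\<^sub>M borel) \<and>
    (\<forall>s y. 0 \<le> v s y \<and> v s y \<le> 1) \<and>
    (\<forall>t\<ge>0. \<forall>x. ennreal (v t x) + (\<integral>\<^sup>+r\<in>{0..t}. Sn r (\<lambda>y. ennreal (b y * (v (t - r) y)\<^sup>2)) x \<partial>lborel) =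
      Sn t (\<lambda>y. ennreal (v0 y)) x)"

section \<open>Consequences of the mild equation\<close>

context
  fixes v0 v
  assumes mild: "mild v0 v"
begin

lemma v0_bm: "bm 1 v0"
  using mild by (simp add: mild_def)

lemma v_meas: "(\<lambda>z. v (fst z) (snd z)) \<in> borel_measurable (borel \<Otimes>\<^sub>M borel)"
  using mild by (simp add: mild_def)

lemma v_bounds: "0 \<le> v s y" "v s y \<le> 1"
  using mild by (auto simp: mild_def)

lemma v_meas_raw:
  "f \<in> borel_measurable M \<Longrightarrow> k \<in> borel_measurable M \<Longrightarrow> (\<lambda>z. v (f z) (k z)) \<in> borel_measurable M"
  using measurable_compose[OF measurable_Pair v_meas, of f M k] by simp

lemma v_bm: "bm 1 (v s)"
proof -
  have "(\<lambda>y. v s y) \<in> borel_measurable borel" by (rule v_meas_raw) auto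
  then show ?thesis unfolding bm_def using v_bounds by blast
qed

definition bv :: "real \<Rightarrow> real \<Rightarrow> real" where
  "bv s y = b y * (v s y)\<^sup>2"

lemma bv_bm: "(\<And>y. v s y \<le> n) \<Longrightarrow> bm (bs * n\<^sup>2) (bv s)"
  unfolding bv_def using v_bm[of s] by (intro bm_mult bm_b bm_power2) (auto simp: bm_def)

lemma bv_bm1: "bm bs (bv s)"
  using bv_bm[of s 1] v_bounds by simp

lemma bv_meas: "(\<lambda>z. bv (fst z) (snd z)) \<in> borel_measurable (borel \<Otimes>\<^sub>M borel)"
proof -
  note v_meas[measurable]
  show ?thesis unfolding bv_def by measurable
qed

text \<open>Rate of decrease of the mass \<open>m\<close>, see \<open>m_diff\<close>.\<close>

definition k :: "real \<Rightarrow> real" where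
  "k s = (\<integral>y. bv s y \<partial>\<mu>)"

definition m :: "real \<Rightarrow> real" where
  "m s = (\<integral>y. v s y \<partial>\<mu>)"

lemma k_meas [measurable]: "k \<in> borel_measurable borel"
proof -
  have "(\<lambda>z. bv (fst z) (snd z)) \<in> borel_measurable (borel \<Otimes>\<^sub>M \<mu>)"
    using bv_meas by simp
  then show ?thesis
    unfolding k_def[abs_def] by (intro \<mu>.borel_measurable_lebesgue_integral) (simp add: split_beta')
qed

lemma m_meas [measurable]: "m \<in> borel_measurable borel"
proof -
  have "(\<lambda>z. v (fst z) (snd z)) \<in> borel_measurable (borel \<Otimes>\<^sub>M \<mu>)"
    using v_meas by simp
  then show ?thesis
    unfolding m_def[abs_def] by (intro \<mu>.borel_measurable_lebesgue_integral) (simp add: split_beta')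
qed

lemma k_nonneg: "0 \<le> k s"
  unfolding k_def by (rule bm_integral_nonneg[OF bv_bm1])

lemma k_le: "k s \<le> bs * measure \<mu> UNIV"
  unfolding k_def by (rule bm_integral_le[OF bv_bm1])

lemma k_le_m: "(\<And>y. v s y \<le> n) \<Longrightarrow> k s \<le> bs * n * m s"
proof -
  assume n: "\<And>y. v s y \<le> n"
  have "k s \<le> (\<integral>y. bs * n * v s y \<partial>\<mu>)"
    unfolding k_def
  proof (rule integral_mono)
    show "integrable \<mu> (bv s)" by (rule bm_integrable[OF bv_bm1])
    show "integrable \<mu> (\<lambda>y. bs * n * v s y)" using bm_integrable[OF v_bm] by simp
    show "bv s y \<le> bs * n * v s y" for y
    proof -
      have "bv s y = b y * (v s y * v s y)" by (simp add: bv_def power2_eq_square)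
      also have "\<dots> \<le> bs * (n * v s y)"
        using v_bounds b_nonneg b_le n bs_nonneg order_trans[OF v_bounds(1) n] by (intro mult_mono) auto
      finally show ?thesis by simp
    qed
  qed
  then show ?thesis by (simp add: m_def)
qed

lemma m_nonneg: "0 \<le> m s"
  unfolding m_def by (rule bm_integral_nonneg[OF v_bm])

definition e :: "real \<Rightarrow> real \<Rightarrow> real" where
  "e t x = (LBINT r:{0..t}. S r (bv (t - r)) x)"

lemma bv_shift_meas: "(\<lambda>z. bv (t - fst z) (snd z)) \<in> borel_measurable (borel \<Otimes>\<^sub>M borel)"
  using measurable_compose[OF _ bv_meas, of "\<lambda>z. (t - fst z, snd z)"] by simp

lemma S_bv_meas: "(\<lambda>r. S r (bv (t - r)) x) \<in> borel_measurable borel"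
  by (rule measurable_S1[OF bv_shift_meas])

lemma S_bv_le: "0 \<le> r \<Longrightarrow> r \<le> t \<Longrightarrow> S r (bv s) x \<le> exp (bs * t) * bs"
proof -
  assume r: "0 \<le> r" "r \<le> t"
  have "S r (bv s) x \<le> exp (bs * r) * bs" using bm_bounds[OF bm_S[OF r(1) bv_bm1]] by blast
  also have "\<dots> \<le> exp (bs * t) * bs" using r bs_nonneg by (intro mult_right_mono) (auto intro: mult_left_mono)
  finally show ?thesis .
qed

lemma mild_nn:
  "0 \<le> t \<Longrightarrow> ennreal (v t x) + (\<integral>\<^sup>+r\<in>{0..t}. ennreal (S r (bv (t - r)) x) \<partial>lborel) = ennreal (S t v0 x)"
proof -
  assume t: "0 \<le> t"
  have "(\<integral>\<^sup>+r\<in>{0..t}. Sn r (\<lambda>y. ennreal (b y * (v (t - r) y)\<^sup>2)) x \<partial>lborel) =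
      (\<integral>\<^sup>+r\<in>{0..t}. ennreal (S r (bv (t - r)) x) \<partial>lborel)"
    by (intro nn_integral_cong) (auto simp: Sn_eq[OF _ bv_bm1] simp flip: bv_def split: split_indicator)
  moreover have "ennreal (v t x) + (\<integral>\<^sup>+r\<in>{0..t}. Sn r (\<lambda>y. ennreal (b y * (v (t - r) y)\<^sup>2)) x \<partial>lborel) =
      Sn t (\<lambda>y. ennreal (v0 y)) x"
    using mild t unfolding mild_def by blast
  ultimately show ?thesis by (simp only: Sn_eq[OF t v0_bm])
qed

lemma e_nn: "0 \<le> t \<Longrightarrow> (\<integral>\<^sup>+r\<in>{0..t}. ennreal (S r (bv (t - r)) x) \<partial>lborel) = ennreal (e t x)"
  unfolding e_def
  by (rule set_nn_integral_eq_LBINT[OF S_bv_meas, where c="exp (bs * t) * bs"]) (auto simp: S_nonneg intro: S_bv_le)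

lemma e_nonneg: "0 \<le> e t x"
  unfolding e_def set_lebesgue_integral_def by (rule integral_nonneg_AE) (auto simp: S_nonneg)

lemma mild_real: "0 \<le> t \<Longrightarrow> v t x + e t x = S t v0 x"
  using mild_nn[of t x] v_bounds e_nonneg[of t x]
  by (simp add: e_nn S_nonneg flip: ennreal_plus)

lemma v_le_S: "0 \<le> t \<Longrightarrow> v t x \<le> S t v0 x"
  using mild_real[of t x] e_nonneg[of t x] by linarith

text \<open>Integrate the mild equation against the invariant measure: the semigroup disappears from
  both terms, and reflecting time removes the shift.\<close>

lemma m_0: "0 \<le> t \<Longrightarrow> m t = (\<integral>y. v0 y \<partial>\<mu>) - (LBINT q:{0..t}. k q)"
proof -
  assume t: "0 \<le> t"
  interpret pair_sigma_finite \<mu> lborel ..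
  define f where "f = (\<lambda>z. ennreal (S (snd z) (bv (t - snd z)) (fst z)) * indicator {0..t} (snd z))"
  have "(\<lambda>z. S (snd z) (bv (t - snd z)) (fst z)) \<in> borel_measurable (borel \<Otimes>\<^sub>M borel)"
    using measurable_compose[OF _ measurable_S[OF bv_shift_meas], of "\<lambda>z. (snd z, fst z)"] by simp
  then have "f \<in> borel_measurable (borel \<Otimes>\<^sub>M borel)" unfolding f_def by measurable
  then have f: "f \<in> borel_measurable (\<mu> \<Otimes>\<^sub>M lborel)" by simp
  have fx: "(\<lambda>x. \<integral>\<^sup>+r. f (x, r) \<partial>lborel) \<in> borel_measurable \<mu>"
    by (rule lborel.borel_measurable_nn_integral_fst[OF f])
  have v: "(\<lambda>x. ennreal (v t x)) \<in> borel_measurable \<mu>" using bm_meas[OF v_bm] by simp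
  have "(\<integral>\<^sup>+x. ennreal (S t v0 x) \<partial>\<mu>) = (\<integral>\<^sup>+x. ennreal (v t x) + (\<integral>\<^sup>+r. f (x, r) \<partial>lborel) \<partial>\<mu>)"
    using mild_nn[OF t] by (intro nn_integral_cong) (simp add: f_def)
  also have "\<dots> = (\<integral>\<^sup>+x. ennreal (v t x) \<partial>\<mu>) + (\<integral>\<^sup>+x. \<integral>\<^sup>+r. f (x, r) \<partial>lborel \<partial>\<mu>)"
    by (rule nn_integral_add[OF v fx])
  also have "(\<integral>\<^sup>+x. \<integral>\<^sup>+r. f (x, r) \<partial>lborel \<partial>\<mu>) = (\<integral>\<^sup>+r. \<integral>\<^sup>+x. f (x, r) \<partial>\<mu> \<partial>lborel)"
    by (rule Fubini'[symmetric]) (use f in \<open>simp add: split_beta'\<close>)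
  also have "\<dots> = (\<integral>\<^sup>+r\<in>{0..t}. ennreal (k (t - r)) \<partial>lborel)"
  proof (intro nn_integral_cong)
    fix r
    show "(\<integral>\<^sup>+x. f (x, r) \<partial>\<mu>) = ennreal (k (t - r)) * indicator {0..t} r"
      using bm_nn_integral[OF bm_S[OF _ bv_bm1], of r "t - r"] S_invariant[OF _ bv_bm1, of r "t - r"]
      by (auto simp: f_def k_def split: split_indicator)
  qed
  also have "\<dots> = ennreal (LBINT r:{0..t}. k (t - r))"
    by (rule set_nn_integral_eq_LBINT) (use k_nonneg k_le in auto)
  also have "(LBINT r:{0..t}. k (t - r)) = (LBINT q:{0..t}. k q)" by (rule LBINT_reflect)
  also have "(\<integral>\<^sup>+x. ennreal (v t x) \<partial>\<mu>) = ennreal (m t)"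
    unfolding m_def by (rule bm_nn_integral[OF v_bm])
  also have "(\<integral>\<^sup>+x. ennreal (S t v0 x) \<partial>\<mu>) = ennreal (\<integral>y. v0 y \<partial>\<mu>)"
    using bm_nn_integral[OF bm_S[OF t v0_bm]] S_invariant[OF t v0_bm] by simp
  moreover have "0 \<le> (LBINT q:{0..t}. k q)"
    unfolding set_lebesgue_integral_def by (rule integral_nonneg_AE) (auto simp: k_nonneg)
  ultimately show ?thesis
    using m_nonneg[of t] bm_integral_nonneg[OF v0_bm] by (simp flip: ennreal_plus)
qed

lemma m_diff: "0 \<le> s \<Longrightarrow> s \<le> t \<Longrightarrow> m t = m s - (LBINT q:{s..t}. k q)"
  using m_0[of s] m_0[of t] LBINT_split[OF k_meas, of "bs * measure \<mu> UNIV" 0 s t] k_nonneg k_le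
  by (simp add: abs_of_nonneg)

lemma int_k_nonneg: "0 \<le> (LBINT q:{s..t}. k q)"
  unfolding set_lebesgue_integral_def by (rule integral_nonneg_AE) (auto simp: k_nonneg)

lemma m_mono: "0 \<le> s \<Longrightarrow> s \<le> t \<Longrightarrow> m t \<le> m s"
  using m_diff[of s t] int_k_nonneg[of s t] by simp

text \<open>On \<open>[s, t]\<close> the rate of decrease is at most \<open>bs * n\<close> times the
  mass, and the mass is largest at \<open>s\<close>.\<close>

lemma m_drop:
  assumes s: "0 \<le> s" "s \<le> t" and n: "\<And>q y. s \<le> q \<Longrightarrow> q \<le> t \<Longrightarrow> v q y \<le> n"
  shows "(1 - bs * (t - s) * n) * m s \<le> m t"
proof -
  have n0: "0 \<le> n" using n[of s 0] v_bounds(1)[of s 0] s by linarith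
  have "(LBINT q:{s..t}. k q) \<le> (LBINT q:{s..t}. bs * n * m s)"
  proof (rule set_integral_mono)
    show "set_integrable lborel {s..t} k"
      by (rule set_integrable_bounded[where c="bs * measure \<mu> UNIV"]) (use k_nonneg k_le in auto)
    show "set_integrable lborel {s..t} (\<lambda>q. bs * n * m s)"
      by (rule set_integrable_bounded[where c="\<bar>bs * n * m s\<bar>"]) auto
    fix q assume q: "q \<in> {s..t}"
    have "k q \<le> bs * n * m q" using q by (intro k_le_m n) auto
    also have "\<dots> \<le> bs * n * m s" using q s bs_nonneg n0 by (intro mult_left_mono m_mono) auto
    finally show "k q \<le> bs * n * m s" .
  qed
  also have "\<dots> = bs * n * m s * (t - s)"
    using s by (simp add: set_integral_const mult.commute)
  finally show ?thesis using m_diff[OF s] by (simp add: algebra_simps)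
qed

text \<open>Each \<open>S r\<close> is replaced by its projection; the exponential errors integrate
  to a bound independent of \<open>t\<close>.\<close>

lemma e_gap:
  assumes t: "0 \<le> t" and n: "\<And>q y. 0 \<le> q \<Longrightarrow> q \<le> t \<Longrightarrow> v q y \<le> n"
  shows "\<bar>e t x - \<Theta> x * (LBINT q:{0..t}. k q)\<bar> \<le> H * bs * n\<^sup>2 / lam"
proof -
  have i1: "set_integrable lborel {0..t} (\<lambda>r. S r (bv (t - r)) x)"
    by (rule set_integrable_bounded[OF S_bv_meas, where c="exp (bs * t) * bs"])
       (auto simp: S_nonneg abs_of_nonneg intro: S_bv_le)
  have i2: "set_integrable lborel {0..t} (\<lambda>r. \<Theta> x * k (t - r))"
  proof (rule set_integrable_bounded[where c="\<Theta> x * (bs * measure \<mu> UNIV)"])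
    show "\<bar>\<Theta> x * k (t - r)\<bar> \<le> \<Theta> x * (bs * measure \<mu> UNIV)" for r
      using k_nonneg k_le \<Theta>_pos[of x] by (auto simp: abs_mult intro!: mult_left_mono)
  qed measurable
  have i3: "set_integrable lborel {0..t} (\<lambda>r. bs * n\<^sup>2 * (H * exp (- lam * r)))"
    by (intro borel_integrable_atLeastAtMost' continuous_intros)
  have i4: "set_integrable lborel {0..t} (\<lambda>r. \<bar>S r (bv (t - r)) x - \<Theta> x * k (t - r)\<bar>)"
    by (rule set_integrable_abs[OF set_integral_diff(1)[OF i1 i2]])
  have eq: "e t x - \<Theta> x * (LBINT q:{0..t}. k q) = (LBINT r:{0..t}. S r (bv (t - r)) x - \<Theta> x * k (t - r))"
    unfolding set_integral_diff(2)[OF i1 i2] e_def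
    by (simp add: LBINT_reflect)
  have "\<bar>e t x - \<Theta> x * (LBINT q:{0..t}. k q)\<bar> \<le> (LBINT r:{0..t}. \<bar>S r (bv (t - r)) x - \<Theta> x * k (t - r)\<bar>)"
    unfolding eq using set_integral_norm_bound[OF set_integral_diff(1)[OF i1 i2]] by simp
  also have "\<dots> \<le> (LBINT r:{0..t}. bs * n\<^sup>2 * (H * exp (- lam * r)))"
  proof (rule set_integral_mono[OF i4 i3])
    fix r assume r: "r \<in> {0..t}"
    have "bm (bs * n\<^sup>2) (bv (t - r))" by (rule bv_bm, rule n) (use r in auto)
    moreover have "0 \<le> r" using r by simp
    ultimately show "\<bar>S r (bv (t - r)) x - \<Theta> x * k (t - r)\<bar> \<le> bs * n\<^sup>2 * (H * exp (- lam * r))"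
      unfolding k_def by (intro S_gap)
  qed
  also have "\<dots> = bs * n\<^sup>2 * H * (LBINT r:{0..t}. exp (- lam * r))"
    by (simp add: mult.assoc flip: set_integral_mult_right)
  also have "\<dots> \<le> bs * n\<^sup>2 * H * (1 / lam)"
    using bs_nonneg H by (intro mult_left_mono exp_integral_le[OF lam t]) auto
  finally show ?thesis by (simp add: mult_ac)
qed

text \<open>Subtracting \<open>\<Theta>\<close> times the integrated equation from the equation
  itself leaves two spectral gap errors: one from the initial datum, which decays, and one from the
  nonlinear term, which is quadratic in the size of \<open>v\<close>.\<close>

lemma v_close:
  assumes t: "0 \<le> t" and c: "bm c v0" and n: "\<And>q y. 0 \<le> q \<Longrightarrow> q \<le> t \<Longrightarrow> v q y \<le> n"
  shows "\<bar>v t x - \<Theta> x * m t\<bar> \<le> H * c * exp (- lam * t) + H * bs * n\<^sup>2 / lam"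
proof -
  have "v t x - \<Theta> x * m t = (S t v0 x - \<Theta> x * (\<integral>y. v0 y \<partial>\<mu>)) - (e t x - \<Theta> x * (LBINT q:{0..t}. k q))"
  proof -
    have *: "(\<integral>y. v0 y \<partial>\<mu>) = m t + (LBINT q:{0..t}. k q)" using m_0[OF t] by simp
    show ?thesis unfolding * mild_real[OF t, symmetric] by (simp add: algebra_simps)
  qed
  then show ?thesis
    using S_gap[OF t c, of x] e_gap[OF t n, of x] by (simp add: mult_ac)
qed

text \<open>Flow property: apply the semigroup for time \<open>t\<close> to the equation at time
  \<open>s\<close>. The part of the integral over \<open>[t, s + t]\<close> occurs on both sides and
  is finite, so it cancels.\<close>

lemma restart:
  assumes s: "0 \<le> s"
  shows "mild (v s) (\<lambda>t. v (s + t))"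
  unfolding mild_def
proof (intro conjI allI impI)
  show "bm 1 (v s)" by (rule v_bm)
  show "(\<lambda>z. v (s + fst z) (snd z)) \<in> borel_measurable (borel \<Otimes>\<^sub>M borel)"
    by (rule v_meas_raw) measurable
  show "0 \<le> v (s + s') y" "v (s + s') y \<le> 1" for s' y by (rule v_bounds)+
  fix t x :: real assume t: "0 \<le> t"
  let ?g = "\<lambda>q y. ennreal (bv q y)"
  have bm: "(\<lambda>z. ?g (c - fst z) (snd z)) \<in> borel_measurable (borel \<Otimes>\<^sub>M borel)" for c
    using bv_shift_meas by measurable
  have gm [measurable]: "?g q \<in> borel_measurable borel" for q using bm_meas[OF bv_bm1] by measurable
  have Sm: "(\<lambda>r. Sn r (?g (c - r)) x) \<in> borel_measurable borel" for c
    using bm[of c] by (intro measurable_Sn) (auto simp: split_beta')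
  define Y where "Y = (\<integral>\<^sup>+r\<in>{t..s + t}. Sn r (?g (s + t - r)) x \<partial>lborel)"
  have "Sn (t + s) (\<lambda>y. ennreal (v0 y)) x = Sn t (Sn s (\<lambda>y. ennreal (v0 y))) x"
    using bm_meas[OF v0_bm] by (intro Sn_semigroup t s) measurable
  also have "Sn s (\<lambda>y. ennreal (v0 y)) = (\<lambda>y. ennreal (v s y) + (\<integral>\<^sup>+r\<in>{0..s}. Sn r (?g (s - r)) y \<partial>lborel))"
    using mild s by (auto simp: mild_def bv_def)
  also have "Sn t \<dots> x = Sn t (\<lambda>y. ennreal (v s y)) x + Sn t (\<lambda>y. \<integral>\<^sup>+r\<in>{0..s}. Sn r (?g (s - r)) y \<partial>lborel) x"
  proof (rule Sn_add)
    show "(\<lambda>y. ennreal (v s y)) \<in> borel_measurable borel" using bm_meas[OF v_bm] by measurable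
    have "(\<lambda>z. Sn (snd z) (?g (s - snd z)) (fst z)) \<in> borel_measurable (borel \<Otimes>\<^sub>M borel)"
      using measurable_compose[OF _ bm[of s], of "\<lambda>z. (snd (fst z), snd z)" "(borel \<Otimes>\<^sub>M borel) \<Otimes>\<^sub>M borel"]
      by (intro measurable_Sn) (auto simp: split_beta')
    then show "(\<lambda>y. \<integral>\<^sup>+r\<in>{0..s}. Sn r (?g (s - r)) y \<partial>lborel) \<in> borel_measurable borel"
      by (rule measurable_interval_nn_integral) auto
  qed
  also have "Sn t (\<lambda>y. \<integral>\<^sup>+r\<in>{0..s}. Sn r (?g (s - r)) y \<partial>lborel) x = (\<integral>\<^sup>+r\<in>{0..s}. Sn t (Sn r (?g (s - r))) x \<partial>lborel)"
  proof (rule Sn_nn_integral)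
    have "(\<lambda>z. Sn (fst z) (?g (s - fst z)) (snd z)) \<in> borel_measurable (borel \<Otimes>\<^sub>M borel)"
      using measurable_compose[OF _ bm[of s], of "\<lambda>z. (fst (fst z), snd z)" "(borel \<Otimes>\<^sub>M borel) \<Otimes>\<^sub>M borel"]
      by (intro measurable_Sn) (auto simp: split_beta')
    then show "(\<lambda>(r, y). Sn r (?g (s - r)) y) \<in> borel_measurable (borel \<Otimes>\<^sub>M borel)"
      by (simp add: split_beta')
  qed simp
  also have "\<dots> = (\<integral>\<^sup>+r\<in>{0..s}. (\<lambda>r. Sn r (?g (s + t - r)) x) (t + r) \<partial>lborel)"
    by (intro nn_integral_cong) (auto simp: Sn_semigroup[OF t, symmetric] split: split_indicator)
  also have "\<dots> = Y"
    using interval_shift[OF Sm[of "s + t"], where r=t and c=s] by (simp add: Y_def add.commute)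
  finally have 1: "Sn (t + s) (\<lambda>y. ennreal (v0 y)) x = Sn t (\<lambda>y. ennreal (v s y)) x + Y" .
  have "Sn (s + t) (\<lambda>y. ennreal (v0 y)) x = ennreal (v (s + t) x) + (\<integral>\<^sup>+r\<in>{0..s + t}. Sn r (?g (s + t - r)) x \<partial>lborel)"
    using mild s t by (auto simp: mild_def bv_def)
  also have "(\<integral>\<^sup>+r\<in>{0..s + t}. Sn r (?g (s + t - r)) x \<partial>lborel) =
      (\<integral>\<^sup>+r\<in>{0..t}. Sn r (?g (s + t - r)) x \<partial>lborel) + Y"
    unfolding Y_def using s t by (intro interval_split Sm) auto
  finally have 2: "Sn t (\<lambda>y. ennreal (v s y)) x + Y =
      (ennreal (v (s + t) x) + (\<integral>\<^sup>+r\<in>{0..t}. Sn r (?g (s + t - r)) x \<partial>lborel)) + Y"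
    unfolding 1[symmetric] add.commute[of t s] add.assoc .
  have "Y \<le> Sn (t + s) (\<lambda>y. ennreal (v0 y)) x" unfolding 1 by simp
  also have "\<dots> < \<top>" using s t by (simp add: Sn_eq[OF _ v0_bm])
  finally have "Y \<noteq> \<top>" by simp
  moreover have "Y + Sn t (\<lambda>y. ennreal (v s y)) x =
      Y + (ennreal (v (s + t) x) + (\<integral>\<^sup>+r\<in>{0..t}. Sn r (?g (s + t - r)) x \<partial>lborel))"
    using 2 by (simp only: add.commute)
  ultimately have "Sn t (\<lambda>y. ennreal (v s y)) x =
      ennreal (v (s + t) x) + (\<integral>\<^sup>+r\<in>{0..t}. Sn r (?g (s + t - r)) x \<partial>lborel)"
    unfolding ennreal_add_left_cancel infinity_ennreal_def by blast
  then show "ennreal (v (s + t) x) + (\<integral>\<^sup>+r\<in>{0..t}. Sn r (\<lambda>y. ennreal (b y * (v (s + (t - r)) y)\<^sup>2)) x \<partial>lborel) =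
      Sn t (\<lambda>y. ennreal (v s y)) x"
    by (simp add: bv_def add_diff_eq)
qed

end

end

section \<open>Logistic comparison for small initial data\<close>

context critical_semigroup
begin

definition A :: real where "A = measure \<mu> UNIV"

definition B :: real where "B = (\<integral>y. (\<Theta> y)\<^sup>2 * b y \<partial>\<mu>)"

text \<open>First-order analogue of \<open>B\<close>; its positivity forces the mass to tend to 0 in
  \<open>m_tends_0\<close>.\<close>

definition B1 :: real where "B1 = (\<integral>y. b y * \<Theta> y \<partial>\<mu>)"

text \<open>A positive value of a continuous function persists on an open set, which
  \<open>\<mu>\<close> charges.\<close>

lemma positive_integral:
  assumes f: "bm c f" and cont: "continuous_on UNIV f" and pos: "0 < f y0"
  shows "0 < (\<integral>y. f y \<partial>\<mu>)"
proof -
  define U where "U = {y. f y0 / 2 < f y}"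
  have U: "open U"
    unfolding U_def by (intro open_Collect_less continuous_intros cont)
  then have [measurable]: "U \<in> sets borel" by simp
  have "y0 \<in> U" using pos by (simp add: U_def)
  then have "0 < emeasure \<mu> U" using U by (intro \<mu>_open) auto
  then have "0 < measure \<mu> U" by (simp add: \<mu>.emeasure_eq_measure)
  then have "0 < (\<integral>y. f y0 / 2 * indicator U y \<partial>\<mu>)" using pos by simp
  also have "\<dots> \<le> (\<integral>y. f y \<partial>\<mu>)"
  proof (rule integral_mono)
    show "integrable \<mu> (\<lambda>y. f y0 / 2 * indicator U y)"
      by (intro integrable_mult_right integrable_real_indicator) (auto simp: \<mu>.emeasure_eq_measure)
    show "f y0 / 2 * indicator U y \<le> f y" for y
      using bm_bounds[OF f, of y] by (auto simp: U_def split: split_indicator)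
  qed (rule bm_integrable[OF f])
  finally show ?thesis .
qed

lemma A_pos: "0 < A"
proof -
  have "bm 1 (\<lambda>_. 1)" by (simp add: bm_def)
  from positive_integral[OF this] show ?thesis by (simp add: A_def)
qed

lemma b_pos_point: "\<exists>y. 0 < b y"
  using b_nonzero b_nonneg by (metis less_eq_real_def)

lemma bm_\<Theta>2b: "bm (\<theta>s\<^sup>2 * bs) (\<lambda>y. (\<Theta> y)\<^sup>2 * b y)"
  by (intro bm_mult bm_power2 bm_\<Theta> bm_b)

lemma bm_b\<Theta>: "bm (bs * \<theta>s) (\<lambda>y. b y * \<Theta> y)"
  by (intro bm_mult bm_\<Theta> bm_b)

lemma B_pos: "0 < B"
proof -
  obtain y where "0 < b y" using b_pos_point by blast
  then have "0 < (\<Theta> y)\<^sup>2 * b y" using \<Theta>_pos[of y] by simp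
  then show ?thesis
    unfolding B_def by (intro positive_integral[OF bm_\<Theta>2b] continuous_intros \<Theta>_cont b_cont)
qed

lemma B1_pos: "0 < B1"
proof -
  obtain y where "0 < b y" using b_pos_point by blast
  then have "0 < b y * \<Theta> y" using \<Theta>_pos[of y] by simp
  then show ?thesis
    unfolding B1_def by (intro positive_integral[OF bm_b\<Theta>] continuous_intros \<Theta>_cont b_cont)
qed

lemma bs_pos: "0 < bs"
  using b_pos_point b_le by (auto intro: less_le_trans)

lemma integral_b_le: "(\<integral>y. b y \<partial>\<mu>) \<le> bs * A"
  using bm_integral_le[OF bm_b] by (simp add: A_def)

lemma exp_lam_le_1: "0 \<le> t \<Longrightarrow> exp (- lam * t) \<le> 1"
  using lam by simp

text \<open>Bound for the operators \<open>S t\<close> uniform in \<open>t\<close>, whereas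
  \<open>Sn_bound\<close> grows exponentially.\<close>

definition K :: real where "K = \<theta>s * A + H"

lemma K_pos: "0 < K"
  unfolding K_def using \<theta>s_pos A_pos H by (simp add: add_pos_pos)

lemma S_bound: "0 \<le> t \<Longrightarrow> bm c f \<Longrightarrow> S t f x \<le> K * c"
proof -
  assume t: "0 \<le> t" and f: "bm c f"
  have "S t f x \<le> \<Theta> x * (\<integral>y. f y \<partial>\<mu>) + c * (H * exp (- lam * t))"
    using S_gap[OF t f, of x] by linarith
  also have "\<dots> \<le> \<theta>s * (c * A) + c * (H * 1)"
    using bm_integral_le[OF f] bm_integral_nonneg[OF f] bm_nonneg[OF f] \<Theta>_le[of x] \<theta>s_pos H exp_lam_le_1[OF t]
    unfolding A_def by (intro add_mono mult_mono mult_left_mono) auto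
  finally show ?thesis by (simp add: K_def algebra_simps)
qed

lemma logistic_integral:
  assumes "0 \<le> a" "0 \<le> t"
  shows "a / (1 + B * a * t) = a - B * (LBINT s:{0..t}. (a / (1 + B * a * s))\<^sup>2)"
proof -
  define F where "F s = a / (1 + B * a * s)" for s
  define f where "f s = - B * (a / (1 + B * a * s))\<^sup>2" for s
  have pos: "0 < 1 + B * a * s" if "0 \<le> s" for s
    using B_pos assms that by (simp add: add_pos_nonneg)
  have "(f has_integral (F t - F 0)) {0..t}"
  proof (rule fundamental_theorem_of_calculus[OF assms(2)])
    fix s assume s: "s \<in> {0..t}"
    have "(F has_real_derivative f s) (at s within {0..t})"
      unfolding F_def f_def using pos[of s] s
      by (auto intro!: derivative_eq_intros simp: power2_eq_square field_simps)
    then show "(F has_vector_derivative f s) (at s within {0..t})"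
      by (simp add: has_real_derivative_iff_has_vector_derivative)
  qed
  moreover have "set_integrable lborel {0..t} f"
    unfolding f_def
    by (intro borel_integrable_atLeastAtMost' continuous_intros) (use pos in force)
  ultimately have "(LBINT s:{0..t}. f s) = F t - F 0"
    by (metis set_borel_integral_eq_integral(2) integral_unique)
  then have "- B * (LBINT s:{0..t}. (a / (1 + B * a * s))\<^sup>2) = F t - F 0"
    unfolding f_def by (simp only: set_integral_mult_right)
  then show ?thesis by (simp add: F_def)
qed

text \<open>The constant is independent of \<open>T\<close>, of the datum and of \<open>x\<close>,
  because later every \<open>t\<close> comes with its own datum. For data of order
  \<open>c = C / T\<close>, alignment with \<open>\<Theta>\<close> holds up to an error of order
  \<open>c exp (- lam s) + c^2\<close>, so the mass solves the logistic equation up to an integrated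
  error of order \<open>1 / T^2\<close>. Gronwall costs a bounded factor, as its rate is of order
  \<open>1 / T\<close>.\<close>

lemma small_initial_asymptotics:
  assumes C: "0 < C"
  shows "\<exists>C'. \<forall>T\<ge>1. \<forall>v0 v x. mild v0 v \<longrightarrow> bm (C / T) v0 \<longrightarrow>
    \<bar>T * v T x - \<Theta> x * (T * (\<integral>y. v0 y \<partial>\<mu>) / (1 + B * (T * (\<integral>y. v0 y \<partial>\<mu>))))\<bar> \<le> C' * (exp (- lam * T) + 1 / T)"
proof -
  \<comment> \<open>\<open>K2 * c\<close> bounds \<open>v + \<Theta> m\<close>, the second factor of
    \<open>v^2 - (\<Theta> m)^2\<close>; \<open>C4 / T^2\<close> is the integrated error in the
    logistic equation, and the exponential in \<open>C'\<close> is the Gronwall factor.\<close>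
  define K2 where "K2 = K + \<theta>s * A"
  define C4 where "C4 = A * bs * K2 * (H * C\<^sup>2 / lam + H * bs * K\<^sup>2 * C ^ 3 / lam)"
  define C' where "C' = H * C + H * bs * K\<^sup>2 * C\<^sup>2 / lam + \<theta>s * (2 * C4 * exp (4 * B * C * A))"
  note pos = K_pos A_pos B_pos \<theta>s_pos bs_pos lam H C
  have K2: "0 < K2" unfolding K2_def using pos by (simp add: add_pos_pos)
  have C4: "0 \<le> C4" unfolding C4_def using pos K2 by (intro mult_nonneg_nonneg add_nonneg_nonneg) auto
  have main: "\<bar>T * v T x - \<Theta> x * (T * (\<integral>y. v0 y \<partial>\<mu>) / (1 + B * (T * (\<integral>y. v0 y \<partial>\<mu>))))\<bar> \<le> C' * (exp (- lam * T) + 1 / T)"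
    if T: "1 \<le> T" and mild: "mild v0 v" and v0: "bm (C / T) v0" for T v0 v x
  proof -
    define c where "c = C / T"
    have c: "0 < c" using C T by (simp add: c_def)
    define n where "n = K * c"
    have vn: "v q y \<le> n" if "0 \<le> q" for q y
      using v_le_S[OF mild that, of y] S_bound[OF that v0, of y] by (simp add: n_def c_def)
    define M0 where "M0 = (\<integral>y. v0 y \<partial>\<mu>)"
    have M0: "0 \<le> M0" "M0 \<le> c * A"
      using bm_integral_nonneg[OF v0] bm_integral_le[OF v0] by (auto simp: M0_def c_def A_def)
    let ?m = "m v" and ?k = "k v"
    note [measurable] = k_meas[OF mild] m_meas[OF mild]
    have m_eq: "?m t = M0 - (LBINT q:{0..t}. ?k q)" if "0 \<le> t" for t
      using m_0[OF mild that] by (simp add: M0_def)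
    have m: "0 \<le> ?m t" "?m t \<le> M0" if "0 \<le> t" for t
      using m_nonneg[OF mild, of t] m_eq[OF that] int_k_nonneg[OF mild, of 0 t] by linarith+
    define \<epsilon> where "\<epsilon> t = H * c * exp (- lam * t) + H * bs * n\<^sup>2 / lam" for t
    have close: "\<bar>v t y - \<Theta> y * ?m t\<bar> \<le> \<epsilon> t" if t: "0 \<le> t" for t y
      unfolding \<epsilon>_def using v0 vn by (intro v_close[OF mild t]) (auto simp: c_def)
    have \<epsilon>0: "0 \<le> \<epsilon> t" for t
      unfolding \<epsilon>_def using pos c by (intro add_nonneg_nonneg divide_nonneg_nonneg mult_nonneg_nonneg) auto
    have kB: "\<bar>?k t - B * (?m t)\<^sup>2\<bar> \<le> A * bs * K2 * c * \<epsilon> t" if t: "0 \<le> t" for t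
    proof -
      have i1: "integrable \<mu> (bv v t)" by (rule bm_integrable[OF bv_bm1[OF mild]])
      have i2: "integrable \<mu> (\<lambda>y. (\<Theta> y)\<^sup>2 * b y * (?m t)\<^sup>2)"
        using bm_integrable[OF bm_\<Theta>2b] by simp
      have "?k t - B * (?m t)\<^sup>2 = (\<integral>y. bv v t y - (\<Theta> y)\<^sup>2 * b y * (?m t)\<^sup>2 \<partial>\<mu>)"
        unfolding k_def[OF mild] B_def using i1 i2 by simp
      then have "\<bar>?k t - B * (?m t)\<^sup>2\<bar> \<le> (\<integral>y. \<bar>bv v t y - (\<Theta> y)\<^sup>2 * b y * (?m t)\<^sup>2\<bar> \<partial>\<mu>)"
        by (simp add: integral_abs_bound)
      also have "\<dots> \<le> (\<integral>y. bs * (\<epsilon> t * (K2 * c)) \<partial>\<mu>)"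
      proof (rule integral_mono)
        show "integrable \<mu> (\<lambda>y. \<bar>bv v t y - (\<Theta> y)\<^sup>2 * b y * (?m t)\<^sup>2\<bar>)" using i1 i2 by simp
        fix y
        have "bv v t y - (\<Theta> y)\<^sup>2 * b y * (?m t)\<^sup>2 = b y * ((v t y - \<Theta> y * ?m t) * (v t y + \<Theta> y * ?m t))"
          unfolding bv_def[OF mild] by (simp add: power2_eq_square algebra_simps)
        also have "\<bar>\<dots>\<bar> = b y * (\<bar>v t y - \<Theta> y * ?m t\<bar> * (v t y + \<Theta> y * ?m t))"
          using b_nonneg[of y] v_bounds[OF mild, of t y] m[OF t] \<Theta>_pos[of y] by (simp add: abs_mult)
        also have "\<dots> \<le> bs * (\<epsilon> t * (K2 * c))"
        proof (intro mult_mono b_le close t)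
          have "\<Theta> y * ?m t \<le> \<theta>s * (c * A)"
            using \<Theta>_le[of y] \<Theta>_pos[of y] m[OF t] M0 \<theta>s_pos by (intro mult_mono) auto
          then show "v t y + \<Theta> y * ?m t \<le> K2 * c"
            using vn[OF t, of y] by (simp add: n_def K2_def algebra_simps)
          show "0 \<le> v t y + \<Theta> y * ?m t"
            using v_bounds[OF mild, of t y] m[OF t] \<Theta>_pos[of y] by simp
          then show "0 \<le> \<bar>v t y - \<Theta> y * ?m t\<bar> * (v t y + \<Theta> y * ?m t)" by simp
        qed (use bs_nonneg \<epsilon>0 in auto)
        finally show "\<bar>bv v t y - (\<Theta> y)\<^sup>2 * b y * (?m t)\<^sup>2\<bar> \<le> bs * (\<epsilon> t * (K2 * c))" .
      qed simp
      also have "\<dots> = A * bs * K2 * c * \<epsilon> t" by (simp add: A_def)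
      finally show ?thesis .
    qed
    \<comment> \<open>Exact solution of \<open>y' = - B y^2\<close> with initial value
      \<open>M0\<close>.\<close>
    define y where "y t = M0 / (1 + B * M0 * t)" for t
    have y_meas [measurable]: "y \<in> borel_measurable borel" unfolding y_def by measurable
    have y: "0 \<le> y t" "y t \<le> M0" if t: "0 \<le> t" for t
    proof -
      have "1 \<le> 1 + B * M0 * t" using B_pos M0 t by simp
      then have "0 \<le> M0 / (1 + B * M0 * t)" "M0 / (1 + B * M0 * t) \<le> M0 / 1"
        using M0 by (auto intro!: divide_left_mono divide_nonneg_nonneg simp del: div_by_1)
      then show "0 \<le> y t" "y t \<le> M0" by (simp_all add: y_def)
    qed
    have y_eq: "y t = M0 - B * (LBINT s:{0..t}. (y s)\<^sup>2)" if "0 \<le> t" for t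
      unfolding y_def by (rule logistic_integral[OF M0(1) that])
    define L where "L = 2 * B * (c * A)"
    have L: "0 < L" unfolding L_def using pos c by simp
    define \<delta>' where "\<delta>' = C4 / T\<^sup>2"
    have zle: "\<bar>?m t - y t\<bar> \<le> \<delta>' + L * (LBINT s:{0..t}. \<bar>?m s - y s\<bar>)" if t: "0 \<le> t" "t \<le> T" for t
    proof -
      have ik: "set_integrable lborel {0..t} ?k"
        by (rule set_integrable_bounded[where c="bs * A"]) (use k_nonneg[OF mild] k_le[OF mild] in \<open>auto simp: A_def abs_of_nonneg\<close>)
      have im2: "set_integrable lborel {0..t} (\<lambda>s. B * (?m s)\<^sup>2)"
      proof (rule set_integrable_bounded[where c="B * M0\<^sup>2"])
        show "\<bar>B * (?m s)\<^sup>2\<bar> \<le> B * M0\<^sup>2" if "s \<in> {0..t}" for s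
          using m[of s] that B_pos by (simp add: abs_mult power_mono)
      qed measurable
      have iy2: "set_integrable lborel {0..t} (\<lambda>s. B * (y s)\<^sup>2)"
      proof (rule set_integrable_bounded[where c="B * M0\<^sup>2"])
        show "\<bar>B * (y s)\<^sup>2\<bar> \<le> B * M0\<^sup>2" if "s \<in> {0..t}" for s
          using y[of s] that B_pos by (simp add: abs_mult power_mono)
      qed measurable
      have iz: "set_integrable lborel {0..t} (\<lambda>s. L * \<bar>?m s - y s\<bar>)"
      proof (rule set_integrable_bounded[where c="L * M0"])
        show "\<bar>L * \<bar>?m s - y s\<bar>\<bar> \<le> L * M0" if "s \<in> {0..t}" for s
          using y[of s] m[of s] that L by (simp add: abs_mult)
      qed measurable
      have ie: "set_integrable lborel {0..t} (\<lambda>s. A * bs * K2 * c * \<epsilon> s)"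
        unfolding \<epsilon>_def by (intro borel_integrable_atLeastAtMost' continuous_intros)
      have iexp: "set_integrable lborel {0..t} (\<lambda>s. H * c * exp (- lam * s))"
        by (intro borel_integrable_atLeastAtMost' continuous_intros)
      have ic: "set_integrable lborel {0..t} (\<lambda>s. H * bs * n\<^sup>2 / lam)"
        by (intro borel_integrable_atLeastAtMost' continuous_intros)
      have e1: "?m t - y t = - (LBINT s:{0..t}. ?k s - B * (?m s)\<^sup>2) - (LBINT s:{0..t}. B * (?m s)\<^sup>2 - B * (y s)\<^sup>2)"
        unfolding m_eq[OF t(1)] y_eq[OF t(1)] set_integral_diff(2)[OF ik im2] set_integral_diff(2)[OF im2 iy2]
        by (simp add: set_integral_mult_right)
      have e2: "\<bar>LBINT s:{0..t}. ?k s - B * (?m s)\<^sup>2\<bar> \<le> (LBINT s:{0..t}. A * bs * K2 * c * \<epsilon> s)"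
      proof -
        have "\<bar>LBINT s:{0..t}. ?k s - B * (?m s)\<^sup>2\<bar> \<le> (LBINT s:{0..t}. \<bar>?k s - B * (?m s)\<^sup>2\<bar>)"
          using set_integral_norm_bound[OF set_integral_diff(1)[OF ik im2]] by simp
        also have "\<dots> \<le> (LBINT s:{0..t}. A * bs * K2 * c * \<epsilon> s)"
          by (rule set_integral_mono[OF set_integrable_abs[OF set_integral_diff(1)[OF ik im2]] ie]) (rule kB, simp)
        finally show ?thesis .
      qed
      have e3: "\<bar>LBINT s:{0..t}. B * (?m s)\<^sup>2 - B * (y s)\<^sup>2\<bar> \<le> (LBINT s:{0..t}. L * \<bar>?m s - y s\<bar>)"
      proof -
        have "\<bar>LBINT s:{0..t}. B * (?m s)\<^sup>2 - B * (y s)\<^sup>2\<bar> \<le> (LBINT s:{0..t}. \<bar>B * (?m s)\<^sup>2 - B * (y s)\<^sup>2\<bar>)"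
          using set_integral_norm_bound[OF set_integral_diff(1)[OF im2 iy2]] by simp
        also have "\<dots> \<le> (LBINT s:{0..t}. L * \<bar>?m s - y s\<bar>)"
        proof (rule set_integral_mono[OF set_integrable_abs[OF set_integral_diff(1)[OF im2 iy2]] iz])
          fix s assume s: "s \<in> {0..t}"
          have "B * (?m s)\<^sup>2 - B * (y s)\<^sup>2 = B * ((?m s + y s) * (?m s - y s))"
            by (simp add: power2_eq_square algebra_simps)
          also have "\<bar>\<dots>\<bar> = B * (?m s + y s) * \<bar>?m s - y s\<bar>"
            using m[of s] y[of s] s B_pos by (simp add: abs_mult)
          also have "\<dots> \<le> B * (2 * (c * A)) * \<bar>?m s - y s\<bar>"
            using m[of s] y[of s] s B_pos M0 by (intro mult_right_mono mult_left_mono) auto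
          finally show "\<bar>B * (?m s)\<^sup>2 - B * (y s)\<^sup>2\<bar> \<le> L * \<bar>?m s - y s\<bar>" by (simp add: L_def)
        qed
        finally show ?thesis .
      qed
      have e4: "(LBINT s:{0..t}. A * bs * K2 * c * \<epsilon> s) \<le> \<delta>'"
      proof -
        have "(LBINT s:{0..t}. \<epsilon> s) = H * c * (LBINT s:{0..t}. exp (- lam * s)) + H * bs * n\<^sup>2 / lam * t"
          unfolding \<epsilon>_def set_integral_add(2)[OF iexp ic] using t
          by (simp add: set_integral_mult_right set_integral_const)
        also have "\<dots> \<le> H * c * (1 / lam) + H * bs * n\<^sup>2 / lam * T"
          using pos c t by (intro add_mono mult_left_mono exp_integral_le[OF lam]) auto
        finally have "A * bs * K2 * c * (LBINT s:{0..t}. \<epsilon> s) \<le> A * bs * K2 * c * (H * c * (1 / lam) + H * bs * n\<^sup>2 / lam * T)"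
          using pos K2 c by (intro mult_left_mono) auto
        also have "\<dots> = \<delta>'"
          unfolding \<delta>'_def C4_def n_def c_def using T lam by (simp add: field_simps power2_eq_square power3_eq_cube)
        finally show ?thesis by (simp add: set_integral_mult_right)
      qed
      have "\<bar>?m t - y t\<bar> \<le> \<delta>' + (LBINT s:{0..t}. L * \<bar>?m s - y s\<bar>)"
        using e1 e2 e3 e4 by linarith
      then show ?thesis by (simp add: set_integral_mult_right)
    qed
    have "\<bar>?m T - y T\<bar> \<le> 2 * \<delta>' * exp (2 * L * T)"
    proof (rule gronwall[where M=M0, OF _ _ L zle])
      show "0 \<le> \<bar>?m t - y t\<bar> \<and> \<bar>?m t - y t\<bar> \<le> M0" if "0 \<le> t" for t
        using m[OF that] y[OF that] by auto
    qed (use T in auto)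
    also have "2 * L * T = 4 * B * C * A" using T by (simp add: L_def c_def)
    finally have z: "\<bar>?m T - y T\<bar> \<le> 2 * \<delta>' * exp (4 * B * C * A)" .
    have T0: "0 \<le> T" using T by simp
    have Ty: "T * (\<integral>y. v0 y \<partial>\<mu>) / (1 + B * (T * (\<integral>y. v0 y \<partial>\<mu>))) = T * y T"
      by (simp add: y_def M0_def mult_ac)
    have "T * v T x - \<Theta> x * (T * y T) = T * (v T x - \<Theta> x * ?m T) + T * (\<Theta> x * (?m T - y T))"
      by (simp add: algebra_simps)
    then have "\<bar>T * v T x - \<Theta> x * (T * y T)\<bar> \<le> T * \<bar>v T x - \<Theta> x * ?m T\<bar> + T * (\<Theta> x * \<bar>?m T - y T\<bar>)"
      using T0 \<Theta>_pos[of x] abs_triangle_ineq[of "T * (v T x - \<Theta> x * ?m T)" "T * (\<Theta> x * (?m T - y T))"]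
      by (simp add: abs_mult)
    also have "\<dots> \<le> T * \<epsilon> T + T * (\<theta>s * (2 * \<delta>' * exp (4 * B * C * A)))"
      using T0 \<Theta>_pos[of x] \<Theta>_le[of x] \<theta>s_pos z close[OF T0, of x]
      by (intro add_mono mult_left_mono mult_mono) auto
    also have "\<dots> = H * C * exp (- lam * T) + (H * bs * K\<^sup>2 * C\<^sup>2 / lam) * (1 / T) + (\<theta>s * (2 * C4 * exp (4 * B * C * A))) * (1 / T)"
      unfolding \<epsilon>_def \<delta>'_def n_def c_def using T lam by (simp add: field_simps power2_eq_square)
    also have "\<dots> \<le> C' * exp (- lam * T) + C' * (1 / T)"
    proof -
      define X where "X = H * bs * K\<^sup>2 * C\<^sup>2 / lam"
      define Y where "Y = \<theta>s * (2 * C4 * exp (4 * B * C * A))"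
      have X: "0 \<le> X" unfolding X_def using pos by (intro divide_nonneg_nonneg mult_nonneg_nonneg) auto
      have Y: "0 \<le> Y" unfolding Y_def using pos C4 by (intro mult_nonneg_nonneg) auto
      have "H * C * exp (- lam * T) \<le> C' * exp (- lam * T)"
        using X Y unfolding C'_def X_def[symmetric] Y_def[symmetric] by (intro mult_right_mono) auto
      moreover have "X * (1 / T) + Y * (1 / T) \<le> C' * (1 / T)"
        using pos T unfolding C'_def X_def[symmetric] Y_def[symmetric] distrib_right[symmetric]
        by (intro mult_right_mono) auto
      ultimately show ?thesis unfolding X_def Y_def by linarith
    qed
    finally show ?thesis unfolding Ty by (simp add: distrib_left)
  qed
  show ?thesis by (intro exI[of _ C'] allI impI) (rule main)
qed

end

section \<open>Upper bound for the survival probability\<close>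

context critical_semigroup
begin

context
  fixes v
  assumes surv: "mild (\<lambda>_. 1) v"
begin

abbreviation (input) mv where "mv \<equiv> m v"

text \<open>The supremum runs over all later times as well; this makes it nonincreasing, like the
  mass with which it will be compared.\<close>

definition n :: "real \<Rightarrow> real" where
  "n t = (SUP p\<in>{t..} \<times> UNIV. v (fst p) (snd p))"

lemma n_bound: "t \<le> s \<Longrightarrow> v s y \<le> n t"
proof -
  assume "t \<le> s"
  moreover have "bdd_above ((\<lambda>p. v (fst p) (snd p)) ` ({t..} \<times> UNIV))"
    using v_bounds[OF surv] by (intro bdd_aboveI2[where M=1]) auto
  ultimately show ?thesis
    unfolding n_def using cSUP_upper[of "(s, y)" "{t..} \<times> UNIV" "\<lambda>p. v (fst p) (snd p)"] by auto
qed

lemma n_least: "(\<And>s y. t \<le> s \<Longrightarrow> v s y \<le> c) \<Longrightarrow> n t \<le> c"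
  unfolding n_def by (intro cSUP_least) auto

lemma n_nonneg: "0 \<le> n t"
  using n_bound[of t t 0] v_bounds(1)[OF surv, of t 0] by linarith

lemma n_le_1: "n t \<le> 1"
  using v_bounds[OF surv] by (intro n_least) auto

lemma n_antimono: "s \<le> t \<Longrightarrow> n t \<le> n s"
  by (rule n_least) (auto intro: n_bound)

lemma v_bm_n: "bm (n s) (v s)"
  using v_bm[OF surv, of s] n_bound[of s s] by (auto simp: bm_def)

lemma v_step_upper:
  assumes "0 \<le> s" "0 \<le> r"
  shows "v (s + r) x \<le> \<Theta> x * mv s + H * exp (- lam * r) * n s"
  using v_le_S[OF restart[OF surv assms(1)] assms(2), of x] S_gap[OF assms(2) v_bm_n, of s x]
  by (simp add: m_def[OF surv] mult_ac)

lemma n_step: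
  assumes "0 \<le> t" "0 \<le> r"
  shows "n (t + r) \<le> \<theta>s * mv t + H * exp (- lam * r) * n t"
proof (rule n_least)
  fix s y assume s: "t + r \<le> s"
  have s': "0 \<le> s - r" "t \<le> s - r" using s assms by auto
  have "v s y \<le> \<Theta> y * mv (s - r) + H * exp (- lam * r) * n (s - r)"
    using v_step_upper[OF s'(1) assms(2), of y] by simp
  also have "\<dots> \<le> \<theta>s * mv t + H * exp (- lam * r) * n t"
    using s' assms H \<theta>s_pos \<Theta>_le[of y] m_nonneg[OF surv]
    by (intro add_mono mult_mono mult_left_mono n_antimono m_mono[OF surv]) auto
  finally show "v s y \<le> \<theta>s * mv t + H * exp (- lam * r) * n t" .
qed

lemma m_step:
  assumes "0 \<le> t" "0 \<le> r"
  shows "(1 - bs * r * n t) * mv t \<le> mv (t + r)"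
  using m_drop[OF surv, of t "t + r" "n t"] assms n_bound by simp

text \<open>The nonlinear term is at most \<open>bs * r * n t\<close> times the linear one: bound
  one factor of \<open>v^2\<close> by \<open>n t\<close>, the other by the linear flow, and use the
  semigroup property.\<close>

lemma v_step_lower:
  assumes t: "0 \<le> t" and r: "0 \<le> r"
  shows "(1 - bs * r * n t) * S r (v t) x \<le> v (t + r) x"
proof -
  define w where "w q = v (t + q)" for q
  have w: "mild (v t) w" unfolding w_def by (rule restart[OF surv t])
  have "e w r x \<le> (LBINT q:{0..r}. bs * n t * S r (v t) x)"
    unfolding e_def[OF w]
  proof (rule set_integral_mono)
    show "set_integrable lborel {0..r} (\<lambda>q. S q (bv w (r - q)) x)"
      by (rule set_integrable_bounded[OF S_bv_meas[OF w], where c="exp (bs * r) * bs"])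
         (auto simp: S_nonneg abs_of_nonneg intro: S_bv_le[OF w])
    show "set_integrable lborel {0..r} (\<lambda>q. bs * n t * S r (v t) x)"
      by (intro borel_integrable_atLeastAtMost' continuous_intros)
    fix q assume q: "q \<in> {0..r}"
    have bw: "bm 1 (w (r - q))" by (rule v_bm[OF w])
    have bS: "bm (exp (bs * (r - q)) * 1) (S (r - q) (v t))"
      using q by (intro bm_S v_bm[OF surv]) auto
    have nw: "w (r - q) y \<le> n t" for y
      unfolding w_def using q by (intro n_bound) auto
    have "S q (bv w (r - q)) x \<le> S q (\<lambda>y. bs * n t * w (r - q) y) x"
    proof (rule S_mono)
      show "bm bs (bv w (r - q))" by (rule bv_bm1[OF w])
      show "bm (bs * n t * 1) (\<lambda>y. bs * n t * w (r - q) y)"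
        using bw bs_nonneg n_nonneg by (intro bm_mult) (auto simp: bm_def)
      show "bv w (r - q) y \<le> bs * n t * w (r - q) y" for y
      proof -
        have "b y * (w (r - q) y * w (r - q) y) \<le> bs * (n t * w (r - q) y)"
          using bm_bounds[OF bw, of y] nw[of y] b_nonneg b_le bs_nonneg n_nonneg by (intro mult_mono) auto
        then show ?thesis by (simp add: bv_def[OF w] power2_eq_square mult.assoc)
      qed
    qed (use q in auto)
    also have "\<dots> = bs * n t * S q (w (r - q)) x"
      using bs_nonneg n_nonneg by (intro S_cmult[OF bw]) auto
    also have "S q (w (r - q)) x \<le> S q (S (r - q) (v t)) x"
      by (rule S_mono[OF _ bw bS]) (use q v_le_S[OF w] in auto)
    also have "\<dots> = S r (v t) x"
      using S_semigroup[OF _ _ v_bm[OF surv, of t], of q "r - q" x] q by simp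
    finally show "S q (bv w (r - q)) x \<le> bs * n t * S r (v t) x"
      using bs_nonneg n_nonneg by (simp add: mult_left_mono)
  qed
  also have "\<dots> = bs * r * n t * S r (v t) x"
    using r by (simp add: set_integral_const)
  finally show ?thesis
    using mild_real[OF w r, of x] by (simp add: w_def algebra_simps)
qed

lemma m_start: "mv 0 = A"
proof -
  have "(LBINT q:{0..0}. k v q) = (LBINT q:{0..0}. k v q) + (LBINT q:{0..0}. k v q)"
    by (rule LBINT_split[OF k_meas[OF surv], of "bs * measure \<mu> UNIV"])
       (use k_nonneg[OF surv] k_le[OF surv] in \<open>auto simp: abs_of_nonneg\<close>)
  then show ?thesis using m_0[OF surv, of 0] by (simp add: A_def)
qed

text \<open>A step of length \<open>1 / (2 * bs)\<close> loses at most half of the mass, because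
  \<open>n\<close> is at most 1.\<close>

lemma m_pos: "0 \<le> t \<Longrightarrow> 0 < mv t"
proof -
  assume t: "0 \<le> t"
  define h where "h = 1 / (2 * bs)"
  have h: "0 < h" using bs_pos by (simp add: h_def)
  have pos: "0 < mv (real j * h)" for j
  proof (induction j)
    case 0
    then show ?case using m_start A_pos by simp
  next
    case (Suc j)
    have "bs * h * n (real j * h) \<le> 1 / 2 * 1"
      using n_le_1 n_nonneg bs_pos by (simp add: h_def)
    then have "1 / 2 * mv (real j * h) \<le> (1 - bs * h * n (real j * h)) * mv (real j * h)"
      using Suc by (intro mult_right_mono) auto
    also have "\<dots> \<le> mv (real j * h + h)" using h by (intro m_step) auto
    finally show ?case using Suc by (simp add: algebra_simps)
  qed
  obtain j where "t / h \<le> real j" using real_arch_simple by blast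
  then have "t \<le> real j * h" using h by (simp add: divide_le_eq)
  then show ?thesis using pos[of j] m_mono[OF surv t, of "real j * h"] by linarith
qed

text \<open>Let \<open>L\<close> be the infimum of the mass. After a near-minimal time the mass
  hardly decreases, so \<open>k\<close>, and with it the integral of \<open>b v\<close>, is small at
  some time \<open>s\<close>. But \<open>v s\<close> is close in mean to the linear flow
  \<open>S r (v t)\<close> with \<open>t = s - r\<close>, whose integral against \<open>b\<close> is
  nearly \<open>B1\<close> times the mass, at least \<open>B1 * L\<close>. Hence
  \<open>L \<le> 0\<close>.\<close>

lemma m_tends_0:
  assumes "0 < \<epsilon>"
  shows "\<exists>t\<ge>0. mv t < \<epsilon>"
proof -
  define L where "L = (INF t\<in>{0..}. mv t)"
  have bdd: "bdd_below (mv ` {0..})" using m_nonneg[OF surv] by (intro bdd_belowI2[where m=0]) auto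
  have L_le: "L \<le> mv t" if "0 \<le> t" for t
    unfolding L_def using that bdd by (intro cINF_lower) auto
  define bb where "bb = (\<integral>y. b y \<partial>\<mu>)"
  have bb: "0 \<le> bb" unfolding bb_def by (rule bm_integral_nonneg[OF bm_b])
  \<comment> \<open>\<open>\<eta>\<close> measures near-minimality and \<open>r\<close> is the time
    allowed for alignment. The limits are taken with \<open>\<eta>\<close> to 0 for fixed
    \<open>r\<close>, then \<open>r\<close> to infinity.\<close>
  have key: "B1 * L \<le> \<eta> * bb + \<eta> + H * exp (- lam * r) * bb + bs * \<eta>\<^sup>2" if \<eta>: "0 < \<eta>" and r: "0 \<le> r" for \<eta> r
  proof -
    have "L < L + \<eta>\<^sup>2" using \<eta> by simp
    then have "\<exists>p\<in>{0..}. mv p < L + \<eta>\<^sup>2"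
      using cINF_less_iff[of "{0..}" mv "L + \<eta>\<^sup>2", OF _ bdd] by (simp add: L_def)
    then obtain p where p: "0 \<le> p" "mv p < L + \<eta>\<^sup>2" by auto
    \<comment> \<open>The window has length 1, so values of \<open>k\<close> above
      \<open>\<eta>\<^sup>2\<close> throughout would take the mass below \<open>L\<close>.\<close>
    have "\<exists>s\<in>{p + r..p + r + 1}. k v s \<le> \<eta>\<^sup>2"
    proof (rule ccontr)
      assume "\<not> ?thesis"
      then have gt: "\<eta>\<^sup>2 < k v s" if "s \<in> {p + r..p + r + 1}" for s using that by (auto simp: not_le)
      have "(LBINT s:{p + r..p + r + 1}. \<eta>\<^sup>2) \<le> (LBINT s:{p + r..p + r + 1}. k v s)"
      proof (rule set_integral_mono)
        show "set_integrable lborel {p + r..p + r + 1} (k v)"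
          by (rule set_integrable_bounded[where c="bs * measure \<mu> UNIV"])
             (use k_meas[OF surv] k_nonneg[OF surv] k_le[OF surv] in \<open>auto simp: abs_of_nonneg\<close>)
        show "set_integrable lborel {p + r..p + r + 1} (\<lambda>s. \<eta>\<^sup>2)"
          by (intro borel_integrable_atLeastAtMost' continuous_intros)
      qed (use gt in \<open>auto intro: less_imp_le\<close>)
      then have "\<eta>\<^sup>2 \<le> (LBINT s:{p + r..p + r + 1}. k v s)" by (simp add: set_integral_const)
      then have "\<eta>\<^sup>2 \<le> mv (p + r) - mv (p + r + 1)"
        using m_diff[OF surv, of "p + r" "p + r + 1"] p r by simp
      moreover have "mv (p + r) \<le> mv p" using p r by (intro m_mono[OF surv]) auto
      moreover have "L \<le> mv (p + r + 1)" using p r by (intro L_le) auto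
      ultimately show False using p(2) by linarith
    qed
    then obtain s where s: "p + r \<le> s" "k v s \<le> \<eta>\<^sup>2" by auto
    define t where "t = s - r"
    have t: "0 \<le> t" "p \<le> t" using s p by (auto simp: t_def)
    define w where "w q = v (t + q)" for q
    have w: "mild (v t) w" unfolding w_def by (rule restart[OF surv t(1)])
    have wr: "w r = v s" by (simp add: w_def t_def)
    have bS: "bm (exp (bs * r) * 1) (S r (v t))" by (intro bm_S r v_bm[OF surv])
    have iS: "integrable \<mu> (S r (v t))" by (rule bm_integrable[OF bS])
    have iv: "integrable \<mu> (v s)" by (rule bm_integrable[OF v_bm[OF surv]])
    have ibS: "integrable \<mu> (\<lambda>y. b y * S r (v t) y)" by (rule bm_integrable[OF bm_mult[OF bm_b bS]])
    have ibv: "integrable \<mu> (\<lambda>y. b y * v s y)" by (rule bm_integrable[OF bm_mult[OF bm_b v_bm[OF surv]]])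
    have ib: "integrable \<mu> b" by (rule bm_integrable[OF bm_b])
    have ib\<Theta>: "integrable \<mu> (\<lambda>y. b y * \<Theta> y)" by (rule bm_integrable[OF bm_b\<Theta>])
    have ibvv: "integrable \<mu> (bv v s)" by (rule bm_integrable[OF bv_bm1[OF surv]])
    have "(\<integral>y. b y * S r (v t) y \<partial>\<mu>) - (\<integral>y. b y * v s y \<partial>\<mu>) = (\<integral>y. b y * (S r (v t) y - v s y) \<partial>\<mu>)"
      using ibS ibv by (simp add: right_diff_distrib)
    also have "\<dots> \<le> (\<integral>y. bs * (S r (v t) y - v s y) \<partial>\<mu>)"
    proof (rule integral_mono)
      show "integrable \<mu> (\<lambda>y. b y * (S r (v t) y - v s y))" using ibS ibv by (simp add: right_diff_distrib)
      show "integrable \<mu> (\<lambda>y. bs * (S r (v t) y - v s y))" using iS iv by simp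
      fix y
      have "0 \<le> S r (v t) y - v s y" using v_le_S[OF w r, of y] by (simp add: wr)
      then show "b y * (S r (v t) y - v s y) \<le> bs * (S r (v t) y - v s y)"
        by (intro mult_right_mono b_le)
    qed
    also have "\<dots> = bs * (mv t - mv s)"
      using iS iv S_invariant[OF r v_bm[OF surv], of t] by (simp add: m_def[OF surv])
    also have "\<dots> \<le> bs * \<eta>\<^sup>2"
    proof -
      have "mv t \<le> mv p" using t p by (intro m_mono[OF surv]) auto
      moreover have "L \<le> mv s" using s p r by (intro L_le) auto
      ultimately show ?thesis using p(2) bs_nonneg by (intro mult_left_mono) auto
    qed
    finally have 1: "(\<integral>y. b y * S r (v t) y \<partial>\<mu>) \<le> (\<integral>y. b y * v s y \<partial>\<mu>) + bs * \<eta>\<^sup>2" by simp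
    have "(\<integral>y. b y * v s y \<partial>\<mu>) \<le> (\<integral>y. \<eta> * b y + bv v s y / \<eta> \<partial>\<mu>)"
    proof (rule integral_mono[OF ibv])
      show "integrable \<mu> (\<lambda>y. \<eta> * b y + bv v s y / \<eta>)" using ib ibvv by simp
      fix y
      \<comment> \<open>Trades the first power of \<open>v\<close> for its square, which is the
        quantity that \<open>k\<close> controls.\<close>
      have "0 \<le> (v s y - \<eta>)\<^sup>2 + v s y * \<eta>" using v_bounds[OF surv, of s y] \<eta> by simp
      then have "\<eta> * v s y \<le> \<eta>\<^sup>2 + (v s y)\<^sup>2" by (simp add: power2_eq_square algebra_simps)
      then have "v s y \<le> \<eta> + (v s y)\<^sup>2 / \<eta>" using \<eta> by (simp add: field_simps power2_eq_square)
      then have "b y * v s y \<le> b y * (\<eta> + (v s y)\<^sup>2 / \<eta>)" using b_nonneg by (intro mult_left_mono)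
      then show "b y * v s y \<le> \<eta> * b y + bv v s y / \<eta>" by (simp add: bv_def[OF surv] distrib_left mult.commute)
    qed
    also have "\<dots> = \<eta> * bb + k v s / \<eta>" using ib ibvv by (simp add: bb_def k_def[OF surv])
    also have "\<dots> \<le> \<eta> * bb + \<eta>"
      using s(2) \<eta> by (simp add: divide_le_eq power2_eq_square)
    finally have 2: "(\<integral>y. b y * v s y \<partial>\<mu>) \<le> \<eta> * bb + \<eta>" .
    have "B1 * mv t - H * exp (- lam * r) * bb = (\<integral>y. mv t * (b y * \<Theta> y) - H * exp (- lam * r) * b y \<partial>\<mu>)"
      using ib ib\<Theta> by (simp add: B1_def bb_def mult.commute)
    also have "\<dots> \<le> (\<integral>y. b y * S r (v t) y \<partial>\<mu>)"
    proof (rule integral_mono[OF _ ibS])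
      show "integrable \<mu> (\<lambda>y. mv t * (b y * \<Theta> y) - H * exp (- lam * r) * b y)" using ib ib\<Theta> by simp
      fix y
      have "\<Theta> y * mv t - H * exp (- lam * r) \<le> S r (v t) y"
        using S_gap[OF r v_bm[OF surv], of t y] by (simp add: m_def[OF surv])
      then have "b y * (\<Theta> y * mv t - H * exp (- lam * r)) \<le> b y * S r (v t) y"
        using b_nonneg by (intro mult_left_mono)
      then show "mv t * (b y * \<Theta> y) - H * exp (- lam * r) * b y \<le> b y * S r (v t) y"
        by (simp add: algebra_simps)
    qed
    finally have 3: "B1 * mv t - H * exp (- lam * r) * bb \<le> (\<integral>y. b y * S r (v t) y \<partial>\<mu>)" .
    have "B1 * L \<le> B1 * mv t" using B1_pos t by (intro mult_left_mono L_le) auto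
    then show ?thesis using 1 2 3 by linarith
  qed
  have "B1 * L \<le> H * exp (- lam * r) * bb" if r: "0 \<le> r" for r
  proof -
    have "((\<lambda>\<eta>. \<eta> * bb + \<eta> + H * exp (- lam * r) * bb + bs * \<eta>\<^sup>2) \<longlongrightarrow> 0 * bb + 0 + H * exp (- lam * r) * bb + bs * 0\<^sup>2) (at_right 0)"
      by (intro tendsto_intros)
    then have "B1 * L \<le> 0 * bb + 0 + H * exp (- lam * r) * bb + bs * 0\<^sup>2"
      by (rule tendsto_lowerbound) (use key[OF _ r] in \<open>auto simp: eventually_at_filter\<close>)
    then show ?thesis by simp
  qed
  moreover have "((\<lambda>r. H * exp (- lam * r) * bb) \<longlongrightarrow> H * 0 * bb) at_top"
    by (intro tendsto_intros exp_lam_tendsto)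
  ultimately have "B1 * L \<le> H * 0 * bb"
    by (intro tendsto_lowerbound[where F=at_top and f="\<lambda>r. H * exp (- lam * r) * bb"])
       (auto intro: eventually_at_top_linorderI[of 0])
  then have "L \<le> 0" using B1_pos by (simp add: mult_le_0_iff)
  then have "L < \<epsilon>" using assms by simp
  then show ?thesis using cINF_less_iff[of "{0..}" mv, OF _ bdd] unfolding L_def by auto
qed

lemma exp_lam_small: "0 < \<epsilon> \<Longrightarrow> \<exists>r>0. H * exp (- lam * r) * c \<le> \<epsilon>"
proof -
  assume \<epsilon>: "0 < \<epsilon>"
  have "((\<lambda>r. H * exp (- lam * r) * c) \<longlongrightarrow> H * 0 * c) at_top"
    by (intro tendsto_intros exp_lam_tendsto)
  then have "eventually (\<lambda>r. H * exp (- lam * r) * c < \<epsilon>) at_top"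
    using \<epsilon> by (intro order_tendstoD) auto
  then have "eventually (\<lambda>r. H * exp (- lam * r) * c < \<epsilon> \<and> 0 < r) at_top"
    using eventually_gt_at_top[of 0] by eventually_elim simp
  then obtain r where "H * exp (- lam * r) * c < \<epsilon> \<and> 0 < r"
    using eventually_happens' trivial_limit_at_top_linorder by blast
  then show ?thesis by (intro exI[of _ r]) auto
qed

text \<open>One application of \<open>n_step\<close>: wait until the mass is small, then until the
  exponential remainder is.\<close>

lemma n_tends_0:
  assumes \<epsilon>: "0 < \<epsilon>"
  shows "\<exists>t\<ge>0. n t \<le> \<epsilon>"
proof -
  obtain r where r: "0 < r" "H * exp (- lam * r) * 1 \<le> \<epsilon> / 2"
    using exp_lam_small[of "\<epsilon> / 2" 1] \<epsilon> by auto
  obtain t where t: "0 \<le> t" "mv t < \<epsilon> / (2 * \<theta>s)"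
    using m_tends_0[of "\<epsilon> / (2 * \<theta>s)"] \<epsilon> \<theta>s_pos by auto
  have "n (t + r) \<le> \<theta>s * mv t + H * exp (- lam * r) * n t" using t r by (intro n_step) auto
  also have "\<dots> \<le> \<epsilon> / 2 + H * exp (- lam * r) * 1"
  proof (intro add_mono mult_left_mono n_le_1)
    show "\<theta>s * mv t \<le> \<epsilon> / 2" using t(2) \<theta>s_pos by (simp add: field_simps)
  qed (use H in auto)
  also have "\<dots> \<le> \<epsilon>" using r by simp
  finally show ?thesis using t r by (intro exI[of _ "t + r"]) auto
qed

text \<open>Along the lattice \<open>t0 + j r\<close> the supremum is contracted by
  \<open>1 / 4\<close> up to a multiple of the mass, whereas the mass loses at most a half; hence
  their ratio stays bounded. Monotonicity of both fills the gaps of the lattice at the cost of a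
  factor 2.\<close>

lemma n_le_ratio: "\<exists>R t0. 0 < R \<and> 0 \<le> t0 \<and> (\<forall>t\<ge>t0. n t \<le> R * mv t)"
proof -
  obtain r where r: "0 < r" "H * exp (- lam * r) * 1 \<le> 1 / 4"
    using exp_lam_small[of "1 / 4" 1] by auto
  obtain t0 where t0: "0 \<le> t0" "n t0 \<le> 1 / (2 * bs * r)"
    using n_tends_0[of "1 / (2 * bs * r)"] bs_pos r by auto
  \<comment> \<open>The first entry closes the induction, since then
    \<open>\<theta>s + \<rho> / 4 \<le> \<rho> / 2\<close>; the second starts it.\<close>
  define \<rho> where "\<rho> = max (4 * \<theta>s) (n t0 / mv t0)"
  have \<rho>: "0 < \<rho>" "4 * \<theta>s \<le> \<rho>" using \<theta>s_pos by (auto simp: \<rho>_def)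
  have half: "mv t / 2 \<le> mv (t + r)" if t: "t0 \<le> t" for t
  proof -
    have "bs * r * n t \<le> bs * r * (1 / (2 * bs * r))"
      using t0 n_antimono[OF t] bs_pos r by (intro mult_left_mono) auto
    also have "\<dots> = 1 / 2" using bs_pos r by simp
    finally have "1 / 2 * mv t \<le> (1 - bs * r * n t) * mv t"
      using m_nonneg[OF surv] by (intro mult_right_mono) auto
    also have "\<dots> \<le> mv (t + r)" using t t0 r by (intro m_step) auto
    finally show ?thesis by simp
  qed
  have lattice: "n (t0 + real j * r) \<le> \<rho> * mv (t0 + real j * r)" for j
  proof (induction j)
    case 0
    have "n t0 = n t0 / mv t0 * mv t0" using m_pos[OF t0(1)] by simp
    also have "\<dots> \<le> \<rho> * mv t0" using m_pos[OF t0(1)] by (intro mult_right_mono) (auto simp: \<rho>_def)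
    finally show ?case by simp
  next
    case (Suc j)
    define t where "t = t0 + real j * r"
    have t: "0 \<le> t" "t0 \<le> t" using t0 r by (auto simp: t_def)
    have "n (t + r) \<le> \<theta>s * mv t + H * exp (- lam * r) * n t" using t r by (intro n_step) auto
    also have "\<dots> \<le> \<theta>s * mv t + 1 / 4 * (\<rho> * mv t)"
      using r Suc n_nonneg unfolding t_def[symmetric] by (intro add_left_mono mult_mono) auto
    also have "\<dots> \<le> \<rho> / 2 * mv t"
      using \<rho> m_nonneg[OF surv, of t] mult_right_mono[OF \<rho>(2), of "mv t"] by simp
    also have "\<dots> \<le> \<rho> * mv (t + r)"
      using mult_left_mono[OF half[OF t(2)], of \<rho>] \<rho> by simp
    finally show ?case by (simp add: t_def algebra_simps)
  qed
  have "n t \<le> 2 * \<rho> * mv t" if t: "t0 \<le> t" for t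
  proof -
    define j where "j = nat \<lfloor>(t - t0) / r\<rfloor>"
    have "0 \<le> (t - t0) / r" using t r by simp
    then have "real j \<le> (t - t0) / r" "(t - t0) / r < real j + 1" unfolding j_def by linarith+
    then have j: "t0 + real j * r \<le> t" "t \<le> t0 + real j * r + r"
      using r by (auto simp: field_simps)
    have "n t \<le> n (t0 + real j * r)" by (rule n_antimono[OF j(1)])
    also have "\<dots> \<le> \<rho> * mv (t0 + real j * r)" by (rule lattice)
    also have "\<dots> \<le> \<rho> * (2 * mv (t0 + real j * r + r))"
      using half[of "t0 + real j * r"] r \<rho> by (intro mult_left_mono) auto
    also have "\<dots> \<le> \<rho> * (2 * mv t)"
      using j t t0 \<rho> by (intro mult_left_mono m_mono[OF surv]) auto
    finally show ?thesis by simp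
  qed
  then show ?thesis using \<rho> t0 by (intro exI[of _ "2 * \<rho>"] exI[of _ t0]) auto
qed

text \<open>\<open>r\<close> and \<open>t1\<close> are chosen so that over a time \<open>r\<close>
  both the relative nonlinear loss and the misalignment are at most \<open>\<eta>\<close>. This
  bounds \<open>v\<close> from below by almost \<open>\<Theta> m\<close>, hence \<open>k\<close> by
  almost \<open>B m^2\<close>. Then \<open>1 / m\<close> gains at least \<open>r * \<gamma>\<close>
  per step of length \<open>r\<close>, and its linear growth bounds \<open>T v\<close>.\<close>

lemma survival_upper_eta:
  assumes \<eta>: "0 < \<eta>" "\<eta> < 1" and \<beta>: "0 < (1 - \<eta>)\<^sup>2 * (B - 2 * \<eta> * \<theta>s * bs * A)" (is "0 < ?\<beta>")
  shows "\<exists>T0. \<forall>T>T0. 0 \<le> T \<and> T * v T x \<le> (\<Theta> x + \<eta>) / (?\<beta> * (1 - \<eta>)) * (T / (T - T0))"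
proof -
  obtain R t0 where R: "0 < R" "0 \<le> t0" "\<And>t. t0 \<le> t \<Longrightarrow> n t \<le> R * mv t"
    using n_le_ratio by blast
  obtain r where r: "0 < r" "H * exp (- lam * r) * R \<le> \<eta>"
    using exp_lam_small[of \<eta> R] \<eta> by auto
  obtain t1' where t1': "0 \<le> t1'" "n t1' \<le> \<eta> / (bs * r)"
    using n_tends_0[of "\<eta> / (bs * r)"] \<eta> bs_pos r by auto
  define t1 where "t1 = max t0 t1'"
  have t1: "0 \<le> t1" "t0 \<le> t1" "t1' \<le> t1" using R t1' by (auto simp: t1_def)
  have nr: "bs * r * n t \<le> \<eta>" if "t1 \<le> t" for t
  proof -
    have "bs * r * n t \<le> bs * r * (\<eta> / (bs * r))"
      using n_antimono[of t1' t] that t1 t1' bs_pos r by (intro mult_left_mono) auto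
    then show ?thesis using bs_pos r by simp
  qed
  have Hn: "H * exp (- lam * r) * n t \<le> \<eta> * mv t" if "t1 \<le> t" for t
  proof -
    have "H * exp (- lam * r) * n t \<le> H * exp (- lam * r) * (R * mv t)"
      using that t1 H by (intro mult_left_mono R) auto
    also have "\<dots> = H * exp (- lam * r) * R * mv t" by simp
    also have "\<dots> \<le> \<eta> * mv t" using r m_nonneg[OF surv] by (intro mult_right_mono) auto
    finally show ?thesis .
  qed
  have drop: "(1 - \<eta>) * mv t \<le> mv (t + r)" if t: "t1 \<le> t" for t
  proof -
    have "(1 - \<eta>) * mv t \<le> (1 - bs * r * n t) * mv t"
      using nr[OF t] m_nonneg[OF surv] by (intro mult_right_mono) auto
    also have "\<dots> \<le> mv (t + r)" using t t1 r by (intro m_step) auto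
    finally show ?thesis .
  qed
  have lower: "(1 - \<eta>) * (max 0 (\<Theta> y - \<eta>) * mv s) \<le> v s y" if s: "t1 + r \<le> s" for s y
  proof -
    define t where "t = s - r"
    have t: "t1 \<le> t" "0 \<le> t" using s t1 by (auto simp: t_def)
    have "\<Theta> y * mv t - H * exp (- lam * r) * n t \<le> S r (v t) y"
      using S_gap[OF less_imp_le[OF r(1)] v_bm_n, of t y] by (simp add: m_def[OF surv] mult_ac)
    then have "(\<Theta> y - \<eta>) * mv t \<le> S r (v t) y" using Hn[OF t(1)] by (simp add: left_diff_distrib)
    then have "max 0 (\<Theta> y - \<eta>) * mv t \<le> S r (v t) y" using S_nonneg[of r "v t" y] by (auto simp: max_def)
    moreover have "max 0 (\<Theta> y - \<eta>) * mv s \<le> max 0 (\<Theta> y - \<eta>) * mv t"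
      using t r by (intro mult_left_mono m_mono[OF surv]) (auto simp: t_def)
    ultimately have "max 0 (\<Theta> y - \<eta>) * mv s \<le> S r (v t) y" by linarith
    then have "(1 - \<eta>) * (max 0 (\<Theta> y - \<eta>) * mv s) \<le> (1 - bs * r * n t) * S r (v t) y"
      using nr[OF t(1)] \<eta> m_nonneg[OF surv, of s] by (intro mult_mono) auto
    also have "\<dots> \<le> v (t + r) y" using t r by (intro v_step_lower) auto
    finally show ?thesis by (simp add: t_def)
  qed
  have k_lower: "?\<beta> * (mv s)\<^sup>2 \<le> k v s" if s: "t1 + r \<le> s" for s
  proof -
    have ib: "integrable \<mu> b" by (rule bm_integrable[OF bm_b])
    have i\<Theta>: "integrable \<mu> (\<lambda>y. (\<Theta> y)\<^sup>2 * b y)" by (rule bm_integrable[OF bm_\<Theta>2b])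
    have "B - 2 * \<eta> * \<theta>s * bs * A \<le> B - 2 * \<eta> * \<theta>s * (\<integral>y. b y \<partial>\<mu>)"
      using mult_left_mono[OF integral_b_le, of "2 * \<eta> * \<theta>s"] \<eta> \<theta>s_pos by (simp add: mult_ac)
    also have "\<dots> = (\<integral>y. (\<Theta> y)\<^sup>2 * b y - 2 * \<eta> * \<theta>s * b y \<partial>\<mu>)"
      using ib i\<Theta> by (simp add: B_def)
    finally have "?\<beta> * (mv s)\<^sup>2 \<le> (1 - \<eta>)\<^sup>2 * (\<integral>y. (\<Theta> y)\<^sup>2 * b y - 2 * \<eta> * \<theta>s * b y \<partial>\<mu>) * (mv s)\<^sup>2"
      by (intro mult_right_mono mult_left_mono) auto
    also have "\<dots> = (\<integral>y. (1 - \<eta>)\<^sup>2 * (mv s)\<^sup>2 * ((\<Theta> y)\<^sup>2 * b y - 2 * \<eta> * \<theta>s * b y) \<partial>\<mu>)"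
      by (simp add: mult_ac)
    also have "\<dots> \<le> (\<integral>y. bv v s y \<partial>\<mu>)"
    proof (rule integral_mono)
      show "integrable \<mu> (\<lambda>y. (1 - \<eta>)\<^sup>2 * (mv s)\<^sup>2 * ((\<Theta> y)\<^sup>2 * b y - 2 * \<eta> * \<theta>s * b y))"
        using ib i\<Theta> by simp
      show "integrable \<mu> (bv v s)" by (rule bm_integrable[OF bv_bm1[OF surv]])
      fix y
      \<comment> \<open>Replacing \<open>\<Theta>\<close> by the positive part of
        \<open>\<Theta> - \<eta>\<close> costs at most \<open>2 * \<eta> * \<theta>s\<close> in the
        square; integrated against \<open>b\<close>, this is the correction in
        \<open>?\<beta>\<close>.\<close>
      have sq: "(\<Theta> y)\<^sup>2 - 2 * \<eta> * \<theta>s \<le> (max 0 (\<Theta> y - \<eta>))\<^sup>2"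
      proof (cases "\<Theta> y \<le> \<eta>")
        case True
        have "(\<Theta> y)\<^sup>2 \<le> \<eta> * \<theta>s"
          unfolding power2_eq_square using True \<Theta>_pos[of y] \<Theta>_le[of y] \<eta> by (intro mult_mono) auto
        moreover have "0 \<le> \<eta> * \<theta>s" using \<eta> \<theta>s_pos by simp
        ultimately show ?thesis using True by (simp add: mult.assoc)
      next
        case False
        have "\<eta> * \<Theta> y \<le> \<eta> * \<theta>s" using \<eta> \<Theta>_le by (intro mult_left_mono) auto
        moreover have "(\<Theta> y - \<eta>)\<^sup>2 = (\<Theta> y)\<^sup>2 - 2 * (\<eta> * \<Theta> y) + \<eta>\<^sup>2" by (simp add: power2_eq_square algebra_simps)
        ultimately have "(\<Theta> y)\<^sup>2 - 2 * (\<eta> * \<theta>s) \<le> (\<Theta> y - \<eta>)\<^sup>2" by (smt (verit) zero_le_power2)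
        then show ?thesis using False by simp
      qed
      have "(1 - \<eta>)\<^sup>2 * (mv s)\<^sup>2 * ((\<Theta> y)\<^sup>2 * b y - 2 * \<eta> * \<theta>s * b y) = b y * ((1 - \<eta>)\<^sup>2 * ((mv s)\<^sup>2 * ((\<Theta> y)\<^sup>2 - 2 * \<eta> * \<theta>s)))"
        by (simp add: algebra_simps)
      also have "\<dots> \<le> b y * ((1 - \<eta>)\<^sup>2 * ((mv s)\<^sup>2 * (max 0 (\<Theta> y - \<eta>))\<^sup>2))"
        using b_nonneg sq by (intro mult_left_mono) auto
      also have "\<dots> = b y * ((1 - \<eta>) * (max 0 (\<Theta> y - \<eta>) * mv s))\<^sup>2"
        by (simp add: power_mult_distrib mult_ac)
      also have "\<dots> \<le> b y * (v s y)\<^sup>2"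
        using \<eta> m_nonneg[OF surv, of s] by (intro mult_left_mono power_mono lower s b_nonneg mult_nonneg_nonneg) auto
      finally show "(1 - \<eta>)\<^sup>2 * (mv s)\<^sup>2 * ((\<Theta> y)\<^sup>2 * b y - 2 * \<eta> * \<theta>s * b y) \<le> bv v s y"
        by (simp add: bv_def[OF surv])
    qed
    finally show ?thesis by (simp add: k_def[OF surv])
  qed
  define bt where "bt = ?\<beta>"
  have bt: "0 < bt" unfolding bt_def by (rule \<beta>)
  define t2 where "t2 = t1 + r"
  have t2: "0 \<le> t2" "t1 \<le> t2" using t1 r by (auto simp: t2_def)
  define \<gamma> where "\<gamma> = bt * (1 - \<eta>)"
  have \<gamma>: "0 < \<gamma>" unfolding \<gamma>_def using bt \<eta> by (intro mult_pos_pos) auto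
  \<comment> \<open>The increment of \<open>1 / m\<close> is the drop of \<open>m\<close> divided by
    the product of the end values; \<open>drop\<close> bounds their ratio from below.\<close>
  have inc: "1 / mv s + r * \<gamma> \<le> 1 / mv (s + r)" if s: "t2 \<le> s" for s
  proof -
    have s0: "0 \<le> s" "t1 \<le> s" using s t2 by auto
    have p: "0 < mv s" "0 < mv (s + r)" using s0 r by (auto intro!: m_pos)
    have "(LBINT q:{s..s + r}. bt * (mv (s + r))\<^sup>2) \<le> (LBINT q:{s..s + r}. k v q)"
    proof (rule set_integral_mono)
      show "set_integrable lborel {s..s + r} (k v)"
        by (rule set_integrable_bounded[where c="bs * measure \<mu> UNIV"])
           (use k_meas[OF surv] k_nonneg[OF surv] k_le[OF surv] in \<open>auto simp: abs_of_nonneg\<close>)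
      show "set_integrable lborel {s..s + r} (\<lambda>q. bt * (mv (s + r))\<^sup>2)"
        by (intro borel_integrable_atLeastAtMost' continuous_intros)
      fix q assume q: "q \<in> {s..s + r}"
      have "bt * (mv (s + r))\<^sup>2 \<le> bt * (mv q)\<^sup>2"
        using q s0 p bt by (intro mult_left_mono power_mono m_mono[OF surv]) auto
      also have "\<dots> \<le> k v q" using q s by (intro k_lower[folded bt_def]) (auto simp: t2_def)
      finally show "bt * (mv (s + r))\<^sup>2 \<le> k v q" .
    qed
    then have "r * (bt * (mv (s + r))\<^sup>2) \<le> mv s - mv (s + r)"
      using m_diff[OF surv, of s "s + r"] s0 r by (simp add: set_integral_const mult_ac)
    then have "r * (bt * (mv (s + r))\<^sup>2) / (mv s * mv (s + r)) \<le> (mv s - mv (s + r)) / (mv s * mv (s + r))"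
      using p by (intro divide_right_mono) auto
    moreover have "(mv s - mv (s + r)) / (mv s * mv (s + r)) = 1 / mv (s + r) - 1 / mv s"
      using p by (simp add: field_simps)
    moreover have "r * (bt * (mv (s + r))\<^sup>2) / (mv s * mv (s + r)) = r * bt * (mv (s + r) / mv s)"
      using p by (simp add: power2_eq_square)
    moreover have "r * bt * (1 - \<eta>) \<le> r * bt * (mv (s + r) / mv s)"
      using drop[OF s0(2)] p r bt by (intro mult_left_mono) (auto simp: pos_le_divide_eq)
    ultimately show ?thesis unfolding \<gamma>_def by (simp add: mult.assoc)
  qed
  have lat: "real j * (r * \<gamma>) \<le> 1 / mv (t2 + real j * r)" for j
  proof (induction j)
    case (Suc j)
    have "real (Suc j) * (r * \<gamma>) = real j * (r * \<gamma>) + r * \<gamma>" by (simp add: algebra_simps)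
    also have "\<dots> \<le> 1 / mv (t2 + real j * r) + r * \<gamma>" using Suc by simp
    also have "\<dots> \<le> 1 / mv (t2 + real j * r + r)" using r by (intro inc) auto
    finally show ?case by (simp add: algebra_simps)
  qed (use m_nonneg[OF surv] in simp)
  have mT: "mv T \<le> 1 / ((T - (t2 + r)) * \<gamma>)" if T: "t2 + r < T" for T
  proof -
    define j where "j = nat \<lfloor>(T - t2) / r\<rfloor>"
    have "0 \<le> (T - t2) / r" using T r by simp
    then have "real j \<le> (T - t2) / r" "(T - t2) / r < real j + 1" unfolding j_def by linarith+
    then have j: "t2 + real j * r \<le> T" "T - (t2 + r) \<le> real j * r" using r by (auto simp: field_simps)
    have "mv T \<le> mv (t2 + real j * r)" using j t2 r by (intro m_mono[OF surv]) auto
    moreover have pm: "0 < mv (t2 + real j * r)" using t2 r by (intro m_pos) auto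
    moreover have "(T - (t2 + r)) * \<gamma> \<le> 1 / mv (t2 + real j * r)"
    proof -
      have "(T - (t2 + r)) * \<gamma> \<le> real j * r * \<gamma>" using j(2) \<gamma> by (intro mult_right_mono) auto
      then show ?thesis using lat[of j] unfolding mult.assoc by linarith
    qed
    moreover have "0 < (T - (t2 + r)) * \<gamma>" using T \<gamma> by simp
    ultimately show ?thesis
      by (smt (verit) le_divide_eq mult.commute)
  qed
  \<comment> \<open>One \<open>r\<close> is lost by rounding down to the lattice, another by
    evaluating the mass at \<open>T - r\<close>.\<close>
  define T0 where "T0 = t2 + 2 * r"
  have "0 \<le> T \<and> T * v T x \<le> (\<Theta> x + \<eta>) / \<gamma> * (T / (T - T0))" if T: "T0 < T" for T
  proof -
    have T': "0 \<le> T - r" "t1 \<le> T - r" "t2 + r < T - r" "0 < T" using T t2 r by (auto simp: T0_def)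
    have "v T x \<le> \<Theta> x * mv (T - r) + H * exp (- lam * r) * n (T - r)"
      using v_step_upper[OF T'(1), of r x] r by simp
    also have "\<dots> \<le> (\<Theta> x + \<eta>) * mv (T - r)" using Hn[OF T'(2)] by (simp add: distrib_right)
    also have "\<dots> \<le> (\<Theta> x + \<eta>) * (1 / ((T - r - (t2 + r)) * \<gamma>))"
      using \<Theta>_pos[of x] \<eta> by (intro mult_left_mono mT T') auto
    also have "T - r - (t2 + r) = T - T0" by (simp add: T0_def)
    finally have "T * v T x \<le> T * ((\<Theta> x + \<eta>) * (1 / ((T - T0) * \<gamma>)))" using T' by (intro mult_left_mono) auto
    also have "\<dots> = (\<Theta> x + \<eta>) / \<gamma> * (T / (T - T0))" by (simp add: mult.commute)
    finally show ?thesis using T' by simp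
  qed
  then show ?thesis unfolding \<gamma>_def bt_def by blast
qed

text \<open>As \<open>\<eta>\<close> decreases to 0 the constants of
  \<open>survival_upper_eta\<close> tend to the desired one, and for fixed \<open>\<eta>\<close> the
  factor \<open>T / (T - T0)\<close> tends to 1.\<close>

theorem survival_upper:
  assumes \<epsilon>: "0 < \<epsilon>"
  shows "\<forall>\<^sub>F T in at_top. T * v T x \<le> \<Theta> x / B + \<epsilon>"
proof -
  define g where "g \<eta> = (1 - \<eta>)\<^sup>2 * (B - 2 * \<eta> * \<theta>s * bs * A)" for \<eta>
  have g0: "(g \<longlongrightarrow> (1 - 0)\<^sup>2 * (B - 2 * 0 * \<theta>s * bs * A)) (at_right 0)"
    unfolding g_def by (intro tendsto_intros)
  then have g: "(g \<longlongrightarrow> B) (at_right 0)" by simp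
  have "((\<lambda>\<eta>. (\<Theta> x + \<eta>) / (g \<eta> * (1 - \<eta>))) \<longlongrightarrow> (\<Theta> x + 0) / (B * (1 - 0))) (at_right 0)"
    by (intro tendsto_intros g) (use B_pos in auto)
  then have "eventually (\<lambda>\<eta>. (\<Theta> x + \<eta>) / (g \<eta> * (1 - \<eta>)) < \<Theta> x / B + \<epsilon> / 2) (at_right 0)"
    using \<epsilon> by (intro order_tendstoD) auto
  moreover have "eventually (\<lambda>\<eta>. 0 < g \<eta>) (at_right 0)"
    using g B_pos by (intro order_tendstoD) auto
  moreover have "eventually (\<lambda>\<eta>. 0 < \<eta> \<and> \<eta> < 1) (at_right (0::real))"
    using eventually_at_right_real[of 0 1] by simp
  ultimately have "eventually (\<lambda>\<eta>. (\<Theta> x + \<eta>) / (g \<eta> * (1 - \<eta>)) < \<Theta> x / B + \<epsilon> / 2 \<and> 0 < g \<eta> \<and> 0 < \<eta> \<and> \<eta> < 1) (at_right 0)"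
    by eventually_elim simp
  then obtain \<eta> where \<eta>: "(\<Theta> x + \<eta>) / (g \<eta> * (1 - \<eta>)) < \<Theta> x / B + \<epsilon> / 2" "0 < g \<eta>" "0 < \<eta>" "\<eta> < 1"
    using eventually_happens'[OF trivial_limit_at_right_real] by blast
  define c where "c = (\<Theta> x + \<eta>) / (g \<eta> * (1 - \<eta>))"
  obtain T0 where T0: "\<And>T. T0 < T \<Longrightarrow> T * v T x \<le> c * (T / (T - T0))"
    using survival_upper_eta[OF \<eta>(3,4) \<eta>(2)[unfolded g_def]] unfolding c_def g_def by blast
  have "((\<lambda>T. c * (T / (T - T0))) \<longlongrightarrow> c * 1) at_top"
    by (intro tendsto_intros) real_asymp
  then have "eventually (\<lambda>T. c * (T / (T - T0)) < \<Theta> x / B + \<epsilon>) at_top"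
    using \<eta>(1) \<epsilon> unfolding c_def[symmetric] by (intro order_tendstoD) auto
  then show ?thesis
    using eventually_gt_at_top[of T0] by eventually_elim (use T0 in \<open>auto intro: order_trans less_imp_le\<close>)
qed

end

end

section \<open>Population functionals and their generating functions\<close>

context branching_tree
begin

lemma measurable_alive [measurable]: "Measurable.pred (tree_space D) (\<lambda>c. l \<in> alive b d t c)"
proof -
  have [measurable]: "(\<lambda>c. birth_time b d c l) \<in> borel_measurable (tree_space D)"
    by (rule measurable_birth_time) simp
  show ?thesis unfolding alive_def mem_Collect_eq by measurable
qed

lemma alive_age_nonneg: "l \<in> alive b d t c \<Longrightarrow> 0 \<le> t - real_of_ereal (birth_time b d c l)"
  using birth_time_nonneg[of c l] by (cases "birth_time b d c l") (auto simp: alive_def)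

lemma measurable_trait:
  "(\<lambda>c. if l \<in> alive b d t c then trait b d t c l else 0) \<in> borel_measurable (tree_space D)"
proof -
  have [measurable]: "(\<lambda>c. birth_time b d c l) \<in> borel_measurable (tree_space D)"
    by (rule measurable_birth_time) simp
  have "(\<lambda>c. if l \<in> alive b d t c then path_at (fst (c l)) (t - real_of_ereal (birth_time b d c l)) else 0)
      \<in> borel_measurable (tree_space D)"
    by measurable
  also have "(\<lambda>c. if l \<in> alive b d t c then path_at (fst (c l)) (t - real_of_ereal (birth_time b d c l)) else 0) =
      (\<lambda>c. if l \<in> alive b d t c then trait b d t c l else 0)"
    using alive_age_nonneg by (auto simp: fun_eq_iff trait_def path_at_def)
  finally show ?thesis .
qed

lemma indiv_alive:
  "indiv t c l = (if l \<in> alive b d t c then \<phi> (trait b d t c l) else 1)"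
  using alive_age_nonneg[of l t c]
  by (auto simp: indiv_def own_def alive_def trait_def path_at_def)

text \<open>A label enters the diagonal truncation once its length and all its entries are below
  \<open>k\<close>; the sum of the entries bounds each of them.\<close>

lemma exhaust_low:
  assumes "finite F"
  shows "\<exists>N. \<forall>k\<ge>N. F \<subseteq> low k k"
proof -
  have "\<exists>N. \<forall>k\<ge>N. l \<in> low k k" for l
  proof (intro exI allI impI)
    fix k assume k: "Suc (length l + sum_list l) \<le> k"
    have "i \<in> set l \<Longrightarrow> i \<le> sum_list l" for i by (rule member_le_sum_list) auto
    then show "l \<in> low k k" using k by (fastforce simp: low_def)
  qed
  then obtain N where N: "\<And>l k. N l \<le> k \<Longrightarrow> l \<in> low k k" by metis
  have "F \<subseteq> low k k" if "Max (N ` F) \<le> k" for k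
  proof
    fix l assume "l \<in> F"
    then have "N l \<le> Max (N ` F)" using assms by simp
    then show "l \<in> low k k" using that by (intro N) simp
  qed
  then show ?thesis by blast
qed

lemma INF_low_finite:
  assumes fin: "finite (alive b d t c)"
  shows "(INF k. \<Prod>l\<in>low k k. indiv t c l) = (\<Prod>l\<in>alive b d t c. \<phi> (trait b d t c l))"
proof (rule antisym)
  have eq: "(\<Prod>l\<in>low k k. indiv t c l) = (\<Prod>l\<in>alive b d t c \<inter> low k k. \<phi> (trait b d t c l))" for k
    using prod.inter_restrict[of "low k k" "\<lambda>l. \<phi> (trait b d t c l)" "alive b d t c"]
    by (simp add: indiv_alive Int_commute)
  obtain N where "\<forall>k\<ge>N. alive b d t c \<subseteq> low k k" using exhaust_low[OF fin] by blast
  then have "alive b d t c \<inter> low N N = alive b d t c" by auto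
  then show "(INF k. \<Prod>l\<in>low k k. indiv t c l) \<le> (\<Prod>l\<in>alive b d t c. \<phi> (trait b d t c l))"
    by (intro INF_lower2[of N]) (simp_all add: eq)
  show "(\<Prod>l\<in>alive b d t c. \<phi> (trait b d t c l)) \<le> (INF k. \<Prod>l\<in>low k k. indiv t c l)"
    unfolding eq by (intro INF_greatest prod_antimono_ennreal fin \<phi>_le) auto
qed

text \<open>Any \<open>j\<close> of the infinitely many factors already push the product below
  \<open>q ^ j\<close>.\<close>

lemma INF_low_infinite:
  assumes inf: "infinite (alive b d t c)" and q: "\<And>y. \<phi> y \<le> ennreal q" "0 \<le> q" "q < 1"
  shows "(INF k. \<Prod>l\<in>low k k. indiv t c l) = 0"
proof -
  have "(INF k. \<Prod>l\<in>low k k. indiv t c l) \<le> ennreal (q ^ j)" for j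
  proof -
    have "\<exists>F. finite F \<and> card F = j \<and> F \<subseteq> alive b d t c" using inf by (rule infinite_arbitrarily_large)
    then obtain F where "finite F \<and> card F = j \<and> F \<subseteq> alive b d t c" ..
    then have F: "finite F" "card F = j" "F \<subseteq> alive b d t c" by simp_all
    obtain N where "\<forall>k\<ge>N. F \<subseteq> low k k" using exhaust_low[OF F(1)] ..
    then have N: "F \<subseteq> low N N" by simp
    have le: "indiv t c l \<le> ennreal q" if "l \<in> F" for l
    proof -
      have "l \<in> alive b d t c" using that F(3) by blast
      then show ?thesis using q(1) by (simp only: indiv_alive if_True)
    qed
    have "(INF k. \<Prod>l\<in>low k k. indiv t c l) \<le> (\<Prod>l\<in>low N N. indiv t c l)" by (rule INF_lower) simp
    also have "\<dots> \<le> (\<Prod>l\<in>F. indiv t c l)" by (intro prod_antimono_ennreal N finite_low indiv_le)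
    also have "\<dots> \<le> (\<Prod>l\<in>F. ennreal q)" by (intro prod_mono_ennreal le)
    also have "\<dots> = ennreal (q ^ j)" using F(2) q(2) by (simp only: prod_constant ennreal_power)
    finally show ?thesis .
  qed
  moreover have "(\<lambda>j. ennreal (q ^ j)) \<longlonglongrightarrow> ennreal 0"
    using q by (intro tendsto_ennrealI LIMSEQ_realpow_zero)
  ultimately have "(INF k. \<Prod>l\<in>low k k. indiv t c l) \<le> ennreal 0"
    by (intro LIMSEQ_le_const[where X="\<lambda>j. ennreal (q ^ j)"]) auto
  then show ?thesis by simp
qed

lemma u_le_Sn: "0 \<le> t \<Longrightarrow> u t x \<le> Sn t (\<lambda>y. 1 - \<phi> y) x"
  by (simp add: u_mild[symmetric])

end

section \<open>Finiteness and measurability of the population\<close>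

locale critical_branching = critical_semigroup D P b d bs \<mu> \<Theta> \<theta>s lam H + branching_markov_process D P b Q
  for D :: "(real \<Rightarrow> real) set" and P :: "real \<Rightarrow> (real \<Rightarrow> real) measure"
    and b d :: "real \<Rightarrow> real" and bs :: real and \<mu> :: "real measure"
    and \<Theta> :: "real \<Rightarrow> real" and \<theta>s lam H :: real and Q :: "real \<Rightarrow> tree measure"
begin

interpretation T0: branching_tree D P b d bs Q "\<lambda>_. 0"
  by unfold_locales auto

lemma Q_measurable_eq: "Q x \<rightarrow>\<^sub>M N = tree_space D \<rightarrow>\<^sub>M N"
  by (rule T0.Q_measurable)

text \<open>There are countably many finite sets of labels, so finiteness is a countable union of
  events.\<close>

lemma measurable_finite_alive [measurable]: "Measurable.pred (tree_space D) (\<lambda>c. finite (alive b d t c))"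
proof -
  have "{c \<in> space (tree_space D). \<forall>u. (u \<in> alive b d t c) = (u \<in> S)} \<in> sets (tree_space D)" for S
    by measurable
  then have "(\<Union>S\<in>Collect finite. {c \<in> space (tree_space D). \<forall>u. (u \<in> alive b d t c) = (u \<in> S)}) \<in> sets (tree_space D)"
    by (intro sets.countable_UN'[OF countable_Collect_finite]) blast
  also have "(\<Union>S\<in>Collect finite. {c \<in> space (tree_space D). \<forall>u. (u \<in> alive b d t c) = (u \<in> S)}) =
      {c \<in> space (tree_space D). finite (alive b d t c)}"
    by (auto simp flip: set_eq_iff)
  finally show ?thesis by (simp add: pred_def)
qed

text \<open>Replaces an infinite population by the empty one. This matches the value 0 of sums over
  infinite sets and leaves countably many possible values.\<close>

definition aliveF :: "real \<Rightarrow> tree \<Rightarrow> nat list set" where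
  "aliveF t c = (if finite (alive b d t c) then alive b d t c else {})"

definition atrait :: "real \<Rightarrow> tree \<Rightarrow> nat list \<Rightarrow> real" where
  "atrait t c u = (if u \<in> alive b d t c then trait b d t c u else 0)"

lemma measurable_atrait [measurable]: "(\<lambda>c. atrait t c u) \<in> borel_measurable (tree_space D)"
  unfolding atrait_def by (rule T0.measurable_trait)

lemma measurable_aliveF: "aliveF t \<in> tree_space D \<rightarrow>\<^sub>M count_space (Collect finite)"
proof (subst measurable_count_space_eq_countable[OF countable_Collect_finite], intro conjI ballI)
  show "aliveF t \<in> space (tree_space D) \<rightarrow> Collect finite" by (auto simp: aliveF_def)
  fix S :: "nat list set" assume "S \<in> Collect finite"
  have "{c \<in> space (tree_space D). if finite (alive b d t c) then (\<forall>u. (u \<in> alive b d t c) = (u \<in> S)) else S = {}} \<in> sets (tree_space D)"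
    by measurable
  also have "{c \<in> space (tree_space D). if finite (alive b d t c) then (\<forall>u. (u \<in> alive b d t c) = (u \<in> S)) else S = {}} =
      aliveF t -` {S} \<inter> space (tree_space D)"
  proof (rule set_eqI)
    fix c
    have "(if finite (alive b d t c) then (\<forall>u. (u \<in> alive b d t c) = (u \<in> S)) else S = {}) \<longleftrightarrow> aliveF t c = S"
    proof (cases "finite (alive b d t c)")
      case True
      then show ?thesis unfolding aliveF_def set_eq_iff[of "alive b d t c" S, symmetric] by (simp only: if_True)
    next
      case False
      then show ?thesis unfolding aliveF_def by (simp only: if_False) (rule eq_commute)
    qed
    then show "c \<in> {c \<in> space (tree_space D). if finite (alive b d t c) then (\<forall>u. (u \<in> alive b d t c) = (u \<in> S)) else S = {}} \<longleftrightarrow>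
      c \<in> aliveF t -` {S} \<inter> space (tree_space D)"
      by (simp only: mem_Collect_eq Int_iff vimage_eq singleton_iff) (rule conj_commute)
  qed
  finally show "aliveF t -` {S} \<inter> space (tree_space D) \<in> sets (tree_space D)" .
qed

lemma measurable_aliveF_compose:
  assumes "\<And>S. finite S \<Longrightarrow> g S \<in> tree_space D \<rightarrow>\<^sub>M N"
  shows "(\<lambda>c. g (aliveF t c) c) \<in> tree_space D \<rightarrow>\<^sub>M N"
  by (rule measurable_compose_countable'[OF _ measurable_aliveF countable_Collect_finite]) (use assms in auto)

lemma Zpair_aliveF: "Zpair b d t f c = (\<Sum>u\<in>aliveF t c. f (atrait t c u))"
  by (auto simp: Zpair_def aliveF_def atrait_def)

lemma measurable_Zpair [measurable]:
  "f \<in> borel_measurable borel \<Longrightarrow> (\<lambda>c. Zpair b d t f c) \<in> borel_measurable (tree_space D)"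
  unfolding Zpair_aliveF
  by (rule measurable_aliveF_compose) (auto intro!: borel_measurable_sum measurable_compose[OF measurable_atrait])

lemma measurable_Npop [measurable]: "(\<lambda>c. Npop b d t c) \<in> borel_measurable (tree_space D)"
  unfolding Npop_def by (rule measurable_Zpair) simp

lemma Npop_eq: "Npop b d t c = real (card (aliveF t c))"
  by (simp add: Npop_def Zpair_aliveF)

definition gprod :: "(real \<Rightarrow> real) \<Rightarrow> real \<Rightarrow> tree \<Rightarrow> real" where
  "gprod p t c = (\<Prod>u\<in>aliveF t c. p (atrait t c u))"

lemma measurable_gprod [measurable]:
  "p \<in> borel_measurable borel \<Longrightarrow> (\<lambda>c. gprod p t c) \<in> borel_measurable (tree_space D)"
  unfolding gprod_def
  by (rule measurable_aliveF_compose) (auto intro!: borel_measurable_prod measurable_compose[OF measurable_atrait])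

lemma gprod_bounds: "(\<And>y. 0 \<le> p y \<and> p y \<le> 1) \<Longrightarrow> 0 \<le> gprod p t c \<and> gprod p t c \<le> 1"
  unfolding gprod_def by (auto intro!: prod_nonneg prod_le_1)

text \<open>With a constant mark \<open>q < 1\<close> the generating functional vanishes on infinite
  populations, so their probability is at most \<open>u t x\<close>, hence at most a linear bound of
  order \<open>1 - q\<close>; then \<open>q\<close> tends to 1.\<close>

lemma AE_finite_alive:
  assumes t: "0 \<le> t"
  shows "AE c in Q x. finite (alive b d t c)"
proof -
  interpret Q: prob_space "Q x" by (rule Q_prob)
  let ?I = "{c \<in> space (Q x). infinite (alive b d t c)}"
  have I: "?I \<in> sets (Q x)" unfolding Q_sets T0.Q_space by measurable
  have bound: "emeasure (Q x) ?I \<le> ennreal (exp (bs * t) / real (Suc N))" for N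
  proof -
    define q where "q = 1 - 1 / real (Suc N)"
    have q: "0 \<le> q" "q < 1" by (auto simp: q_def divide_le_eq)
    interpret T: branching_tree D P b d bs Q "\<lambda>_. ennreal q"
      by unfold_locales (use q in \<open>auto simp: ennreal_le_1\<close>)
    have INF: "(INF k. \<Prod>u\<in>T.low k k. T.indiv t c u) \<le> 1 - indicator ?I c" if "c \<in> space (Q x)" for c
    proof (cases "infinite (alive b d t c)")
      case True
      then show ?thesis using T.INF_low_infinite[OF True _ q] by simp
    next
      case False
      have "(INF k. \<Prod>u\<in>T.low k k. T.indiv t c u) \<le> (\<Prod>u\<in>T.low 0 0. T.indiv t c u)" by (rule INF_lower) simp
      then show ?thesis using False by (simp add: T.low_def)
    qed
    have "T.h t x \<le> (\<integral>\<^sup>+c. 1 - indicator ?I c \<partial>Q x)"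
      unfolding T.h_eq_integral[OF t] by (intro nn_integral_mono INF)
    also have "\<dots> = (\<integral>\<^sup>+c. 1 \<partial>Q x) - (\<integral>\<^sup>+c. indicator ?I c \<partial>Q x)"
      using I by (intro nn_integral_diff) (auto split: split_indicator simp: less_top[symmetric] Q.emeasure_eq_measure)
    also have "\<dots> = 1 - emeasure (Q x) ?I" using I Q.emeasure_space_1 by simp
    finally have h: "T.h t x \<le> 1 - emeasure (Q x) ?I" .
    have le1: "emeasure (Q x) ?I \<le> 1" by (rule Q.measure_le_1)
    have "emeasure (Q x) ?I = 1 - (1 - emeasure (Q x) ?I)"
      using le1 by (simp add: diff_diff_ennreal'')
    also have "\<dots> \<le> 1 - T.h t x" by (intro ennreal_minus_mono h) simp
    also have "\<dots> = T.u t x" using t by (simp add: T.u_def)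
    also have "\<dots> \<le> Sn t (\<lambda>y. 1 - ennreal q) x" by (rule T.u_le_Sn[OF t])
    also have "\<dots> \<le> ennreal (exp (bs * t)) * ennreal (1 / real (Suc N))"
      using q by (intro Sn_le[OF t]) (auto simp: q_def ennreal_minus simp flip: ennreal_1)
    also have "\<dots> = ennreal (exp (bs * t) / real (Suc N))"
      by (simp flip: ennreal_mult)
    finally show ?thesis .
  qed
  have "(\<lambda>N. ennreal (exp (bs * t) / real (Suc N))) \<longlonglongrightarrow> ennreal 0"
    by (intro tendsto_ennrealI) real_asymp
  then have "emeasure (Q x) ?I \<le> ennreal 0"
    by (rule LIMSEQ_le_const) (use bound in auto)
  then show ?thesis
    using I by (intro AE_I[where N="?I"]) auto
qed

text \<open>Almost sure finiteness turns the infimum over truncations into the product over the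
  population; the rest is the passage from \<open>ennreal\<close> to real values.\<close>

lemma generating_mild:
  assumes p [measurable]: "p \<in> borel_measurable borel" and p01: "\<And>y. 0 \<le> p y \<and> p y \<le> 1"
  shows "\<exists>w. mild (\<lambda>y. 1 - p y) w \<and> (\<forall>t\<ge>0. \<forall>x. w t x = 1 - (\<integral>c. gprod p t c \<partial>Q x))"
proof -
  interpret T: branching_tree D P b d bs Q "\<lambda>y. ennreal (p y)"
    by unfold_locales (use p01 in \<open>auto simp: ennreal_le_1\<close>)
  define w where "w t x = enn2real (T.u t x)" for t x
  have wu: "ennreal (w t x) = T.u t x" for t x
    unfolding w_def using T.u_le_1[of t x] by (simp add: le_less_trans)
  have "mild (\<lambda>y. 1 - p y) w"
    unfolding mild_def
  proof (intro conjI allI impI)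
    show "bm 1 (\<lambda>y. 1 - p y)" using p01 by (simp add: bm_def)
    have "(\<lambda>z. (\<lambda>(s, y). T.u s y) z) \<in> borel_measurable (borel \<Otimes>\<^sub>M borel)" using T.measurable_u by simp
    then show "(\<lambda>z. w (fst z) (snd z)) \<in> borel_measurable (borel \<Otimes>\<^sub>M borel)"
      unfolding w_def by (simp add: split_beta')
    show "0 \<le> w s y" for s y by (simp add: w_def)
    show "w s y \<le> 1" for s y
      using T.u_le_1[of s y] unfolding w_def by (intro enn2real_leI) auto
    fix t x :: real assume t: "0 \<le> t"
    have "ennreal (b y * (w s y)\<^sup>2) = ennreal (b y) * (T.u s y)\<^sup>2" for s y
    proof -
      have "0 \<le> w s y" by (simp add: w_def)
      then show ?thesis using b_nonneg by (simp add: wu[symmetric] ennreal_mult ennreal_power)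
    qed
    moreover have "(\<lambda>y. ennreal (1 - p y)) = (\<lambda>y. 1 - ennreal (p y))"
      using p01 by (simp add: ennreal_minus flip: ennreal_1)
    ultimately show "ennreal (w t x) + (\<integral>\<^sup>+r\<in>{0..t}. Sn r (\<lambda>y. ennreal (b y * (w (t - r) y)\<^sup>2)) x \<partial>lborel) =
        Sn t (\<lambda>y. ennreal (1 - p y)) x"
      using T.u_mild[OF t, of x] by (simp add: wu)
  qed
  moreover have "w t x = 1 - (\<integral>c. gprod p t c \<partial>Q x)" if t: "0 \<le> t" for t x
  proof -
    interpret Q: prob_space "Q x" by (rule Q_prob)
    have gm: "(\<lambda>c. gprod p t c) \<in> borel_measurable (Q x)" by (simp add: Q_measurable_eq)
    have int: "integrable (Q x) (gprod p t)"
      by (rule Q.integrable_const_bound[of _ 1]) (use gprod_bounds[OF p01] gm in \<open>auto simp: abs_of_nonneg\<close>)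
    have "T.h t x = (\<integral>\<^sup>+c. ennreal (gprod p t c) \<partial>Q x)"
      unfolding T.h_eq_integral[OF t]
    proof (rule nn_integral_cong_AE)
      show "AE c in Q x. (INF k. \<Prod>u\<in>T.low k k. T.indiv t c u) = ennreal (gprod p t c)"
        using AE_finite_alive[OF t, of x]
      proof eventually_elim
        case (elim c)
        have "(\<Prod>u\<in>alive b d t c. ennreal (p (trait b d t c u))) = ennreal (gprod p t c)"
          using elim p01 unfolding gprod_def aliveF_def atrait_def by (simp add: prod_ennreal)
        then show ?case using T.INF_low_finite[OF elim] by simp
      qed
    qed
    also have "\<dots> = ennreal (\<integral>c. gprod p t c \<partial>Q x)"
      using gprod_bounds[OF p01] by (intro nn_integral_eq_integral int) auto
    finally have h: "T.h t x = ennreal (\<integral>c. gprod p t c \<partial>Q x)" .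
    have "0 \<le> (\<integral>c. gprod p t c \<partial>Q x)" using gprod_bounds[OF p01] by (intro integral_nonneg_AE) auto
    moreover have "(\<integral>c. gprod p t c \<partial>Q x) \<le> 1"
      using T.h_le_1[OF t, of x] unfolding h by (simp add: ennreal_le_1)
    ultimately show ?thesis
      using t by (simp add: w_def T.u_def h ennreal_minus flip: ennreal_1)
  qed
  ultimately show ?thesis by blast
qed

lemma gprod_exp: "gprod (\<lambda>y. exp (- g y)) t c = exp (- Zpair b d t g c)"
  unfolding gprod_def Zpair_aliveF by (simp add: sum_negf[symmetric] exp_sum aliveF_def)

text \<open>Only the empty product survives: the generating functional at 0 detects
  extinction.\<close>

lemma gprod_0: "gprod (\<lambda>_. 0) t c = (if Npop b d t c = 0 then 1 else 0)"
proof -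
  have "finite (aliveF t c)" by (simp add: aliveF_def)
  then show ?thesis unfolding gprod_def Npop_eq by (auto simp: card_gt_0_iff)
qed

end

section \<open>Convergence to the exponential law\<close>

text \<open>Tilting by \<open>exp (- k z)\<close> gives, up to the factor \<open>1 / l\<close>, the
  exponential density of rate \<open>l\<close>.\<close>

lemma exp1_laplace: "(\<integral>z. exp (- (real k * z)) \<partial>exp1) = 1 / (1 + real k)"
proof -
  define l where "l = 1 + real k"
  have l: "0 < l" by (simp add: l_def)
  interpret E: prob_space "density lborel (exponential_density l)"
    by (rule prob_space_exponential_density[OF l])
  have "(\<integral>z. 1 \<partial>density lborel (exponential_density l)) = (\<integral>z. exponential_density l z *\<^sub>R (1::real) \<partial>lborel)"
    using l by (intro integral_density) (auto simp: exponential_density_nonneg)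
  then have 1: "(\<integral>z. exponential_density l z \<partial>lborel) = 1"
    using E.prob_space by simp
  have "(\<integral>z. exp (- (real k * z)) \<partial>exp1) = (\<integral>z. exponential_density 1 z *\<^sub>R exp (- (real k * z)) \<partial>lborel)"
    by (intro integral_density) (auto simp: exponential_density_nonneg)
  also have "\<dots> = (\<integral>z. (1 / l) * exponential_density l z \<partial>lborel)"
  proof (intro Bochner_Integration.integral_cong refl)
    fix z :: real
    have "exp (- z) * exp (- (real k * z)) = exp (- (z * l))"
      by (simp add: l_def algebra_simps flip: exp_add)
    then show "exponential_density 1 z *\<^sub>R exp (- (real k * z)) = (1 / l) * exponential_density l z"
      using l by (simp add: exponential_density_def)
  qed
  finally show ?thesis using 1 by (simp add: l_def)
qed

lemma AE_exp1_pos: "AE z in exp1. 0 < z"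
  using AE_lborel_singleton[of "0::real"]
  by (subst AE_density) (auto simp: exponential_density_def elim!: eventually_mono)

text \<open>Convergence of the Laplace transform at the integers gives convergence of \<open>E[G(e\<^sup>-\<^sup>Y)]\<close>
  for polynomial \<open>G\<close>, hence for continuous \<open>G\<close> by Bernstein approximation.\<close>

lemma laplace_weak_real:
  fixes M :: "'i \<Rightarrow> real measure" and Y :: "'i \<Rightarrow> real \<Rightarrow> real" and G :: "real \<Rightarrow> real"
  assumes ev: "\<forall>\<^sub>F i in F. prob_space (M i) \<and> Y i \<in> borel_measurable (M i) \<and> (AE \<omega> in M i. 0 \<le> Y i \<omega>)"
    and lap: "\<And>k::nat. ((\<lambda>i. \<integral>\<omega>. exp (- (real k * Y i \<omega>)) \<partial>M i) \<longlongrightarrow> 1 / (1 + real k)) F"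
    and G: "continuous_on UNIV G"
  shows "((\<lambda>i. \<integral>\<omega>. G (exp (- Y i \<omega>)) \<partial>M i) \<longlongrightarrow> (\<integral>z. G (exp (- z)) \<partial>exp1)) F"
proof -
  interpret E: prob_space exp1 by (rule prob_space_exponential_density) simp
  define good where "good N y \<longleftrightarrow> prob_space N \<and> y \<in> borel_measurable N \<and> (AE \<omega> in N. 0 \<le> y \<omega>)"
    for N :: "real measure" and y
  have goodE: "prob_space (exp1)" "(\<lambda>z. z) \<in> borel_measurable exp1" "AE z in exp1. 0 \<le> z"
    using AE_exp1_pos by (auto intro: E.prob_space_axioms elim!: eventually_mono)
  have int: "integrable N (\<lambda>\<omega>. g (exp (- y \<omega>)))"
    if N: "prob_space N" "y \<in> borel_measurable N" "AE \<omega> in N. 0 \<le> y \<omega>"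
      and g: "continuous_on UNIV g" for N :: "real measure" and y and g :: "real \<Rightarrow> real"
  proof -
    interpret N: prob_space N by fact
    have "bounded (g ` {0..1})"
      by (intro compact_imp_bounded compact_continuous_image continuous_on_subset[OF g]) auto
    then obtain C where C: "\<And>s. s \<in> {0..1} \<Longrightarrow> norm (g s) \<le> C"
      unfolding bounded_iff by blast
    have "(\<lambda>\<omega>. g (exp (- y \<omega>))) \<in> borel_measurable N"
      using borel_measurable_continuous_onI[OF g] N(2) by measurable
    moreover have "AE \<omega> in N. norm (g (exp (- y \<omega>))) \<le> C"
      using N(3) by eventually_elim (rule C, simp)
    ultimately show ?thesis by (intro N.integrable_const_bound[of _ C])
  qed
  \<comment> \<open>Splitting off a factor \<open>1 - s\<close> leaves two terms, one with a higher
    power of \<open>s\<close>. Induction on \<open>j\<close> with \<open>k\<close> arbitrary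
    therefore reduces Bernstein monomials to powers.\<close>
  have mono: "((\<lambda>i. \<integral>\<omega>. exp (- Y i \<omega>) ^ k * (1 - exp (- Y i \<omega>)) ^ j \<partial>M i) \<longlongrightarrow>
      (\<integral>z. exp (- z) ^ k * (1 - exp (- z)) ^ j \<partial>exp1)) F" for k j
  proof (induction j arbitrary: k)
    case 0
    have "exp (- y) ^ k = exp (- (real k * y))" for y :: real by (simp flip: exp_of_nat_mult)
    then show ?case using lap[of k] exp1_laplace[of k] by simp
  next
    case (Suc j)
    have c: "continuous_on UNIV (\<lambda>s::real. s ^ k * (1 - s) ^ j)" for k by (intro continuous_intros)
    have eq: "(\<integral>\<omega>. exp (- y \<omega>) ^ k * (1 - exp (- y \<omega>)) ^ Suc j \<partial>N) =
        (\<integral>\<omega>. exp (- y \<omega>) ^ k * (1 - exp (- y \<omega>)) ^ j \<partial>N) - (\<integral>\<omega>. exp (- y \<omega>) ^ Suc k * (1 - exp (- y \<omega>)) ^ j \<partial>N)"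
      if N: "prob_space N" "y \<in> borel_measurable N" "AE \<omega> in N. 0 \<le> y \<omega>" for N :: "real measure" and y :: "real \<Rightarrow> real"
      unfolding Bochner_Integration.integral_diff[OF int[OF N c] int[OF N c], symmetric]
      by (intro Bochner_Integration.integral_cong) (simp_all add: algebra_simps)
    have "((\<lambda>i. (\<integral>\<omega>. exp (- Y i \<omega>) ^ k * (1 - exp (- Y i \<omega>)) ^ j \<partial>M i) -
        (\<integral>\<omega>. exp (- Y i \<omega>) ^ Suc k * (1 - exp (- Y i \<omega>)) ^ j \<partial>M i)) \<longlongrightarrow>
      (\<integral>z. exp (- z) ^ k * (1 - exp (- z)) ^ Suc j \<partial>exp1)) F"
      unfolding eq[OF goodE] by (intro tendsto_diff Suc)
    moreover have "\<forall>\<^sub>F i in F. (\<integral>\<omega>. exp (- Y i \<omega>) ^ k * (1 - exp (- Y i \<omega>)) ^ j \<partial>M i) -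
        (\<integral>\<omega>. exp (- Y i \<omega>) ^ Suc k * (1 - exp (- Y i \<omega>)) ^ j \<partial>M i) =
        (\<integral>\<omega>. exp (- Y i \<omega>) ^ k * (1 - exp (- Y i \<omega>)) ^ Suc j \<partial>M i)"
      using ev by eventually_elim (rule eq[symmetric], auto)
    ultimately show ?case by (rule Lim_transform_eventually)
  qed
  have cG: "continuous_on {0..1} G" using G by (rule continuous_on_subset) simp
  show ?thesis
  proof (rule tendstoI)
    fix e :: real assume e: "0 < e"
    obtain N where N: "\<And>n s. N \<le> n \<Longrightarrow> s \<in> {0..1} \<Longrightarrow> \<bar>G s - (\<Sum>k\<le>n. G (k / n) * Bernstein n k s)\<bar> < e / 3"
      using Bernstein_Weierstrass[OF cG, of "e / 3"] e by auto
    define p where "p s = (\<Sum>k\<le>N. G (k / N) * Bernstein N k s)" for s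
    have cp: "continuous_on UNIV p" unfolding p_def Bernstein_def by (intro continuous_intros)
    have Gp: "\<bar>(\<integral>\<omega>. G (exp (- y \<omega>)) \<partial>Q) - (\<integral>\<omega>. p (exp (- y \<omega>)) \<partial>Q)\<bar> \<le> e / 3"
      if Q: "prob_space Q" "y \<in> borel_measurable Q" "AE \<omega> in Q. 0 \<le> y \<omega>" for Q :: "real measure" and y
    proof -
      interpret Q: prob_space Q by fact
      note i = int[OF Q G] int[OF Q cp]
      have "\<bar>(\<integral>\<omega>. G (exp (- y \<omega>)) \<partial>Q) - (\<integral>\<omega>. p (exp (- y \<omega>)) \<partial>Q)\<bar> \<le> (\<integral>\<omega>. \<bar>G (exp (- y \<omega>)) - p (exp (- y \<omega>))\<bar> \<partial>Q)"
        unfolding Bochner_Integration.integral_diff[OF i, symmetric] by (rule integral_abs_bound)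
      also have "\<dots> \<le> (\<integral>\<omega>. e / 3 \<partial>Q)"
      proof (rule integral_mono_AE)
        show "AE \<omega> in Q. \<bar>G (exp (- y \<omega>)) - p (exp (- y \<omega>))\<bar> \<le> e / 3"
          using Q(3) by eventually_elim (use N[of N] in \<open>auto simp: p_def intro!: less_imp_le\<close>)
      qed (use i in auto)
      finally show ?thesis by (simp add: Q.prob_space)
    qed
    have pe: "(\<integral>\<omega>. p (exp (- y \<omega>)) \<partial>Q) = (\<Sum>k\<le>N. G (k / N) * (N choose k) *
        (\<integral>\<omega>. exp (- y \<omega>) ^ k * (1 - exp (- y \<omega>)) ^ (N - k) \<partial>Q))"
      if Q: "prob_space Q" "y \<in> borel_measurable Q" "AE \<omega> in Q. 0 \<le> y \<omega>" for Q :: "real measure" and y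
    proof -
      have c: "continuous_on UNIV (\<lambda>s::real. s ^ k * (1 - s) ^ j)" for k j by (intro continuous_intros)
      have "(\<integral>\<omega>. p (exp (- y \<omega>)) \<partial>Q) = (\<integral>\<omega>. (\<Sum>k\<le>N. G (k / N) * (N choose k) *
          (exp (- y \<omega>) ^ k * (1 - exp (- y \<omega>)) ^ (N - k))) \<partial>Q)"
        unfolding p_def Bernstein_def by (simp add: mult.assoc)
      also have "\<dots> = (\<Sum>k\<le>N. G (k / N) * (N choose k) *
        (\<integral>\<omega>. exp (- y \<omega>) ^ k * (1 - exp (- y \<omega>)) ^ (N - k) \<partial>Q))"
        using int[OF Q c] by (subst Bochner_Integration.integral_sum) auto
      finally show ?thesis .
    qed
    have "((\<lambda>i. \<Sum>k\<le>N. G (k / N) * (N choose k) * (\<integral>\<omega>. exp (- Y i \<omega>) ^ k * (1 - exp (- Y i \<omega>)) ^ (N - k) \<partial>M i)) \<longlongrightarrow>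
        (\<integral>z. p (exp (- z)) \<partial>exp1)) F"
      unfolding pe[OF goodE] by (intro tendsto_sum tendsto_mult tendsto_const mono)
    then have "\<forall>\<^sub>F i in F. dist (\<Sum>k\<le>N. G (k / N) * (N choose k) * (\<integral>\<omega>. exp (- Y i \<omega>) ^ k * (1 - exp (- Y i \<omega>)) ^ (N - k) \<partial>M i))
        (\<integral>z. p (exp (- z)) \<partial>exp1) < e / 3"
      by (rule tendstoD) (use e in simp)
    then show "\<forall>\<^sub>F i in F. dist (\<integral>\<omega>. G (exp (- Y i \<omega>)) \<partial>M i) (\<integral>z. G (exp (- z)) \<partial>exp1) < e"
      using ev
    proof eventually_elim
      case (elim i)
      then have i: "prob_space (M i)" "Y i \<in> borel_measurable (M i)" "AE \<omega> in M i. 0 \<le> Y i \<omega>" by auto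
      show ?case
        using elim(1) Gp[OF i] Gp[OF goodE] unfolding pe[OF i, symmetric] dist_real_def by linarith
    qed
  qed
qed

text \<open>Push forward along \<open>Y\<close> to measures on the line, where the given laws and
  the exponential law have the same type and share the auxiliary estimates.\<close>

lemma laplace_weak:
  fixes M :: "'i \<Rightarrow> 'a measure" and Y :: "'i \<Rightarrow> 'a \<Rightarrow> real" and G :: "real \<Rightarrow> real"
  assumes ev: "\<forall>\<^sub>F i in F. prob_space (M i) \<and> Y i \<in> borel_measurable (M i) \<and> (AE \<omega> in M i. 0 \<le> Y i \<omega>)"
    and lap: "\<And>k::nat. ((\<lambda>i. \<integral>\<omega>. exp (- (real k * Y i \<omega>)) \<partial>M i) \<longlongrightarrow> 1 / (1 + real k)) F"
    and G: "continuous_on UNIV G"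
  shows "((\<lambda>i. \<integral>\<omega>. G (exp (- Y i \<omega>)) \<partial>M i) \<longlongrightarrow> (\<integral>z. G (exp (- z)) \<partial>exp1)) F"
proof -
  define N where "N i = distr (M i) borel (Y i)" for i
  have [measurable]: "G \<in> borel_measurable borel" by (rule borel_measurable_continuous_onI[OF G])
  have "((\<lambda>i. \<integral>z. G (exp (- z)) \<partial>N i) \<longlongrightarrow> (\<integral>z. G (exp (- z)) \<partial>exp1)) F"
  proof (rule laplace_weak_real[OF _ _ G])
    show "\<forall>\<^sub>F i in F. prob_space (N i) \<and> (\<lambda>z. z) \<in> borel_measurable (N i) \<and> (AE z in N i. 0 \<le> z)"
      using ev
    proof eventually_elim
      case (elim i)
      then have "AE z in N i. 0 \<le> z" unfolding N_def by (subst AE_distr_iff) auto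
      moreover have "prob_space (N i)" unfolding N_def using elim by (intro prob_space.prob_space_distr) auto
      ultimately show ?case by (simp add: N_def)
    qed
    fix k :: nat
    have "\<forall>\<^sub>F i in F. (\<integral>\<omega>. exp (- (real k * Y i \<omega>)) \<partial>M i) = (\<integral>z. exp (- (real k * z)) \<partial>N i)"
      using ev by eventually_elim (auto simp: N_def integral_distr)
    with lap[of k] show "((\<lambda>i. \<integral>z. exp (- (real k * z)) \<partial>N i) \<longlongrightarrow> 1 / (1 + real k)) F"
      by (rule Lim_transform_eventually)
  qed
  moreover have "\<forall>\<^sub>F i in F. (\<integral>z. G (exp (- z)) \<partial>N i) = (\<integral>\<omega>. G (exp (- Y i \<omega>)) \<partial>M i)"
    using ev by eventually_elim (auto simp: N_def integral_distr)
  ultimately show ?thesis by (rule Lim_transform_eventually)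
qed

text \<open>Continuous mapping in a relaxed form: \<open>\<psi>\<close> is continuous on
  \<open>]0, \<infinity>[\<close>, and \<open>\<Psi>\<close> is close to \<open>\<psi> (Y)\<close>
  in probability as long as \<open>Y\<close> stays in a compact part of it. A cutoff in
  \<open>exp (- Y)\<close> confines \<open>Y\<close> there, and its cost is small because the
  exponential law charges neither 0 nor \<infinity>.\<close>

lemma transfer_limit:
  fixes M :: "'i \<Rightarrow> 'a measure" and Y \<Psi> :: "'i \<Rightarrow> 'a \<Rightarrow> real" and \<psi> :: "real \<Rightarrow> real" and K :: real
  assumes ev: "\<forall>\<^sub>F i in F. prob_space (M i) \<and> Y i \<in> borel_measurable (M i) \<and> (AE \<omega> in M i. 0 \<le> Y i \<omega>)"
    and lap: "\<And>k::nat. ((\<lambda>i. \<integral>\<omega>. exp (- (real k * Y i \<omega>)) \<partial>M i) \<longlongrightarrow> 1 / (1 + real k)) F"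
    and \<Psi>: "\<forall>\<^sub>F i in F. \<Psi> i \<in> borel_measurable (M i)" "\<And>i \<omega>. \<bar>\<Psi> i \<omega>\<bar> \<le> K"
    and \<psi>: "continuous_on {0<..} \<psi>" "\<psi> \<in> borel_measurable borel" "\<And>z. \<bar>\<psi> z\<bar> \<le> K"
    and close: "\<And>\<alpha> \<beta> \<epsilon>. 0 < \<alpha> \<Longrightarrow> 0 < \<epsilon> \<Longrightarrow>
      ((\<lambda>i. measure (M i) {\<omega> \<in> space (M i). \<alpha> \<le> Y i \<omega> \<and> Y i \<omega> \<le> \<beta> \<and> \<epsilon> \<le> \<bar>\<Psi> i \<omega> - \<psi> (Y i \<omega>)\<bar>}) \<longlongrightarrow> 0) F"
  shows "((\<lambda>i. \<integral>\<omega>. \<Psi> i \<omega> \<partial>M i) \<longlongrightarrow> (\<integral>z. \<psi> z \<partial>exp1)) F"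
proof -
  interpret E: prob_space exp1 by (rule prob_space_exponential_density) simp
  have K: "0 \<le> K" using \<psi>(3)[of 0] by linarith
  \<comment> \<open>In the variable \<open>s = exp (- y)\<close>: it vanishes within
    \<open>1 / n\<close> of 0 and of 1 and outside \<open>[0, 1]\<close>, and equals 1 at distance
    at least \<open>2 / n\<close> inside.\<close>
  define cutoff where "cutoff n s = max 0 (min 1 (min (real n * s - 1) (real n * (1 - s) - 1)))" for n s
  have ctc: "continuous_on UNIV (cutoff n)" for n unfolding cutoff_def by (intro continuous_intros)
  have ct01: "0 \<le> cutoff n s" "cutoff n s \<le> 1" for n s by (auto simp: cutoff_def)
  note [measurable] = \<psi>(2) borel_measurable_continuous_onI[OF ctc]
  have lim1: "(\<lambda>n. \<integral>z. cutoff n (exp (- z)) \<partial>exp1) \<longlonglongrightarrow> (\<integral>z. 1 \<partial>exp1)"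
  proof (rule integral_dominated_convergence[where w="\<lambda>_. 1"])
    show "AE z in exp1. (\<lambda>n. cutoff n (exp (- z))) \<longlonglongrightarrow> 1"
      using AE_exp1_pos
    proof eventually_elim
      case (elim z)
      define q where "q = min (exp (- z)) (1 - exp (- z))"
      have q: "0 < q" using elim by (simp add: q_def)
      obtain n0 where n0: "2 / q \<le> real n0" using real_arch_simple by blast
      have "\<forall>\<^sub>F n in sequentially. cutoff n (exp (- z)) = 1"
      proof (rule eventually_sequentiallyI[of n0])
        fix n assume "n0 \<le> n"
        then have "2 / q \<le> real n" using n0 by simp
        then have "2 \<le> real n * q" using q by (simp add: divide_le_eq)
        moreover have "real n * q \<le> real n * exp (- z)" "real n * q \<le> real n * (1 - exp (- z))"
          by (auto simp: q_def intro!: mult_left_mono)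
        ultimately show "cutoff n (exp (- z)) = 1" by (simp add: cutoff_def)
      qed
      then show ?case by (rule tendsto_eventually)
    qed
    show "AE z in exp1. norm (cutoff n (exp (- z))) \<le> 1" for n using ct01 by (simp add: abs_of_nonneg)
  qed auto
  show ?thesis
  proof (rule tendstoI)
    fix e :: real assume e: "0 < e"
    \<comment> \<open>Chosen for the final sum: \<open>K * \<epsilon>\<close> for each of the two
      cutoffs, \<open>2 * K * \<epsilon>\<close> for the bad set, and plain
      \<open>\<epsilon>\<close> terms.\<close>
    define \<epsilon> where "\<epsilon> = e / (4 * K + 3)"
    have \<epsilon>: "0 < \<epsilon>" using e K by (simp add: \<epsilon>_def)
    have "\<forall>\<^sub>F n in sequentially. 1 - \<epsilon> < (\<integral>z. cutoff n (exp (- z)) \<partial>exp1)"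
      by (rule order_tendstoD(1)[OF lim1]) (use \<epsilon> E.prob_space in simp)
    then have "\<forall>\<^sub>F n in sequentially. 1 - \<epsilon> < (\<integral>z. cutoff n (exp (- z)) \<partial>exp1) \<and> 3 \<le> n"
      using eventually_ge_at_top[of 3] by (rule eventually_conj)
    then obtain n where n: "1 - \<epsilon> < (\<integral>z. cutoff n (exp (- z)) \<partial>exp1)" "3 \<le> n"
      by (auto dest: eventually_happens)
    define ct where "ct = cutoff n"
    have n0: "0 < real n" using n(2) by simp
    have ct_zero: "ct s = 0" if "s \<le> 1 / real n \<or> 1 - 1 / real n \<le> s" for s
    proof -
      have "real n * s \<le> 1 \<or> real n * (1 - s) \<le> 1"
        using that n0 by (auto simp: field_simps)
      then show ?thesis by (auto simp: ct_def cutoff_def)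
    qed
    define \<alpha> where "\<alpha> = - ln (1 - 1 / real n)"
    define \<beta> where "\<beta> = - ln (1 / real n)"
    have n1: "0 < 1 - 1 / real n" "1 - 1 / real n < 1" "0 < 1 / real n" using n(2) by (auto simp: field_simps)
    have \<alpha>: "0 < \<alpha>" unfolding \<alpha>_def using n1 by simp
    have ct_supp: "\<alpha> \<le> y \<and> y \<le> \<beta>" if "ct (exp (- y)) \<noteq> 0" for y
    proof -
      have "1 / real n < exp (- y)" "exp (- y) < 1 - 1 / real n" using ct_zero that by (meson not_le)+
      then have "ln (1 / real n) < - y" "- y < ln (1 - 1 / real n)"
        using n1 by (metis ln_exp ln_less_cancel_iff exp_gt_zero)+
      then show ?thesis by (simp add: \<alpha>_def \<beta>_def)
    qed
    \<comment> \<open>The cutoff vanishes near and outside the ends of \<open>[0, 1]\<close>, so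
      \<open>G\<close> is continuous on the whole line although \<open>\<psi> (- ln s)\<close> need
      not be.\<close>
    define G where "G s = \<psi> (- ln s) * ct s" for s
    have cG: "continuous_on UNIV G"
    proof -
      have z: "continuous_on S G" if "\<And>s. s \<in> S \<Longrightarrow> s \<le> 1 / real n \<or> 1 - 1 / real n \<le> s" for S
        by (rule continuous_on_eq[of _ "\<lambda>_. 0"]) (use ct_zero that in \<open>auto simp: G_def\<close>)
      have m: "continuous_on {1 / real n..1 - 1 / real n} G"
        unfolding G_def
      proof (intro continuous_on_mult continuous_on_compose2[OF \<psi>(1)])
        show "continuous_on {1 / real n..1 - 1 / real n} ct"
          unfolding ct_def by (rule continuous_on_subset[OF ctc]) simp
        show "continuous_on {1 / real n..1 - 1 / real n} (\<lambda>s. - ln s)"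
          using n1 by (intro continuous_intros) auto
        show "(\<lambda>s. - ln s) ` {1 / real n..1 - 1 / real n} \<subseteq> {0<..}"
        proof
          fix y assume "y \<in> (\<lambda>s. - ln s) ` {1 / real n..1 - 1 / real n}"
          then obtain s where s: "y = - ln s" "1 / real n \<le> s" "s \<le> 1 - 1 / real n" by auto
          then have "0 < s" "s < 1" using n1 by linarith+
          then show "y \<in> {0<..}" using s by simp
        qed
      qed
      have "continuous_on ({..1 / real n} \<union> ({1 / real n..1 - 1 / real n} \<union> {1 - 1 / real n..})) G"
        by (intro continuous_on_closed_Un z m closed_Un) auto
      moreover have "{..1 / real n} \<union> ({1 / real n..1 - 1 / real n} \<union> {1 - 1 / real n..}) = UNIV" by auto
      ultimately show ?thesis by simp
    qed
    have G_exp: "G (exp (- y)) = \<psi> y * ct (exp (- y))" for y by (simp add: G_def)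
    have [measurable]: "ct \<in> borel_measurable borel" unfolding ct_def by simp
    have ctb: "0 \<le> ct s" "ct s \<le> 1" for s using ct01 by (auto simp: ct_def)
    have \<psi>ct: "\<bar>\<psi> y * ct s\<bar> \<le> K" for y s
      using mult_mono[OF \<psi>(3) ctb(2)[of s], of y] ctb(1)[of s] K by (simp add: abs_mult)
    have l1: "((\<lambda>i. \<integral>\<omega>. \<psi> (Y i \<omega>) * ct (exp (- Y i \<omega>)) \<partial>M i) \<longlongrightarrow> (\<integral>z. \<psi> z * ct (exp (- z)) \<partial>exp1)) F"
      using laplace_weak[OF ev lap cG] unfolding G_exp .
    have l2: "((\<lambda>i. \<integral>\<omega>. ct (exp (- Y i \<omega>)) \<partial>M i) \<longlongrightarrow> (\<integral>z. ct (exp (- z)) \<partial>exp1)) F"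
      unfolding ct_def by (rule laplace_weak[OF ev lap ctc])
    define bad where "bad i = {\<omega> \<in> space (M i). \<alpha> \<le> Y i \<omega> \<and> Y i \<omega> \<le> \<beta> \<and> \<epsilon> \<le> \<bar>\<Psi> i \<omega> - \<psi> (Y i \<omega>)\<bar>}" for i
    have l3: "((\<lambda>i. measure (M i) (bad i)) \<longlongrightarrow> 0) F" unfolding bad_def by (rule close[OF \<alpha> \<epsilon>])
    have E1: "\<bar>(\<integral>z. \<psi> z \<partial>exp1) - (\<integral>z. \<psi> z * ct (exp (- z)) \<partial>exp1)\<bar> \<le> K * \<epsilon>"
    proof -
      have i1: "integrable exp1 \<psi>" by (rule E.integrable_const_bound[of _ K]) (use \<psi>(3) in auto)
      have i2: "integrable exp1 (\<lambda>z. \<psi> z * ct (exp (- z)))"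
        by (rule E.integrable_const_bound[of _ K])
           (auto intro!: AE_I2 \<psi>ct)
      have i3: "integrable exp1 (\<lambda>z. ct (exp (- z)))"
        by (rule E.integrable_const_bound[of _ 1]) (use ctb in \<open>auto simp: abs_of_nonneg\<close>)
      have "\<bar>(\<integral>z. \<psi> z \<partial>exp1) - (\<integral>z. \<psi> z * ct (exp (- z)) \<partial>exp1)\<bar> \<le> (\<integral>z. \<bar>\<psi> z - \<psi> z * ct (exp (- z))\<bar> \<partial>exp1)"
        unfolding Bochner_Integration.integral_diff[OF i1 i2, symmetric] by (rule integral_abs_bound)
      also have "\<dots> \<le> (\<integral>z. K * (1 - ct (exp (- z))) \<partial>exp1)"
      proof (rule integral_mono)
        show "integrable exp1 (\<lambda>z. K * (1 - ct (exp (- z))))" using i3 by simp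
        show "integrable exp1 (\<lambda>z. \<bar>\<psi> z - \<psi> z * ct (exp (- z))\<bar>)" using i1 i2 by simp
        fix z
        have "\<psi> z - \<psi> z * ct (exp (- z)) = \<psi> z * (1 - ct (exp (- z)))" by (simp add: algebra_simps)
        then show "\<bar>\<psi> z - \<psi> z * ct (exp (- z))\<bar> \<le> K * (1 - ct (exp (- z)))"
          using \<psi>(3) ctb by (auto simp: abs_mult intro!: mult_right_mono)
      qed
      also have "\<dots> = K * (1 - (\<integral>z. ct (exp (- z)) \<partial>exp1))" using i3 E.prob_space by simp
      also have "\<dots> \<le> K * \<epsilon>" using n(1) K by (intro mult_left_mono) (auto simp: ct_def)
      finally show ?thesis .
    qed
    have "\<forall>\<^sub>F i in F. \<bar>(\<integral>\<omega>. \<psi> (Y i \<omega>) * ct (exp (- Y i \<omega>)) \<partial>M i) - (\<integral>z. \<psi> z * ct (exp (- z)) \<partial>exp1)\<bar> < \<epsilon>"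
      using tendstoD[OF l1 \<epsilon>] by (simp add: dist_real_def)
    moreover have "\<forall>\<^sub>F i in F. 1 - \<epsilon> < (\<integral>\<omega>. ct (exp (- Y i \<omega>)) \<partial>M i)"
      by (rule order_tendstoD(1)[OF l2]) (use n(1) in \<open>simp add: ct_def\<close>)
    moreover have "\<forall>\<^sub>F i in F. measure (M i) (bad i) < \<epsilon>"
      by (rule order_tendstoD(2)[OF l3 \<epsilon>])
    ultimately show "\<forall>\<^sub>F i in F. dist (\<integral>\<omega>. \<Psi> i \<omega> \<partial>M i) (\<integral>z. \<psi> z \<partial>exp1) < e"
      using ev \<Psi>(1)
    proof eventually_elim
      case (elim i)
      then interpret M: prob_space "M i" by simp
      have [measurable]: "Y i \<in> borel_measurable (M i)" "\<Psi> i \<in> borel_measurable (M i)" using elim by auto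
      have bad [measurable]: "bad i \<in> sets (M i)" unfolding bad_def by measurable
      have i1: "integrable (M i) (\<Psi> i)" by (rule M.integrable_const_bound[of _ K]) (use \<Psi>(2) in auto)
      have i2: "integrable (M i) (\<lambda>\<omega>. \<psi> (Y i \<omega>) * ct (exp (- Y i \<omega>)))"
        by (rule M.integrable_const_bound[of _ K])
           (auto intro!: AE_I2 \<psi>ct)
      have i3: "integrable (M i) (\<lambda>\<omega>. ct (exp (- Y i \<omega>)))"
        by (rule M.integrable_const_bound[of _ 1]) (use ctb in \<open>auto simp: abs_of_nonneg\<close>)
      have i4: "integrable (M i) (indicator (bad i) :: _ \<Rightarrow> real)"
        by (intro integrable_real_indicator) (auto simp: M.emeasure_eq_measure)
      have "\<bar>(\<integral>\<omega>. \<Psi> i \<omega> \<partial>M i) - (\<integral>\<omega>. \<psi> (Y i \<omega>) * ct (exp (- Y i \<omega>)) \<partial>M i)\<bar>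
          \<le> (\<integral>\<omega>. \<bar>\<Psi> i \<omega> - \<psi> (Y i \<omega>) * ct (exp (- Y i \<omega>))\<bar> \<partial>M i)"
        unfolding Bochner_Integration.integral_diff[OF i1 i2, symmetric] by (rule integral_abs_bound)
      also have "\<dots> \<le> (\<integral>\<omega>. K * (1 - ct (exp (- Y i \<omega>))) + \<epsilon> + 2 * K * indicator (bad i) \<omega> \<partial>M i)"
      proof (rule integral_mono)
        show "integrable (M i) (\<lambda>\<omega>. \<bar>\<Psi> i \<omega> - \<psi> (Y i \<omega>) * ct (exp (- Y i \<omega>))\<bar>)" using i1 i2 by simp
        show "integrable (M i) (\<lambda>\<omega>. K * (1 - ct (exp (- Y i \<omega>))) + \<epsilon> + 2 * K * indicator (bad i) \<omega>)"
          using i3 i4 by simp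
        fix \<omega> assume w: "\<omega> \<in> space (M i)"
        define X where "X = ct (exp (- Y i \<omega>))"
        have X: "0 \<le> X" "X \<le> 1" using ctb by (auto simp: X_def)
        have "\<Psi> i \<omega> - \<psi> (Y i \<omega>) * X = \<Psi> i \<omega> * (1 - X) + (\<Psi> i \<omega> - \<psi> (Y i \<omega>)) * X"
          by (simp add: algebra_simps)
        also have "\<bar>\<dots>\<bar> \<le> \<bar>\<Psi> i \<omega>\<bar> * (1 - X) + \<bar>\<Psi> i \<omega> - \<psi> (Y i \<omega>)\<bar> * X"
          using X by (intro order_trans[OF abs_triangle_ineq]) (simp add: abs_mult)
        also have "\<dots> \<le> K * (1 - X) + (\<epsilon> + 2 * K * indicator (bad i) \<omega>)"
        proof (intro add_mono mult_right_mono \<Psi>)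
          show "\<bar>\<Psi> i \<omega> - \<psi> (Y i \<omega>)\<bar> * X \<le> \<epsilon> + 2 * K * indicator (bad i) \<omega>"
          proof (cases "X = 0")
            case True
            then show ?thesis using \<epsilon> K by simp
          next
            case False
            then have Y: "\<alpha> \<le> Y i \<omega>" "Y i \<omega> \<le> \<beta>" using ct_supp[of "Y i \<omega>"] by (auto simp: X_def)
            have le: "\<bar>\<Psi> i \<omega> - \<psi> (Y i \<omega>)\<bar> * X \<le> \<bar>\<Psi> i \<omega> - \<psi> (Y i \<omega>)\<bar>"
              using X by (simp add: mult_left_le)
            show ?thesis
            proof (cases "\<omega> \<in> bad i")
              case True
              have "\<bar>\<Psi> i \<omega> - \<psi> (Y i \<omega>)\<bar> \<le> 2 * K" using \<Psi>(2)[of i \<omega>] \<psi>(3)[of "Y i \<omega>"] by linarith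
              then show ?thesis using le True \<epsilon> by simp
            next
              case False
              then have "\<bar>\<Psi> i \<omega> - \<psi> (Y i \<omega>)\<bar> < \<epsilon>" using Y w by (auto simp: bad_def)
              then show ?thesis using le False by simp
            qed
          qed
        qed (use X in auto)
        finally show "\<bar>\<Psi> i \<omega> - \<psi> (Y i \<omega>) * ct (exp (- Y i \<omega>))\<bar> \<le> K * (1 - ct (exp (- Y i \<omega>))) + \<epsilon> + 2 * K * indicator (bad i) \<omega>"
          unfolding X_def by simp
      qed
      also have "\<dots> = K * (1 - (\<integral>\<omega>. ct (exp (- Y i \<omega>)) \<partial>M i)) + \<epsilon> + 2 * K * measure (M i) (bad i)"
        using i3 i4 M.prob_space by simp
      also have "\<dots> \<le> K * \<epsilon> + \<epsilon> + 2 * K * \<epsilon>"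
        using elim K by (intro add_mono mult_left_mono) auto
      finally have "\<bar>(\<integral>\<omega>. \<Psi> i \<omega> \<partial>M i) - (\<integral>z. \<psi> z \<partial>exp1)\<bar> < K * \<epsilon> + \<epsilon> + 2 * K * \<epsilon> + \<epsilon> + K * \<epsilon> + \<epsilon>"
        using elim(1) E1 \<epsilon> by linarith
      also have "\<dots> = (4 * K + 3) * \<epsilon>" by (simp add: algebra_simps)
      also have "\<dots> = e" using K by (simp add: \<epsilon>_def)
      finally show ?case by (simp add: dist_real_def)
    qed
  qed
qed

text \<open>On this event the two exponents differ by at least \<open>\<delta>\<close> while the
  second is at most \<open>(a + c) * \<beta>\<close>, so the exponentials differ by at least
  \<open>\<kappa>\<close>; Chebyshev's inequality concludes. The shift by \<open>c\<close> makes
  both exponents nonnegative for a signed \<open>X\<close>.\<close>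

lemma close_in_probability:
  fixes M :: "'i \<Rightarrow> 'a measure" and X Y :: "'i \<Rightarrow> 'a \<Rightarrow> real" and a c \<delta> \<beta> :: real
  assumes ev: "\<forall>\<^sub>F i in F. prob_space (M i) \<and> X i \<in> borel_measurable (M i) \<and> Y i \<in> borel_measurable (M i)"
    and pos: "\<And>i \<omega>. 0 \<le> X i \<omega> + c * Y i \<omega>" "\<And>i \<omega>. 0 \<le> Y i \<omega>" "0 \<le> a + c"
    and L2: "((\<lambda>i. \<integral>\<omega>. (exp (- (X i \<omega> + c * Y i \<omega>)) - exp (- ((a + c) * Y i \<omega>)))\<^sup>2 \<partial>M i) \<longlongrightarrow> 0) F"
    and \<delta>: "0 < \<delta>"
  shows "((\<lambda>i. measure (M i) {\<omega> \<in> space (M i). Y i \<omega> \<le> \<beta> \<and> \<delta> \<le> \<bar>X i \<omega> - a * Y i \<omega>\<bar>}) \<longlongrightarrow> 0) F"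
proof -
  define \<kappa> where "\<kappa> = exp (- ((a + c) * \<beta>)) * (1 - exp (- \<delta>))"
  have \<kappa>: "0 < \<kappa>" unfolding \<kappa>_def using \<delta> by simp
  define Z where "Z i \<omega> = exp (- (X i \<omega> + c * Y i \<omega>)) - exp (- ((a + c) * Y i \<omega>))" for i \<omega>
  have Z: "\<kappa> \<le> \<bar>Z i \<omega>\<bar>" if "Y i \<omega> \<le> \<beta>" "\<delta> \<le> \<bar>X i \<omega> - a * Y i \<omega>\<bar>" for i \<omega>
  proof -
    define p where "p = X i \<omega> + c * Y i \<omega>"
    define q where "q = (a + c) * Y i \<omega>"
    have pq: "p - q = X i \<omega> - a * Y i \<omega>" by (simp add: p_def q_def algebra_simps)
    have q: "q \<le> (a + c) * \<beta>" unfolding q_def using that pos by (intro mult_left_mono) auto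
    then have eq: "exp (- ((a + c) * \<beta>)) \<le> exp (- q)" by simp
    have d: "0 \<le> 1 - exp (- \<delta>)" using \<delta> by simp
    have "q + \<delta> \<le> p \<or> p \<le> q - \<delta>" using that(2) pq by linarith
    then consider "q + \<delta> \<le> p" | "p \<le> q - \<delta>" by blast
    then show ?thesis
    proof cases
      case 1
      have "exp (- p) \<le> exp (- q) * exp (- \<delta>)" using 1 by (simp flip: exp_add)
      moreover have "\<kappa> \<le> exp (- q) * (1 - exp (- \<delta>))" unfolding \<kappa>_def using eq d by (intro mult_right_mono)
      ultimately show ?thesis unfolding Z_def p_def[symmetric] q_def[symmetric] by (simp add: right_diff_distrib)
    next
      case 2
      have "exp (- q) * exp \<delta> \<le> exp (- p)" using 2 by (simp flip: exp_add)
      moreover have "\<kappa> \<le> exp (- q) * (1 - exp (- \<delta>))" unfolding \<kappa>_def using eq d by (intro mult_right_mono)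
      \<comment> \<open>Since \<open>exp \<delta> + exp (- \<delta>) \<ge> 2\<close>, a smaller
        exponent \<open>p\<close> separates the exponentials at least as much as a larger
        one.\<close>
      moreover have "exp (- q) * (1 - exp (- \<delta>)) \<le> exp (- q) * (exp \<delta> - 1)"
      proof (intro mult_left_mono)
        have "1 + - \<delta> \<le> exp (- \<delta>)" "1 + \<delta> \<le> exp \<delta>" by (rule exp_ge_add_one_self)+
        then show "1 - exp (- \<delta>) \<le> exp \<delta> - 1" by linarith
      qed simp
      ultimately show ?thesis unfolding Z_def p_def[symmetric] q_def[symmetric] by (simp add: right_diff_distrib)
    qed
  qed
  have Zle: "\<bar>Z i \<omega>\<bar> \<le> 1" for i \<omega>
  proof -
    have "0 < exp (- (X i \<omega> + c * Y i \<omega>))" "exp (- (X i \<omega> + c * Y i \<omega>)) \<le> 1"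
      "0 < exp (- ((a + c) * Y i \<omega>))" "exp (- ((a + c) * Y i \<omega>)) \<le> 1"
      using pos(1,2)[of i \<omega>] pos(3) by auto
    then show ?thesis unfolding Z_def by linarith
  qed
  show ?thesis
  proof (rule tendsto_sandwich[where f="\<lambda>_. 0" and h="\<lambda>i. (\<integral>\<omega>. (Z i \<omega>)\<^sup>2 \<partial>M i) / \<kappa>\<^sup>2"])
    show "\<forall>\<^sub>F i in F. measure (M i) {\<omega> \<in> space (M i). Y i \<omega> \<le> \<beta> \<and> \<delta> \<le> \<bar>X i \<omega> - a * Y i \<omega>\<bar>}
        \<le> (\<integral>\<omega>. (Z i \<omega>)\<^sup>2 \<partial>M i) / \<kappa>\<^sup>2"
      using ev
    proof eventually_elim
      case (elim i)
      then interpret M: prob_space "M i" by simp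
      have [measurable]: "X i \<in> borel_measurable (M i)" "Y i \<in> borel_measurable (M i)" using elim by auto
      let ?S = "{\<omega> \<in> space (M i). Y i \<omega> \<le> \<beta> \<and> \<delta> \<le> \<bar>X i \<omega> - a * Y i \<omega>\<bar>}"
      have S: "?S \<in> sets (M i)" by measurable
      have [measurable]: "Z i \<in> borel_measurable (M i)" unfolding Z_def by measurable
      have iZ: "integrable (M i) (\<lambda>\<omega>. (Z i \<omega>)\<^sup>2)"
        by (rule M.integrable_const_bound[of _ 1]) (use Zle in \<open>auto simp: abs_square_le_1\<close>)
      have "\<kappa>\<^sup>2 * measure (M i) ?S = (\<integral>\<omega>. \<kappa>\<^sup>2 * indicator ?S \<omega> \<partial>M i)"
        using S by simp
      also have "\<dots> \<le> (\<integral>\<omega>. (Z i \<omega>)\<^sup>2 \<partial>M i)"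
      proof (rule integral_mono[OF _ iZ])
        show "integrable (M i) (\<lambda>\<omega>. \<kappa>\<^sup>2 * indicator ?S \<omega>)"
          using S by (intro integrable_mult_right integrable_real_indicator) (auto simp: M.emeasure_eq_measure)
        fix \<omega>
        show "\<kappa>\<^sup>2 * indicator ?S \<omega> \<le> (Z i \<omega>)\<^sup>2"
        proof (cases "\<omega> \<in> ?S")
          case True
          then have "\<kappa> \<le> \<bar>Z i \<omega>\<bar>" by (intro Z) auto
          then have "\<kappa>\<^sup>2 \<le> \<bar>Z i \<omega>\<bar>\<^sup>2" using \<kappa> by (intro power_mono) auto
          then show ?thesis using True by simp
        qed auto
      qed
      finally show ?case using \<kappa> by (simp add: pos_le_divide_eq mult.commute)
    qed
    have "((\<lambda>i. (\<integral>\<omega>. (Z i \<omega>)\<^sup>2 \<partial>M i) / \<kappa>\<^sup>2) \<longlongrightarrow> 0 / \<kappa>\<^sup>2) F"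
      using L2 \<kappa> unfolding Z_def by (intro tendsto_divide tendsto_const) auto
    then show "((\<lambda>i. (\<integral>\<omega>. (Z i \<omega>)\<^sup>2 \<partial>M i) / \<kappa>\<^sup>2) \<longlongrightarrow> 0) F" by simp
  qed auto
qed

section \<open>Survival probability and conditional Laplace transforms\<close>

context critical_branching
begin

interpretation T0: branching_tree D P b d bs Q "\<lambda>_. 0"
  by unfold_locales auto

declare T0.Q_space [simp del]

lemma integrable_gprod:
  assumes "p \<in> borel_measurable borel" "\<And>y. 0 \<le> p y \<and> p y \<le> 1"
  shows "integrable (Q x) (gprod p t)"
proof -
  interpret Q: prob_space "Q x" by (rule Q_prob)
  have "gprod p t \<in> borel_measurable (Q x)" using measurable_gprod[OF assms(1)] by (simp add: Q_measurable_eq)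
  then show ?thesis
    by (intro Q.integrable_const_bound[of _ 1]) (use gprod_bounds[OF assms(2)] in \<open>auto simp: abs_of_nonneg\<close>)
qed

lemma measurable_Npop_Q [measurable]: "(\<lambda>c. Npop b d t c) \<in> borel_measurable (Q x)"
  by (simp add: Q_measurable_eq)

definition surv :: "real \<Rightarrow> real \<Rightarrow> real" where
  "surv x t = measure (Q x) {c \<in> space (Q x). Npop b d t c > 0}"

lemma Npop_nonneg: "0 \<le> Npop b d t c"
  by (simp add: Npop_eq)

lemma surv_eq: "surv x t = 1 - (\<integral>c. gprod (\<lambda>_. 0) t c \<partial>Q x)"
proof -
  interpret Q: prob_space "Q x" by (rule Q_prob)
  have i: "integrable (Q x) (gprod (\<lambda>_. 0) t)" by (rule integrable_gprod) auto
  have "surv x t = (\<integral>c. indicator {c \<in> space (Q x). Npop b d t c > 0} c \<partial>Q x)"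
    by (simp add: surv_def)
  also have "\<dots> = (\<integral>c. 1 - gprod (\<lambda>_. 0) t c \<partial>Q x)"
    by (intro Bochner_Integration.integral_cong refl)
       (use Npop_nonneg in \<open>auto simp: gprod_0 less_le split: split_indicator\<close>)
  finally show ?thesis using i by (simp add: Q.prob_space)
qed

lemma survival_mild: "\<exists>w. mild (\<lambda>_. 1) w \<and> (\<forall>t\<ge>0. \<forall>x. w t x = surv x t)"
  using generating_mild[of "\<lambda>_. 0"] by (simp add: surv_eq)

text \<open>Used with \<open>r = A * B\<close>, \<open>q = 1\<close> for the normalisation of the
  limit theorem, and with \<open>r = 1 / \<theta>\<close>, \<open>q = 0\<close> for the lower bound
  on survival.\<close>

definition lap :: "(real \<Rightarrow> real) \<Rightarrow> real \<Rightarrow> real \<Rightarrow> real \<Rightarrow> real \<Rightarrow> real" where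
  "lap g r q x t = 1 - (\<integral>c. gprod (\<lambda>y. exp (- (g y / (r * (t + q))))) t c \<partial>Q x)"

lemma one_minus_exp_bounds:
  fixes u :: real
  assumes "0 \<le> u"
  shows "1 - exp (- u) \<le> u" "u - u\<^sup>2 \<le> 1 - exp (- u)" "0 \<le> 1 - exp (- u)"
proof -
  show "1 - exp (- u) \<le> u" using exp_ge_add_one_self[of "- u"] by simp
  show "0 \<le> 1 - exp (- u)" using assms by simp
  have "exp (- u) \<le> 1 / (1 + u)"
    using exp_ge_add_one_self[of u] assms by (simp add: exp_minus inverse_eq_divide frac_le)
  moreover have "(u - u\<^sup>2) * (1 + u) \<le> u"
    using assms by (simp add: algebra_simps power2_eq_square)
  then have "u - u\<^sup>2 \<le> 1 - 1 / (1 + u)" using assms by (simp add: field_simps)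
  ultimately show "u - u\<^sup>2 \<le> 1 - exp (- u)" by linarith
qed

text \<open>The initial datum depends on \<open>t\<close>, so every \<open>t\<close> has its own
  solution and the uniform constant of \<open>small_initial_asymptotics\<close> is applied at
  \<open>T = t\<close>. To first order the datum is \<open>g / (r t)\<close>, which gives the limit
  of \<open>a t\<close>.\<close>

lemma lap_tendsto:
  assumes g: "bm cg g" and r: "0 < r" and q: "0 \<le> q"
  shows "((\<lambda>t. t * lap g r q x t) \<longlongrightarrow> \<Theta> x * ((\<integral>y. g y \<partial>\<mu>) / r / (1 + B * ((\<integral>y. g y \<partial>\<mu>) / r)))) at_top"
proof -
  have cg: "0 \<le> cg" using bm_nonneg[OF g] .
  note [measurable] = bm_meas[OF g]
  define G where "G = (\<integral>y. g y \<partial>\<mu>)"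
  have G: "0 \<le> G" unfolding G_def by (rule bm_integral_nonneg[OF g])
  have compare: "(f \<longlongrightarrow> 0) at_top" if "(h \<longlongrightarrow> 0) at_top" "\<And>t. 1 \<le> t \<Longrightarrow> \<bar>f t\<bar> \<le> h t" for f h :: "real \<Rightarrow> real"
  proof (rule Lim_null_comparison[OF _ that(1)])
    show "\<forall>\<^sub>F t in at_top. norm (f t) \<le> h t"
      using eventually_ge_at_top[of 1] by eventually_elim (use that(2) in simp)
  qed
  \<comment> \<open>The \<open>+ 1\<close> keeps \<open>C\<close> positive when
    \<open>cg = 0\<close>.\<close>
  define C where "C = (cg + 1) / r"
  have C: "0 < C" using cg r by (simp add: C_def)
  define v0 where "v0 t y = 1 - exp (- (g y / (r * (t + q))))" for t y
  have u: "0 \<le> g y / (r * (t + q))" "g y / (r * (t + q)) \<le> C / t" "g y / (r * (t + q)) \<le> cg / (r * (t + q))" if "1 \<le> t" for t y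
  proof -
    show "0 \<le> g y / (r * (t + q))" "g y / (r * (t + q)) \<le> cg / (r * (t + q))"
      using bm_bounds[OF g, of y] that r q by (auto intro!: divide_right_mono)
    have "g y / (r * (t + q)) \<le> (cg + 1) / (r * t)"
      using bm_bounds[OF g, of y] that r q by (intro frac_le) auto
    then show "g y / (r * (t + q)) \<le> C / t" by (simp add: C_def)
  qed
  have v0: "bm (C / t) (v0 t)" if "1 \<le> t" for t
    unfolding bm_def
  proof (intro conjI allI)
    show "v0 t \<in> borel_measurable borel" unfolding v0_def by measurable
    show "0 \<le> v0 t y" "v0 t y \<le> C / t" for y
      using one_minus_exp_bounds[OF u(1)[OF that, of y]] u(2)[OF that, of y] by (auto simp: v0_def)
  qed
  define a where "a t = t * (\<integral>y. v0 t y \<partial>\<mu>)" for t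
  have a_bound: "\<bar>a t - t * (G / (r * (t + q)))\<bar> \<le> t * ((cg / (r * (t + q)))\<^sup>2 * A)" if t: "1 \<le> t" for t
  proof -
    have i1: "integrable \<mu> (v0 t)" by (rule bm_integrable[OF v0[OF t]])
    have i2: "integrable \<mu> (\<lambda>y. g y / (r * (t + q)))" using bm_integrable[OF g] by simp
    have "\<bar>(\<integral>y. v0 t y \<partial>\<mu>) - G / (r * (t + q))\<bar> = \<bar>\<integral>y. v0 t y - g y / (r * (t + q)) \<partial>\<mu>\<bar>"
      using i1 i2 by (simp add: G_def)
    also have "\<dots> \<le> (\<integral>y. \<bar>v0 t y - g y / (r * (t + q))\<bar> \<partial>\<mu>)" by (rule integral_abs_bound)
    also have "\<dots> \<le> (\<integral>y. (cg / (r * (t + q)))\<^sup>2 \<partial>\<mu>)"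
    proof (rule integral_mono)
      show "integrable \<mu> (\<lambda>y. \<bar>v0 t y - g y / (r * (t + q))\<bar>)" using i1 i2 by simp
      fix y
      have "\<bar>v0 t y - g y / (r * (t + q))\<bar> \<le> (g y / (r * (t + q)))\<^sup>2"
        using one_minus_exp_bounds[OF u(1)[OF t, of y]] by (simp add: v0_def abs_le_iff)
      also have "\<dots> \<le> (cg / (r * (t + q)))\<^sup>2" using u[OF t, of y] by (intro power_mono)
      finally show "\<bar>v0 t y - g y / (r * (t + q))\<bar> \<le> (cg / (r * (t + q)))\<^sup>2" .
    qed simp
    also have "\<dots> = (cg / (r * (t + q)))\<^sup>2 * A" by (simp add: A_def)
    finally have "t * \<bar>(\<integral>y. v0 t y \<partial>\<mu>) - G / (r * (t + q))\<bar> \<le> t * ((cg / (r * (t + q)))\<^sup>2 * A)"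
      using t by (intro mult_left_mono) auto
    then show ?thesis using t by (simp add: a_def abs_mult_pos' algebra_simps flip: abs_mult_pos)
  qed
  have a_lim: "(a \<longlongrightarrow> G / r) at_top"
  proof -
    have "((\<lambda>t. t / (t + q)\<^sup>2) \<longlongrightarrow> 0) at_top" by real_asymp
    then have "((\<lambda>t. (cg / r)\<^sup>2 * A * (t / (t + q)\<^sup>2)) \<longlongrightarrow> (cg / r)\<^sup>2 * A * 0) at_top" by (intro tendsto_intros)
    then have "((\<lambda>t. t * ((cg / (r * (t + q)))\<^sup>2 * A)) \<longlongrightarrow> 0) at_top"
      by (simp add: power_divide power_mult_distrib mult_ac)
    then have "((\<lambda>t. a t - t * (G / (r * (t + q)))) \<longlongrightarrow> 0) at_top"
      using a_bound by (rule compare)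
    moreover have "((\<lambda>t. t * (G / (r * (t + q)))) \<longlongrightarrow> G / r) at_top"
    proof -
      have "((\<lambda>t. t / (t + q)) \<longlongrightarrow> 1) at_top" by real_asymp
      then have "((\<lambda>t. (G / r) * (t / (t + q))) \<longlongrightarrow> (G / r) * 1) at_top" by (intro tendsto_intros)
      then show ?thesis by (simp add: mult.commute)
    qed
    ultimately have "((\<lambda>t. (a t - t * (G / (r * (t + q)))) + t * (G / (r * (t + q)))) \<longlongrightarrow> 0 + G / r) at_top"
      by (rule tendsto_add)
    then show ?thesis by simp
  qed
  have main: "((\<lambda>t. \<Theta> x * (a t / (1 + B * a t))) \<longlongrightarrow> \<Theta> x * (G / r / (1 + B * (G / r)))) at_top"
    using B_pos G r by (intro tendsto_intros a_lim) (auto simp: add_nonneg_eq_0_iff)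
  obtain C' where C': "\<And>T v0 v x. 1 \<le> T \<Longrightarrow> mild v0 v \<Longrightarrow> bm (C / T) v0 \<Longrightarrow>
      \<bar>T * v T x - \<Theta> x * (T * (\<integral>y. v0 y \<partial>\<mu>) / (1 + B * (T * (\<integral>y. v0 y \<partial>\<mu>))))\<bar> \<le> C' * (exp (- lam * T) + 1 / T)"
    using small_initial_asymptotics[OF C] by blast
  have bound: "\<bar>t * lap g r q x t - \<Theta> x * (a t / (1 + B * a t))\<bar> \<le> C' * (exp (- lam * t) + 1 / t)" if t: "1 \<le> t" for t
  proof -
    have "\<exists>w. mild (\<lambda>y. 1 - exp (- (g y / (r * (t + q))))) w \<and>
        (\<forall>s\<ge>0. \<forall>x. w s x = 1 - (\<integral>c. gprod (\<lambda>y. exp (- (g y / (r * (t + q))))) s c \<partial>Q x))"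
      using u(1)[OF t] by (intro generating_mild) auto
    then obtain w where w: "mild (v0 t) w"
        "\<And>s x. 0 \<le> s \<Longrightarrow> w s x = 1 - (\<integral>c. gprod (\<lambda>y. exp (- (g y / (r * (t + q))))) s c \<partial>Q x)"
      unfolding v0_def by blast
    have "w t x = lap g r q x t" using w(2)[of t x] t by (simp add: lap_def)
    then show ?thesis using C'[OF t w(1) v0[OF t], of x] by (simp add: a_def)
  qed
  have "((\<lambda>t. C' * (exp (- lam * t) + 1 / t)) \<longlongrightarrow> 0) at_top" using lam by real_asymp
  then have "((\<lambda>t. t * lap g r q x t - \<Theta> x * (a t / (1 + B * a t))) \<longlongrightarrow> 0) at_top"
    using bound by (rule compare)
  then have "((\<lambda>t. (t * lap g r q x t - \<Theta> x * (a t / (1 + B * a t))) + \<Theta> x * (a t / (1 + B * a t))) \<longlongrightarrow>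
      0 + \<Theta> x * (G / r / (1 + B * (G / r)))) at_top"
    by (intro tendsto_add main)
  then show ?thesis by (simp add: G_def)
qed

text \<open>\<open>gprod\<close> is monotone in \<open>p\<close>, and survival corresponds to the
  smallest choice \<open>p = 0\<close>.\<close>

lemma lap_le_surv:
  assumes "\<And>y. 0 \<le> g y / (r * (t + q))" "g \<in> borel_measurable borel"
  shows "lap g r q x t \<le> surv x t"
proof -
  note [measurable] = assms(2)
  have "(\<integral>c. gprod (\<lambda>_. 0) t c \<partial>Q x) \<le> (\<integral>c. gprod (\<lambda>y. exp (- (g y / (r * (t + q))))) t c \<partial>Q x)"
  proof (intro integral_mono integrable_gprod)
    fix c
    show "gprod (\<lambda>_. 0) t c \<le> gprod (\<lambda>y. exp (- (g y / (r * (t + q))))) t c"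
      unfolding gprod_def by (intro prod_mono) simp
  qed (use assms in auto)
  then show ?thesis by (simp add: lap_def surv_eq)
qed

text \<open>Kolmogorov's estimate. The lower bound compares the initial datum 1 with the small constant
  \<open>\<theta> / t\<close> at each time \<open>t\<close>, and then \<open>\<theta> \<rightarrow> \<infinity>\<close>.\<close>

lemma surv_tendsto: "((\<lambda>t. t * surv x t) \<longlongrightarrow> \<Theta> x / B) at_top"
proof (rule order_tendstoI)
  obtain w where w: "mild (\<lambda>_. 1) w" "\<And>t x. 0 \<le> t \<Longrightarrow> w t x = surv x t"
    using survival_mild by blast
  fix a assume a: "\<Theta> x / B < a"
  have "\<forall>\<^sub>F t in at_top. t * w t x \<le> \<Theta> x / B + (a - \<Theta> x / B) / 2"
    using a by (intro survival_upper[OF w(1)]) simp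
  then show "\<forall>\<^sub>F t in at_top. t * surv x t < a"
    using eventually_ge_at_top[of 0] by eventually_elim (use a w(2) in \<open>auto simp: field_simps\<close>)
next
  fix a assume a: "a < \<Theta> x / B"
  have "((\<lambda>\<theta>. \<Theta> x * (A * \<theta> / (1 + B * (A * \<theta>)))) \<longlongrightarrow> \<Theta> x / B) at_top"
  proof -
    have "((\<lambda>\<theta>. a * \<theta> / (1 + b * (a * \<theta>))) \<longlongrightarrow> 1 / b) at_top" if "0 < a" "0 < b" for a b :: real
    proof -
      have "((\<lambda>\<theta>. a * \<theta> / (1 + b * (a * \<theta>))) \<longlongrightarrow> a * (inverse b * inverse a)) at_top"
        using that by real_asymp
      moreover have "a * (inverse b * inverse a) = 1 / b" using that by (simp add: field_simps)
      ultimately show ?thesis by simp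
    qed
    from tendsto_mult[OF tendsto_const[of "\<Theta> x"] this[OF A_pos B_pos]] show ?thesis by simp
  qed
  then have "\<forall>\<^sub>F \<theta> in at_top. a < \<Theta> x * (A * \<theta> / (1 + B * (A * \<theta>)))" using a by (rule order_tendstoD)
  then have "\<forall>\<^sub>F \<theta> in at_top. a < \<Theta> x * (A * \<theta> / (1 + B * (A * \<theta>))) \<and> 0 < \<theta>"
    using eventually_gt_at_top[of 0] by eventually_elim simp
  then obtain \<theta> where \<theta>: "a < \<Theta> x * (A * \<theta> / (1 + B * (A * \<theta>)))" "0 < \<theta>"
    using eventually_happens[of _ "at_top :: real filter"] by (auto simp: trivial_limit_at_top_linorder)
  have one: "bm 1 (\<lambda>_. 1)" by (simp add: bm_def)
  have "((\<lambda>t. t * lap (\<lambda>_. 1) (1 / \<theta>) 0 x t) \<longlongrightarrow>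
      \<Theta> x * ((\<integral>y. 1 \<partial>\<mu>) / (1 / \<theta>) / (1 + B * ((\<integral>y. 1 \<partial>\<mu>) / (1 / \<theta>))))) at_top"
    using \<theta> by (intro lap_tendsto[OF one]) auto
  moreover have "\<Theta> x * ((\<integral>y. 1 \<partial>\<mu>) / (1 / \<theta>) / (1 + B * ((\<integral>y. 1 \<partial>\<mu>) / (1 / \<theta>)))) = \<Theta> x * (A * \<theta> / (1 + B * (A * \<theta>)))"
    by (simp add: A_def)
  ultimately have "\<forall>\<^sub>F t in at_top. a < t * lap (\<lambda>_. 1) (1 / \<theta>) 0 x t" using \<theta>(1) by (intro order_tendstoD(1)) auto
  then show "\<forall>\<^sub>F t in at_top. a < t * surv x t"
    using eventually_gt_at_top[of 0]
  proof eventually_elim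
    case (elim t)
    have "lap (\<lambda>_. 1) (1 / \<theta>) 0 x t \<le> surv x t" using \<theta> elim by (intro lap_le_surv) auto
    then have "t * lap (\<lambda>_. 1) (1 / \<theta>) 0 x t \<le> t * surv x t" using elim by (intro mult_left_mono) auto
    then show ?case using elim by linarith
  qed
qed

lemma eventually_surv_pos: "\<forall>\<^sub>F t in at_top. 0 < surv x t"
proof -
  have "\<forall>\<^sub>F t in at_top. 0 < t * surv x t"
    using surv_tendsto[of x] by (rule order_tendstoD) (use \<Theta>_pos B_pos in simp)
  then show ?thesis
    using eventually_gt_at_top[of 0] by eventually_elim (simp add: zero_less_mult_iff)
qed

lemma sets_cond_law [measurable_cong]: "sets (cond_law Q b d x t) = sets (tree_space D)"
  by (simp add: cond_law_def uniform_measure_def Q_sets)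

lemma prob_space_cond_law:
  assumes "0 < surv x t"
  shows "prob_space (cond_law Q b d x t)"
proof -
  interpret Q: prob_space "Q x" by (rule Q_prob)
  show ?thesis
    unfolding cond_law_def using assms
    by (intro prob_space_uniform_measure) (auto simp: surv_def Q.emeasure_eq_measure)
qed

lemma integral_cond_law:
  assumes F: "F \<in> borel_measurable (tree_space D)" and s: "0 < surv x t"
  shows "(\<integral>c. F c \<partial>cond_law Q b d x t) =
    (\<integral>c. indicator {c \<in> space (Q x). Npop b d t c > 0} c * F c \<partial>Q x) / surv x t"
proof -
  interpret Q: prob_space "Q x" by (rule Q_prob)
  let ?S = "{c \<in> space (Q x). Npop b d t c > 0}"
  have measurable_F: "F \<in> borel_measurable (Q x)" using F by (simp add: Q_measurable_eq)
  have measurable_w: "(\<lambda>c. indicator ?S c / surv x t :: real) \<in> borel_measurable (Q x)" by measurable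
  have "cond_law Q b d x t = density (Q x) (\<lambda>c. ennreal (indicator ?S c / surv x t))"
    unfolding cond_law_def uniform_measure_def
  proof (intro density_cong)
    show "AE c in Q x. indicator ?S c / emeasure (Q x) ?S = ennreal (indicator ?S c / surv x t)"
    proof (intro AE_I2)
      fix c
      have "1 / ennreal (surv x t) = ennreal (1 / surv x t)"
        using s divide_ennreal[of 1 "surv x t"] by simp
      then show "indicator ?S c / emeasure (Q x) ?S = ennreal (indicator ?S c / surv x t)"
        unfolding Q.emeasure_eq_measure surv_def[symmetric] by (simp split: split_indicator)
    qed
  qed measurable
  then have "(\<integral>c. F c \<partial>cond_law Q b d x t) = (\<integral>c. (indicator ?S c / surv x t) *\<^sub>R F c \<partial>Q x)"
    using s by (simp only:) (intro integral_density measurable_F measurable_w; simp)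
  also have "\<dots> = (\<integral>c. (indicator ?S c * F c) / surv x t \<partial>Q x)" by simp
  finally show ?thesis by simp
qed

text \<open>The \<open>max\<close> makes the scale positive for every real \<open>t\<close>, which
  spares side conditions; the limits concern large \<open>t\<close>.\<close>

definition scl :: "real \<Rightarrow> real" where "scl t = (max 0 t + 1) * A * B"

lemma scl_pos: "0 < scl t"
  using A_pos B_pos by (simp add: scl_def add_pos_nonneg)

lemma Zpair_dead: "Npop b d t c \<le> 0 \<Longrightarrow> Zpair b d t g c = 0"
  unfolding Zpair_aliveF Npop_eq by (auto simp: aliveF_def split: if_splits)

lemma Zpair_divide: "Zpair b d t (\<lambda>y. g y / s) c = Zpair b d t g c / s"
  by (simp add: Zpair_def sum_divide_distrib)

lemma Zpair_cmult: "Zpair b d t (\<lambda>y. s * g y) c = s * Zpair b d t g c"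
  by (simp add: Zpair_def sum_distrib_left)

lemma Zpair_add: "Zpair b d t (\<lambda>y. g y + h y) c = Zpair b d t g c + Zpair b d t h c"
  by (simp add: Zpair_def sum.distrib)

lemma Zpair_const: "Zpair b d t (\<lambda>y. s) c = s * Npop b d t c"
  by (simp add: Npop_def flip: Zpair_cmult)

text \<open>Extinct populations contribute exactly 1 to the Laplace transform, so the conditional
  transform is \<open>1 - lap / surv\<close>. Numerator and denominator are both of order
  \<open>1 / t\<close>, and the factors \<open>\<Theta> x\<close> cancel.\<close>

lemma cond_law_laplace:
  assumes g: "bm cg g"
  shows "((\<lambda>t. \<integral>c. exp (- (Zpair b d t g c / scl t)) \<partial>cond_law Q b d x t) \<longlongrightarrow> 1 / (1 + (\<integral>y. g y \<partial>\<mu>) / A)) at_top"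
proof -
  note [measurable] = bm_meas[OF g]
  define G where "G = (\<integral>y. g y \<partial>\<mu>)"
  have G: "0 \<le> G" unfolding G_def by (rule bm_integral_nonneg[OF g])
  have AB: "0 < A * B" using A_pos B_pos by simp
  have "((\<lambda>t. 1 - (t * lap g (A * B) 1 x t) / (t * surv x t)) \<longlongrightarrow>
      1 - (\<Theta> x * (G / (A * B) / (1 + B * (G / (A * B))))) / (\<Theta> x / B)) at_top"
    using \<Theta>_pos[of x] B_pos AB unfolding G_def
    by (intro tendsto_diff tendsto_divide tendsto_const lap_tendsto[OF g] surv_tendsto) auto
  also have "1 - (\<Theta> x * (G / (A * B) / (1 + B * (G / (A * B))))) / (\<Theta> x / B) = 1 / (1 + G / A)"
  proof -
    have "B * (G / (A * B)) = G / A" using B_pos by simp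
    moreover have "(\<Theta> x * (G / (A * B) / (1 + G / A))) / (\<Theta> x / B) = (G / A) / (1 + G / A)"
    proof -
      have "(T * (G / (A * B) / e)) / (T / B) = (G / A) / e" if "T \<noteq> 0" "B \<noteq> 0" for T B e :: real
        using that by (simp add: field_simps)
      then show ?thesis using \<Theta>_pos[of x] B_pos by simp
    qed
    moreover have "1 - (G / A) / (1 + G / A) = 1 / (1 + G / A)"
      using G A_pos by (simp add: field_simps add_nonneg_eq_0_iff)
    ultimately show ?thesis by simp
  qed
  finally show ?thesis
    unfolding G_def[symmetric]
  proof (rule Lim_transform_eventually)
    show "\<forall>\<^sub>F t in at_top. 1 - (t * lap g (A * B) 1 x t) / (t * surv x t) =
        (\<integral>c. exp (- (Zpair b d t g c / scl t)) \<partial>cond_law Q b d x t)"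
      using eventually_surv_pos[of x] eventually_gt_at_top[of 0]
    proof eventually_elim
      case (elim t)
      interpret Q: prob_space "Q x" by (rule Q_prob)
      let ?S = "{c \<in> space (Q x). Npop b d t c > 0}"
      have s: "A * B * (t + 1) = scl t" using elim by (simp add: scl_def algebra_simps)
      have sp: "0 < scl t" by (rule scl_pos)
      define F where "F = gprod (\<lambda>y. exp (- (g y / scl t))) t"
      have Fe: "F c = exp (- (Zpair b d t g c / scl t))" for c
        by (simp add: F_def gprod_exp Zpair_divide)
      have i: "integrable (Q x) F"
        unfolding F_def using bm_bounds[OF g] sp by (intro integrable_gprod) auto
      have Fm: "F \<in> borel_measurable (tree_space D)" unfolding F_def by measurable
      have iS: "integrable (Q x) (indicator ?S :: _ \<Rightarrow> real)"
        by (intro integrable_real_indicator) (auto simp: Q.emeasure_eq_measure)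
      have "(\<integral>c. indicator ?S c * F c \<partial>Q x) = (\<integral>c. indicator ?S c + F c - 1 \<partial>Q x)"
        by (intro Bochner_Integration.integral_cong refl)
           (auto simp: Fe Zpair_dead not_less split: split_indicator)
      also have "\<dots> = surv x t - lap g (A * B) 1 x t"
        using i iS by (simp add: Q.prob_space surv_def lap_def F_def s)
      finally have "(\<integral>c. F c \<partial>cond_law Q b d x t) = (surv x t - lap g (A * B) 1 x t) / surv x t"
        unfolding integral_cond_law[OF Fm elim(1)] by simp
      then show ?case using elim by (simp add: Fe diff_divide_distrib)
    qed
  qed
qed

end

section \<open>The weak topology on finite measures\<close>

lemma scale_measure_density: "scale_measure r M = density M (\<lambda>_. r)"
  by (rule measure_eqI) (simp_all add: emeasure_density nn_integral_cmult)

lemma integral_scale_measure: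
  fixes g :: "'a \<Rightarrow> real"
  assumes "0 \<le> k" "g \<in> borel_measurable M"
  shows "(\<integral>y. g y \<partial>scale_measure (ennreal k) M) = k * (\<integral>y. g y \<partial>M)"
  using assms by (simp add: scale_measure_density integral_density)

lemma Cb_measurable: "g \<in> Cb \<Longrightarrow> g \<in> borel_measurable borel"
  by (simp add: Cb_def borel_measurable_continuous_onI)

lemma Cb_bounded:
  fixes g :: "'a::topological_space \<Rightarrow> real"
  shows "g \<in> Cb \<Longrightarrow> \<exists>c. \<forall>y. \<bar>g y\<bar> \<le> c"
  by (auto simp: Cb_def bounded_iff)

lemma scale_finite_borel:
  assumes "m \<in> finite_borel_measures"
  shows "scale_measure (ennreal k) m \<in> finite_borel_measures"
proof -
  interpret finite_measure m using assms by (simp add: finite_borel_measures_def)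
  show ?thesis
    using assms
    by (auto simp: finite_borel_measures_def space_scale_measure ennreal_mult_eq_top_iff intro!: finite_measureI)
qed

lemma continuous_map_weak_topologyI:
  fixes h :: "'a::topological_space \<Rightarrow> real measure"
  assumes h: "\<And>x. h x \<in> finite_borel_measures"
    and c: "\<And>g. g \<in> Cb \<Longrightarrow> continuous_on UNIV (\<lambda>x. \<integral>y. g y \<partial>h x)"
  shows "continuous_map euclidean weak_topology h"
  unfolding weak_topology_def
proof (rule continuous_on_generated_topo)
  fix V assume "V \<in> {{\<mu> \<in> finite_borel_measures. (\<integral>y. g y \<partial>\<mu>) \<in> U} |g U. g \<in> Cb \<and> open U}"
  then obtain g U where V: "V = {\<mu> \<in> finite_borel_measures. (\<integral>y. g y \<partial>\<mu>) \<in> U}" "g \<in> Cb" "open U" by blast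
  have "h -` V \<inter> topspace euclidean = (\<lambda>x. \<integral>y. g y \<partial>h x) -` U" using h by (auto simp: V(1))
  moreover have "open ((\<lambda>x. \<integral>y. g y \<partial>h x) -` U)" by (rule open_vimage[OF V(3) c[OF V(2)]])
  ultimately show "openin euclidean (h -` V \<inter> topspace euclidean)" by simp
next
  show "h ` topspace euclidean \<subseteq> \<Union>{{\<mu> \<in> finite_borel_measures. (\<integral>y. g y \<partial>\<mu>) \<in> U} |g U. g \<in> Cb \<and> open U}"
    using h topspace_weak_topology unfolding weak_topology_def topology_generated_by_topspace by auto
qed

lemma space_weak_borel: "space weak_borel = finite_borel_measures"
  unfolding weak_borel_def
  by (rule space_measure_of) (use openin_subset[of weak_topology] topspace_weak_topology in auto)

lemma measurable_weak_borel:
  assumes "continuous_map euclidean weak_topology h"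
  shows "h \<in> borel \<rightarrow>\<^sub>M weak_borel"
  unfolding weak_borel_def
proof (rule measurable_measure_of)
  show "{U. openin weak_topology U} \<subseteq> Pow finite_borel_measures"
    using openin_subset[of weak_topology] topspace_weak_topology by auto
  show "h \<in> space borel \<rightarrow> finite_borel_measures"
    using continuous_map_image_subset_topspace[OF assms] topspace_weak_topology by auto
  fix U assume "U \<in> {U. openin weak_topology U}"
  then have "openin euclidean {x \<in> topspace euclidean. h x \<in> U}"
    by (intro openin_continuous_map_preimage[OF assms]) simp
  then show "h -` U \<inter> space borel \<in> sets borel" by (simp add: vimage_def)
qed

lemma measurable_weak_continuous:
  assumes "continuous_map weak_topology euclideanreal \<Phi>"
  shows "\<Phi> \<in> borel_measurable weak_borel"
proof (rule borel_measurableI)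
  fix S :: "real set" assume "open S"
  then have "openin weak_topology {m \<in> topspace weak_topology. \<Phi> m \<in> S}"
    by (intro openin_continuous_map_preimage[OF assms]) simp
  then have "{m \<in> finite_borel_measures. \<Phi> m \<in> S} \<in> {U. openin weak_topology U}" by (simp add: topspace_weak_topology)
  moreover have "{U. openin weak_topology U} \<subseteq> Pow finite_borel_measures"
    using openin_subset[of weak_topology] topspace_weak_topology by auto
  ultimately have "{m \<in> finite_borel_measures. \<Phi> m \<in> S} \<in> sets weak_borel"
    unfolding weak_borel_def by (simp add: sets_measure_of sigma_sets.Basic)
  moreover have "\<Phi> -` S \<inter> space weak_borel = {m \<in> finite_borel_measures. \<Phi> m \<in> S}"
    unfolding space_weak_borel by auto
  ultimately show "\<Phi> -` S \<inter> space weak_borel \<in> sets weak_borel" by simp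
qed

text \<open>Induction over the generation of the topology: an intersection merges the test functions
  and takes the smaller radius.\<close>

lemma weak_topology_neighbourhood:
  assumes U: "openin weak_topology U" and m: "m \<in> U"
  shows "\<exists>G r. finite G \<and> G \<subseteq> Cb \<and> 0 < r \<and>
    (\<forall>m'\<in>finite_borel_measures. (\<forall>g\<in>G. \<bar>(\<integral>y. g y \<partial>m') - (\<integral>y. g y \<partial>m)\<bar> < r) \<longrightarrow> m' \<in> U)"
    (is "\<exists>G r. ?P U G r")
proof -
  have "generate_topology_on {{\<mu> \<in> finite_borel_measures. (\<integral>y. g y \<partial>\<mu>) \<in> U} |g U. g \<in> Cb \<and> open U} U"
    using U unfolding weak_topology_def by (rule openin_topology_generated_by)
  then show ?thesis using m
  proof (induction rule: generate_topology_on.induct)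
    case Empty
    then show ?case by simp
  next
    case (Int U V)
    then obtain G r G' r' where *: "?P U G r" "?P V G' r'" by blast
    have "?P (U \<inter> V) (G \<union> G') (min r r')"
      using * by auto
    then show ?case by blast
  next
    case (UN K)
    then obtain U where U: "U \<in> K" "m \<in> U" by blast
    with UN.IH[OF U] obtain G r where "?P U G r" by blast
    with U have "?P (\<Union>K) G r" by blast
    then show ?case by blast
  next
    case (Basis V)
    then obtain g W where V: "V = {\<mu> \<in> finite_borel_measures. (\<integral>y. g y \<partial>\<mu>) \<in> W}" "g \<in> Cb" "open W" by blast
    then obtain r where r: "0 < r" "\<And>s. dist s (\<integral>y. g y \<partial>m) < r \<Longrightarrow> s \<in> W"
      using Basis.prems unfolding open_dist by blast
    have "?P V {g} r" using r V(2) by (auto simp: V(1) dist_real_def)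
    then show ?case by blast
  qed
qed

text \<open>\<open>L t\<close> is a probability law for large \<open>t\<close>, so along a sequence
  of times it is first modified into \<open>L'\<close>, which changes finitely many terms.\<close>

lemma weak_conv_at_topI:
  assumes ev: "\<forall>\<^sub>F t in at_top. real_distribution (L t)" and M: "real_distribution M"
    and conv: "\<And>g :: real \<Rightarrow> real. continuous_on UNIV g \<Longrightarrow> (\<And>z. \<bar>g z\<bar> \<le> 1) \<Longrightarrow> ((\<lambda>t. \<integral>z. g z \<partial>L t) \<longlongrightarrow> (\<integral>z. g z \<partial>M)) at_top"
  shows "weak_conv_at_top L M"
  unfolding weak_conv_at_top_def
proof (intro allI impI)
  fix T :: "nat \<Rightarrow> real" assume T: "filterlim T at_top sequentially"
  define L' where "L' n = (if real_distribution (L (T n)) then L (T n) else M)" for n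
  have "\<forall>\<^sub>F n in sequentially. real_distribution (L (T n))"
    by (rule eventually_compose_filterlim[OF ev T])
  then have eq: "\<forall>\<^sub>F n in sequentially. L' n = L (T n)" by eventually_elim (simp add: L'_def)
  have "weak_conv_m L' M"
  proof (rule integral_bdd_continuous_conv_imp_weak_conv[OF _ M])
    show "real_distribution (L' n)" for n using M by (simp add: L'_def)
    fix g :: "real \<Rightarrow> real" assume g: "\<And>x. isCont g x" "\<And>x. \<bar>g x\<bar> \<le> 1"
    have "((\<lambda>t. \<integral>z. g z \<partial>L t) \<longlongrightarrow> (\<integral>z. g z \<partial>M)) at_top"
      using g by (intro conv continuous_at_imp_continuous_on) auto
    from filterlim_compose[OF this T]
    show "(\<lambda>n. \<integral>z. g z \<partial>L' n) \<longlonglongrightarrow> (\<integral>z. g z \<partial>M)"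
      by (rule Lim_transform_eventually) (use eq in \<open>auto elim!: eventually_mono\<close>)
  qed
  then show "weak_conv_m (\<lambda>n. L (T n)) M"
    unfolding weak_conv_m_def weak_conv_def
  proof (intro allI impI)
    fix z assume *: "\<forall>x. isCont (cdf M) x \<longrightarrow> (\<lambda>n. cdf (L' n) x) \<longlonglongrightarrow> cdf M x" and z: "isCont (cdf M) z"
    have "\<forall>\<^sub>F n in sequentially. cdf (L' n) z = cdf (L (T n)) z"
      using eq by eventually_elim simp
    with * z show "(\<lambda>n. cdf (L (T n)) z) \<longlonglongrightarrow> cdf M z" by (blast intro: Lim_transform_eventually)
  qed
qed

lemma measure_to_0_mono:
  assumes B: "((\<lambda>i. measure (M i) (B i)) \<longlongrightarrow> 0) F"
    and ev: "\<forall>\<^sub>F i in F. finite_measure (M i) \<and> B i \<in> sets (M i)" and sub: "\<And>i. A i \<subseteq> B i"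
  shows "((\<lambda>i. measure (M i) (A i)) \<longlongrightarrow> 0) F"
proof (rule tendsto_sandwich[OF _ _ tendsto_const B])
  show "\<forall>\<^sub>F i in F. measure (M i) (A i) \<le> measure (M i) (B i)"
    using ev
  proof eventually_elim
    case (elim i)
    then interpret finite_measure "M i" by simp
    show ?case using elim sub by (intro finite_measure_mono) auto
  qed
qed auto

text \<open>A point measure as a function of the positions of a fixed finite set of labels. In this
  form it depends continuously on the positions, which yields the measurability of the empirical
  measure in \<open>weak_borel\<close>.\<close>

definition atoms :: "'u set \<Rightarrow> ('u \<Rightarrow> real) \<Rightarrow> real measure" where
  "atoms S x = distr (count_space S) borel x"

lemma sets_atoms [simp]: "sets (atoms S x) = sets borel"
  by (simp add: atoms_def)

lemma emeasure_atoms: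
  "finite S \<Longrightarrow> E \<in> sets borel \<Longrightarrow> emeasure (atoms S x) E = (\<Sum>u\<in>S. indicator E (x u))"
proof -
  assume S: "finite S" and E: "E \<in> sets borel"
  have "emeasure (atoms S x) E = of_nat (card (x -` E \<inter> S))"
    using E S by (simp add: atoms_def emeasure_distr emeasure_count_space)
  also have "\<dots> = (\<Sum>u\<in>x -` E \<inter> S. 1)" by simp
  also have "\<dots> = (\<Sum>u\<in>S. indicator E (x u))"
    using S by (intro sum.mono_neutral_cong_left) (auto simp: indicator_def)
  finally show ?thesis .
qed

lemma integral_atoms:
  fixes g :: "real \<Rightarrow> real"
  shows "finite S \<Longrightarrow> g \<in> borel_measurable borel \<Longrightarrow> (\<integral>y. g y \<partial>atoms S x) = (\<Sum>u\<in>S. g (x u))"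
  by (simp add: atoms_def integral_distr lebesgue_integral_count_space_finite)

lemma atoms_finite_borel: "finite S \<Longrightarrow> atoms S x \<in> finite_borel_measures"
proof -
  assume S: "finite S"
  have "space (atoms S x) = UNIV" by (simp add: atoms_def)
  then have "emeasure (atoms S x) (space (atoms S x)) \<noteq> \<infinity>"
    using S by (simp add: emeasure_atoms)
  then show ?thesis by (auto simp: finite_borel_measures_def intro: finite_measureI)
qed

lemma continuous_atoms:
  fixes S :: "'a set"
  assumes S: "finite S" and k: "0 \<le> k"
  shows "continuous_map euclidean weak_topology (\<lambda>x. scale_measure (ennreal k) (atoms S x))"
proof (rule continuous_map_weak_topologyI)
  show "scale_measure (ennreal k) (atoms S x) \<in> finite_borel_measures" for x
    by (intro scale_finite_borel atoms_finite_borel S)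
  fix g :: "real \<Rightarrow> real" assume g: "g \<in> Cb"
  have cg: "continuous_on UNIV g" using g by (simp add: Cb_def)
  have "continuous_on UNIV (\<lambda>x :: 'a \<Rightarrow> real. g (x u))" for u
    by (rule continuous_on_compose2[OF cg continuous_on_product_coordinates]) simp
  then have "continuous_on UNIV (\<lambda>x :: 'a \<Rightarrow> real. k * (\<Sum>u\<in>S. g (x u)))"
    by (intro continuous_on_mult continuous_on_const continuous_on_sum)
  moreover have "(\<integral>y. g y \<partial>scale_measure (ennreal k) (atoms S x)) = k * (\<Sum>u\<in>S. g (x u))" for x
    using Cb_measurable[OF g] k S by (subst integral_scale_measure) (simp_all add: integral_atoms measurable_cong_sets[OF sets_atoms refl])
  ultimately show "continuous_on UNIV (\<lambda>x. \<integral>y. g y \<partial>scale_measure (ennreal k) (atoms S x))" by simp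
qed

lemma continuous_scale:
  assumes m: "m \<in> finite_borel_measures"
  shows "continuous_map euclidean weak_topology (\<lambda>z. scale_measure (ennreal z) m)"
proof (rule continuous_map_weak_topologyI)
  show "scale_measure (ennreal z) m \<in> finite_borel_measures" for z by (rule scale_finite_borel[OF m])
  fix g :: "real \<Rightarrow> real" assume g: "g \<in> Cb"
  have gm: "g \<in> borel_measurable m"
    using Cb_measurable[OF g] m by (simp add: finite_borel_measures_def measurable_cong_sets[of m borel])
  have "(\<integral>y. g y \<partial>scale_measure (ennreal z) m) = max 0 z * (\<integral>y. g y \<partial>m)" for z
  proof -
    have "ennreal z = ennreal (max 0 z)" by (cases "0 \<le> z") (simp_all add: ennreal_neg)
    then show ?thesis using integral_scale_measure[of "max 0 z" g m] gm by simp
  qed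
  then show "continuous_on UNIV (\<lambda>z. \<integral>y. g y \<partial>scale_measure (ennreal z) m)"
    by (simp, intro continuous_intros)
qed

text \<open>Compactness of \<open>[\<alpha>, \<beta>]\<close> makes the weak neighbourhoods of the points of a segment of the ray
  \<open>z \<mapsto> z m\<close> uniform, with finitely many test functions.\<close>

lemma weak_uniform_on_ray:
  assumes m: "m \<in> finite_borel_measures" and \<Phi>: "continuous_map weak_topology euclideanreal \<Phi>"
    and \<alpha>: "0 < \<alpha>" and \<epsilon>: "0 < \<epsilon>"
  shows "\<exists>G r. finite G \<and> G \<subseteq> Cb \<and> 0 < r \<and> (\<forall>z\<in>{\<alpha>..\<beta>}. \<forall>m'\<in>finite_borel_measures.
    (\<forall>g\<in>G. \<bar>(\<integral>y. g y \<partial>m') - z * (\<integral>y. g y \<partial>m)\<bar> < r) \<longrightarrow>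
    \<bar>\<Phi> m' - \<Phi> (scale_measure (ennreal z) m)\<bar> < \<epsilon>)"
proof -
  define ray where "ray z = scale_measure (ennreal z) m" for z
  have ray_fin: "ray z \<in> finite_borel_measures" for z unfolding ray_def by (rule scale_finite_borel[OF m])
  have ray_int: "(\<integral>y. g y \<partial>ray z) = z * (\<integral>y. g y \<partial>m)" if "g \<in> Cb" "0 \<le> z" for g z
    unfolding ray_def using that m Cb_measurable[OF that(1)]
    by (intro integral_scale_measure) (simp_all add: finite_borel_measures_def measurable_cong_sets[of m borel])
  define P where "P z G r \<longleftrightarrow> finite G \<and> G \<subseteq> Cb \<and> 0 < r \<and>
      (\<forall>m'\<in>finite_borel_measures. (\<forall>g\<in>G. \<bar>(\<integral>y. g y \<partial>m') - (\<integral>y. g y \<partial>ray z)\<bar> < r) \<longrightarrow>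
        \<bar>\<Phi> m' - \<Phi> (ray z)\<bar> < \<epsilon> / 2)" for z G r
  have "\<exists>G r. P z G r" for z
  proof -
    let ?U = "{m' \<in> topspace weak_topology. \<Phi> m' \<in> ball (\<Phi> (ray z)) (\<epsilon> / 2)}"
    have "openin weak_topology ?U"
      by (intro openin_continuous_map_preimage[OF \<Phi>]) simp
    moreover have "ray z \<in> ?U" using \<epsilon> ray_fin by (simp add: topspace_weak_topology)
    ultimately obtain G r where *: "finite G" "G \<subseteq> Cb" "0 < r"
      "\<forall>m'\<in>finite_borel_measures. (\<forall>g\<in>G. \<bar>(\<integral>y. g y \<partial>m') - (\<integral>y. g y \<partial>ray z)\<bar> < r) \<longrightarrow> m' \<in> ?U"
      using weak_topology_neighbourhood by meson
    then have "P z G r" unfolding P_def by (fastforce simp: dist_real_def abs_minus_commute)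
    then show ?thesis by blast
  qed
  then obtain G r where Gr: "\<And>z. P z (G z) (r z)" by metis
  define W where "W z = (\<Inter>g\<in>G z. {z'. \<bar>z' * (\<integral>y. g y \<partial>m) - z * (\<integral>y. g y \<partial>m)\<bar> < r z / 2})" for z
  have W: "open (W z)" "z \<in> W z" for z
  proof -
    show "open (W z)"
      unfolding W_def using Gr[of z] by (intro open_INT ballI open_Collect_less continuous_intros) (simp add: P_def)
    show "z \<in> W z" unfolding W_def using Gr[of z] by (simp add: P_def)
  qed
  have cover: "{\<alpha>..\<beta>} \<subseteq> (\<Union>z\<in>{\<alpha>..\<beta>}. W z)" using W(2) by blast
  obtain T where T: "T \<subseteq> {\<alpha>..\<beta>}" "finite T" "{\<alpha>..\<beta>} \<subseteq> (\<Union>z\<in>T. W z)"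
    by (rule compactE_image[OF compact_Icc W(1) cover])
  \<comment> \<open>Inserting 1 covers the case of an empty interval, where \<open>T\<close> may be
    empty.\<close>
  define \<rho> where "\<rho> = Min (insert 1 ((\<lambda>z. r z / 2) ` T))"
  have \<rho>: "0 < \<rho>" "\<And>z. z \<in> T \<Longrightarrow> \<rho> \<le> r z / 2"
  proof -
    show "0 < \<rho>" using T(2) Gr by (auto simp: \<rho>_def P_def)
    show "\<rho> \<le> r z / 2" if "z \<in> T" for z
      unfolding \<rho>_def using T(2) that by (intro Min_le) auto
  qed
  show ?thesis
  proof (intro exI conjI ballI impI)
    show "finite (\<Union>z\<in>T. G z)" "(\<Union>z\<in>T. G z) \<subseteq> Cb" using T(2) Gr by (auto simp: P_def)
    show "0 < \<rho>" by (rule \<rho>)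
    fix z m' assume z: "z \<in> {\<alpha>..\<beta>}" and m': "m' \<in> finite_borel_measures"
      and c: "\<forall>g\<in>(\<Union>z\<in>T. G z). \<bar>(\<integral>y. g y \<partial>m') - z * (\<integral>y. g y \<partial>m)\<bar> < \<rho>"
    obtain s where s: "s \<in> T" "z \<in> W s" using T(3) z by blast
    have s0: "0 \<le> s" "0 \<le> z" using T(1) s(1) z \<alpha> by auto
    have d: "\<bar>z * (\<integral>y. g y \<partial>m) - s * (\<integral>y. g y \<partial>m)\<bar> < r s / 2" if "g \<in> G s" for g
      using s(2) that by (simp add: W_def)
    have GC: "G s \<subseteq> Cb" "0 < r s" using Gr[of s] by (auto simp: P_def)
    have 1: "\<bar>\<Phi> m' - \<Phi> (ray s)\<bar> < \<epsilon> / 2"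
    proof -
      have "\<bar>(\<integral>y. g y \<partial>m') - (\<integral>y. g y \<partial>ray s)\<bar> < r s" if g: "g \<in> G s" for g
      proof -
        have gC: "g \<in> Cb" using g GC by blast
        have "\<bar>(\<integral>y. g y \<partial>m') - z * (\<integral>y. g y \<partial>m)\<bar> < \<rho>" using c s(1) g by blast
        then show ?thesis using d[OF g] \<rho>(2)[OF s(1)] unfolding ray_int[OF gC s0(1)] by linarith
      qed
      then show ?thesis using Gr[of s] m' by (simp add: P_def)
    qed
    have 2: "\<bar>\<Phi> (ray z) - \<Phi> (ray s)\<bar> < \<epsilon> / 2"
    proof -
      have "\<bar>(\<integral>y. g y \<partial>ray z) - (\<integral>y. g y \<partial>ray s)\<bar> < r s" if g: "g \<in> G s" for g
      proof -
        have gC: "g \<in> Cb" using g GC by blast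
        show ?thesis using d[OF g] GC(2) unfolding ray_int[OF gC s0(1)] ray_int[OF gC s0(2)] by linarith
      qed
      then show ?thesis using Gr[of s] ray_fin[of z] by (simp add: P_def)
    qed
    show "\<bar>\<Phi> m' - \<Phi> (scale_measure (ennreal z) m)\<bar> < \<epsilon>"
      using 1 2 unfolding ray_def[symmetric] by linarith
  qed
qed

section \<open>Limits conditioned on survival\<close>

context critical_branching
begin

abbreviation CL :: "real \<Rightarrow> real \<Rightarrow> tree measure" where
  "CL x t \<equiv> cond_law Q b d x t"

definition Y :: "real \<Rightarrow> tree \<Rightarrow> real" where
  "Y t c = Npop b d t c / scl t"

definition X :: "(real \<Rightarrow> real) \<Rightarrow> real \<Rightarrow> tree \<Rightarrow> real" where
  "X f t c = Zpair b d t f c / scl t"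

text \<open>Integral against the normalised measure, see \<open>integral_\<nu>\<close>.\<close>

definition mean :: "(real \<Rightarrow> real) \<Rightarrow> real" where
  "mean f = (\<integral>y. f y \<partial>\<mu>) / A"

lemma Y_nonneg: "0 \<le> Y t c"
  using scl_pos[of t] by (simp add: Y_def Npop_nonneg)

lemma measurable_Y [measurable]: "Y t \<in> borel_measurable (tree_space D)"
  unfolding Y_def by measurable

lemma measurable_X [measurable]: "f \<in> borel_measurable borel \<Longrightarrow> X f t \<in> borel_measurable (tree_space D)"
  unfolding X_def by (intro borel_measurable_divide measurable_Zpair borel_measurable_const)

lemma cond_measurable: "CL x t \<rightarrow>\<^sub>M N = tree_space D \<rightarrow>\<^sub>M N"
  by (rule measurable_cong_sets[OF sets_cond_law refl])

lemma eventually_prob: "\<forall>\<^sub>F t in at_top. prob_space (CL x t)"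
  using eventually_surv_pos by eventually_elim (rule prob_space_cond_law)

lemma X_laplace:
  "bm cg g \<Longrightarrow> ((\<lambda>t. \<integral>c. exp (- X g t c) \<partial>CL x t) \<longlongrightarrow> 1 / (1 + mean g)) at_top"
  using cond_law_laplace[of cg g x] by (simp add: X_def mean_def)

lemma X_const: "X (\<lambda>_. s) t c = s * Y t c"
  by (simp add: X_def Y_def Zpair_const)

lemma X_add: "X (\<lambda>y. f y + g y) t c = X f t c + X g t c"
  by (simp add: X_def Zpair_add add_divide_distrib)

lemma X_cmult: "X (\<lambda>y. s * f y) t c = s * X f t c"
  by (simp add: X_def Zpair_cmult)

lemma mean_const: "mean (\<lambda>_. s) = s"
  using A_pos by (simp add: mean_def A_def)

lemma Y_laplace: "((\<lambda>t. \<integral>c. exp (- (real j * Y t c)) \<partial>CL x t) \<longlongrightarrow> 1 / (1 + real j)) at_top"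
proof -
  have "bm (real j) (\<lambda>_. real j)" by (simp add: bm_def)
  from X_laplace[OF this, of x] show ?thesis by (simp add: X_const mean_const)
qed

lemma integrable_bounded:
  fixes f :: "real \<Rightarrow> real"
  assumes f: "f \<in> borel_measurable borel" and fc: "\<And>y. \<bar>f y\<bar> \<le> c"
  shows "integrable \<mu> f"
  by (rule \<mu>.integrable_const_bound[of _ c]) (use f fc in \<open>auto simp: measurable_cong_sets[OF sets_\<mu> refl]\<close>)

text \<open>The functions \<open>i (f + c) + (2 - i) (a + c)\<close>, for
  \<open>i = 0, 1, 2\<close>, are nonnegative with the same mean. Expanding the square gives three
  conditional Laplace transforms with a common limit, which the coefficients
  \<open>1 - 2 + 1\<close> kill. Adding \<open>c\<close> makes \<open>f\<close> nonnegative, as the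
  Laplace limit requires.\<close>

lemma X_close:
  fixes f :: "real \<Rightarrow> real" and c \<delta> \<beta> :: real
  assumes f: "f \<in> borel_measurable borel" and fc: "\<And>y. \<bar>f y\<bar> \<le> c" and \<delta>: "0 < \<delta>"
  shows "((\<lambda>t. measure (CL x t) {\<omega> \<in> space (CL x t). Y t \<omega> \<le> \<beta> \<and> \<delta> \<le> \<bar>X f t \<omega> - mean f * Y t \<omega>\<bar>}) \<longlongrightarrow> 0) at_top"
proof -
  define a where "a = mean f"
  have int: "integrable \<mu> f" by (rule integrable_bounded[OF f fc])
  have mean_add: "mean (\<lambda>y. f y + k) = a + k" for k
    using int mean_const[of k] by (simp add: mean_def a_def add_divide_distrib)
  have f0: "0 \<le> f y + c" "f y + c \<le> 2 * c" for y using fc[of y] by linarith+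
  have c0: "0 \<le> c" using fc[of 0] by linarith
  have ac: "0 \<le> a + c"
  proof -
    have "0 \<le> (\<integral>y. f y + c \<partial>\<mu>)" using f0 by (intro integral_nonneg_AE) auto
    then have "0 \<le> mean (\<lambda>y. f y + c)" using A_pos unfolding mean_def by (intro divide_nonneg_pos)
    then show ?thesis by (simp only: mean_add)
  qed
  have X1: "X (\<lambda>y. f y + k) t \<omega> = X f t \<omega> + k * Y t \<omega>" for k t \<omega>
    using X_add[of f "\<lambda>_. k"] by (simp add: X_const)
  have nonneg: "0 \<le> X f t \<omega> + c * Y t \<omega>" for t \<omega>
    unfolding X1[symmetric] using f0 scl_pos[of t] by (simp add: X_def Zpair_def sum_nonneg)
  define E where "E i t \<omega> = exp (- X (\<lambda>y. real i * (f y + c) + (2 - real i) * (a + c)) t \<omega>)" for i :: nat and t \<omega>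
  have XE: "X (\<lambda>y. real i * (f y + c) + (2 - real i) * (a + c)) t \<omega> =
      real i * (X f t \<omega> + c * Y t \<omega>) + (2 - real i) * (a + c) * Y t \<omega>" for i t \<omega>
    using X_add[of "\<lambda>y. real i * (f y + c)" "\<lambda>_. (2 - real i) * (a + c)"] X_cmult[of "real i" "\<lambda>y. f y + c"]
    by (simp add: X1 X_const)
  have E_lim: "((\<lambda>t. \<integral>\<omega>. E i t \<omega> \<partial>CL x t) \<longlongrightarrow> 1 / (1 + 2 * (a + c))) at_top" if "i \<le> 2" for i
  proof -
    have i2: "0 \<le> 2 - real i" using that by simp
    have "bm (real i * (2 * c) + (2 - real i) * (a + c)) (\<lambda>y. real i * (f y + c) + (2 - real i) * (a + c))"
      unfolding bm_def
    proof (intro conjI allI)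
      show "(\<lambda>y. real i * (f y + c) + (2 - real i) * (a + c)) \<in> borel_measurable borel" using f by measurable
      fix y
      show "0 \<le> real i * (f y + c) + (2 - real i) * (a + c)"
        by (rule add_nonneg_nonneg[OF mult_nonneg_nonneg[OF of_nat_0_le_iff f0(1)] mult_nonneg_nonneg[OF i2 ac]])
      show "real i * (f y + c) + (2 - real i) * (a + c) \<le> real i * (2 * c) + (2 - real i) * (a + c)"
        using f0[of y] by (intro add_right_mono mult_left_mono) auto
    qed
    from X_laplace[OF this, of x]
    have "((\<lambda>t. \<integral>\<omega>. E i t \<omega> \<partial>CL x t) \<longlongrightarrow> 1 / (1 + mean (\<lambda>y. real i * (f y + c) + (2 - real i) * (a + c)))) at_top"
      unfolding E_def .
    moreover have "mean (\<lambda>y. real i * (f y + c) + (2 - real i) * (a + c)) = 2 * (a + c)"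
    proof -
      have "(\<integral>y. real i * (f y + c) + (2 - real i) * (a + c) \<partial>\<mu>) = real i * ((\<integral>y. f y \<partial>\<mu>) + c * A) + (2 - real i) * (a + c) * A"
        using int by (simp add: A_def mult.commute)
      also have "(\<integral>y. f y \<partial>\<mu>) = a * A" using A_pos by (simp add: a_def mean_def)
      finally show ?thesis using A_pos by (simp add: mean_def field_simps)
    qed
    ultimately show ?thesis by simp
  qed
  have L2: "((\<lambda>t. \<integral>\<omega>. (exp (- (X f t \<omega> + c * Y t \<omega>)) - exp (- ((a + c) * Y t \<omega>)))\<^sup>2 \<partial>CL x t) \<longlongrightarrow> 0) at_top"
  proof -
    have sq: "(exp (- p) - exp (- q))\<^sup>2 = exp (- (2 * p)) - 2 * exp (- (p + q)) + exp (- (2 * q))" for p q :: real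
      by (simp add: power2_diff exp_add exp_double exp_minus_inverse algebra_simps power2_eq_square flip: exp_add)
    have "((\<lambda>t. (\<integral>\<omega>. E 2 t \<omega> \<partial>CL x t) - 2 * (\<integral>\<omega>. E 1 t \<omega> \<partial>CL x t) + (\<integral>\<omega>. E 0 t \<omega> \<partial>CL x t)) \<longlongrightarrow>
        1 / (1 + 2 * (a + c)) - 2 * (1 / (1 + 2 * (a + c))) + 1 / (1 + 2 * (a + c))) at_top"
      by (intro tendsto_intros E_lim) auto
    moreover have "\<forall>\<^sub>F t in at_top. (\<integral>\<omega>. E 2 t \<omega> \<partial>CL x t) - 2 * (\<integral>\<omega>. E 1 t \<omega> \<partial>CL x t) + (\<integral>\<omega>. E 0 t \<omega> \<partial>CL x t) =
        (\<integral>\<omega>. (exp (- (X f t \<omega> + c * Y t \<omega>)) - exp (- ((a + c) * Y t \<omega>)))\<^sup>2 \<partial>CL x t)"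
      using eventually_prob[of x]
    proof eventually_elim
      case (elim t)
      then interpret M: prob_space "CL x t" .
      have iE: "integrable (CL x t) (E i t)" if "i \<le> 2" for i
      proof (rule M.integrable_const_bound[of _ 1])
        have "0 \<le> real i * (X f t \<omega> + c * Y t \<omega>) + (2 - real i) * (a + c) * Y t \<omega>" for \<omega>
          by (rule add_nonneg_nonneg[OF mult_nonneg_nonneg[OF of_nat_0_le_iff nonneg]
            mult_nonneg_nonneg[OF mult_nonneg_nonneg[OF _ ac] Y_nonneg]]) (use that in simp)
        then show "AE \<omega> in CL x t. norm (E i t \<omega>) \<le> 1" 
          by (intro AE_I2) (simp only: E_def XE real_norm_def abs_exp_cancel exp_le_one_iff neg_le_0_iff_le)
        show "E i t \<in> borel_measurable (CL x t)"
          unfolding E_def cond_measurable using f by measurable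
      qed
      have "(\<lambda>\<omega>. (exp (- (X f t \<omega> + c * Y t \<omega>)) - exp (- ((a + c) * Y t \<omega>)))\<^sup>2) = (\<lambda>\<omega>. E 2 t \<omega> - 2 * E 1 t \<omega> + E 0 t \<omega>)"
        by (simp only: sq E_def XE) (simp add: algebra_simps)
      then show ?case using iE by simp
    qed
    ultimately have "((\<lambda>t. \<integral>\<omega>. (exp (- (X f t \<omega> + c * Y t \<omega>)) - exp (- ((a + c) * Y t \<omega>)))\<^sup>2 \<partial>CL x t) \<longlongrightarrow>
        1 / (1 + 2 * (a + c)) - 2 * (1 / (1 + 2 * (a + c))) + 1 / (1 + 2 * (a + c))) at_top"
      by (rule Lim_transform_eventually)
    then show ?thesis by simp
  qed
  have ev: "\<forall>\<^sub>F t in at_top. prob_space (CL x t) \<and> X f t \<in> borel_measurable (CL x t) \<and> Y t \<in> borel_measurable (CL x t)"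
    using eventually_prob[of x] by eventually_elim (use f in \<open>simp add: cond_measurable\<close>)
  show ?thesis
    unfolding a_def[symmetric] by (rule close_in_probability[OF ev nonneg Y_nonneg ac L2 \<delta>])
qed

lemma eventually_Y:
  "\<forall>\<^sub>F t in at_top. prob_space (CL x t) \<and> Y t \<in> borel_measurable (CL x t) \<and> (AE \<omega> in CL x t. 0 \<le> Y t \<omega>)"
  using eventually_prob[of x] by eventually_elim (simp add: cond_measurable Y_nonneg)

text \<open>\<open>G\<close> may be singular where its second coordinate vanishes, which the ratio
  and the fluctuation call for. On a compact rectangle it is uniformly continuous, so the closeness
  of \<open>X f t\<close> to \<open>mean f * Y t\<close> passes to \<open>G\<close>.\<close>

lemma joint_limit:
  fixes G :: "real \<times> real \<Rightarrow> real" and K :: real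
  assumes f: "f \<in> Cb" and G: "G \<in> borel_measurable borel" "\<And>p. \<bar>G p\<bar> \<le> K"
    and cont: "continuous_on (UNIV \<times> {0<..}) G"
  shows "((\<lambda>t. \<integral>\<omega>. G (X f t \<omega>, Y t \<omega>) \<partial>CL x t) \<longlongrightarrow> (\<integral>z. G (mean f * z, z) \<partial>exp1)) at_top"
proof (rule transfer_limit[OF eventually_Y Y_laplace])
  note [measurable] = Cb_measurable[OF f] G(1)
  obtain c where c: "\<And>y. \<bar>f y\<bar> \<le> c" using Cb_bounded[OF f] by blast
  show "\<forall>\<^sub>F t in at_top. (\<lambda>\<omega>. G (X f t \<omega>, Y t \<omega>)) \<in> borel_measurable (CL x t)"
    unfolding cond_measurable by (intro always_eventually allI) measurable
  show "\<bar>G (X f t \<omega>, Y t \<omega>)\<bar> \<le> K" "\<bar>G (mean f * z, z)\<bar> \<le> K" for t \<omega> z by (rule G(2))+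
  show "continuous_on {0<..} (\<lambda>z. G (mean f * z, z))"
    by (rule continuous_on_compose2[OF cont]) (auto intro!: continuous_intros)
  show "(\<lambda>z. G (mean f * z, z)) \<in> borel_measurable borel" by measurable
  fix \<alpha> \<beta> \<epsilon> :: real assume \<alpha>: "0 < \<alpha>" and \<epsilon>: "0 < \<epsilon>"
  \<comment> \<open>The \<open>+ 1\<close> leaves room for a deviation of \<open>X\<close> from
    \<open>mean f * Y\<close> smaller than \<open>\<delta> \<le> 1\<close>.\<close>
  define R where "R = \<bar>mean f\<bar> * \<beta> + 1"
  define S where "S = {- R..R} \<times> {\<alpha>..\<beta>}"
  have "uniformly_continuous_on S G"
    unfolding S_def using \<alpha>
    by (intro compact_uniformly_continuous continuous_on_subset[OF cont] compact_Times compact_Icc) auto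
  then obtain \<delta>0 where \<delta>0: "0 < \<delta>0" "\<And>p q. p \<in> S \<Longrightarrow> q \<in> S \<Longrightarrow> dist q p < \<delta>0 \<Longrightarrow> dist (G q) (G p) < \<epsilon>"
    unfolding uniformly_continuous_on_def using \<epsilon> by blast
  define \<delta> where "\<delta> = min 1 \<delta>0"
  have \<delta>: "0 < \<delta>" using \<delta>0 by (simp add: \<delta>_def)
  have near: "\<bar>G (u, y) - G (mean f * y, y)\<bar> < \<epsilon>" if "\<alpha> \<le> y" "y \<le> \<beta>" "\<bar>u - mean f * y\<bar> < \<delta>" for u y
  proof -
    have "\<bar>mean f * y\<bar> \<le> \<bar>mean f\<bar> * \<beta>" using that \<alpha> by (auto simp: abs_mult intro!: mult_left_mono)
    then have "(u, y) \<in> S" "(mean f * y, y) \<in> S" using that by (auto simp: S_def R_def \<delta>_def)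
    moreover have "dist (u, y) (mean f * y, y) < \<delta>0" using that(3) by (simp add: dist_Pair_Pair dist_real_def \<delta>_def)
    ultimately show ?thesis using \<delta>0(2) by (simp add: dist_real_def)
  qed
  show "((\<lambda>t. measure (CL x t) {\<omega> \<in> space (CL x t). \<alpha> \<le> Y t \<omega> \<and> Y t \<omega> \<le> \<beta> \<and>
      \<epsilon> \<le> \<bar>G (X f t \<omega>, Y t \<omega>) - G (mean f * Y t \<omega>, Y t \<omega>)\<bar>}) \<longlongrightarrow> 0) at_top"
  proof (rule measure_to_0_mono[OF X_close[OF Cb_measurable[OF f] c \<delta>]])
    show "\<forall>\<^sub>F t in at_top. finite_measure (CL x t) \<and>
        {\<omega> \<in> space (CL x t). Y t \<omega> \<le> \<beta> \<and> \<delta> \<le> \<bar>X f t \<omega> - mean f * Y t \<omega>\<bar>} \<in> sets (CL x t)"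
      using eventually_prob[of x]
    proof eventually_elim
      case (elim t)
      have "{\<omega> \<in> space (CL x t). Y t \<omega> \<le> \<beta> \<and> \<delta> \<le> \<bar>X f t \<omega> - mean f * Y t \<omega>\<bar>} \<in> sets (CL x t)"
        by measurable
      then show ?case using elim by (simp add: prob_space.finite_measure)
    qed
    show "{\<omega> \<in> space (CL x t). \<alpha> \<le> Y t \<omega> \<and> Y t \<omega> \<le> \<beta> \<and> \<epsilon> \<le> \<bar>G (X f t \<omega>, Y t \<omega>) - G (mean f * Y t \<omega>, Y t \<omega>)\<bar>} \<subseteq>
        {\<omega> \<in> space (CL x t). Y t \<omega> \<le> \<beta> \<and> \<delta> \<le> \<bar>X f t \<omega> - mean f * Y t \<omega>\<bar>}" for t
      using near[of "Y t _" "X f t _"] by (auto simp: not_less[symmetric])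
  qed
qed

definition Zs :: "real \<Rightarrow> tree \<Rightarrow> real measure" where
  "Zs t c = scale_measure (ennreal (1 / scl t)) (Zmeas b d t c)"

lemma Zmeas_atoms: "Zmeas b d t c = atoms (aliveF t c) (atrait t c)"
proof (rule measure_eqI)
  show s: "sets (Zmeas b d t c) = sets (atoms (aliveF t c) (atrait t c))"
    using Zmeas_finite_borel[of b d t c] by (simp add: finite_borel_measures_def)
  fix E assume "E \<in> sets (Zmeas b d t c)"
  then have "E \<in> sets borel" using s by simp
  then show "emeasure (Zmeas b d t c) E = emeasure (atoms (aliveF t c) (atrait t c)) E"
    by (subst emeasure_atoms) (auto simp: emeasure_Zmeas aliveF_def atrait_def)
qed

lemma finite_aliveF: "finite (aliveF t c)"
  by (simp add: aliveF_def)

lemma Zs_finite_borel: "Zs t c \<in> finite_borel_measures"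
  unfolding Zs_def by (intro scale_finite_borel Zmeas_finite_borel)

lemma integral_Zs:
  assumes g: "g \<in> Cb"
  shows "(\<integral>y. g y \<partial>Zs t c) = X g t c"
proof -
  have "(\<integral>y. g y \<partial>Zs t c) = (1 / scl t) * (\<integral>y. g y \<partial>Zmeas b d t c)"
    unfolding Zs_def using scl_pos[of t] Cb_measurable[OF g]
    by (intro integral_scale_measure) (simp_all add: Zmeas_atoms measurable_cong_sets[OF sets_atoms refl])
  also have "\<dots> = X g t c"
    using Cb_measurable[OF g] finite_aliveF by (simp add: Zmeas_atoms integral_atoms X_def Zpair_aliveF)
  finally show ?thesis .
qed

text \<open>The finite set of labels takes countably many values, and for each of them the measure
  depends continuously on the traits.\<close>

lemma measurable_Zs: "Zs t \<in> tree_space D \<rightarrow>\<^sub>M weak_borel"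
proof -
  have at: "atrait t \<in> borel_measurable (tree_space D)"
    by (rule measurable_coordinatewise_then_product) (rule measurable_atrait)
  have "(\<lambda>c. scale_measure (ennreal (1 / scl t)) (atoms (aliveF t c) (atrait t c))) \<in> tree_space D \<rightarrow>\<^sub>M weak_borel"
  proof (rule measurable_aliveF_compose)
    fix S :: "nat list set" assume S: "finite S"
    have "(\<lambda>x. scale_measure (ennreal (1 / scl t)) (atoms S x)) \<in> borel \<rightarrow>\<^sub>M weak_borel"
      using scl_pos[of t] by (intro measurable_weak_borel continuous_atoms S) simp
    from measurable_compose[OF at this]
    show "(\<lambda>c. scale_measure (ennreal (1 / scl t)) (atoms S (atrait t c))) \<in> tree_space D \<rightarrow>\<^sub>M weak_borel" .
  qed
  then show ?thesis unfolding Zs_def Zmeas_atoms .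
qed

definition \<nu> :: "real measure" where
  "\<nu> = scale_measure (ennreal (1 / A)) \<mu>"

lemma \<nu>_finite_borel: "\<nu> \<in> finite_borel_measures"
  unfolding \<nu>_def
  by (rule scale_finite_borel) (simp add: finite_borel_measures_def sets_\<mu> \<mu>.finite_measure_axioms)

lemma integral_\<nu>: "g \<in> Cb \<Longrightarrow> (\<integral>y. g y \<partial>\<nu>) = mean g"
  unfolding \<nu>_def mean_def using A_pos Cb_measurable[of g]
  by (subst integral_scale_measure) (simp_all add: measurable_cong_sets[OF sets_\<mu> refl])

text \<open>While \<open>Y\<close> is in \<open>[\<alpha>, \<beta>]\<close>, finitely many test
  functions decide whether \<open>\<Phi>\<close> is close to its value on the ray through
  \<open>\<nu>\<close>, and \<open>X_close\<close> applies to each of them.\<close>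

lemma measure_limit:
  assumes \<Phi>: "continuous_map weak_topology euclideanreal \<Phi>" and bd: "bounded (\<Phi> ` finite_borel_measures)"
  shows "((\<lambda>t. \<integral>\<omega>. \<Phi> (Zs t \<omega>) \<partial>CL x t) \<longlongrightarrow> (\<integral>z. \<Phi> (scale_measure (ennreal z) \<nu>) \<partial>exp1)) at_top"
proof -
  obtain K where K: "\<And>m. m \<in> finite_borel_measures \<Longrightarrow> \<bar>\<Phi> m\<bar> \<le> K"
    using bd by (auto simp: bounded_iff)
  have ray: "continuous_map euclidean weak_topology (\<lambda>z. scale_measure (ennreal z) \<nu>)"
    by (rule continuous_scale[OF \<nu>_finite_borel])
  have c: "continuous_on UNIV (\<lambda>z. \<Phi> (scale_measure (ennreal z) \<nu>))"
    using continuous_map_compose[OF ray \<Phi>] by (simp add: o_def)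
  show ?thesis
  proof (rule transfer_limit[OF eventually_Y Y_laplace])
    show "\<forall>\<^sub>F t in at_top. (\<lambda>\<omega>. \<Phi> (Zs t \<omega>)) \<in> borel_measurable (CL x t)"
      unfolding cond_measurable
      by (intro always_eventually allI measurable_compose[OF measurable_Zs] measurable_weak_continuous \<Phi>)
    show "\<bar>\<Phi> (Zs t \<omega>)\<bar> \<le> K" for t \<omega> by (intro K Zs_finite_borel)
    show "\<bar>\<Phi> (scale_measure (ennreal z) \<nu>)\<bar> \<le> K" for z by (intro K scale_finite_borel \<nu>_finite_borel)
    show "continuous_on {0<..} (\<lambda>z. \<Phi> (scale_measure (ennreal z) \<nu>))" by (rule continuous_on_subset[OF c]) simp
    show "(\<lambda>z. \<Phi> (scale_measure (ennreal z) \<nu>)) \<in> borel_measurable borel" by (rule borel_measurable_continuous_onI[OF c])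
    fix \<alpha> \<beta> \<epsilon> :: real assume \<alpha>: "0 < \<alpha>" and \<epsilon>: "0 < \<epsilon>"
    obtain G r where Gr: "finite G" "G \<subseteq> Cb" "0 < r" "\<And>z m'. z \<in> {\<alpha>..\<beta>} \<Longrightarrow> m' \<in> finite_borel_measures \<Longrightarrow>
        (\<And>g. g \<in> G \<Longrightarrow> \<bar>(\<integral>y. g y \<partial>m') - z * (\<integral>y. g y \<partial>\<nu>)\<bar> < r) \<Longrightarrow>
        \<bar>\<Phi> m' - \<Phi> (scale_measure (ennreal z) \<nu>)\<bar> < \<epsilon>"
      using weak_uniform_on_ray[OF \<nu>_finite_borel \<Phi> \<alpha> \<epsilon>, of \<beta>] by meson
    define bad where "bad g t = {\<omega> \<in> space (CL x t). Y t \<omega> \<le> \<beta> \<and> r \<le> \<bar>X g t \<omega> - mean g * Y t \<omega>\<bar>}" for g t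
    have bad_sets: "bad g t \<in> sets (CL x t)" if "g \<in> G" for g t
    proof -
      have [measurable]: "g \<in> borel_measurable borel" using that Gr(2) by (intro Cb_measurable) blast
      show ?thesis unfolding bad_def by measurable
    qed
    have bad_lim: "((\<lambda>t. measure (CL x t) (bad g t)) \<longlongrightarrow> 0) at_top" if "g \<in> G" for g
    proof -
      have g: "g \<in> Cb" using that Gr(2) by blast
      then obtain c where "\<And>y. \<bar>g y\<bar> \<le> c" using Cb_bounded by blast
      from X_close[OF Cb_measurable[OF g] this Gr(3)] show ?thesis unfolding bad_def .
    qed
    have sum_lim: "((\<lambda>t. \<Sum>g\<in>G. measure (CL x t) (bad g t)) \<longlongrightarrow> (\<Sum>g\<in>G. 0)) at_top"
      by (intro tendsto_sum bad_lim)
    have un: "((\<lambda>t. measure (CL x t) (\<Union>g\<in>G. bad g t)) \<longlongrightarrow> 0) at_top"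
    proof (rule tendsto_sandwich[OF _ _ tendsto_const])
      show "((\<lambda>t. \<Sum>g\<in>G. measure (CL x t) (bad g t)) \<longlongrightarrow> 0) at_top" using sum_lim by simp
      show "\<forall>\<^sub>F t in at_top. measure (CL x t) (\<Union>g\<in>G. bad g t) \<le> (\<Sum>g\<in>G. measure (CL x t) (bad g t))"
        using eventually_prob[of x]
      proof eventually_elim
        case (elim t)
        then interpret M: prob_space "CL x t" .
        show ?case using bad_sets by (intro M.finite_measure_subadditive_finite Gr(1)) auto
      qed
    qed simp
    show "((\<lambda>t. measure (CL x t) {\<omega> \<in> space (CL x t). \<alpha> \<le> Y t \<omega> \<and> Y t \<omega> \<le> \<beta> \<and>
        \<epsilon> \<le> \<bar>\<Phi> (Zs t \<omega>) - \<Phi> (scale_measure (ennreal (Y t \<omega>)) \<nu>)\<bar>}) \<longlongrightarrow> 0) at_top"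
    proof (rule measure_to_0_mono[OF un])
      show "\<forall>\<^sub>F t in at_top. finite_measure (CL x t) \<and> (\<Union>g\<in>G. bad g t) \<in> sets (CL x t)"
        using eventually_prob[of x]
        by eventually_elim (use Gr(1) bad_sets in \<open>auto simp: prob_space.finite_measure intro!: sets.finite_UN\<close>)
      show "{\<omega> \<in> space (CL x t). \<alpha> \<le> Y t \<omega> \<and> Y t \<omega> \<le> \<beta> \<and>
        \<epsilon> \<le> \<bar>\<Phi> (Zs t \<omega>) - \<Phi> (scale_measure (ennreal (Y t \<omega>)) \<nu>)\<bar>} \<subseteq> (\<Union>g\<in>G. bad g t)" for t
      proof
        fix \<omega> assume w: "\<omega> \<in> {\<omega> \<in> space (CL x t). \<alpha> \<le> Y t \<omega> \<and> Y t \<omega> \<le> \<beta> \<and>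
          \<epsilon> \<le> \<bar>\<Phi> (Zs t \<omega>) - \<Phi> (scale_measure (ennreal (Y t \<omega>)) \<nu>)\<bar>}"
        show "\<omega> \<in> (\<Union>g\<in>G. bad g t)"
        proof (rule ccontr)
          assume n: "\<omega> \<notin> (\<Union>g\<in>G. bad g t)"
          have "\<bar>\<Phi> (Zs t \<omega>) - \<Phi> (scale_measure (ennreal (Y t \<omega>)) \<nu>)\<bar> < \<epsilon>"
          proof (rule Gr(4)[OF _ Zs_finite_borel])
            show "Y t \<omega> \<in> {\<alpha>..\<beta>}" using w by simp
            fix g assume g: "g \<in> G"
            then have gC: "g \<in> Cb" using Gr(2) by blast
            have "\<omega> \<notin> bad g t" using n g by blast
            then have "\<bar>X g t \<omega> - mean g * Y t \<omega>\<bar> < r" using w by (auto simp: bad_def)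
            then show "\<bar>(\<integral>y. g y \<partial>Zs t \<omega>) - Y t \<omega> * (\<integral>y. g y \<partial>\<nu>)\<bar> < r"
              by (simp add: integral_Zs[OF gC] integral_\<nu>[OF gC] mult.commute)
          qed
          then show False using w by simp
        qed
      qed
    qed
  qed
qed

end

lemma integral_exp1_distributed:
  fixes g :: "real \<Rightarrow> real"
  assumes "distributed R lborel \<xi> (exponential_density 1)" and g: "g \<in> borel_measurable borel"
  shows "(\<integral>\<omega>. g (\<xi> \<omega>) \<partial>R) = (\<integral>z. g z \<partial>exp1)"
  unfolding distributed_distr_eq_density[OF assms(1), symmetric]
  using distributed_measurable[OF assms(1)] g by (intro integral_distr[symmetric]) auto

section \<open>The limit theorems in the stated normalisation\<close>

context critical_branching
begin

lemma eventually_scl: "\<forall>\<^sub>F t in at_top. 0 < t \<and> (t + 1) * A * B = scl t"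
  using eventually_gt_at_top[of 0] by eventually_elim (simp add: scl_def)

lemma pair_limit:
  assumes F: "F \<in> Cb" and f: "f \<in> Cb"
  shows "((\<lambda>t. \<integral>c. F ((1 / ((t + 1) * A * B)) *\<^sub>R (Zpair b d t f c, Npop b d t c)) \<partial>CL x t) \<longlongrightarrow>
    (\<integral>z. F (mean f * z, z) \<partial>exp1)) at_top"
proof -
  obtain c where c: "\<And>p. \<bar>F p\<bar> \<le> c" using Cb_bounded[OF F] by blast
  have "continuous_on (UNIV \<times> {0<..}) F" using F by (auto simp: Cb_def intro: continuous_on_subset)
  from joint_limit[OF f Cb_measurable[OF F] c this, of x] show ?thesis
  proof (rule Lim_transform_eventually)
    show "\<forall>\<^sub>F t in at_top. (\<integral>\<omega>. F (X f t \<omega>, Y t \<omega>) \<partial>CL x t) =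
        (\<integral>c. F ((1 / ((t + 1) * A * B)) *\<^sub>R (Zpair b d t f c, Npop b d t c)) \<partial>CL x t)"
      using eventually_scl by eventually_elim (simp add: X_def Y_def)
  qed
qed

lemma law_limit:
  "law_conv_at_top (\<lambda>t. distr (CL x t) weak_borel
     (\<lambda>c. scale_measure (ennreal (1 / ((t + 1) * A * B))) (Zmeas b d t c))) (yaglom_limit \<nu>)"
  unfolding law_conv_at_top_def
proof (intro allI impI)
  fix \<Phi> :: "real measure \<Rightarrow> real"
  assume "continuous_map weak_topology euclideanreal \<Phi> \<and> bounded (\<Phi> ` finite_borel_measures)"
  then have \<Phi>: "continuous_map weak_topology euclideanreal \<Phi>" and bd: "bounded (\<Phi> ` finite_borel_measures)" by auto
  have m: "\<Phi> \<in> borel_measurable weak_borel" by (rule measurable_weak_continuous[OF \<Phi>])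
  have "(\<lambda>z. scale_measure (ennreal z) \<nu>) \<in> exp1 \<rightarrow>\<^sub>M weak_borel"
    using measurable_weak_borel[OF continuous_scale[OF \<nu>_finite_borel]] by simp
  then have "(\<integral>\<mu>'. \<Phi> \<mu>' \<partial>yaglom_limit \<nu>) = (\<integral>z. \<Phi> (scale_measure (ennreal z) \<nu>) \<partial>exp1)"
    unfolding yaglom_limit_def by (rule integral_distr[OF _ m])
  then have "((\<lambda>t. \<integral>\<omega>. \<Phi> (Zs t \<omega>) \<partial>CL x t) \<longlongrightarrow> (\<integral>\<mu>'. \<Phi> \<mu>' \<partial>yaglom_limit \<nu>)) at_top"
    using measure_limit[OF \<Phi> bd, of x] by simp
  then show "((\<lambda>t. \<integral>\<mu>'. \<Phi> \<mu>' \<partial>distr (CL x t) weak_borel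
      (\<lambda>c. scale_measure (ennreal (1 / ((t + 1) * A * B))) (Zmeas b d t c))) \<longlongrightarrow> (\<integral>\<mu>'. \<Phi> \<mu>' \<partial>yaglom_limit \<nu>)) at_top"
  proof (rule Lim_transform_eventually)
    show "\<forall>\<^sub>F t in at_top. (\<integral>\<omega>. \<Phi> (Zs t \<omega>) \<partial>CL x t) = (\<integral>\<mu>'. \<Phi> \<mu>' \<partial>distr (CL x t) weak_borel
      (\<lambda>c. scale_measure (ennreal (1 / ((t + 1) * A * B))) (Zmeas b d t c)))"
      using eventually_scl
    proof eventually_elim
      case (elim t)
      have "Zs t \<in> CL x t \<rightarrow>\<^sub>M weak_borel" unfolding cond_measurable by (rule measurable_Zs)
      from integral_distr[OF this m] show ?case using elim by (simp add: Zs_def[abs_def])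
    qed
  qed
qed

text \<open>Common form of the two one-dimensional limits: the statistic is a function
  \<open>h\<close> of \<open>(X, Y)\<close>, possibly singular at \<open>Y = 0\<close>, and
  \<open>lim\<close> identifies \<open>M\<close> as the law of \<open>h\<close> along the ray
  \<open>(mean f * z, z)\<close>.\<close>

lemma function_limit:
  fixes h :: "real \<times> real \<Rightarrow> real"
  assumes f: "f \<in> Cb" and h: "h \<in> borel_measurable borel" "continuous_on (UNIV \<times> {0<..}) h"
    and U: "\<forall>\<^sub>F t in at_top. \<forall>c. U t c = h (X f t c, Y t c)"
    and M: "real_distribution M"
    and lim: "\<And>g :: real \<Rightarrow> real. continuous_on UNIV g \<Longrightarrow> (\<integral>z. g z \<partial>M) = (\<integral>z. g (h (mean f * z, z)) \<partial>exp1)"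
  shows "weak_conv_at_top (\<lambda>t. distr (CL x t) borel (U t)) M"
proof (rule weak_conv_at_topI[OF _ M])
  note [measurable] = Cb_measurable[OF f] h(1)
  have Xm: "X f t \<in> borel_measurable (tree_space D)" for t by (rule measurable_X[OF Cb_measurable[OF f]])
  have m: "(\<lambda>c. h (X f t c, Y t c)) \<in> borel_measurable (CL x t)" for t
    unfolding cond_measurable using Xm by measurable
  show "\<forall>\<^sub>F t in at_top. real_distribution (distr (CL x t) borel (U t))"
    using eventually_prob[of x] U
  proof eventually_elim
    case (elim t)
    then interpret prob_space "CL x t" by simp
    have "U t = (\<lambda>c. h (X f t c, Y t c))" using elim by auto
    then have "U t \<in> borel_measurable (CL x t)" using m by simp
    then show ?case by (intro real_distribution.intro prob_space_distr) (auto simp: real_distribution_axioms_def)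
  qed
  fix g :: "real \<Rightarrow> real" assume g: "continuous_on UNIV g" "\<And>z. \<bar>g z\<bar> \<le> 1"
  have [measurable]: "g \<in> borel_measurable borel" by (rule borel_measurable_continuous_onI[OF g(1)])
  have "((\<lambda>t. \<integral>\<omega>. g (h (X f t \<omega>, Y t \<omega>)) \<partial>CL x t) \<longlongrightarrow> (\<integral>z. g (h (mean f * z, z)) \<partial>exp1)) at_top"
    using g(2) by (intro joint_limit[OF f, where G="\<lambda>p. g (h p)" and K=1] continuous_on_compose2[OF g(1) h(2)]) auto
  then show "((\<lambda>t. \<integral>z. g z \<partial>distr (CL x t) borel (U t)) \<longlongrightarrow> (\<integral>z. g z \<partial>M)) at_top"
    unfolding lim[OF g(1)]
  proof (rule Lim_transform_eventually)
    show "\<forall>\<^sub>F t in at_top. (\<integral>\<omega>. g (h (X f t \<omega>, Y t \<omega>)) \<partial>CL x t) = (\<integral>z. g z \<partial>distr (CL x t) borel (U t))"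
      using U
    proof eventually_elim
      case (elim t)
      have "U t = (\<lambda>c. h (X f t c, Y t c))" using elim by auto
      then show ?case using integral_distr[OF m, of g t] by simp
    qed
  qed
qed

text \<open>The scale cancels in the quotient, which is constant along the ray.\<close>

lemma ratio_limit:
  assumes f: "f \<in> Cb"
  shows "weak_conv_at_top (\<lambda>t. distr (CL x t) borel (\<lambda>c. Zpair b d t f c / Npop b d t c)) (return borel (mean f))"
proof (rule function_limit[OF f, where h="\<lambda>p. fst p / snd p"])
  interpret E: prob_space exp1 by (rule prob_space_exponential_density) simp
  show "(\<lambda>p. fst p / snd p) \<in> borel_measurable (borel :: (real \<times> real) measure)"
    unfolding borel_prod[symmetric] by measurable
  show "continuous_on (UNIV \<times> {0<..}) (\<lambda>p. fst p / snd p :: real)" by (intro continuous_intros) auto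
  show "\<forall>\<^sub>F t in at_top. \<forall>c. Zpair b d t f c / Npop b d t c = fst (X f t c, Y t c) / snd (X f t c, Y t c)"
    using scl_pos by (simp add: X_def Y_def less_imp_neq[symmetric])
  show "real_distribution (return borel (mean f))"
    by (intro real_distribution.intro prob_space_return) (auto simp: real_distribution_axioms_def)
  fix g :: "real \<Rightarrow> real" assume g: "continuous_on UNIV g"
  have [measurable]: "g \<in> borel_measurable borel" by (rule borel_measurable_continuous_onI[OF g])
  have "(\<integral>z. g (fst (mean f * z, z) / snd (mean f * z, z)) \<partial>exp1) = (\<integral>z. g (mean f) \<partial>exp1)"
  proof (rule integral_cong_AE)
    show "AE z in exp1. g (fst (mean f * z, z) / snd (mean f * z, z)) = g (mean f)"
      using AE_exp1_pos by eventually_elim simp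
  qed auto
  also have "\<dots> = (\<integral>z. g z \<partial>return borel (mean f))"
    using E.prob_space by (simp add: integral_return)
  finally show "(\<integral>z. g z \<partial>return borel (mean f)) = (\<integral>z. g (fst (mean f * z, z) / snd (mean f * z, z)) \<partial>exp1)" ..
qed

text \<open>With \<open>s = A * B\<close>, the prefactor and the square root absorb the scale and
  leave \<open>(X / mean f - 1 / 2) / sqrt Y\<close>, which on the ray is
  \<open>(z - 1 / 2) / sqrt z\<close>.\<close>

lemma fluctuation_limit:
  assumes f: "f \<in> Cb" and a: "mean f \<noteq> 0"
    and R: "prob_space R" and \<xi>: "distributed R lborel \<xi> (exponential_density 1)"
  shows "weak_conv_at_top
     (\<lambda>t. distr (CL x t) borel (\<lambda>c. 1 / (mean f * (A * B) powr (1/2))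
        * ((Zpair b d t f c / (t + 1) - mean f * A * B / 2) / sqrt (Npop b d t c / (t + 1)))))
     (distr R borel (\<lambda>\<omega>. \<xi> \<omega> powr (1/2) - 1/2 * \<xi> \<omega> powr (- 1/2)))"
proof (rule function_limit[OF f, where h="\<lambda>p. (fst p / mean f - 1 / 2) / sqrt (snd p)"])
  interpret R: prob_space R by (rule R)
  have \<xi>m [measurable]: "\<xi> \<in> borel_measurable R" using distributed_measurable[OF \<xi>] by simp
  show "(\<lambda>p. (fst p / mean f - 1 / 2) / sqrt (snd p)) \<in> borel_measurable (borel :: (real \<times> real) measure)"
    unfolding borel_prod[symmetric] by measurable
  show "continuous_on (UNIV \<times> {0<..}) (\<lambda>p. (fst p / mean f - 1 / 2) / sqrt (snd p))"
    using a by (intro continuous_intros) auto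
  show "\<forall>\<^sub>F t in at_top. \<forall>c. 1 / (mean f * (A * B) powr (1/2))
        * ((Zpair b d t f c / (t + 1) - mean f * A * B / 2) / sqrt (Npop b d t c / (t + 1))) =
      (fst (X f t c, Y t c) / mean f - 1 / 2) / sqrt (snd (X f t c, Y t c))"
    using eventually_scl
  proof (eventually_elim, intro allI)
    fix t c assume t: "0 < t \<and> (t + 1) * A * B = scl t"
    define s where "s = A * B"
    have s: "0 < s" using A_pos B_pos by (simp add: s_def)
    have scl: "scl t = (t + 1) * s" using t by (simp add: s_def mult.assoc)
    have Z: "Zpair b d t f c / (t + 1) = X f t c * s" and N: "Npop b d t c / (t + 1) = Y t c * s"
      using t s by (simp_all add: X_def Y_def scl)
    have "(X f t c * s - mean f * s / 2) / sqrt (Y t c * s) / (mean f * sqrt s) =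
        ((X f t c - mean f / 2) * (s / (sqrt s * sqrt s))) / (mean f * sqrt (Y t c))"
      by (simp add: real_sqrt_mult left_diff_distrib)
    also have "s / (sqrt s * sqrt s) = 1" using s by simp
    finally show "1 / (mean f * (A * B) powr (1/2))
        * ((Zpair b d t f c / (t + 1) - mean f * A * B / 2) / sqrt (Npop b d t c / (t + 1))) =
      (fst (X f t c, Y t c) / mean f - 1 / 2) / sqrt (snd (X f t c, Y t c))"
      using a s unfolding Z N mult.assoc s_def[symmetric]
      by (simp add: powr_half_sqrt diff_divide_distrib)
  qed
  show "real_distribution (distr R borel (\<lambda>\<omega>. \<xi> \<omega> powr (1/2) - 1/2 * \<xi> \<omega> powr (- 1/2)))"
    by (intro real_distribution.intro R.prob_space_distr) (auto simp: real_distribution_axioms_def)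
  fix g :: "real \<Rightarrow> real" assume g: "continuous_on UNIV g"
  have [measurable]: "g \<in> borel_measurable borel" by (rule borel_measurable_continuous_onI[OF g])
  have "(\<integral>z. g z \<partial>distr R borel (\<lambda>\<omega>. \<xi> \<omega> powr (1/2) - 1/2 * \<xi> \<omega> powr (- 1/2))) =
      (\<integral>\<omega>. g (\<xi> \<omega> powr (1/2) - 1/2 * \<xi> \<omega> powr (- 1/2)) \<partial>R)"
    by (rule integral_distr) auto
  also have "\<dots> = (\<integral>z. g (z powr (1/2) - 1/2 * z powr (- 1/2)) \<partial>exp1)"
    by (rule integral_exp1_distributed[OF \<xi>]) measurable
  also have "\<dots> = (\<integral>z. g ((fst (mean f * z, z) / mean f - 1 / 2) / sqrt (snd (mean f * z, z))) \<partial>exp1)"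
  proof (rule integral_cong_AE)
    have *: "z powr (1/2) - 1/2 * z powr (- 1/2) = (z - 1 / 2) / sqrt z" if "0 < z" for z :: real
    proof -
      have "z powr (- 1/2) = 1 / sqrt z"
        using that powr_minus_divide[of z "1/2"] by (simp add: powr_half_sqrt)
      moreover have "z / sqrt z = sqrt z" using that by (simp add: real_div_sqrt)
      ultimately show ?thesis using that by (simp add: powr_half_sqrt diff_divide_distrib)
    qed
    show "AE z in exp1. g (z powr (1/2) - 1/2 * z powr (- 1/2)) =
        g ((fst (mean f * z, z) / mean f - 1 / 2) / sqrt (snd (mean f * z, z)))"
      using AE_exp1_pos by eventually_elim (use a * in simp)
  qed (use a in auto)
  finally show "(\<integral>z. g z \<partial>distr R borel (\<lambda>\<omega>. \<xi> \<omega> powr (1/2) - 1/2 * \<xi> \<omega> powr (- 1/2))) =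
    (\<integral>z. g ((fst (mean f * z, z) / mean f - 1 / 2) / sqrt (snd (mean f * z, z))) \<partial>exp1)" .
qed

end

text \<open>Decay at infinity handles the outside of a ball, compactness the inside.\<close>

lemma C0_bounded: "f \<in> C0 \<Longrightarrow> \<exists>c. \<forall>y. f y \<le> c"
proof -
  assume f: "f \<in> C0"
  have "\<forall>\<^sub>F y in at_infinity. f y < 1"
    using f by (intro order_tendstoD[where y=0]) (auto simp: C0_def)
  then obtain r where r: "\<And>y. r \<le> norm y \<Longrightarrow> f y < 1" unfolding eventually_at_infinity by blast
  have "compact (f ` cball 0 r)"
    using f by (intro compact_continuous_image) (auto simp: C0_def intro: continuous_on_subset)
  then obtain c where c: "\<And>y. y \<in> cball 0 r \<Longrightarrow> \<bar>f y\<bar> \<le> c"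
    using compact_imp_bounded by (force simp: bounded_iff)
  have "f y \<le> max 1 c" for y
  proof (cases "r \<le> norm y")
    case True
    then show ?thesis using r[of y] by simp
  next
    case False
    then show ?thesis using c[of y] by (force simp: dist_norm)
  qed
  then show ?thesis by blast
qed


theorem theorem3p6:
  fixes D :: "(real \<Rightarrow> real) set"
    and P :: "real \<Rightarrow> (real \<Rightarrow> real) measure"
    and b d :: "real \<Rightarrow> real"
    and Q :: "real \<Rightarrow> tree measure"
    and \<Theta>0 :: "real \<Rightarrow> real"
    and \<mu>0 \<nu> :: "real measure"
    and l0 A B x :: real
    and f :: "real \<Rightarrow> real"
    and R :: "'r measure"
    and \<xi> :: "'r \<Rightarrow> real"
  assumes "branching_markov_process D P b Q"
    and "HV b d"
    and "HP P b d Q \<Theta>0 \<mu>0 l0"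
    and "l0 = 0"
    and "\<nu> = scale_measure (ennreal (1 / measure \<mu>0 UNIV)) \<mu>0"
    and "A = (\<integral>y. 1 \<partial>\<mu>0)"
    and "B = (\<integral>y. (\<Theta>0 y)\<^sup>2 * b y \<partial>\<mu>0)"
    and "prob_space R"
    and "distributed R lborel \<xi> (exponential_density 1)"
    and "f \<in> Cb"
  shows "(\<forall>F \<in> (Cb :: (real \<times> real \<Rightarrow> real) set).
           ((\<lambda>t. \<integral>c. F ((1 / ((t + 1) * A * B)) *\<^sub>R (Zpair b d t f c, Npop b d t c))
                   \<partial>cond_law Q b d x t)
             \<longlongrightarrow> (\<integral>\<omega>. F (\<xi> \<omega> * (\<integral>y. f y \<partial>\<nu>), \<xi> \<omega>) \<partial>R)) at_top)
       \<and> law_conv_at_top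
           (\<lambda>t. distr (cond_law Q b d x t) weak_borel
                  (\<lambda>c. scale_measure (ennreal (1 / ((t + 1) * A * B))) (Zmeas b d t c)))
           (yaglom_limit \<nu>)
       \<and> weak_conv_at_top
           (\<lambda>t. distr (cond_law Q b d x t) borel (\<lambda>c. Zpair b d t f c / Npop b d t c))
           (return borel (\<integral>y. f y \<partial>\<nu>))
       \<and> ((\<integral>y. f y \<partial>\<nu>) \<noteq> 0 \<longrightarrow>
           weak_conv_at_top
             (\<lambda>t. distr (cond_law Q b d x t) borel
                (\<lambda>c. 1 / ((\<integral>y. f y \<partial>\<nu>) * (A * B) powr (1/2))
                      * ((Zpair b d t f c / (t + 1) - (\<integral>y. f y \<partial>\<nu>) * A * B / 2)
                          / sqrt (Npop b d t c / (t + 1)))))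
             (distr R borel (\<lambda>\<omega>. \<xi> \<omega> powr (1/2) - 1/2 * \<xi> \<omega> powr (- 1/2))))"
proof -
  note bp = assms(1) and HV = assms(2) and HP = assms(3) and R = assms(8) and \<xi> = assms(9) and f = assms(10)
  obtain bs where b: "\<And>y. 0 \<le> b y" "\<exists>y. b y \<noteq> 0" "continuous_on UNIV b" "\<And>y. b y \<le> bs"
    and d: "\<And>y. 0 \<le> d y" "continuous_on UNIV d"
    using HV unfolding HV_def by blast
  define S where "S = FK P (\<lambda>y. b y - d y)"
  have hp: "HP1 S \<Theta>0 l0" "HP2 S \<Theta>0 \<mu>0 l0" using HP by (simp_all add: HP_def S_def Let_def)
  have \<Theta>: "\<Theta>0 \<in> C0" "\<And>y. 0 < \<Theta>0 y" using hp(1) by (simp_all add: HP1_def)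
  obtain \<theta>s where \<theta>s: "\<And>y. \<Theta>0 y \<le> \<theta>s" using C0_bounded[OF \<Theta>(1)] by blast
  \<comment> \<open>With \<open>l0 = 0\<close> the exponential prefactor in HP2 is 1, and
    \<open>l1\<close> itself is the rate of convergence.\<close>
  obtain l1 H where gap: "0 < l1" "0 < H" "\<And>g t x. g \<in> Cb \<Longrightarrow> 0 \<le> t \<Longrightarrow>
      \<bar>S t g x - \<Theta>0 x * (\<integral>y. g y \<partial>\<mu>0)\<bar> \<le> H * sup_norm g * exp (- l1 * t)"
    using hp(2) unfolding HP2_def assms(4) by auto
  have \<mu>0: "finite_measure \<mu>0" "sets \<mu>0 = sets borel" "(\<integral>y. \<Theta>0 y \<partial>\<mu>0) = 1"
      "\<And>U. open U \<Longrightarrow> U \<noteq> {} \<Longrightarrow> 0 < emeasure \<mu>0 U"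
    using hp(2) by (auto simp: HP2_def finite_borel_measures_def)
  interpret bp: branching_markov_process D P b Q by (rule bp)
  interpret finite_measure \<mu>0 by (rule \<mu>0)
  interpret CB: critical_branching D P b d bs \<mu>0 \<Theta>0 \<theta>s l1 H Q
    by unfold_locales
      (use b d \<Theta> \<theta>s gap \<mu>0 in \<open>auto simp: C0_def S_def intro: borel_measurable_continuous_onI\<close>)
  have A: "A = CB.A" using assms(6) by (simp add: CB.A_def)
  have B: "B = CB.B" using assms(7) by (simp add: CB.B_def)
  have \<nu>: "\<nu> = CB.\<nu>" using assms(5) by (simp add: CB.\<nu>_def CB.A_def)
  have pair: "(\<integral>z. F (CB.mean f * z, z) \<partial>exp1) = (\<integral>\<omega>. F (\<xi> \<omega> * CB.mean f, \<xi> \<omega>) \<partial>R)"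
    if F: "F \<in> Cb" for F :: "real \<times> real \<Rightarrow> real"
  proof -
    have [measurable]: "F \<in> borel_measurable borel" by (rule Cb_measurable[OF F])
    have "(\<lambda>z. F (z * CB.mean f, z)) \<in> borel_measurable borel" by measurable
    from integral_exp1_distributed[OF \<xi> this] show ?thesis by (simp add: mult.commute)
  qed
  show ?thesis
    unfolding \<nu> CB.integral_\<nu>[OF f] A B
    using CB.pair_limit[OF _ f, of _ x] pair CB.law_limit[of x] CB.ratio_limit[OF f, of x] CB.fluctuation_limit[OF f _ R \<xi>, of x]
    by auto
qed


end
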